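(* Let $X_1,X_2,Y_3$ be $\mathrm{UMD}$ spaces with Pisier's property $(\alpha)$ and suppose $p_1,p_2,p_3\in(1,\infty)$ satisfy $\sum_{m=1}^31/p_m=1$. Let $\mathcal D$ be a dyadic lattice in $\mathbb R^d$ and fix a complexity $k=(k_1,k_2,k_3)$, $0\le k_i\in\mathbb Z$. Suppose $\{S_j\}_{j\in\mathcal J}$ is a family of operator-valued bilinear dyadic shifts with respect to the spaces $X_1,X_2,Y_3$, where each $S_j$ is a shift of complexity $k$ with respect to the lattice $\mathcal D$. Then $$\widehat{\mathcal R}\big(\{S_j:L^{p_1}(X_1)\times L^{p_2}(X_2)\to L^{p_3'}(Y_3)\,:\,j\in\mathcal J\}\big)\lesssim\big(1+\max_{i}k_i\big)\,\widehat{\mathcal R}\Big(\bigcup_{j\in\mathcal J}\mathcal C(S_j)\Big).$$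
   Context: **Conventions.** $L^p(X)=L^p(\mathbb R^d;X)$ (Bochner); $p'$ is the conjugate exponent. $A\lesssim B$ means $A\le CB$ with $C$ depending only on $d$, the exponents and the Banach spaces, not on $k$ or the family. $\mathcal L(X_1\times X_2,Y_3)$: bounded bilinear operators. $\varepsilon$'s denote independent random signs; $\langle\cdot,\cdot\rangle$ is the natural duality pairing (or integration against a scalar function). **Property $(\alpha)$.** $X$ has Pisier's property $(\alpha)$ if there is $C$ such that for all $N$, scalars $a_{i,j}$ and $e_{i,j}\in X$, $1\le i,j\le N$: $(\mathbb E\mathbb E'|\sum_{i,j}\varepsilon_i\varepsilon_j'a_{i,j}e_{i,j}|_X^2)^{1/2}\le C\max|a_{i,j}|(\mathbb E\mathbb E'|\sum_{i,j}\varepsilon_i\varepsilon'_je_{i,j}|_X^2)^{1/2}$. **$\widehat{\mathcal R}$-boundedness.** $\|(e_{l,m})_{l,m}\|_{\mathrm{Rad}_2(X)}=(\mathbb E\|\sum_{l,m}\varepsilon_{l,m}e_{l,m}\|_X^2)^{1/2}$. For Banach spaces $E_1,E_2,F_3$, $E_3=F_3^*$, and $\mathcal T\subset\mathcal L(E_1\times E_2,F_3)$, $\widehat{\mathcal R}(\mathcal T)$ is the smallest $C$ such that $$\sum_{t,u,v=1}^N|\langle T_{t,u,v}[e^1_{t,u},e^2_{u,v}],e^3_{t,v}\rangle|\le C\prod_{i=1}^3\|(e^i_{l,m})_{l,m=1}^N\|_{\mathrm{Rad}_2(E_i)}$$ for all $N\in\mathbb N$, $T_{t,u,v}\in\mathcal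 T$, $e^1_{t,u}\in E_1$, $e^2_{u,v}\in E_2$, $e^3_{t,v}\in E_3$ ($t,u,v\in\{1,\dots,N\}$). **Dyadic lattices and Haar functions.** $\mathcal D_0=\{2^{-k}([0,1)^d+m):k\in\mathbb Z,m\in\mathbb Z^d\}$; a dyadic lattice is $\{Q+\omega:Q\in\mathcal D_0\}$, $\omega\in(\{0,1\}^d)^{\mathbb Z}$, $Q+\omega:=Q+\sum_{k:2^{-k}<\ell(Q)}\omega_k2^{-k}$. $Q^{(k)}$ is the $k$th dyadic ancestor. For an interval $I$ with halves $I_l,I_r$: $h^0_I=|I|^{-1/2}1_I$, $h_I^1=|I|^{-1/2}(1_{I_l}-1_{I_r})$; for $Q=I_1\times\dots\times I_d$, $h_Q^\eta=\otimes_ih_{I_i}^{\eta_i}$; $h_Q$ denotes some $h_Q^\eta$ with $\eta\ne0$ and $h_Q^0=|Q|^{-1/2}1_Q$. **Bilinear shifts.** A bilinear operator-valued dyadic shift of complexity $k$ is $$S(f_1,f_2)=\sum_{K\in\mathcal D}\ \sum_{I_1,I_2,I_3\in\mathcal D,\ I_i^{(k_i)}=K}a_{K,(I_i)}[\langle f_1,\tilde h_{I_1}\rangle,\langle f_2,\tilde h_{I_2}\rangle]\tilde h_{I_3},$$ with $f_m\in L^1_{\mathrm{loc}}(X_m)$, $a_{K,(I_i)}\in\mathcal L(X_1\times X_2,Y_3)$ (only finitely many nonzero), where in two fixed slots (depending only on the shift) $\tilde h_{I_i}=h_{I_i}$ is cancellative and in the remaining slot $\tilde h_{I_i}=h^0_{I_i}$.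 Normalized coefficients: $\mathcal C(S)=\{|K|^2\prod_{i=1}^3|I_i|^{-1/2}a_{K,(I_i)}:K,I_i\in\mathcal D,\ I_i^{(k_i)}=K\}$. *)

theory Defs
  imports "HOL-Probability.Probability" "HOL-Library.Function_Algebras"
begin

section \<open>Pointwise vector space structure on functions\<close>

instantiation "fun" :: (type, real_vector) real_vector
begin

definition scaleR_fun :: "real \<Rightarrow> ('a \<Rightarrow> 'b) \<Rightarrow> 'a \<Rightarrow> 'b" where
  "scaleR_fun c f = (\<lambda>x. c *\<^sub>R f x)"

instance
  by standard (auto simp: scaleR_fun_def plus_fun_def algebra_simps)

end


section \<open>Bochner integration without separability\<close>

text \<open>The library's Bochner integral requires a second countable codomain. The following drops
  this restriction, since the Banach spaces of the theorem are arbitrary: Borel measurability is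
  replaced by strong measurability, and the rest copies the library definition.\<close>

definition strongly_measurable :: "'w measure \<Rightarrow> ('w \<Rightarrow> 'x::banach) \<Rightarrow> bool" where
  "strongly_measurable M f \<longleftrightarrow>
     (\<exists>s::nat \<Rightarrow> 'w \<Rightarrow> 'x. (\<forall>i. simple_function M (s i)) \<and>
        (\<forall>w\<in>space M. (\<lambda>i. s i w) \<longlonglongrightarrow> f w))"

definition has_strong_integral :: "'w measure \<Rightarrow> ('w \<Rightarrow> 'x::banach) \<Rightarrow> 'x \<Rightarrow> bool" where
  "has_strong_integral M f v \<longleftrightarrow>
     strongly_measurable M f \<and>
     (\<exists>s::nat \<Rightarrow> 'w \<Rightarrow> 'x. (\<forall>i. Bochner_Integration.simple_bochner_integrable M (s i)) \<and>
        (\<lambda>i. \<integral>\<^sup>+w. ennreal (norm (f w - s i w)) \<partial>M) \<longlonglongrightarrow> 0 \<and>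
        (\<lambda>i. Bochner_Integration.simple_bochner_integral M (s i)) \<longlonglongrightarrow> v)"

definition strong_integral :: "'w measure \<Rightarrow> ('w \<Rightarrow> 'x::banach) \<Rightarrow> 'x" where
  "strong_integral M f =
     (if \<exists>v. has_strong_integral M f v then THE v. has_strong_integral M f v else 0)"

lemma strongly_measurable_iff_borel:
  fixes f :: "'w \<Rightarrow> 'x::{banach, second_countable_topology}"
  shows "strongly_measurable M f \<longleftrightarrow> f \<in> borel_measurable M"
proof
  assume "strongly_measurable M f"
  then obtain s where s: "\<And>i. simple_function M (s i)"
    and lim: "\<And>w. w \<in> space M \<Longrightarrow> (\<lambda>i. s i w) \<longlonglongrightarrow> f w"
    unfolding strongly_measurable_def by blast
  show "f \<in> borel_measurable M"
    by (rule borel_measurable_LIMSEQ_metric[OF borel_measurable_simple_function[OF s] lim])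
next
  assume "f \<in> borel_measurable M"
  from borel_measurable_implies_sequence_metric[OF this, of 0]
  show "strongly_measurable M f"
    unfolding strongly_measurable_def by blast
qed

lemma strong_integral_eq_lebesgue_integral:
  fixes f :: "'w \<Rightarrow> 'x::{banach, second_countable_topology}"
  shows "strong_integral M f = lebesgue_integral M f"
proof -
  have "has_strong_integral M f v \<longleftrightarrow> has_bochner_integral M f v" for v
    unfolding has_strong_integral_def strongly_measurable_iff_borel has_bochner_integral.simps
    by auto
  then have "has_strong_integral M f = has_bochner_integral M f"
    by auto
  then show ?thesis
    unfolding strong_integral_def lebesgue_integral_def by auto
qed


section \<open>Seminormed spaces, duals and Lebesgue--Bochner spaces\<close>

text \<open>A space is given by a carrier and a (semi)norm on it. The elements of Lebesgue--Bochner
  spaces are represented by functions rather than by classes modulo null sets, so that the norm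
  is only a seminorm there.\<close>

type_synonym 'e nspace = "'e set \<times> ('e \<Rightarrow> real)"

definition whole :: "('e::real_normed_vector) nspace" where
  "whole = (UNIV, norm)"

definition Lp_norm :: "real \<Rightarrow> 'w measure \<Rightarrow> ('w \<Rightarrow> 'x::banach) \<Rightarrow> real" where
  "Lp_norm p M f = (\<integral>w. norm (f w) powr p \<partial>M) powr (1 / p)"

definition Lp :: "real \<Rightarrow> 'w measure \<Rightarrow> ('w \<Rightarrow> 'x::banach) nspace" where
  "Lp p M = ({f. strongly_measurable M f \<and> integrable M (\<lambda>w. norm (f w) powr p)}, Lp_norm p M)"

text \<open>A functional is a function on the whole type; only its values on the carrier matter. A
  functional that is bounded with respect to a seminorm is constant on classes of elements at
  distance zero, so these are exactly the functionals on the associated normed space.\<close>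

definition dual_norm :: "'e nspace \<Rightarrow> ('e \<Rightarrow> real) \<Rightarrow> real" where
  "dual_norm E \<phi> = (SUP e\<in>{e \<in> fst E. snd E e \<le> 1}. \<bar>\<phi> e\<bar>)"

definition dual :: "('e::real_vector) nspace \<Rightarrow> ('e \<Rightarrow> real) nspace" where
  "dual E =
     ({\<phi>. (\<forall>e\<in>fst E. \<forall>f\<in>fst E. \<phi> (e + f) = \<phi> e + \<phi> f) \<and>
          (\<forall>c. \<forall>e\<in>fst E. \<phi> (c *\<^sub>R e) = c * \<phi> e) \<and>
          (\<exists>C. \<forall>e\<in>fst E. \<bar>\<phi> e\<bar> \<le> C * snd E e)},
      dual_norm E)"


section \<open>Random signs, property alpha and R-hat-boundedness\<close>

definition random_signs :: "'i set \<Rightarrow> ('i \<Rightarrow> real) pmf" where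
  "random_signs A = Pi_pmf A 1 (\<lambda>_. pmf_of_set {-1, 1})"

definition property_alpha :: "'x::banach itself \<Rightarrow> bool" where
  "property_alpha _ \<longleftrightarrow>
     (\<exists>C::real. \<forall>(N::nat) (a :: nat \<Rightarrow> nat \<Rightarrow> real) (e :: nat \<Rightarrow> nat \<Rightarrow> 'x).
        sqrt (measure_pmf.expectation (random_signs {1..N}) (\<lambda>\<epsilon>.
              measure_pmf.expectation (random_signs {1..N}) (\<lambda>\<epsilon>'.
                (norm (\<Sum>i=1..N. \<Sum>j=1..N. (\<epsilon> i * \<epsilon>' j * a i j) *\<^sub>R e i j))\<^sup>2)))
        \<le> C * (MAX (i, j)\<in>{1..N} \<times> {1..N}. \<bar>a i j\<bar>) *
          sqrt (measure_pmf.expectation (random_signs {1..N}) (\<lambda>\<epsilon>.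
              measure_pmf.expectation (random_signs {1..N}) (\<lambda>\<epsilon>'.
                (norm (\<Sum>i=1..N. \<Sum>j=1..N. (\<epsilon> i * \<epsilon>' j) *\<^sub>R e i j))\<^sup>2))))"

definition Rad2 :: "('e::real_vector) nspace \<Rightarrow> nat \<Rightarrow> (nat \<Rightarrow> nat \<Rightarrow> 'e) \<Rightarrow> real" where
  "Rad2 E N e =
     sqrt (measure_pmf.expectation (random_signs ({1..N} \<times> {1..N})) (\<lambda>\<epsilon>.
       (snd E (\<Sum>l=1..N. \<Sum>m=1..N. \<epsilon> (l, m) *\<^sub>R e l m))\<^sup>2))"

text \<open>The value is \<^term>\<open>\<infinity>\<close> if no constant is admissible.\<close>

definition Rhat ::
  "('e1::real_vector) nspace \<Rightarrow> ('e2::real_vector) nspace \<Rightarrow> ('f3::real_vector) nspace \<Rightarrow>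
   ('e1 \<Rightarrow> 'e2 \<Rightarrow> 'f3) set \<Rightarrow> ennreal" where
  "Rhat E1 E2 F3 \<T> =
     Inf (ennreal ` {C. 0 \<le> C \<and>
       (\<forall>N T e1 e2 e3.
          (\<forall>t\<in>{1..N}. \<forall>u\<in>{1..N}. \<forall>v\<in>{1..N}. T t u v \<in> \<T>) \<and>
          (\<forall>t\<in>{1..N}. \<forall>u\<in>{1..N}. e1 t u \<in> fst E1) \<and>
          (\<forall>u\<in>{1..N}. \<forall>v\<in>{1..N}. e2 u v \<in> fst E2) \<and>
          (\<forall>t\<in>{1..N}. \<forall>v\<in>{1..N}. e3 t v \<in> fst (dual F3)) \<longrightarrow>
          (\<Sum>t=1..N. \<Sum>u=1..N. \<Sum>v=1..N. \<bar>e3 t v (T t u v (e1 t u) (e2 u v))\<bar>)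
            \<le> C * (Rad2 E1 N e1 * Rad2 E2 N e2 * Rad2 (dual F3) N e3))})"


section \<open>UMD spaces\<close>

text \<open>The functions \<open>d 1, \<dots>, d N\<close> form a martingale difference sequence with respect to the filtration
  \<open>F 0, \<dots>, F N\<close>. The condition on the integrals over \<^term>\<open>A\<close> states that the
  conditional expectation of \<^term>\<open>d n\<close> given \<^term>\<open>F (n - 1)\<close> vanishes; the library's
  conditional expectation only covers real-valued functions.\<close>

definition martingale_differences ::
  "real \<Rightarrow> 'w measure \<Rightarrow> (nat \<Rightarrow> 'w measure) \<Rightarrow> nat \<Rightarrow> (nat \<Rightarrow> 'w \<Rightarrow> 'x::banach) \<Rightarrow> bool" where
  "martingale_differences p M F N d \<longleftrightarrow>
     (\<forall>n\<le>N. subalgebra M (F n)) \<and>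
     (\<forall>n<N. subalgebra (F (Suc n)) (F n)) \<and>
     (\<forall>n\<in>{1..N}. d n \<in> fst (Lp p M) \<and> strongly_measurable (F n) (d n) \<and>
        (\<forall>A\<in>sets (F (n - 1)). strong_integral M (\<lambda>w. indicator A w *\<^sub>R d n w) = 0))"

text \<open>A definition cannot quantify over the type of the sample space. Probability measures on
  the reals suffice: the differences may be taken with respect to the filtration they generate,
  then only their joint law matters, and by strong measurability this is a Borel measure on a
  Polish space, which can be realised by random variables on the unit interval.\<close>

definition UMD :: "'x::banach itself \<Rightarrow> bool" where
  "UMD _ \<longleftrightarrow>
     (\<forall>p>1. \<exists>\<beta>::real. \<forall>(M :: real measure) F N (d :: nat \<Rightarrow> real \<Rightarrow> 'x) (\<sigma> :: nat \<Rightarrow> real).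
        prob_space M \<and> martingale_differences p M F N d \<and> (\<forall>n. \<sigma> n \<in> {-1, 1}) \<longrightarrow>
        Lp_norm p M (\<lambda>w. \<Sum>n=1..N. \<sigma> n *\<^sub>R d n w) \<le> \<beta> * Lp_norm p M (\<lambda>w. \<Sum>n=1..N. d n w))"


section \<open>Dyadic lattices and Haar functions\<close>

definition std_cube :: "int \<Rightarrow> int ^ 'n \<Rightarrow> (real ^ 'n) set" where
  "std_cube k m =
     {x. \<forall>i. 2 powi (-k) * of_int (m $ i) \<le> x $ i \<and> x $ i < 2 powi (-k) * (of_int (m $ i) + 1)}"

definition side :: "(real ^ 'n) set \<Rightarrow> real" where
  "side Q = root CARD('n) (measure lborel Q)"

definition translated_cube :: "(int \<Rightarrow> real ^ 'n) \<Rightarrow> (real ^ 'n) set \<Rightarrow> (real ^ 'n) set" where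
  "translated_cube \<omega> Q =
     (\<lambda>x. x + (\<Sum>\<^sub>\<infinity>k\<in>{k::int. 2 powi (-k) < side Q}. 2 powi (-k) *\<^sub>R \<omega> k)) ` Q"

definition dyadic_lattice :: "(real ^ 'n) set set \<Rightarrow> bool" where
  "dyadic_lattice \<D> \<longleftrightarrow>
     (\<exists>\<omega>. (\<forall>k i. \<omega> k $ i \<in> {0, 1}) \<and> \<D> = {translated_cube \<omega> (std_cube k m) | k m. True})"

definition ancestor :: "(real ^ 'n) set set \<Rightarrow> nat \<Rightarrow> (real ^ 'n) set \<Rightarrow> (real ^ 'n) set" where
  "ancestor \<D> k Q = (THE R. R \<in> \<D> \<and> Q \<subseteq> R \<and> side R = 2 ^ k * side Q)"

definition left_half :: "real set \<Rightarrow> real set" where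
  "left_half I = {t \<in> I. t < (Inf I + Sup I) / 2}"

definition right_half :: "real set \<Rightarrow> real set" where
  "right_half I = {t \<in> I. (Inf I + Sup I) / 2 \<le> t}"

text \<open>\<^const>\<open>True\<close> and \<^const>\<open>False\<close> stand for the superscripts 1 and 0.\<close>

definition haar1 :: "bool \<Rightarrow> real set \<Rightarrow> real \<Rightarrow> real" where
  "haar1 b I t = measure lborel I powr (- 1 / 2) *
     (if b then indicator (left_half I) t - indicator (right_half I) t else indicator I t)"

definition haar :: "('n \<Rightarrow> bool) \<Rightarrow> (real ^ 'n) set \<Rightarrow> real ^ 'n \<Rightarrow> real" where
  "haar \<eta> Q x = (\<Prod>i\<in>UNIV. haar1 (\<eta> i) ((\<lambda>y. y $ i) ` Q) (x $ i))"

definition pairing :: "(real ^ 'n \<Rightarrow> 'x::banach) \<Rightarrow> (real ^ 'n \<Rightarrow> real) \<Rightarrow> 'x" where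
  "pairing f h = strong_integral lborel (\<lambda>x. h x *\<^sub>R f x)"


section \<open>Bilinear dyadic shifts\<close>

text \<open>A shift is given by the types \<^term>\<open>\<eta> i I\<close> of the Haar functions in slot
  \<open>i \<in> {1, 2, 3}\<close> and by its coefficients \<^term>\<open>a K I1 I2 I3\<close>.\<close>

type_synonym ('n, 'x1, 'x2, 'y3) shift =
  "(nat \<Rightarrow> (real ^ 'n) set \<Rightarrow> 'n \<Rightarrow> bool) \<times>
   ((real ^ 'n) set \<Rightarrow> (real ^ 'n) set \<Rightarrow> (real ^ 'n) set \<Rightarrow> (real ^ 'n) set \<Rightarrow> 'x1 \<Rightarrow> 'x2 \<Rightarrow> 'y3)"

definition shift_index ::
  "(real ^ 'n) set set \<Rightarrow> nat \<Rightarrow> nat \<Rightarrow> nat \<Rightarrow>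
   ((real ^ 'n) set \<times> (real ^ 'n) set \<times> (real ^ 'n) set \<times> (real ^ 'n) set) set" where
  "shift_index \<D> k1 k2 k3 =
     {(K, I1, I2, I3). K \<in> \<D> \<and> I1 \<in> \<D> \<and> I2 \<in> \<D> \<and> I3 \<in> \<D> \<and>
        ancestor \<D> k1 I1 = K \<and> ancestor \<D> k2 I2 = K \<and> ancestor \<D> k3 I3 = K}"

definition shift_support ::
  "(real ^ 'n) set set \<Rightarrow> nat \<Rightarrow> nat \<Rightarrow> nat \<Rightarrow>
   ('n::finite, 'x1::banach, 'x2::banach, 'y3::banach) shift \<Rightarrow>
   ((real ^ 'n) set \<times> (real ^ 'n) set \<times> (real ^ 'n) set \<times> (real ^ 'n) set) set" where
  "shift_support \<D> k1 k2 k3 S =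
     {(K, I1, I2, I3) \<in> shift_index \<D> k1 k2 k3. snd S K I1 I2 I3 \<noteq> (\<lambda>_ _. 0)}"

definition is_shift ::
  "(real ^ 'n) set set \<Rightarrow> nat \<Rightarrow> nat \<Rightarrow> nat \<Rightarrow>
   ('n::finite, 'x1::banach, 'x2::banach, 'y3::banach) shift \<Rightarrow> bool" where
  "is_shift \<D> k1 k2 k3 S \<longleftrightarrow>
     (\<exists>i0\<in>{1, 2, 3}. \<forall>I\<in>\<D>. (\<forall>j. \<not> fst S i0 I j) \<and>
        (\<forall>i\<in>{1, 2, 3} - {i0}. \<exists>j. fst S i I j)) \<and>
     (\<forall>(K, I1, I2, I3)\<in>shift_index \<D> k1 k2 k3. bounded_bilinear (snd S K I1 I2 I3)) \<and>
     finite (shift_support \<D> k1 k2 k3 S)"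

definition shift_op ::
  "(real ^ 'n) set set \<Rightarrow> nat \<Rightarrow> nat \<Rightarrow> nat \<Rightarrow>
   ('n::finite, 'x1::banach, 'x2::banach, 'y3::banach) shift \<Rightarrow>
   (real ^ 'n \<Rightarrow> 'x1) \<Rightarrow> (real ^ 'n \<Rightarrow> 'x2) \<Rightarrow> real ^ 'n \<Rightarrow> 'y3" where
  "shift_op \<D> k1 k2 k3 S f1 f2 x =
     (\<Sum>(K, I1, I2, I3)\<in>shift_support \<D> k1 k2 k3 S.
        haar (fst S 3 I3) I3 x *\<^sub>R
          snd S K I1 I2 I3 (pairing f1 (haar (fst S 1 I1) I1)) (pairing f2 (haar (fst S 2 I2) I2)))"

definition normalized_coeffs ::
  "(real ^ 'n) set set \<Rightarrow> nat \<Rightarrow> nat \<Rightarrow> nat \<Rightarrow>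
   ('n::finite, 'x1::banach, 'x2::banach, 'y3::banach) shift \<Rightarrow> ('x1 \<Rightarrow> 'x2 \<Rightarrow> 'y3) set" where
  "normalized_coeffs \<D> k1 k2 k3 S =
     (\<lambda>(K, I1, I2, I3) x1 x2.
        ((measure lborel K)\<^sup>2 * measure lborel I1 powr (- 1 / 2) * measure lborel I2 powr (- 1 / 2) *
           measure lborel I3 powr (- 1 / 2)) *\<^sub>R snd S K I1 I2 I3 x1 x2)
       ` shift_index \<D> k1 k2 k3"

end

theory Submission
  imports Defs
begin

text \<open>Tested against functionals, a shift is a trilinear form. At generation \<open>n\<close> it averages, over triples of
  points of a cube \<open>K\<close>, a normalized coefficient applied to a martingale difference of generation
  \<open>n + k\<^sub>i\<close> in the two cancellative slots and to a conditional expectation in the remaining slot. All three spaces,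
  the dual of \<open>Y\<^sub>3\<close> included, are UMD with property alpha, so the slots play symmetric roles. Writing the
  conditional expectation as \<open>E\<^sub>n\<close> plus a block of differences leaves two kinds of terms. In each of them the
  level \<open>n\<close> can be absorbed into the indices of the R-hat-bound, at the cost of Rademacher norms of the
  differences at independently chosen points of the cubes. By property alpha, decoupling and UMD these norms
  are controlled by the functions themselves as soon as the blocks of differences are disjoint; this is
  achieved by splitting the levels into \<open>1 + max k\<^sub>i\<close> residue classes.\<close>

section \<open>Random signs\<close>

text \<open>The bound on the coefficients acts only on sums with the index pairs (t, u), (u, v), (t,
  v). A sum over levels must therefore become a larger sum of this shape, and two patterns achieve
  it: matrices that are diagonal in the level in all three pairs, or the level attached to one index
  shared by two of the pairs. The coefficient also depends on the three averaged points, so the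
  estimate is made for fixed points. Choosing one point in every cell of every level at once,
  independently for the three slots, gives a single estimate for all levels, and decoupling leads
  back from these points to the functions. A slot of depth \<open>k\<close> reaches
  \<open>k + 1\<close> levels below its cube, which is why levels \<open>k + 1\<close> apart are
  treated together. Everything happens on a finite set: finitely many coefficients see functions
  only through averages over small cubes and functionals only on step functions. A functional on
  L^s(Y3) thus becomes a finite family in the dual of Y3, whose norm is controlled by vectors that
  norm up to one half; the dual of the Lebesgue-Bochner space is never identified.\<close>

definition signs :: "'i set \<Rightarrow> ('i \<Rightarrow> real) set" where
  "signs A = PiE_dflt A 1 (\<lambda>_. {-1, 1})"

text \<open>A finite average in place of an expectation: linearity and the exchange of two
  expectations become rules for finite sums.\<close>

definition rad :: "'i set \<Rightarrow> (('i \<Rightarrow> real) \<Rightarrow> real) \<Rightarrow> real" where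
  "rad A F = (\<Sum>\<epsilon>\<in>signs A. F \<epsilon>) / 2 ^ card A"

lemma finite_signs [simp]: "finite A \<Longrightarrow> finite (signs A)"
  unfolding signs_def by auto

lemma card_signs: "finite A \<Longrightarrow> card (signs A) = 2 ^ card A"
  unfolding signs_def by (subst card_PiE_dflt) (auto simp: numeral_2_eq_2)

lemma signs_nonempty: "signs A \<noteq> {}"
  unfolding signs_def by simp

text \<open>The default value 1 outside \<open>A\<close> is itself a sign. Membership in
  \<open>A\<close> is therefore not asked for, and a sign pattern can serve as a martingale
  transform indexed by all naturals.\<close>

lemma signsD: "\<epsilon> \<in> signs A \<Longrightarrow> \<epsilon> a \<in> {-1, 1}"
  unfolding signs_def PiE_dflt_def by (cases "a \<in> A") auto

lemma expectation_random_signs: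
  assumes "finite A"
  shows "measure_pmf.expectation (random_signs A) F = rad A F"
proof -
  have "random_signs A = pmf_of_set (signs A)"
    unfolding random_signs_def signs_def using assms by (subst Pi_pmf_of_set) auto
  then show ?thesis
    using assms by (simp add: integral_pmf_of_set signs_nonempty card_signs rad_def)
qed

lemma rad_mono: "(\<And>\<epsilon>. \<epsilon> \<in> signs A \<Longrightarrow> F \<epsilon> \<le> G \<epsilon>) \<Longrightarrow> rad A F \<le> rad A G"
  unfolding rad_def by (intro divide_right_mono sum_mono) auto

lemma rad_nonneg: "(\<And>\<epsilon>. \<epsilon> \<in> signs A \<Longrightarrow> 0 \<le> F \<epsilon>) \<Longrightarrow> 0 \<le> rad A F"
  unfolding rad_def by (intro divide_nonneg_nonneg sum_nonneg) auto

lemma rad_cong: "(\<And>\<epsilon>. \<epsilon> \<in> signs A \<Longrightarrow> F \<epsilon> = G \<epsilon>) \<Longrightarrow> rad A F = rad A G"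
  unfolding rad_def by simp

lemma rad_add: "rad A (\<lambda>\<epsilon>. F \<epsilon> + G \<epsilon>) = rad A F + rad A G"
  unfolding rad_def by (simp add: sum.distrib add_divide_distrib)

lemma rad_cmult: "rad A (\<lambda>\<epsilon>. c * F \<epsilon>) = c * rad A F"
  unfolding rad_def by (simp add: sum_distrib_left)

lemma rad_cdiv: "rad A (\<lambda>\<epsilon>. F \<epsilon> / c) = rad A F / c"
  unfolding rad_def by (simp add: sum_divide_distrib[symmetric])

lemma rad_sum: "rad A (\<lambda>\<epsilon>. \<Sum>s\<in>S. F s \<epsilon>) = (\<Sum>s\<in>S. rad A (F s))"
  unfolding rad_def by (subst sum.swap) (simp add: sum_divide_distrib)

lemma rad_const: "finite A \<Longrightarrow> rad A (\<lambda>_. c) = c"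
  unfolding rad_def by (simp add: card_signs)

lemma rad_swap: "rad A (\<lambda>\<epsilon>. rad B (\<lambda>\<delta>. F \<epsilon> \<delta>)) = rad B (\<lambda>\<delta>. rad A (\<lambda>\<epsilon>. F \<epsilon> \<delta>))"
  unfolding rad_def
  by (simp add: sum_divide_distrib[symmetric]) (subst sum.swap, simp add: mult.commute)

lemma rad_empty: "rad {} F = F (\<lambda>_. 1)"
proof -
  have "signs {} = {\<lambda>_::'a. 1}" by (auto simp: signs_def PiE_dflt_def)
  then show ?thesis unfolding rad_def by simp
qed

lemma rad_insert:
  assumes "finite A" "a \<notin> A"
  shows "rad (insert a A) F = (rad A (\<lambda>\<epsilon>. F (\<epsilon>(a := 1))) + rad A (\<lambda>\<epsilon>. F (\<epsilon>(a := -1)))) / 2"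
proof -
  have un: "signs (insert a A) = (\<lambda>\<epsilon>. \<epsilon>(a := 1)) ` signs A \<union> (\<lambda>\<epsilon>. \<epsilon>(a := -1)) ` signs A"
  proof (intro equalityI subsetI)
    fix x assume x: "x \<in> signs (insert a A)"
    define y where "y = x(a := 1)"
    have y: "y \<in> signs A"
      using x assms by (auto simp: signs_def PiE_dflt_def y_def)
    have "x = y(a := x a)" by (auto simp: y_def)
    moreover have "x a \<in> {-1, 1}" by (rule signsD[OF x])
    ultimately show "x \<in> (\<lambda>\<epsilon>. \<epsilon>(a := 1)) ` signs A \<union> (\<lambda>\<epsilon>. \<epsilon>(a := -1)) ` signs A"
      using y by auto
  next
    fix x assume "x \<in> (\<lambda>\<epsilon>. \<epsilon>(a := 1)) ` signs A \<union> (\<lambda>\<epsilon>. \<epsilon>(a := -1)) ` signs A"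
    then obtain y s where y: "y \<in> signs A" "x = y(a := s)" "s \<in> {-1, 1}" by auto
    have "x i \<in> {-1, 1}" "i \<notin> insert a A \<Longrightarrow> x i = 1" for i
      using y signsD[OF y(1), of i] by (auto simp: signs_def PiE_dflt_def)
    then show "x \<in> signs (insert a A)"
      by (auto simp: signs_def PiE_dflt_def)
  qed
  have inj: "inj_on (\<lambda>\<epsilon>. \<epsilon>(a := s)) (signs A)" for s
  proof (rule inj_onI)
    fix x y assume xy: "x \<in> signs A" "y \<in> signs A" and eq: "x(a := s) = y(a := s)"
    show "x = y"
    proof
      fix i show "x i = y i"
        using xy assms fun_cong[OF eq, of i] by (cases "i = a") (auto simp: signs_def PiE_dflt_def)
    qed
  qed
  have disj: "(\<lambda>\<epsilon>. \<epsilon>(a := 1)) ` signs A \<inter> (\<lambda>\<epsilon>. \<epsilon>(a := -1)) ` signs A = {}"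
    by (auto dest!: fun_cong[of _ _ a])
  have "(\<Sum>\<epsilon>\<in>signs (insert a A). F \<epsilon>)
      = (\<Sum>\<epsilon>\<in>signs A. F (\<epsilon>(a := 1))) + (\<Sum>\<epsilon>\<in>signs A. F (\<epsilon>(a := -1)))"
    unfolding un using assms disj inj
    by (subst sum.union_disjoint) (auto simp: sum.reindex)
  then show ?thesis
    using assms by (simp add: rad_def add_divide_distrib)
qed

text \<open>Every additional coordinate splits the average into two equal halves, because
  \<open>F\<close> does not see its value.\<close>

lemma rad_superset:
  assumes "finite A" "B \<subseteq> A" and dep: "\<And>\<epsilon> \<delta>. (\<And>b. b \<in> B \<Longrightarrow> \<epsilon> b = \<delta> b) \<Longrightarrow> F \<epsilon> = F \<delta>"
  shows "rad A F = rad B F"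
proof -
  have "rad (B \<union> C) F = rad B F" if "finite C" "C \<inter> B = {}" for C
    using that
  proof (induction C)
    case (insert c C)
    have fin: "finite (B \<union> C)" using insert assms finite_subset by blast
    have "F (\<epsilon>(c := s)) = F \<epsilon>" for s \<epsilon>
      using insert by (intro dep) auto
    then have "rad (insert c (B \<union> C)) F = rad (B \<union> C) F"
      using insert fin by (subst rad_insert) auto
    then show ?case using insert by auto
  qed auto
  from this[of "A - B"] assms show ?thesis
    by (metis Diff_disjoint Diff_partition Int_commute finite_Diff)
qed

lemma rad_image:
  assumes "inj_on h B"
  shows "rad (h ` B) F = rad B (\<lambda>\<delta>. F (\<lambda>a. if a \<in> h ` B then \<delta> (the_inv_into B h a) else 1))"
proof -
  have "bij_betw (\<lambda>\<delta> a. if a \<in> h ` B then \<delta> (the_inv_into B h a) else 1) (signs B) (signs (h ` B))"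
  proof (rule bij_betw_byWitness[where f' = "\<lambda>\<epsilon> b. if b \<in> B then \<epsilon> (h b) else 1"])
    show "\<forall>\<delta>\<in>signs B. (\<lambda>b. if b \<in> B then (if h b \<in> h ` B then \<delta> (the_inv_into B h (h b)) else 1) else 1) = \<delta>"
      using assms by (auto simp: signs_def PiE_dflt_def the_inv_into_f_f fun_eq_iff)
    show "\<forall>\<epsilon>\<in>signs (h ` B). (\<lambda>a. if a \<in> h ` B
        then (if the_inv_into B h a \<in> B then \<epsilon> (h (the_inv_into B h a)) else 1) else 1) = \<epsilon>"
      using assms by (auto simp: signs_def PiE_dflt_def the_inv_into_f_f fun_eq_iff)
    show "(\<lambda>\<delta> a. if a \<in> h ` B then \<delta> (the_inv_into B h a) else 1) ` signs B \<subseteq> signs (h ` B)"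
      using assms by (auto simp: signs_def PiE_dflt_def the_inv_into_f_f)
    show "(\<lambda>\<epsilon> b. if b \<in> B then \<epsilon> (h b) else 1) ` signs (h ` B) \<subseteq> signs B"
      by (auto simp: signs_def PiE_dflt_def)
  qed
  from sum.reindex_bij_betw[OF this, of F] show ?thesis
    using assms by (simp add: rad_def card_image)
qed

text \<open>The signs at the image of \<open>h\<close> are again independent, and the remaining ones
  average out. Index sets are moved by this rule, since property alpha and the R-hat-bound are
  formulated over the intervals \<open>{1..N}\<close>.\<close>

lemma rad_reindex_fun:
  assumes "finite A" "inj_on h B" "h ` B \<subseteq> A" and dep: "\<And>\<epsilon> \<delta>. (\<And>b. b \<in> B \<Longrightarrow> \<epsilon> b = \<delta> b) \<Longrightarrow> F \<epsilon> = F \<delta>"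
  shows "rad A (\<lambda>\<epsilon>. F (\<lambda>b. \<epsilon> (h b))) = rad B F"
proof -
  have "rad A (\<lambda>\<epsilon>. F (\<lambda>b. \<epsilon> (h b))) = rad (h ` B) (\<lambda>\<epsilon>. F (\<lambda>b. \<epsilon> (h b)))"
    using assms(1,3) by (intro rad_superset dep) auto
  also have "\<dots> = rad B F"
    unfolding rad_image[OF assms(2)]
    by (intro rad_cong dep) (use assms(2) in \<open>auto simp: the_inv_into_f_f\<close>)
  finally show ?thesis .
qed

lemma rad_reindex:
  fixes e :: "'b \<Rightarrow> 'v::real_vector"
  assumes "finite A" "inj_on h B" "h ` B \<subseteq> A"
  shows "rad A (\<lambda>\<epsilon>. G (\<Sum>b\<in>B. \<epsilon> (h b) *\<^sub>R e b)) = rad B (\<lambda>\<epsilon>. G (\<Sum>b\<in>B. \<epsilon> b *\<^sub>R e b))"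
  by (rule rad_reindex_fun[OF assms, of "\<lambda>\<epsilon>. G (\<Sum>b\<in>B. \<epsilon> b *\<^sub>R e b)"]) simp

text \<open>Multiplication by fixed signs is an involution of \<open>signs A\<close>, so it permutes
  the patterns.\<close>

lemma rad_flip:
  fixes e :: "'b \<Rightarrow> 'v::real_vector"
  assumes "finite A" and \<sigma>: "\<And>a. a \<in> A \<Longrightarrow> \<sigma> a \<in> {-1, 1::real}"
  shows "rad A (\<lambda>\<epsilon>. G (\<Sum>a\<in>A. (\<epsilon> a * \<sigma> a) *\<^sub>R e a)) = rad A (\<lambda>\<epsilon>. G (\<Sum>a\<in>A. \<epsilon> a *\<^sub>R e a))"
proof -
  let ?h = "\<lambda>\<epsilon> a. if a \<in> A then \<epsilon> a * \<sigma> a else 1"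
  have sq: "\<sigma> a * \<sigma> a = 1" if "a \<in> A" for a using \<sigma>[OF that] by auto
  have "bij_betw ?h (signs A) (signs A)"
  proof (rule bij_betw_byWitness[where f' = ?h])
    show "?h ` signs A \<subseteq> signs A" using \<sigma> by (fastforce simp: signs_def PiE_dflt_def)
    then show "?h ` signs A \<subseteq> signs A" .
    show "\<forall>\<epsilon>\<in>signs A. ?h (?h \<epsilon>) = \<epsilon>"
      by (auto simp: signs_def PiE_dflt_def fun_eq_iff mult.assoc sq)
    then show "\<forall>\<epsilon>\<in>signs A. ?h (?h \<epsilon>) = \<epsilon>" .
  qed
  from sum.reindex_bij_betw[OF this, of "\<lambda>\<epsilon>. G (\<Sum>a\<in>A. \<epsilon> a *\<^sub>R e a)"] show ?thesis
    by (simp add: rad_def)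
qed

text \<open>Orthonormality of the sign variables: the square of a sign is 1, and for distinct
  indices the two values of \<open>\<epsilon> a\<close> cancel.\<close>

lemma rad_prod2:
  assumes "finite A" "a \<in> A" "b \<in> A"
  shows "rad A (\<lambda>\<epsilon>. \<epsilon> a * \<epsilon> b) = (if a = b then 1 else 0)"
proof (cases "a = b")
  case True
  have "\<epsilon> a * \<epsilon> a = 1" if "\<epsilon> \<in> signs A" for \<epsilon> using signsD[OF that, of a] by auto
  then have "rad A (\<lambda>\<epsilon>. \<epsilon> a * \<epsilon> b) = rad A (\<lambda>_. 1)"
    using True by (intro rad_cong) auto
  then show ?thesis using True assms by (simp add: rad_const)
next
  case False
  define A' where "A' = A - {a}"
  have A: "A = insert a A'" "a \<notin> A'" "finite A'" using assms by (auto simp: A'_def)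
  have "rad A (\<lambda>\<epsilon>. \<epsilon> a * \<epsilon> b) = (rad A' (\<lambda>\<epsilon>. 1 * \<epsilon> b) + rad A' (\<lambda>\<epsilon>. - 1 * \<epsilon> b)) / 2"
    unfolding A(1) using False A by (subst rad_insert) auto
  also have "\<dots> = 0" unfolding rad_cmult by simp
  finally show ?thesis using False by simp
qed

section \<open>Convexity of powers and Hoelder's inequality\<close>

lemma tangent_powr:
  fixes t l p :: real
  assumes "1 < p" "0 \<le> t" "0 \<le> l"
  shows "l powr p + p * l powr (p - 1) * (t - l) \<le> t powr p"
proof -
  define q where "q = p / (p - 1)"
  have q: "1/p + 1/q = 1" "q > 1" using assms by (auto simp: q_def field_simps)
  \<comment> \<open>Young's inequality for \<open>t\<close> and \<open>l powr (p - 1)\<close> is the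
    tangent inequality in another form, and it covers \<open>l = 0\<close>.\<close>
  have "t * l powr (p - 1) \<le> t powr p / p + (l powr (p - 1)) powr q / q"
    using assms q by (intro Youngs_inequality) auto
  also have "(l powr (p - 1)) powr q = l powr p"
    using assms by (simp add: powr_powr q_def)
  finally have 1: "t * l powr (p - 1) \<le> t powr p / p + l powr p / q" .
  have "1 / q = 1 - 1 / p" using q by simp
  then have "l powr p * (1 / q) = l powr p * (1 - 1 / p)" by simp
  then have "l powr p / q = l powr p - l powr p / p" by (simp add: right_diff_distrib)
  with 1 have "t * l powr (p - 1) - l powr p \<le> t powr p / p - l powr p / p" by simp
  then have "p * (t * l powr (p - 1) - l powr p) \<le> t powr p - l powr p"
    using assms by (simp add: field_simps)
  moreover have "l * l powr (p - 1) = l powr p"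
    using assms by (cases "l = 0") (auto simp: powr_mult_base)
  ultimately show ?thesis by (simp add: algebra_simps)
qed

text \<open>Jensen's inequality for the uniform mean: when the tangents at the mean \<open>l\<close>
  are summed, the linear terms add up to zero.\<close>

lemma power_sum_le:
  fixes f :: "'a \<Rightarrow> real"
  assumes "finite S" "1 < p" "\<And>s. s \<in> S \<Longrightarrow> 0 \<le> f s"
  shows "((\<Sum>s\<in>S. f s) / card S) powr p \<le> (\<Sum>s\<in>S. f s powr p) / card S"
proof (cases "S = {}")
  case False
  define l where "l = (\<Sum>s\<in>S. f s) / card S"
  have c: "real (card S) > 0" using False assms by (simp add: card_gt_0_iff)
  have l: "l \<ge> 0" unfolding l_def using assms by (intro divide_nonneg_nonneg sum_nonneg) auto
  have "(\<Sum>s\<in>S. l powr p + p * l powr (p - 1) * (f s - l)) \<le> (\<Sum>s\<in>S. f s powr p)"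
    using assms l by (intro sum_mono tangent_powr) auto
  also have "(\<Sum>s\<in>S. l powr p + p * l powr (p - 1) * (f s - l))
     = card S * l powr p + p * l powr (p - 1) * ((\<Sum>s\<in>S. f s) - card S * l)"
    by (simp add: sum.distrib sum_distrib_left[symmetric] sum_subtractf)
  also have "\<dots> = card S * l powr p" using c by (simp add: l_def)
  finally show ?thesis using c unfolding l_def[symmetric] by (simp add: field_simps)
qed auto

lemma rad_powr_le:
  assumes "finite A" "1 < p" "\<And>\<epsilon>. \<epsilon> \<in> signs A \<Longrightarrow> 0 \<le> F \<epsilon>"
  shows "rad A F powr p \<le> rad A (\<lambda>\<epsilon>. F \<epsilon> powr p)"
  using power_sum_le[of "signs A" p F] assms by (simp add: rad_def card_signs)

text \<open>After normalising the three norms to 1, the pointwise Young inequality for three factors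
  suffices. It comes from the two-factor one by grouping: first \<open>x\<close> against
  \<open>y * z\<close>, then the powers \<open>t\<close> of \<open>y\<close> and \<open>z\<close>
  against each other.\<close>

lemma Hoelder3:
  fixes a b c :: "'a \<Rightarrow> real"
  assumes p: "1 < p" "1 < q" "1 < r" "1/p + 1/q + 1/r = 1"
    and nn: "\<And>s. s \<in> S \<Longrightarrow> 0 \<le> a s" "\<And>s. s \<in> S \<Longrightarrow> 0 \<le> b s" "\<And>s. s \<in> S \<Longrightarrow> 0 \<le> c s"
  shows "(\<Sum>s\<in>S. a s * b s * c s) \<le>
    (\<Sum>s\<in>S. a s powr p) powr (1/p) * (\<Sum>s\<in>S. b s powr q) powr (1/q) * (\<Sum>s\<in>S. c s powr r) powr (1/r)"
proof (cases "finite S")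
  case fin: True
  have young: "x * y * z \<le> x powr p / p + y powr q / q + z powr r / r"
    if "0 \<le> x" "0 \<le> y" "0 \<le> z" for x y z :: real
  proof -
    \<comment> \<open>\<open>t\<close> is the exponent conjugate to \<open>p\<close>; since 1/t =
      1/q + 1/r, the exponents \<open>q / t\<close> and \<open>r / t\<close> are conjugate
      again.\<close>
    define t where "t = p / (p - 1)"
    have t: "t > 1" "1/p + 1/t = 1" "t > 0" using p by (auto simp: t_def field_simps)
    have it: "1/t = 1/q + 1/r" using t p by linarith
    have "t / q + t / r = t * (1/t)" unfolding it by (simp add: distrib_left)
    then have conj: "1/(q/t) + 1/(r/t) = 1" using t p by simp
    have "1/q < 1/t" "1/r < 1/t" using it p by auto
    then have "t < q" "t < r" using t p by (auto simp: field_simps)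
    then have gt: "q/t > 1" "r/t > 1" using t by auto
    have "x * (y * z) \<le> x powr p / p + (y * z) powr t / t"
      using p t that by (intro Youngs_inequality) auto
    also have "(y * z) powr t = y powr t * z powr t" using that by (simp add: powr_mult)
    also have "\<dots> \<le> (y powr t) powr (q/t) / (q/t) + (z powr t) powr (r/t) / (r/t)"
      using gt conj by (intro Youngs_inequality) auto
    also have "\<dots> = t * (y powr q / q + z powr r / r)" using t by (simp add: powr_powr field_simps)
    finally have "x * (y * z) \<le> x powr p / p + (t * (y powr q / q + z powr r / r)) / t"
      using t by (simp add: divide_right_mono)
    then show ?thesis using t by (simp add: mult.assoc)
  qed
  define A where "A = (\<Sum>s\<in>S. a s powr p) powr (1/p)"
  define B where "B = (\<Sum>s\<in>S. b s powr q) powr (1/q)"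
  define C where "C = (\<Sum>s\<in>S. c s powr r) powr (1/r)"
  have zero: "\<forall>s\<in>S. f s = 0" if "(\<Sum>s\<in>S. f s powr t) powr (1/t) = 0" "t > 1" for f :: "'a \<Rightarrow> real" and t :: real
    using that fin by (auto simp: sum_nonneg_eq_0_iff)
  show ?thesis
  proof (cases "A = 0 \<or> B = 0 \<or> C = 0")
    case True
    then have "\<forall>s\<in>S. a s * b s * c s = 0"
      using zero[of a p] zero[of b q] zero[of c r] p unfolding A_def B_def C_def by auto
    then have "(\<Sum>s\<in>S. a s * b s * c s) = 0" by (intro sum.neutral) auto
    then show ?thesis by simp
  next
    case False
    then have pos: "A > 0" "B > 0" "C > 0" by (auto simp: A_def B_def C_def less_le)
    have one: "(\<Sum>s\<in>S. (f s / D) powr t) = 1"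
      if "D = (\<Sum>s\<in>S. f s powr t) powr (1/t)" "D > 0" "t > 1" "\<And>s. s \<in> S \<Longrightarrow> 0 \<le> f s"
      for f :: "'a \<Rightarrow> real" and t D :: real
    proof -
      have nn: "0 \<le> (\<Sum>s\<in>S. f s powr t)" by (rule sum_nonneg) auto
      then have Dt: "D powr t = (\<Sum>s\<in>S. f s powr t)" using that by (simp add: powr_powr)
      have "(\<Sum>s\<in>S. (f s / D) powr t) = (\<Sum>s\<in>S. f s powr t) / D powr t"
        using that by (simp add: powr_divide sum_divide_distrib)
      then show ?thesis using Dt that by simp
    qed
    have "(\<Sum>s\<in>S. (a s / A) * (b s / B) * (c s / C)) \<le>
       (\<Sum>s\<in>S. (a s / A) powr p / p + (b s / B) powr q / q + (c s / C) powr r / r)"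
      using pos nn by (intro sum_mono young) auto
    also have "\<dots> = 1/p + 1/q + 1/r"
      using one[OF A_def pos(1) p(1) nn(1)] one[OF B_def pos(2) p(2) nn(2)] one[OF C_def pos(3) p(3) nn(3)]
      by (simp add: sum.distrib sum_divide_distrib[symmetric])
    finally have "(\<Sum>s\<in>S. (a s / A) * (b s / B) * (c s / C)) \<le> 1" using p by simp
    moreover have "(\<Sum>s\<in>S. (a s / A) * (b s / B) * (c s / C)) = (\<Sum>s\<in>S. a s * b s * c s) / (A * B * C)"
      by (simp add: sum_divide_distrib)
    ultimately show ?thesis using pos by (simp add: A_def[symmetric] B_def[symmetric] C_def[symmetric])
  qed
qed auto

section \<open>Norms of finite l^p spaces and Minkowski's inequality\<close>

definition lpsum :: "real \<Rightarrow> 'a set \<Rightarrow> ('a \<Rightarrow> real) \<Rightarrow> real" where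
  "lpsum p S f = (\<Sum>s\<in>S. f s powr p) powr (1 / p)"

lemma lpsum_nonneg [simp]: "0 \<le> lpsum p S f"
  by (simp add: lpsum_def)

lemma lpsum_powr: "0 < p \<Longrightarrow> lpsum p S f powr p = (\<Sum>s\<in>S. f s powr p)"
  by (simp add: lpsum_def powr_powr sum_nonneg)

lemma lpsum_mono:
  assumes "0 < p" "\<And>s. s \<in> S \<Longrightarrow> 0 \<le> f s" "\<And>s. s \<in> S \<Longrightarrow> f s \<le> g s"
  shows "lpsum p S f \<le> lpsum p S g"
  unfolding lpsum_def using assms
  by (intro powr_mono2 sum_nonneg sum_mono) auto

lemma lpsum_cmult:
  assumes "0 < p" "0 \<le> c" "\<And>s. s \<in> S \<Longrightarrow> 0 \<le> f s"
  shows "lpsum p S (\<lambda>s. c * f s) = c * lpsum p S f"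
proof -
  have "(\<Sum>s\<in>S. (c * f s) powr p) = c powr p * (\<Sum>s\<in>S. f s powr p)"
    using assms by (simp add: powr_mult sum_distrib_left)
  then show ?thesis
    using assms by (simp add: lpsum_def powr_mult powr_powr sum_nonneg)
qed

lemma lpsum_eq_0:
  assumes "finite S" "0 < p" "\<And>s. s \<in> S \<Longrightarrow> 0 \<le> f s" "lpsum p S f = 0" "s \<in> S"
  shows "f s = 0"
  using assms by (auto simp: lpsum_def sum_nonneg_eq_0_iff)

lemma powr_convex2:
  assumes "1 < p" "0 \<le> u" "0 \<le> v" "0 \<le> a" "0 \<le> b" "a + b = (1::real)"
  shows "(a * u + b * v) powr p \<le> a * u powr p + b * v powr p"
proof -
  define l where "l = a * u + b * v"
  have l: "0 \<le> l" using assms by (auto simp: l_def)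
  have "a * (l powr p + p * l powr (p - 1) * (u - l)) + b * (l powr p + p * l powr (p - 1) * (v - l))
      \<le> a * u powr p + b * v powr p"
    using assms l by (intro add_mono mult_left_mono tangent_powr) auto
  also have "a * (l powr p + p * l powr (p - 1) * (u - l)) + b * (l powr p + p * l powr (p - 1) * (v - l))
      = (a + b) * l powr p + p * l powr (p - 1) * ((a * u + b * v) - (a + b) * l)"
    by (simp add: algebra_simps)
  also have "\<dots> = l powr p" unfolding assms(6) by (simp add: l_def)
  finally show ?thesis by (simp add: l_def)
qed

text \<open>The quotients \<open>f / A\<close> and \<open>g / B\<close> have norm 1, and
  \<open>(f + g) / (A + B)\<close> is their convex combination with weights \<open>A/(A+B)\<close>
  and \<open>B/(A+B)\<close>; convexity of the power bounds its norm by 1.\<close>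

lemma Minkowski:
  assumes p: "1 < p" and fin: "finite S"
    and nn: "\<And>s. s \<in> S \<Longrightarrow> 0 \<le> f s" "\<And>s. s \<in> S \<Longrightarrow> 0 \<le> g s"
  shows "lpsum p S (\<lambda>s. f s + g s) \<le> lpsum p S f + lpsum p S g"
proof -
  define A where "A = lpsum p S f"
  define B where "B = lpsum p S g"
  show ?thesis
  proof (cases "A = 0 \<or> B = 0")
    case True
    then show ?thesis
    proof
      assume "A = 0"
      then have "\<forall>s\<in>S. f s = 0" using lpsum_eq_0[OF fin, of p f] p nn by (auto simp: A_def)
      then have "lpsum p S (\<lambda>s. f s + g s) = lpsum p S g" by (simp add: lpsum_def)
      then show ?thesis by simp
    next
      assume "B = 0"
      then have "\<forall>s\<in>S. g s = 0" using lpsum_eq_0[OF fin, of p g] p nn by (auto simp: B_def)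
      then have "lpsum p S (\<lambda>s. f s + g s) = lpsum p S f" by (simp add: lpsum_def)
      then show ?thesis by simp
    qed
  next
    case False
    then have pos: "A > 0" "B > 0" by (auto simp: A_def B_def less_le)
    have "(f s + g s) powr p = (A + B) powr p * (A/(A+B) * (f s / A) + B/(A+B) * (g s / B)) powr p" if "s \<in> S" for s
    proof -
      have "f s + g s = (A + B) * (A/(A+B) * (f s / A) + B/(A+B) * (g s / B))"
        using pos by (simp add: add_divide_distrib[symmetric])
      then show ?thesis using pos nn that by (simp add: powr_mult)
    qed
    then have "(\<Sum>s\<in>S. (f s + g s) powr p) =
        (A + B) powr p * (\<Sum>s\<in>S. (A/(A+B) * (f s / A) + B/(A+B) * (g s / B)) powr p)"
      by (simp add: sum_distrib_left)
    also have "\<dots> \<le> (A + B) powr p * (\<Sum>s\<in>S. A/(A+B) * (f s / A) powr p + B/(A+B) * (g s / B) powr p)"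
      using pos nn p by (intro mult_left_mono sum_mono powr_convex2) (auto simp: add_divide_distrib[symmetric])
    also have "(\<Sum>s\<in>S. A/(A+B) * (f s / A) powr p + B/(A+B) * (g s / B) powr p)
        = A/(A+B) * ((\<Sum>s\<in>S. f s powr p) / A powr p) + B/(A+B) * ((\<Sum>s\<in>S. g s powr p) / B powr p)"
      using pos nn by (simp add: sum.distrib sum_distrib_left sum_divide_distrib powr_divide)
    also have "\<dots> = 1"
      using p pos lpsum_powr[of p S f] lpsum_powr[of p S g]
      by (simp add: A_def[symmetric] B_def[symmetric] flip: add_divide_distrib lpsum_powr)
    finally have "(\<Sum>s\<in>S. (f s + g s) powr p) \<le> (A + B) powr p" by simp
    then have "lpsum p S (\<lambda>s. f s + g s) \<le> ((A + B) powr p) powr (1/p)"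
      unfolding lpsum_def using p by (intro powr_mono2) (auto intro: sum_nonneg)
    then show ?thesis using p pos by (simp add: powr_powr A_def B_def)
  qed
qed

section \<open>Seminorms and the Khinchine-Kahane inequality\<close>

definition is_seminorm :: "('v::real_vector \<Rightarrow> real) \<Rightarrow> bool" where
  "is_seminorm q \<longleftrightarrow> (\<forall>x y. q (x + y) \<le> q x + q y) \<and> (\<forall>c x. q (c *\<^sub>R x) = \<bar>c\<bar> * q x)"

lemma is_seminorm_norm: "is_seminorm (norm :: 'v::real_normed_vector \<Rightarrow> real)"
  by (auto simp: is_seminorm_def norm_triangle_ineq)

lemma is_seminormD:
  assumes "is_seminorm q"
  shows "q (x + y) \<le> q x + q y" "q (c *\<^sub>R x) = \<bar>c\<bar> * q x" "0 \<le> q x"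
proof -
  show "q (x + y) \<le> q x + q y" "q (c *\<^sub>R x) = \<bar>c\<bar> * q x" for x y c
    using assms by (auto simp: is_seminorm_def)
  from this(1)[of x "-1 *\<^sub>R x"] this(2)[of "-1" x] this(2)[of 0 x] show "0 \<le> q x" by simp
qed

text \<open>A two-point hypercontractive estimate between the second and the \<open>2n\<close>-th
  moment, with the crude contraction factor \<open>1 / (2n)\<close>. With \<open>r = b / a\<close>
  the two powers are at most exp(r) and exp(-r), whose mean is at most 1 + r^2, and this is at most
  its own \<open>n\<close>-th power.\<close>

lemma two_point_power:
  fixes a b :: real
  assumes "\<bar>b\<bar> \<le> a" "0 < n"
  shows "((a + b / (2 * real n)) ^ (2 * n) + (a - b / (2 * real n)) ^ (2 * n)) / 2 \<le> (a\<^sup>2 + b\<^sup>2) ^ n"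
proof (cases "a = 0")
  case True
  then show ?thesis using assms by (simp add: power_0_left)
next
  case False
  then have a: "a > 0" using assms by auto
  define r where "r = b / a"
  have r: "\<bar>r\<bar> \<le> 1" using assms a by (simp add: r_def abs_divide)
  have ex: "(1 + s / (2 * real n)) ^ (2 * n) \<le> exp s" if "\<bar>s\<bar> \<le> 1" for s :: real
    using exp_ge_one_plus_x_over_n_power_n[of "2 * n" s] that assms by simp
  have cosh: "exp s + exp (- s) \<le> 2 * (1 + s\<^sup>2)" if "0 \<le> s" "s \<le> 1" for s :: real
  proof -
    have "exp s \<le> 1 + s + s\<^sup>2" using that by (rule exp_bound)
    moreover have "exp (- s) \<le> 1 - s + s\<^sup>2"
    proof -
      have "exp (- s) = 1 / exp s" by (simp add: exp_minus inverse_eq_divide)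
      also have "\<dots> \<le> 1 / (1 + s)" using that by (intro divide_left_mono) auto
      also have "\<dots> \<le> 1 - s + s\<^sup>2"
      proof -
        have "(1 - s + s\<^sup>2) * (1 + s) = 1 + s ^ 3" by (simp add: algebra_simps power2_eq_square power3_eq_cube)
        then show ?thesis using that by (simp add: field_simps)
      qed
      finally show ?thesis .
    qed
    ultimately show ?thesis by simp
  qed
  have "exp r + exp (- r) \<le> 2 * (1 + r\<^sup>2)"
    using cosh[of r] cosh[of "- r"] r by (cases "0 \<le> r") auto
  moreover have "(1 + r / (2 * real n)) ^ (2 * n) \<le> exp r" "(1 - r / (2 * real n)) ^ (2 * n) \<le> exp (- r)"
    using ex[of r] ex[of "- r"] r by auto
  ultimately have "((1 + r / (2 * real n)) ^ (2 * n) + (1 - r / (2 * real n)) ^ (2 * n)) / 2 \<le> 1 + r\<^sup>2"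
    by simp
  also have "\<dots> \<le> (1 + r\<^sup>2) ^ n"
    using assms by (intro self_le_power) auto
  finally have "a ^ (2 * n) * (((1 + r / (2 * real n)) ^ (2 * n) + (1 - r / (2 * real n)) ^ (2 * n)) / 2)
      \<le> a ^ (2 * n) * (1 + r\<^sup>2) ^ n"
    using a by (intro mult_left_mono) auto
  moreover have "a ^ (2 * n) * (1 + r\<^sup>2) ^ n = (a\<^sup>2 + b\<^sup>2) ^ n"
  proof -
    have "a\<^sup>2 * (1 + r\<^sup>2) = a\<^sup>2 + b\<^sup>2" using a by (simp add: r_def power_divide distrib_left)
    then show ?thesis by (metis power_mult power_mult_distrib)
  qed
  moreover have "a ^ (2 * n) * (1 + r / (2 * real n)) ^ (2 * n) = (a + b / (2 * real n)) ^ (2 * n)"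
    "a ^ (2 * n) * (1 - r / (2 * real n)) ^ (2 * n) = (a - b / (2 * real n)) ^ (2 * n)"
  proof -
    have "a * (1 + r / (2 * real n)) = a + b / (2 * real n)" "a * (1 - r / (2 * real n)) = a - b / (2 * real n)"
      using a by (simp_all add: r_def distrib_left right_diff_distrib)
    then show "a ^ (2 * n) * (1 + r / (2 * real n)) ^ (2 * n) = (a + b / (2 * real n)) ^ (2 * n)"
      "a ^ (2 * n) * (1 - r / (2 * real n)) ^ (2 * n) = (a - b / (2 * real n)) ^ (2 * n)"
      by (metis power_mult_distrib)+
  qed
  ultimately show ?thesis by (simp add: distrib_left)
qed

lemma lpsum2: "(\<And>s. s \<in> S \<Longrightarrow> 0 \<le> f s) \<Longrightarrow> lpsum 2 S f = sqrt (\<Sum>s\<in>S. (f s)\<^sup>2)"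
  by (simp add: lpsum_def powr_half_sqrt sum_nonneg)

lemma Khinchine_Kahane_aux:
  fixes e :: "'i \<Rightarrow> 'v::real_vector"
  assumes q: "is_seminorm q" and n: "0 < n" and "finite A"
  shows "rad A (\<lambda>\<epsilon>. q (x + (\<Sum>a\<in>A. (\<epsilon> a / (2 * real n)) *\<^sub>R e a)) ^ (2 * n))
    \<le> rad A (\<lambda>\<epsilon>. (q (x + (\<Sum>a\<in>A. \<epsilon> a *\<^sub>R e a)))\<^sup>2) ^ n"
  using \<open>finite A\<close>
proof (induction A arbitrary: x)
  case empty
  then show ?case by (simp add: rad_empty power_mult)
next
  case (insert a A)
  define \<rho> where "\<rho> = 1 / (2 * real n)"
  define S where "S \<epsilon> = (\<Sum>a\<in>A. \<epsilon> a *\<^sub>R e a)" for \<epsilon> :: "'i \<Rightarrow> real"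
  define T where "T t \<epsilon> = q (x + t *\<^sub>R e a + S \<epsilon>)" for t \<epsilon>
  define N where "N t = sqrt (rad A (\<lambda>\<epsilon>. (T t \<epsilon>)\<^sup>2))" for t
  have Tnn: "0 \<le> T t \<epsilon>" for t \<epsilon> unfolding T_def by (rule is_seminormD(3)[OF q])
  have N2: "(N t)\<^sup>2 = rad A (\<lambda>\<epsilon>. (T t \<epsilon>)\<^sup>2)" for t
    unfolding N_def by (simp add: rad_nonneg)
  have Nl: "N t = lpsum 2 (signs A) (T t) / sqrt (2 ^ card A)" for t
    by (simp add: N_def rad_def lpsum2 Tnn real_sqrt_divide)
  have \<rho>: "0 \<le> \<rho>" "\<rho> \<le> 1" using n by (auto simp: \<rho>_def field_simps)
  \<comment> \<open>\<open>\<rho> * s\<close> is the convex combination of 1 and -1 with weights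
    \<open>c\<close> and \<open>d\<close>; Minkowski's inequality for second moments transfers this
    to \<open>N\<close>.\<close>
  have conv: "N (\<rho> * s) \<le> (1 + \<rho> * s) / 2 * N 1 + (1 - \<rho> * s) / 2 * N (-1)" if "s \<in> {-1, 1}" for s
  proof -
    define c where "c = (1 + \<rho> * s) / 2"
    define d where "d = (1 - \<rho> * s) / 2"
    have cd: "0 \<le> c" "0 \<le> d" "c = 1 - d" "c - d = \<rho> * s" using \<rho> that by (auto simp: c_def d_def field_simps)
    have "T (\<rho> * s) \<epsilon> \<le> c * T 1 \<epsilon> + d * T (-1) \<epsilon>" for \<epsilon>
    proof -
      have "x + (\<rho> * s) *\<^sub>R e a + S \<epsilon> = c *\<^sub>R (x + 1 *\<^sub>R e a + S \<epsilon>) + d *\<^sub>R (x + (-1) *\<^sub>R e a + S \<epsilon>)"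
      proof -
        have "c *\<^sub>R y + d *\<^sub>R y = y" for y :: 'v unfolding cd(3) by (simp add: algebra_simps)
        from this[of x] this[of "S \<epsilon>"] have "c *\<^sub>R (x + 1 *\<^sub>R e a + S \<epsilon>) + d *\<^sub>R (x + (-1) *\<^sub>R e a + S \<epsilon>)
           = x + S \<epsilon> + (c - d) *\<^sub>R e a" by (simp add: algebra_simps)
        also have "c - d = \<rho> * s" by (rule cd)
        finally show ?thesis by (simp add: algebra_simps)
      qed
      then have "T (\<rho> * s) \<epsilon> \<le> q (c *\<^sub>R (x + 1 *\<^sub>R e a + S \<epsilon>)) + q (d *\<^sub>R (x + (-1) *\<^sub>R e a + S \<epsilon>))"
        unfolding T_def by (simp only: is_seminormD(1)[OF q])
      then show ?thesis using cd by (simp only: is_seminormD(2)[OF q] T_def abs_of_nonneg)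
    qed
    then have "lpsum 2 (signs A) (T (\<rho> * s)) \<le> lpsum 2 (signs A) (\<lambda>\<epsilon>. c * T 1 \<epsilon> + d * T (-1) \<epsilon>)"
      using Tnn by (intro lpsum_mono) auto
    also have "\<dots> \<le> lpsum 2 (signs A) (\<lambda>\<epsilon>. c * T 1 \<epsilon>) + lpsum 2 (signs A) (\<lambda>\<epsilon>. d * T (-1) \<epsilon>)"
      using insert.hyps cd Tnn by (intro Minkowski) auto
    also have "\<dots> = c * lpsum 2 (signs A) (T 1) + d * lpsum 2 (signs A) (T (-1))"
      using cd Tnn by (subst (1 2) lpsum_cmult) auto
    finally have "lpsum 2 (signs A) (T (\<rho> * s)) / sqrt (2 ^ card A)
      \<le> (c * lpsum 2 (signs A) (T 1) + d * lpsum 2 (signs A) (T (-1))) / sqrt (2 ^ card A)"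
      by (intro divide_right_mono) auto
    then show ?thesis unfolding Nl c_def[symmetric] d_def[symmetric] by (simp add: add_divide_distrib)
  qed
  have Nnn: "0 \<le> N t" for t by (simp add: N_def rad_nonneg)
  \<comment> \<open>\<open>N 1\<close> and \<open>N (-1)\<close> are
    \<open>\<alpha> + \<beta>\<close> and \<open>\<alpha> - \<beta>\<close>, the form required by
    the two-point estimate.\<close>
  define \<alpha> where "\<alpha> = (N 1 + N (-1)) / 2"
  define \<beta> where "\<beta> = (N 1 - N (-1)) / 2"
  have ab: "\<bar>\<beta>\<bar> \<le> \<alpha>" using Nnn[of 1] Nnn[of "-1"] by (auto simp: \<alpha>_def \<beta>_def)
  have c1: "N \<rho> \<le> \<alpha> + \<beta> / (2 * real n)" "N (- \<rho>) \<le> \<alpha> - \<beta> / (2 * real n)"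
  proof -
    have "\<alpha> + \<beta> / (2 * real n) = (1 + \<rho>) / 2 * N 1 + (1 - \<rho>) / 2 * N (-1)"
      "\<alpha> - \<beta> / (2 * real n) = (1 - \<rho>) / 2 * N 1 + (1 + \<rho>) / 2 * N (-1)"
      using n by (simp_all add: \<alpha>_def \<beta>_def \<rho>_def field_simps)
    then show "N \<rho> \<le> \<alpha> + \<beta> / (2 * real n)" "N (- \<rho>) \<le> \<alpha> - \<beta> / (2 * real n)"
      using conv[of 1] conv[of "-1"] by simp_all
  qed
  have step: "rad A (\<lambda>\<epsilon>. q (x + t *\<^sub>R e a + (\<Sum>a\<in>A. (\<epsilon> a / (2 * real n)) *\<^sub>R e a)) ^ (2 * n)) \<le> N t ^ (2 * n)" for t
    using insert.IH[of "x + t *\<^sub>R e a"] by (simp add: power_mult N2 T_def S_def)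
  have up: "(\<Sum>b\<in>A. ((if b = a then s else \<epsilon> b) / (2 * real n)) *\<^sub>R e b) = (\<Sum>b\<in>A. (\<epsilon> b / (2 * real n)) *\<^sub>R e b)"
    "(\<Sum>b\<in>A. (if b = a then s else \<epsilon> b) *\<^sub>R e b) = S \<epsilon>" for \<epsilon> s
    using insert.hyps by (auto intro!: sum.cong simp: S_def)
  have "rad (insert a A) (\<lambda>\<epsilon>. q (x + (\<Sum>b\<in>insert a A. (\<epsilon> b / (2 * real n)) *\<^sub>R e b)) ^ (2 * n))
     = (rad A (\<lambda>\<epsilon>. q (x + \<rho> *\<^sub>R e a + (\<Sum>a\<in>A. (\<epsilon> a / (2 * real n)) *\<^sub>R e a)) ^ (2 * n)) +
        rad A (\<lambda>\<epsilon>. q (x + (- \<rho>) *\<^sub>R e a + (\<Sum>a\<in>A. (\<epsilon> a / (2 * real n)) *\<^sub>R e a)) ^ (2 * n))) / 2"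
    using insert.hyps by (simp add: rad_insert fun_upd_def up \<rho>_def add.assoc[symmetric])
  also have "\<dots> \<le> (N \<rho> ^ (2 * n) + N (- \<rho>) ^ (2 * n)) / 2"
    using step[of \<rho>] step[of "- \<rho>"] by (intro divide_right_mono add_mono) simp_all
  also have "\<dots> \<le> ((\<alpha> + \<beta> / (2 * real n)) ^ (2 * n) + (\<alpha> - \<beta> / (2 * real n)) ^ (2 * n)) / 2"
    using c1 Nnn by (intro divide_right_mono add_mono power_mono) auto
  also have "\<dots> \<le> (\<alpha>\<^sup>2 + \<beta>\<^sup>2) ^ n" by (rule two_point_power[OF ab n])
  also have "\<alpha>\<^sup>2 + \<beta>\<^sup>2 = ((N 1)\<^sup>2 + (N (-1))\<^sup>2) / 2"
    by (simp add: \<alpha>_def \<beta>_def power2_eq_square field_simps)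
  also have "\<dots> = rad (insert a A) (\<lambda>\<epsilon>. (q (x + (\<Sum>b\<in>insert a A. \<epsilon> b *\<^sub>R e b)))\<^sup>2)"
    using insert.hyps by (simp add: rad_insert fun_upd_def up N2 T_def add.assoc[symmetric])
  finally show ?case .
qed

text \<open>Without a constant term, contracting every sign by \<open>1 / (2n)\<close> contracts the
  whole sum, so undoing the contraction costs exactly \<open>(2n)^(2n)\<close>.\<close>

lemma Khinchine_Kahane_power:
  fixes e :: "'i \<Rightarrow> 'v::real_vector"
  assumes q: "is_seminorm q" and n: "0 < n" and A: "finite A"
  shows "rad A (\<lambda>\<epsilon>. q (\<Sum>a\<in>A. \<epsilon> a *\<^sub>R e a) ^ (2 * n))
    \<le> (2 * real n) ^ (2 * n) * rad A (\<lambda>\<epsilon>. (q (\<Sum>a\<in>A. \<epsilon> a *\<^sub>R e a))\<^sup>2) ^ n"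
proof -
  have sc: "(\<Sum>a\<in>A. (\<epsilon> a / (2 * real n)) *\<^sub>R e a) = (1 / (2 * real n)) *\<^sub>R (\<Sum>a\<in>A. \<epsilon> a *\<^sub>R e a)" for \<epsilon>
    by (simp add: scaleR_sum_right)
  have "q (\<Sum>a\<in>A. \<epsilon> a *\<^sub>R e a) ^ (2 * n)
      = (2 * real n) ^ (2 * n) * q (0 + (\<Sum>a\<in>A. (\<epsilon> a / (2 * real n)) *\<^sub>R e a)) ^ (2 * n)" for \<epsilon>
    unfolding sc add_0 is_seminormD(2)[OF q] using n by (simp add: power_divide power_mult_distrib)
  then have "rad A (\<lambda>\<epsilon>. q (\<Sum>a\<in>A. \<epsilon> a *\<^sub>R e a) ^ (2 * n))
      = (2 * real n) ^ (2 * n) * rad A (\<lambda>\<epsilon>. q (0 + (\<Sum>a\<in>A. (\<epsilon> a / (2 * real n)) *\<^sub>R e a)) ^ (2 * n))"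
    unfolding rad_cmult[symmetric] by (rule rad_cong)
  also have "\<dots> \<le> (2 * real n) ^ (2 * n) * rad A (\<lambda>\<epsilon>. (q (0 + (\<Sum>a\<in>A. \<epsilon> a *\<^sub>R e a)))\<^sup>2) ^ n"
    by (intro mult_left_mono Khinchine_Kahane_aux[OF q n A]) auto
  finally show ?thesis by simp
qed

text \<open>The exponent \<open>p\<close> lies below the even integer \<open>2n\<close>, where
  \<open>n\<close> is its ceiling. Jensen's inequality with exponent \<open>2n / p\<close> raises
  the \<open>p\<close>-th moment to the \<open>2n\<close>-th, for which the bound is known.\<close>

lemma Khinchine_Kahane_upper:
  fixes e :: "'i \<Rightarrow> 'v::real_vector"
  assumes q: "is_seminorm q" and p: "1 < p" and A: "finite A"
  shows "rad A (\<lambda>\<epsilon>. q (\<Sum>a\<in>A. \<epsilon> a *\<^sub>R e a) powr p)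
    \<le> (2 * real (nat \<lceil>p\<rceil>)) powr p * rad A (\<lambda>\<epsilon>. (q (\<Sum>a\<in>A. \<epsilon> a *\<^sub>R e a))\<^sup>2) powr (p / 2)"
proof -
  define n where "n = nat \<lceil>p\<rceil>"
  have n: "0 < n" "p \<le> real n" using p real_nat_ceiling_ge[of p] by (auto simp: n_def)
  define F where "F \<epsilon> = q (\<Sum>a\<in>A. \<epsilon> a *\<^sub>R e a)" for \<epsilon>
  have F: "0 \<le> F \<epsilon>" for \<epsilon> unfolding F_def by (rule is_seminormD(3)[OF q])
  define s where "s = 2 * real n / p"
  have s: "1 < s" "p * s = 2 * real n" using p n by (auto simp: s_def field_simps)
  have nnp: "0 \<le> rad A (\<lambda>\<epsilon>. F \<epsilon> powr p)" "0 \<le> rad A (\<lambda>\<epsilon>. (F \<epsilon>)\<^sup>2)" by (auto intro: rad_nonneg)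
  have "rad A (\<lambda>\<epsilon>. F \<epsilon> powr p) powr s \<le> rad A (\<lambda>\<epsilon>. (F \<epsilon> powr p) powr s)"
    using A s by (intro rad_powr_le) auto
  also have "\<dots> = rad A (\<lambda>\<epsilon>. F \<epsilon> ^ (2 * n))"
  proof (rule rad_cong)
    fix \<epsilon>
    have "F \<epsilon> powr real (2 * n) = F \<epsilon> ^ (2 * n)"
      using F[of \<epsilon>] n powr_realpow[of "F \<epsilon>" "2 * n"] by (cases "F \<epsilon> = 0") (auto simp: power_0_left)
    then show "(F \<epsilon> powr p) powr s = F \<epsilon> ^ (2 * n)" by (simp add: powr_powr s)
  qed
  also have "\<dots> \<le> (2 * real n) ^ (2 * n) * rad A (\<lambda>\<epsilon>. (F \<epsilon>)\<^sup>2) ^ n"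
    unfolding F_def by (rule Khinchine_Kahane_power[OF q n(1) A])
  finally have "(rad A (\<lambda>\<epsilon>. F \<epsilon> powr p) powr s) powr (1 / s)
    \<le> ((2 * real n) ^ (2 * n) * rad A (\<lambda>\<epsilon>. (F \<epsilon>)\<^sup>2) ^ n) powr (1 / s)"
    using s by (intro powr_mono2) auto
  also have "(rad A (\<lambda>\<epsilon>. F \<epsilon> powr p) powr s) powr (1 / s) = rad A (\<lambda>\<epsilon>. F \<epsilon> powr p)"
    using s nnp by (simp add: powr_powr)
  also have "((2 * real n) ^ (2 * n) * rad A (\<lambda>\<epsilon>. (F \<epsilon>)\<^sup>2) ^ n) powr (1 / s)
     = ((2 * real n) ^ (2 * n)) powr (1 / s) * (rad A (\<lambda>\<epsilon>. (F \<epsilon>)\<^sup>2) ^ n) powr (1 / s)"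
    using nnp by (simp add: powr_mult)
  also have "((2 * real n) ^ (2 * n)) powr (1 / s) = (2 * real n) powr p"
  proof -
    have "(2 * real n) ^ (2 * n) = (2 * real n) powr (real (2 * n))"
      using n by (subst powr_realpow) auto
    moreover have "2 * real n / s = p" using s p n by (simp add: s_def)
    ultimately show ?thesis by (simp add: powr_powr)
  qed
  also have "(rad A (\<lambda>\<epsilon>. (F \<epsilon>)\<^sup>2) ^ n) powr (1 / s) = rad A (\<lambda>\<epsilon>. (F \<epsilon>)\<^sup>2) powr (p / 2)"
  proof (cases "rad A (\<lambda>\<epsilon>. (F \<epsilon>)\<^sup>2) = 0")
    case False
    then have "rad A (\<lambda>\<epsilon>. (F \<epsilon>)\<^sup>2) ^ n = rad A (\<lambda>\<epsilon>. (F \<epsilon>)\<^sup>2) powr real n"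
      using nnp by (simp add: powr_realpow)
    moreover have "real n / s = p / 2" using p n by (simp add: s_def)
    ultimately show ?thesis by (simp only: powr_powr times_divide_eq_right mult_1_right)
  qed (use n in \<open>simp add: power_0_left\<close>)
  finally show ?thesis by (simp add: F_def n_def)
qed

text \<open>The fourth moment is controlled by the square of the second, so large values cannot
  dominate: up to a threshold \<open>l\<close> one has \<open>F^2 \<le> l F\<close>, above it
  \<open>F^2 \<le> F^4 / l^2\<close>.\<close>

lemma Khinchine_Kahane_lower:
  fixes e :: "'i \<Rightarrow> 'v::real_vector"
  assumes q: "is_seminorm q" and A: "finite A"
  shows "rad A (\<lambda>\<epsilon>. (q (\<Sum>a\<in>A. \<epsilon> a *\<^sub>R e a))\<^sup>2) \<le> 2048 * (rad A (\<lambda>\<epsilon>. q (\<Sum>a\<in>A. \<epsilon> a *\<^sub>R e a)))\<^sup>2"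
proof -
  define F where "F \<epsilon> = q (\<Sum>a\<in>A. \<epsilon> a *\<^sub>R e a)" for \<epsilon>
  have F: "0 \<le> F \<epsilon>" for \<epsilon> unfolding F_def by (rule is_seminormD(3)[OF q])
  define V where "V = rad A (\<lambda>\<epsilon>. (F \<epsilon>)\<^sup>2)"
  define W where "W = rad A F"
  have "0 \<le> V" by (auto simp: V_def intro: rad_nonneg)
  show ?thesis
  proof (cases "V = 0")
    case False
    with \<open>0 \<le> V\<close> have V: "V > 0" by simp
    have 4: "rad A (\<lambda>\<epsilon>. F \<epsilon> ^ 4) \<le> 256 * V\<^sup>2"
      using Khinchine_Kahane_power[OF q _ A, of 2 e] by (simp add: F_def V_def)
    \<comment> \<open>The fourth moment is at most \<open>256 * V^2\<close>, where 256 = 4^4. With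
      \<open>l^2 = 512 * V\<close> its share becomes \<open>V / 2\<close> and is absorbed on the
      left; the final constant is 4 * 512.\<close>
    define l where "l = sqrt (512 * V)"
    have l: "l > 0" "l\<^sup>2 = 512 * V" using V by (auto simp: l_def)
    have pt: "(F \<epsilon>)\<^sup>2 \<le> l * F \<epsilon> + F \<epsilon> ^ 4 / l\<^sup>2" for \<epsilon>
    proof (cases "F \<epsilon> \<le> l")
      case True
      then have "F \<epsilon> * F \<epsilon> \<le> l * F \<epsilon>" using F by (intro mult_right_mono) auto
      moreover have "0 \<le> F \<epsilon> ^ 4 / l\<^sup>2" by simp
      ultimately show ?thesis unfolding power2_eq_square by linarith
    next
      case False
      then have "l\<^sup>2 \<le> (F \<epsilon>)\<^sup>2" using l by (intro power_mono) auto
      then have "l\<^sup>2 * (F \<epsilon>)\<^sup>2 \<le> (F \<epsilon>)\<^sup>2 * (F \<epsilon>)\<^sup>2" by (intro mult_right_mono) auto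
      then have "(F \<epsilon>)\<^sup>2 \<le> F \<epsilon> ^ 4 / l\<^sup>2" using l(1) by (simp add: field_simps power2_eq_square power4_eq_xxxx)
      moreover have "0 \<le> l * F \<epsilon>" using l F by simp
      ultimately show ?thesis by linarith
    qed
    have "V \<le> rad A (\<lambda>\<epsilon>. l * F \<epsilon> + F \<epsilon> ^ 4 / l\<^sup>2)" unfolding V_def by (intro rad_mono pt)
    also have "\<dots> = l * W + rad A (\<lambda>\<epsilon>. F \<epsilon> ^ 4) / l\<^sup>2" by (simp add: rad_add rad_cmult rad_cdiv W_def)
    also have "\<dots> \<le> l * W + 256 * V\<^sup>2 / l\<^sup>2" using 4 by (intro add_left_mono divide_right_mono) auto
    also have "256 * V\<^sup>2 / l\<^sup>2 = V / 2" unfolding l(2) using V by (simp add: power2_eq_square)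
    finally have "V \<le> 2 * l * W" by simp
    then have "V * V \<le> (2 * l * W) * (2 * l * W)" using V \<open>V \<le> 2 * l * W\<close> by (intro mult_mono) linarith+
    also have "\<dots> = 4 * l\<^sup>2 * W\<^sup>2" by (simp add: power2_eq_square)
    also have "\<dots> = V * (2048 * W\<^sup>2)" by (simp add: l)
    finally have "V \<le> 2048 * W\<^sup>2" using V by simp
    then show ?thesis unfolding V_def W_def F_def .
  qed (simp add: V_def F_def)
qed

section \<open>Strong integrals\<close>

lemma strongly_measurable_compose2:
  fixes f :: "'w \<Rightarrow> 'x::banach" and g :: "'w \<Rightarrow> 'y::banach" and h :: "'x \<Rightarrow> 'y \<Rightarrow> 'z::banach"
  assumes "strongly_measurable M f" "strongly_measurable M g"
    and h: "continuous_on UNIV (\<lambda>z. h (fst z) (snd z))"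
  shows "strongly_measurable M (\<lambda>w. h (f w) (g w))"
proof -
  from assms obtain s t where s: "\<And>i. simple_function M (s i)" "\<And>w. w \<in> space M \<Longrightarrow> (\<lambda>i. s i w) \<longlonglongrightarrow> f w"
    and t: "\<And>i. simple_function M (t i)" "\<And>w. w \<in> space M \<Longrightarrow> (\<lambda>i. t i w) \<longlonglongrightarrow> g w"
    unfolding strongly_measurable_def by metis
  have "(\<lambda>i. h (s i w) (t i w)) \<longlonglongrightarrow> h (f w) (g w)" if "w \<in> space M" for w
    using continuous_on_tendsto_compose[OF h tendsto_Pair[OF s(2)[OF that] t(2)[OF that]]] by simp
  then show ?thesis
    unfolding strongly_measurable_def using s(1) t(1)
    by (intro exI[of _ "\<lambda>i w. h (s i w) (t i w)"]) (auto intro: simple_function_compose2)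
qed

lemma simple_function_strongly_measurable:
  "simple_function M (s :: 'w \<Rightarrow> 'x::banach) \<Longrightarrow> strongly_measurable M s"
  unfolding strongly_measurable_def by (intro exI[of _ "\<lambda>_. s"]) auto

lemma strongly_measurable_add:
  "strongly_measurable M f \<Longrightarrow> strongly_measurable M g \<Longrightarrow> strongly_measurable M (\<lambda>w. f w + g w)"
  by (erule (1) strongly_measurable_compose2) (intro continuous_intros)

lemma strongly_measurable_scaleR:
  fixes f :: "'w \<Rightarrow> 'x::banach"
  assumes "strongly_measurable M f"
  shows "strongly_measurable M (\<lambda>w. c *\<^sub>R f w)"
proof -
  have "continuous_on UNIV (\<lambda>z :: 'x \<times> 'x. c *\<^sub>R fst z)" by (intro continuous_intros)
  from strongly_measurable_compose2[OF assms assms this] show ?thesis .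
qed

lemma strongly_measurable_norm_diff:
  fixes f g :: "'w \<Rightarrow> 'x::banach"
  assumes "strongly_measurable M f" "strongly_measurable M g"
  shows "(\<lambda>w. norm (f w - g w)) \<in> borel_measurable M"
proof -
  have "continuous_on UNIV (\<lambda>z :: 'x \<times> 'x. norm (fst z - snd z))" by (intro continuous_intros)
  from strongly_measurable_compose2[OF assms this] show ?thesis by (simp add: strongly_measurable_iff_borel)
qed

lemma strongly_measurable_norm:
  fixes f :: "'w \<Rightarrow> 'x::banach"
  assumes "strongly_measurable M f"
  shows "(\<lambda>w. norm (f w)) \<in> borel_measurable M"
proof -
  have "continuous_on UNIV (\<lambda>z :: 'x \<times> 'x. norm (fst z))" by (intro continuous_intros)
  from strongly_measurable_compose2[OF assms assms this] show ?thesis by (simp add: strongly_measurable_iff_borel)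
qed

lemma simple_bochner_integrable_strongly_measurable:
  "Bochner_Integration.simple_bochner_integrable M (s :: 'w \<Rightarrow> 'x::banach) \<Longrightarrow> strongly_measurable M s"
  by (auto elim!: simple_bochner_integrable.cases intro: simple_function_strongly_measurable)

text \<open>The triangle inequality through \<open>f\<close> compares the two simple functions.
  Uniqueness of the integral, the Cauchy property behind its existence and the norm bound all rest
  on this comparison.\<close>

lemma norm_simple_integral_diff:
  fixes f :: "'w \<Rightarrow> 'x::banach"
  assumes f: "strongly_measurable M f"
    and s: "Bochner_Integration.simple_bochner_integrable M s"
    and t: "Bochner_Integration.simple_bochner_integrable M t"
  shows "ennreal (norm (Bochner_Integration.simple_bochner_integral M s -
      Bochner_Integration.simple_bochner_integral M t))
    \<le> (\<integral>\<^sup>+w. ennreal (norm (f w - s w)) \<partial>M) + (\<integral>\<^sup>+w. ennreal (norm (f w - t w)) \<partial>M)"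
proof -
  note m = strongly_measurable_norm_diff[OF f simple_bochner_integrable_strongly_measurable[OF s]]
    strongly_measurable_norm_diff[OF f simple_bochner_integrable_strongly_measurable[OF t]]
  have d: "Bochner_Integration.simple_bochner_integrable M (\<lambda>x. s x - t x)"
    using s t by (rule simple_bochner_integrable_compose2[of "(-)", rotated]) simp
  have dn: "Bochner_Integration.simple_bochner_integrable M (\<lambda>x. norm (s x - t x))"
    using s t by (rule simple_bochner_integrable_compose2[of "\<lambda>x y. norm (x - y)", rotated]) simp
  have "ennreal (norm (Bochner_Integration.simple_bochner_integral M s -
      Bochner_Integration.simple_bochner_integral M t))
     \<le> ennreal (Bochner_Integration.simple_bochner_integral M (\<lambda>x. norm (s x - t x)))"
    using simple_bochner_integral_norm_bound[OF d] by (simp add: simple_bochner_integral_diff[OF s t] ennreal_leI)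
  also have "\<dots> = (\<integral>\<^sup>+x. ennreal (norm (s x - t x)) \<partial>M)"
    using dn by (rule simple_bochner_integral_eq_nn_integral) simp
  also have "\<dots> \<le> (\<integral>\<^sup>+x. ennreal (norm (f x - s x)) + ennreal (norm (f x - t x)) \<partial>M)"
  proof (rule nn_integral_mono)
    fix x
    have "norm (s x - t x) \<le> norm (f x - s x) + norm (f x - t x)"
      using norm_triangle_ineq4[of "f x - t x" "f x - s x"] by simp
    then show "ennreal (norm (s x - t x)) \<le> ennreal (norm (f x - s x)) + ennreal (norm (f x - t x))"
      by (simp add: ennreal_plus[symmetric] del: ennreal_plus)
  qed
  also have "\<dots> = (\<integral>\<^sup>+w. ennreal (norm (f w - s w)) \<partial>M) + (\<integral>\<^sup>+w. ennreal (norm (f w - t w)) \<partial>M)"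
    using m by (intro nn_integral_add) auto
  finally show ?thesis .
qed

lemma has_strong_integralE:
  assumes "has_strong_integral M f v"
  obtains s where "strongly_measurable M f"
    "\<And>i. Bochner_Integration.simple_bochner_integrable M (s i)"
    "(\<lambda>i. \<integral>\<^sup>+w. ennreal (norm (f w - s i w)) \<partial>M) \<longlonglongrightarrow> 0"
    "(\<lambda>i. Bochner_Integration.simple_bochner_integral M (s i)) \<longlonglongrightarrow> v"
  using assms unfolding has_strong_integral_def by (elim conjE exE) (rule that, simp_all)

lemma has_strong_integralI:
  assumes "strongly_measurable M f" "\<And>i. Bochner_Integration.simple_bochner_integrable M (s i)"
    "(\<lambda>i. \<integral>\<^sup>+w. ennreal (norm (f w - s i w)) \<partial>M) \<longlonglongrightarrow> 0"
    "(\<lambda>i. Bochner_Integration.simple_bochner_integral M (s i)) \<longlonglongrightarrow> v"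
  shows "has_strong_integral M f v"
  using assms unfolding has_strong_integral_def by (intro conjI exI[of _ s]) auto

lemma has_strong_integral_unique:
  assumes "has_strong_integral M f v" "has_strong_integral M f v'"
  shows "v = v'"
proof -
  from assms(1) obtain s where f: "strongly_measurable M f"
    and s: "\<And>i. Bochner_Integration.simple_bochner_integrable M (s i)"
      "(\<lambda>i. \<integral>\<^sup>+w. ennreal (norm (f w - s i w)) \<partial>M) \<longlonglongrightarrow> 0"
      "(\<lambda>i. Bochner_Integration.simple_bochner_integral M (s i)) \<longlonglongrightarrow> v"
    by (rule has_strong_integralE) blast
  from assms(2) obtain t where t: "\<And>i. Bochner_Integration.simple_bochner_integrable M (t i)"
      "(\<lambda>i. \<integral>\<^sup>+w. ennreal (norm (f w - t i w)) \<partial>M) \<longlonglongrightarrow> 0"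
      "(\<lambda>i. Bochner_Integration.simple_bochner_integral M (t i)) \<longlonglongrightarrow> v'"
    by (rule has_strong_integralE) blast
  have "(\<lambda>i. ennreal (norm (Bochner_Integration.simple_bochner_integral M (s i) -
      Bochner_Integration.simple_bochner_integral M (t i)))) \<longlonglongrightarrow> ennreal (norm (v - v'))"
    by (intro tendsto_intros s t)
  moreover have "(\<lambda>i. ennreal (norm (Bochner_Integration.simple_bochner_integral M (s i) -
      Bochner_Integration.simple_bochner_integral M (t i)))) \<longlonglongrightarrow> 0"
  proof (rule tendsto_sandwich[OF _ _ tendsto_const])
    show "(\<lambda>i. (\<integral>\<^sup>+w. ennreal (norm (f w - s i w)) \<partial>M) + (\<integral>\<^sup>+w. ennreal (norm (f w - t i w)) \<partial>M)) \<longlonglongrightarrow> 0"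
      using tendsto_add[OF s(2) t(2)] by simp
  qed (auto intro!: always_eventually norm_simple_integral_diff f s t)
  ultimately have "ennreal (norm (v - v')) = 0" by (rule LIMSEQ_unique)
  then show ?thesis by simp
qed

lemma strong_integral_eqI: "has_strong_integral M f v \<Longrightarrow> strong_integral M f = v"
proof -
  assume v: "has_strong_integral M f v"
  then have "(THE v. has_strong_integral M f v) = v"
    by (rule the_equality) (rule has_strong_integral_unique[OF _ v])
  then show ?thesis using v unfolding strong_integral_def by auto
qed

lemma has_strong_integral_simple:
  fixes s :: "'w \<Rightarrow> 'x::banach"
  assumes "Bochner_Integration.simple_bochner_integrable M s"
  shows "has_strong_integral M s (Bochner_Integration.simple_bochner_integral M s)"
  unfolding has_strong_integral_def
  using assms simple_bochner_integrable_strongly_measurable[OF assms]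
  by (auto intro!: exI[of _ "\<lambda>_. s"])

lemma has_strong_integral_add:
  assumes "has_strong_integral M f v" "has_strong_integral M g v'"
  shows "has_strong_integral M (\<lambda>w. f w + g w) (v + v')"
proof -
  from assms(1) obtain s where f: "strongly_measurable M f"
    and s: "\<And>i. Bochner_Integration.simple_bochner_integrable M (s i)"
      "(\<lambda>i. \<integral>\<^sup>+w. ennreal (norm (f w - s i w)) \<partial>M) \<longlonglongrightarrow> 0"
      "(\<lambda>i. Bochner_Integration.simple_bochner_integral M (s i)) \<longlonglongrightarrow> v"
    by (rule has_strong_integralE) blast
  from assms(2) obtain t where g: "strongly_measurable M g" and t: "\<And>i. Bochner_Integration.simple_bochner_integrable M (t i)"
      "(\<lambda>i. \<integral>\<^sup>+w. ennreal (norm (g w - t i w)) \<partial>M) \<longlonglongrightarrow> 0"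
      "(\<lambda>i. Bochner_Integration.simple_bochner_integral M (t i)) \<longlonglongrightarrow> v'"
    by (rule has_strong_integralE) blast
  note m = strongly_measurable_norm_diff[OF f simple_bochner_integrable_strongly_measurable[OF s(1)]]
    strongly_measurable_norm_diff[OF g simple_bochner_integrable_strongly_measurable[OF t(1)]]
  have le: "(\<integral>\<^sup>+w. ennreal (norm (f w + g w - (s i w + t i w))) \<partial>M)
      \<le> (\<integral>\<^sup>+w. ennreal (norm (f w - s i w)) \<partial>M) + (\<integral>\<^sup>+w. ennreal (norm (g w - t i w)) \<partial>M)" for i
  proof -
    have "(\<integral>\<^sup>+w. ennreal (norm (f w + g w - (s i w + t i w))) \<partial>M)
      \<le> (\<integral>\<^sup>+w. ennreal (norm (f w - s i w)) + ennreal (norm (g w - t i w)) \<partial>M)"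
      by (intro nn_integral_mono)
        (simp add: norm_diff_triangle_ineq ennreal_plus[symmetric] del: ennreal_plus)
    then show ?thesis using m by (subst (asm) nn_integral_add) auto
  qed
  have "(\<lambda>i. \<integral>\<^sup>+w. ennreal (norm (f w + g w - (s i w + t i w))) \<partial>M) \<longlonglongrightarrow> 0"
  proof (rule tendsto_sandwich[OF _ _ tendsto_const])
    show "(\<lambda>i. (\<integral>\<^sup>+w. ennreal (norm (f w - s i w)) \<partial>M) + (\<integral>\<^sup>+w. ennreal (norm (g w - t i w)) \<partial>M)) \<longlonglongrightarrow> 0"
      using tendsto_add[OF s(2) t(2)] by simp
  qed (auto intro!: always_eventually le)
  moreover have "(\<lambda>i. Bochner_Integration.simple_bochner_integral M (\<lambda>w. s i w + t i w)) \<longlonglongrightarrow> v + v'"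
    using tendsto_add[OF s(3) t(3)] s(1) t(1) by (simp add: simple_bochner_integral_add)
  moreover have "Bochner_Integration.simple_bochner_integrable M (\<lambda>w. s i w + t i w)" for i
    using s(1) t(1) by (rule simple_bochner_integrable_compose2[of "(+)", rotated]) simp
  ultimately show ?thesis
    using strongly_measurable_add[OF f g] by (intro has_strong_integralI)
qed

lemma has_strong_integral_scaleR:
  assumes "has_strong_integral M f v"
  shows "has_strong_integral M (\<lambda>w. c *\<^sub>R f w) (c *\<^sub>R v)"
proof -
  from assms obtain s where f: "strongly_measurable M f"
    and s: "\<And>i. Bochner_Integration.simple_bochner_integrable M (s i)"
      "(\<lambda>i. \<integral>\<^sup>+w. ennreal (norm (f w - s i w)) \<partial>M) \<longlonglongrightarrow> 0"
      "(\<lambda>i. Bochner_Integration.simple_bochner_integral M (s i)) \<longlonglongrightarrow> v"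
    by (rule has_strong_integralE) blast
  have "(\<integral>\<^sup>+w. ennreal (norm (c *\<^sub>R f w - c *\<^sub>R s i w)) \<partial>M)
      = ennreal \<bar>c\<bar> * (\<integral>\<^sup>+w. ennreal (norm (f w - s i w)) \<partial>M)" for i
    using strongly_measurable_norm_diff[OF f simple_bochner_integrable_strongly_measurable[OF s(1)]]
    by (subst nn_integral_cmult[symmetric]) (auto simp: scaleR_diff_right[symmetric] ennreal_mult')
  then have "(\<lambda>i. \<integral>\<^sup>+w. ennreal (norm (c *\<^sub>R f w - c *\<^sub>R s i w)) \<partial>M) \<longlonglongrightarrow> 0"
    using ennreal_tendsto_cmult[OF _ s(2), of "ennreal \<bar>c\<bar>"] by simp
  moreover have "(\<lambda>i. Bochner_Integration.simple_bochner_integral M (\<lambda>w. c *\<^sub>R s i w)) \<longlonglongrightarrow> c *\<^sub>R v"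
    using tendsto_scaleR[OF tendsto_const s(3), of c] s(1)
    by (simp add: simple_bochner_integral_linear[OF linear_scaleR])
  moreover have "Bochner_Integration.simple_bochner_integrable M (\<lambda>w. c *\<^sub>R s i w)" for i
    using simple_bochner_integrable_compose2[of "\<lambda>x _. c *\<^sub>R x", OF _ s(1) s(1)] by simp
  ultimately show ?thesis
    using strongly_measurable_scaleR[OF f] by (intro has_strong_integralI)
qed

lemma has_strong_integral_zero: "has_strong_integral M (\<lambda>_. 0) 0"
proof -
  have "Bochner_Integration.simple_bochner_integrable M (\<lambda>_. 0 :: 'b)"
    by (auto simp: simple_bochner_integrable.simps)
  from has_strong_integral_scaleR[OF has_strong_integral_simple[OF this], of 0] show ?thesis by simp
qed

lemma has_strong_integral_sum:
  assumes "\<And>i. i \<in> I \<Longrightarrow> has_strong_integral M (f i) (v i)"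
  shows "has_strong_integral M (\<lambda>w. \<Sum>i\<in>I. f i w) (\<Sum>i\<in>I. v i)"
  using assms
  by (induction I rule: infinite_finite_induct) (auto intro: has_strong_integral_zero has_strong_integral_add)

text \<open>The approximating simple functions are cut off where they exceed twice the norm of
  \<open>f\<close>. They still converge pointwise and are now dominated, so dominated convergence
  gives convergence in mean, and completeness the limit of the integrals.\<close>

lemma has_strong_integral_exists:
  fixes f :: "'w \<Rightarrow> 'x::banach"
  assumes f: "strongly_measurable M f" and fin: "(\<integral>\<^sup>+w. ennreal (norm (f w)) \<partial>M) < \<infinity>"
  shows "\<exists>v. has_strong_integral M f v"
proof -
  note nf = strongly_measurable_norm[OF f]
  from f obtain s where s: "\<And>i. simple_function M (s i)" "\<And>w. w \<in> space M \<Longrightarrow> (\<lambda>i. s i w) \<longlonglongrightarrow> f w"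
    unfolding strongly_measurable_def by metis
  define B where "B i = {w \<in> space M. norm (s i w) \<le> 2 * norm (f w)}" for i
  define t where "t i w = (indicator (B i) w :: real) *\<^sub>R s i w" for i w
  have B: "B i \<in> sets M" for i
    unfolding B_def
    using strongly_measurable_norm[OF simple_function_strongly_measurable[OF s(1)]] nf by measurable
  have t: "simple_function M (t i)" for i
    unfolding t_def by (intro simple_function_compose2[OF simple_function_indicator[OF B] s(1)])
  have tb: "norm (t i w) \<le> 2 * norm (f w)" if "w \<in> space M" for i w
    using that by (auto simp: t_def B_def split: split_indicator)
  have lim: "(\<lambda>i. t i w) \<longlonglongrightarrow> f w" if w: "w \<in> space M" for w
  proof (cases "f w = 0")
    case True
    then have "t i w = 0" for i using tb[OF w, of i] by simp
    then show ?thesis using True by simp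
  next
    case False
    \<comment> \<open>The factor 2 leaves room: where \<open>f\<close> does not vanish, the cut-off
      is eventually inactive.\<close>
    have "\<forall>\<^sub>F i in sequentially. norm (s i w) < 2 * norm (f w)"
      using tendsto_norm[OF s(2)[OF w]] False by (intro order_tendstoD(2)) auto
    then have "\<forall>\<^sub>F i in sequentially. t i w = s i w"
      by eventually_elim (use w in \<open>auto simp: t_def B_def\<close>)
    then show ?thesis using s(2)[OF w] by (simp add: tendsto_cong)
  qed
  have "(\<integral>\<^sup>+w. ennreal (norm (t i w)) \<partial>M) < \<infinity>" for i
  proof -
    have "(\<integral>\<^sup>+w. ennreal (norm (t i w)) \<partial>M) \<le> (\<integral>\<^sup>+w. 2 * ennreal (norm (f w)) \<partial>M)"
    proof (rule nn_integral_mono)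
      fix w assume "w \<in> space M"
      then have "ennreal (norm (t i w)) \<le> ennreal (2 * norm (f w))" by (intro ennreal_leI tb)
      then show "ennreal (norm (t i w)) \<le> 2 * ennreal (norm (f w))" by (simp add: ennreal_mult)
    qed
    also have "\<dots> = 2 * (\<integral>\<^sup>+w. ennreal (norm (f w)) \<partial>M)"
      using nf by (intro nn_integral_cmult) auto
    finally show ?thesis using fin by (simp add: ennreal_mult_less_top order_le_less_trans)
  qed
  then have ti: "Bochner_Integration.simple_bochner_integrable M (t i)" for i
    by (intro simple_bochner_integrableI_bounded t) auto
  have "(\<lambda>i. \<integral>\<^sup>+w. norm (0 - norm (f w - t i w)) \<partial>M) \<longlonglongrightarrow> 0"
  proof (rule nn_integral_dominated_convergence_norm[where w = "\<lambda>w. 3 * norm (f w)"])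
    show "(\<lambda>w. norm (f w - t i w)) \<in> borel_measurable M" for i
      by (intro strongly_measurable_norm_diff f simple_function_strongly_measurable t)
    show "(\<lambda>w. 3 * norm (f w)) \<in> borel_measurable M" using nf by measurable
    show "AE w in M. norm (norm (f w - t i w)) \<le> 3 * norm (f w)" for i
    proof (rule AE_I2)
      fix w assume "w \<in> space M"
      with tb[OF this, of i] norm_triangle_ineq4[of "f w" "t i w"]
      show "norm (norm (f w - t i w)) \<le> 3 * norm (f w)" by simp
    qed
    show "(\<integral>\<^sup>+w. ennreal (3 * norm (f w)) \<partial>M) < \<infinity>"
      using fin nf by (simp add: ennreal_mult nn_integral_cmult ennreal_mult_less_top)
    show "AE w in M. (\<lambda>i. norm (f w - t i w)) \<longlonglongrightarrow> 0"
    proof (rule AE_I2)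
      fix w assume "w \<in> space M"
      then have "(\<lambda>i. norm (f w - t i w)) \<longlonglongrightarrow> norm (f w - f w)" by (intro tendsto_intros lim)
      then show "(\<lambda>i. norm (f w - t i w)) \<longlonglongrightarrow> 0" by simp
    qed
  qed simp
  then have l0: "(\<lambda>i. \<integral>\<^sup>+w. ennreal (norm (f w - t i w)) \<partial>M) \<longlonglongrightarrow> 0" by simp
  have "Cauchy (\<lambda>i. Bochner_Integration.simple_bochner_integral M (t i))"
  proof (rule metric_CauchyI)
    fix e :: real assume e: "e > 0"
    have "\<forall>\<^sub>F i in sequentially. (\<integral>\<^sup>+w. ennreal (norm (f w - t i w)) \<partial>M) < ennreal (e / 2)"
      using order_tendstoD(2)[OF l0, of "ennreal (e / 2)"] e by simp
    then obtain K where K: "\<And>i. i \<ge> K \<Longrightarrow> (\<integral>\<^sup>+w. ennreal (norm (f w - t i w)) \<partial>M) < ennreal (e / 2)"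
      by (auto simp: eventually_sequentially)
    have "dist (Bochner_Integration.simple_bochner_integral M (t i)) (Bochner_Integration.simple_bochner_integral M (t j)) < e"
      if "i \<ge> K" "j \<ge> K" for i j
    proof -
      have "ennreal (norm (Bochner_Integration.simple_bochner_integral M (t i) - Bochner_Integration.simple_bochner_integral M (t j)))
         \<le> (\<integral>\<^sup>+w. ennreal (norm (f w - t i w)) \<partial>M) + (\<integral>\<^sup>+w. ennreal (norm (f w - t j w)) \<partial>M)"
        by (rule norm_simple_integral_diff[OF f ti ti])
      also have "\<dots> < ennreal (e / 2) + ennreal (e / 2)"
        using K that by (intro add_strict_mono) auto
      also have "\<dots> = ennreal e" using e by (simp add: ennreal_plus[symmetric] del: ennreal_plus)
      finally show ?thesis by (simp add: dist_norm ennreal_less_iff)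
    qed
    then show "\<exists>K. \<forall>i\<ge>K. \<forall>j\<ge>K. dist (Bochner_Integration.simple_bochner_integral M (t i)) (Bochner_Integration.simple_bochner_integral M (t j)) < e"
      by blast
  qed
  then obtain v where "(\<lambda>i. Bochner_Integration.simple_bochner_integral M (t i)) \<longlonglongrightarrow> v"
    using Cauchy_convergent convergent_def by blast
  then show ?thesis using has_strong_integralI[OF f ti l0] by blast
qed

text \<open>The simple function 0 serves as the second approximation in the comparison of simple
  integrals, followed by a passage to the limit.\<close>

lemma norm_has_strong_integral_le:
  assumes "has_strong_integral M f v"
  shows "ennreal (norm v) \<le> (\<integral>\<^sup>+w. ennreal (norm (f w)) \<partial>M)"
proof -
  from assms obtain s where f: "strongly_measurable M f"
    and s: "\<And>i. Bochner_Integration.simple_bochner_integrable M (s i)"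
      "(\<lambda>i. \<integral>\<^sup>+w. ennreal (norm (f w - s i w)) \<partial>M) \<longlonglongrightarrow> 0"
      "(\<lambda>i. Bochner_Integration.simple_bochner_integral M (s i)) \<longlonglongrightarrow> v"
    by (rule has_strong_integralE) blast
  have z: "Bochner_Integration.simple_bochner_integrable M (\<lambda>_. 0 :: 'b)"
    "Bochner_Integration.simple_bochner_integral M (\<lambda>_. 0 :: 'b) = 0"
    by (auto simp: simple_bochner_integrable.simps simple_bochner_integral_def image_constant_conv)
  have "(\<lambda>i. ennreal (norm (Bochner_Integration.simple_bochner_integral M (s i)))) \<longlonglongrightarrow> ennreal (norm v)"
    by (intro tendsto_intros s)
  moreover have "(\<lambda>i. (\<integral>\<^sup>+w. ennreal (norm (f w - s i w)) \<partial>M) + (\<integral>\<^sup>+w. ennreal (norm (f w)) \<partial>M))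
      \<longlonglongrightarrow> 0 + (\<integral>\<^sup>+w. ennreal (norm (f w)) \<partial>M)"
    by (intro tendsto_intros s)
  moreover have "ennreal (norm (Bochner_Integration.simple_bochner_integral M (s i)))
      \<le> (\<integral>\<^sup>+w. ennreal (norm (f w - s i w)) \<partial>M) + (\<integral>\<^sup>+w. ennreal (norm (f w)) \<partial>M)" for i
    using norm_simple_integral_diff[OF f s(1) z(1), of i] z(2) by simp
  ultimately show ?thesis by (metis (no_types, lifting) LIMSEQ_le add_0)
qed

section \<open>UMD on finite spaces\<close>

text \<open>The set \<open>X\<close> carries the counting measure, and the labels \<open>c n\<close> generate the \<open>n\<close>-th \<open>\<sigma>\<close>-algebra.\<close>

definition fin_mds :: "'w set \<Rightarrow> nat \<Rightarrow> (nat \<Rightarrow> 'w \<Rightarrow> 'b) \<Rightarrow> (nat \<Rightarrow> 'w \<Rightarrow> 'x::real_normed_vector) \<Rightarrow> bool" where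
  "fin_mds X N c d \<longleftrightarrow> finite X \<and>
     (\<forall>n<N. \<forall>w\<in>X. \<forall>w'\<in>X. c (Suc n) w = c (Suc n) w' \<longrightarrow> c n w = c n w' \<and> d n w = d n w') \<and>
     (\<forall>n<N. \<forall>w\<in>X. (\<Sum>w'\<in>{w'\<in>X. c n w' = c n w}. d n w') = 0)"

lemma fin_mdsD:
  assumes "fin_mds X N c d" "n < N" "w \<in> X"
  shows "w' \<in> X \<Longrightarrow> c (Suc n) w = c (Suc n) w' \<Longrightarrow> c n w = c n w'"
    and "w' \<in> X \<Longrightarrow> c (Suc n) w = c (Suc n) w' \<Longrightarrow> d n w = d n w'"
    and "(\<Sum>w'\<in>{w'\<in>X. c n w' = c n w}. d n w') = 0"
  using assms unfolding fin_mds_def by blast+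

text \<open>The constant \<open>\<beta>\<close> is the \<open>p\<close>-th power of a UMD constant. The types \<^typ>\<open>nat\<close> and \<^typ>\<open>nat set\<close> are
  large enough to encode all finite spaces with their partitions.\<close>

definition umd_fin :: "'x::real_normed_vector itself \<Rightarrow> real \<Rightarrow> real \<Rightarrow> bool" where
  "umd_fin _ p \<beta> \<longleftrightarrow> 0 \<le> \<beta> \<and>
     (\<forall>(X :: nat set) N (c :: nat \<Rightarrow> nat \<Rightarrow> nat set) (d :: nat \<Rightarrow> nat \<Rightarrow> 'x) \<sigma>.
        fin_mds X N c d \<and> (\<forall>n. \<sigma> n \<in> {-1, 1}) \<longrightarrow>
        (\<Sum>w\<in>X. norm (\<Sum>n<N. \<sigma> n *\<^sub>R d n w) powr p) \<le> \<beta> * (\<Sum>w\<in>X. norm (\<Sum>n<N. d n w) powr p))"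

lemma umd_finD:
  fixes d :: "nat \<Rightarrow> 'w \<Rightarrow> 'x::real_normed_vector" and c :: "nat \<Rightarrow> 'w \<Rightarrow> 'b"
  assumes umd: "umd_fin TYPE('x) p \<beta>" and mds: "fin_mds X N c d" and \<sigma>: "\<And>n. \<sigma> n \<in> {-1, 1}"
  shows "(\<Sum>w\<in>X. norm (\<Sum>n<N. \<sigma> n *\<^sub>R d n w) powr p) \<le> \<beta> * (\<Sum>w\<in>X. norm (\<Sum>n<N. d n w) powr p)"
proof -
  have "finite X" using mds by (simp add: fin_mds_def)
  then obtain g where g: "bij_betw g {0..<card X} X" using ex_bij_betw_nat_finite by blast
  define X' where "X' = {0..<card X}"
  have g: "bij_betw g X' X" using g by (simp add: X'_def)
  then have gX: "\<And>i. i \<in> X' \<Longrightarrow> g i \<in> X" by (auto simp: bij_betw_def)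
  \<comment> \<open>Each label is replaced by the cell it marks, a set of naturals; this induces the
    same partition of the enumerated points.\<close>
  define c' where "c' n i = {j \<in> X'. c n (g j) = c n (g i)}" for n i
  have c': "c' n i = c' n j \<longleftrightarrow> c n (g i) = c n (g j)" if "i \<in> X'" "j \<in> X'" for n i j
    using that by (auto simp: c'_def)
  have "fin_mds X' N c' (\<lambda>n i. d n (g i))"
    unfolding fin_mds_def
  proof (intro conjI allI impI ballI)
    show "finite X'" by (simp add: X'_def)
  next
    fix n i j assume *: "n < N" "i \<in> X'" "j \<in> X'" "c' (Suc n) i = c' (Suc n) j"
    then show "c' n i = c' n j" "d n (g i) = d n (g j)"
      using mds gX unfolding fin_mds_def by (auto simp: c')
  next
    fix n i assume *: "n < N" "i \<in> X'"
    have "bij_betw g {j \<in> X'. c n (g j) = c n (g i)} {w \<in> X. c n w = c n (g i)}"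
      using g unfolding bij_betw_def by (auto simp: inj_on_def)
    from sum.reindex_bij_betw[OF this, of "d n"]
    have "(\<Sum>j\<in>{j \<in> X'. c n (g j) = c n (g i)}. d n (g j)) = 0"
      using mds * gX unfolding fin_mds_def by simp
    moreover have "{j \<in> X'. c' n j = c' n i} = {j \<in> X'. c n (g j) = c n (g i)}"
      using * c' by auto
    ultimately show "(\<Sum>j\<in>{j \<in> X'. c' n j = c' n i}. d n (g j)) = 0" by simp
  qed
  then have "(\<Sum>i\<in>X'. norm (\<Sum>n<N. \<sigma> n *\<^sub>R d n (g i)) powr p) \<le> \<beta> * (\<Sum>i\<in>X'. norm (\<Sum>n<N. d n (g i)) powr p)"
    using umd \<sigma> unfolding umd_fin_def by blast
  then show ?thesis
    using sum.reindex_bij_betw[OF g, of "\<lambda>w. norm (\<Sum>n<N. \<sigma> n *\<^sub>R d n w) powr p"]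
      sum.reindex_bij_betw[OF g, of "\<lambda>w. norm (\<Sum>n<N. d n w) powr p"] by simp
qed

lemma strong_integral_uniform_count_measure:
  fixes f :: "'w \<Rightarrow> 'x::banach"
  assumes X: "finite X"
  shows "strong_integral (uniform_count_measure X) f = (1 / card X) *\<^sub>R (\<Sum>w\<in>X. f w)"
proof (rule strong_integral_eqI)
  let ?M = "uniform_count_measure X"
  have sf: "simple_function ?M f"
    using X by (auto simp: simple_function_def space_uniform_count_measure sets_uniform_count_measure)
  have "emeasure ?M {y \<in> space ?M. f y \<noteq> 0} \<noteq> \<infinity>"
    using X by (simp add: emeasure_uniform_count_measure space_uniform_count_measure)
  then have sb: "Bochner_Integration.simple_bochner_integrable ?M f"
    using sf by (intro simple_bochner_integrable.intros) auto
  have "Bochner_Integration.simple_bochner_integral ?M f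
      = (\<Sum>y\<in>f ` X. (card {w \<in> X. f w = y} / card X) *\<^sub>R y)"
    unfolding simple_bochner_integral_def using X
    by (auto simp: space_uniform_count_measure measure_uniform_count_measure intro!: sum.cong)
  also have "\<dots> = (1 / card X) *\<^sub>R (\<Sum>y\<in>f ` X. card {w \<in> X. f w = y} *\<^sub>R y)"
    by (simp add: scaleR_sum_right)
  also have "(\<Sum>y\<in>f ` X. card {w \<in> X. f w = y} *\<^sub>R y) = (\<Sum>y\<in>f ` X. \<Sum>w\<in>{w \<in> X. f w = y}. f w)"
    by (intro sum.cong) (auto simp: sum_constant_scaleR)
  also have "\<dots> = (\<Sum>w\<in>X. f w)" using X by (rule sum.image_gen[symmetric])
  finally show "has_strong_integral ?M f ((1 / card X) *\<^sub>R (\<Sum>w\<in>X. f w))"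
    using has_strong_integral_simple[OF sb] by simp
qed

lemma Lp_norm_uniform_count_measure:
  "finite X \<Longrightarrow> Lp_norm p (uniform_count_measure X) f = ((\<Sum>w\<in>X. norm (f w) powr p) / card X) powr (1 / p)"
  by (simp add: Lp_norm_def integral_uniform_count_measure)

text \<open>The finite set is placed on the real line with its uniform probability measure, and the
  labels generate the filtration. The normalisation by the cardinality appears on both sides and
  cancels.\<close>

lemma UMD_imp_umd_fin:
  assumes "UMD TYPE('x::banach)" and p: "1 < p"
  shows "\<exists>\<beta>. umd_fin TYPE('x) p \<beta>"
proof -
  have "\<exists>B. \<forall>(M :: real measure) F N (d :: nat \<Rightarrow> real \<Rightarrow> 'x) (\<sigma> :: nat \<Rightarrow> real).
        prob_space M \<and> martingale_differences p M F N d \<and> (\<forall>n. \<sigma> n \<in> {-1, 1}) \<longrightarrow>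
        Lp_norm p M (\<lambda>w. \<Sum>n=1..N. \<sigma> n *\<^sub>R d n w) \<le> B * Lp_norm p M (\<lambda>w. \<Sum>n=1..N. d n w)"
    using assms unfolding UMD_def by simp
  then obtain B :: real where B: "\<forall>(M :: real measure) F N (d :: nat \<Rightarrow> real \<Rightarrow> 'x) (\<sigma> :: nat \<Rightarrow> real).
        prob_space M \<and> martingale_differences p M F N d \<and> (\<forall>n. \<sigma> n \<in> {-1, 1}) \<longrightarrow>
        Lp_norm p M (\<lambda>w. \<Sum>n=1..N. \<sigma> n *\<^sub>R d n w) \<le> B * Lp_norm p M (\<lambda>w. \<Sum>n=1..N. d n w)"
    by (elim exE)
  \<comment> \<open>The absolute value keeps the constant nonnegative.\<close>
  have "umd_fin TYPE('x) p (\<bar>B\<bar> powr p)"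
    unfolding umd_fin_def
  proof (intro conjI allI impI)
    fix X :: "nat set" and N and c :: "nat \<Rightarrow> nat \<Rightarrow> nat set" and d :: "nat \<Rightarrow> nat \<Rightarrow> 'x" and \<sigma> :: "nat \<Rightarrow> real"
    assume "fin_mds X N c d \<and> (\<forall>n. \<sigma> n \<in> {-1, 1})"
    then have mds: "fin_mds X N c d" and \<sigma>: "\<And>n. \<sigma> n \<in> {-1, 1}" by auto
    have fin: "finite X" using mds by (simp add: fin_mds_def)
    show "(\<Sum>w\<in>X. norm (\<Sum>n<N. \<sigma> n *\<^sub>R d n w) powr p) \<le> \<bar>B\<bar> powr p * (\<Sum>w\<in>X. norm (\<Sum>n<N. d n w) powr p)"
    proof (cases "X = {}")
      case False
      define Y where "Y = real ` X"
      define g where "g w = nat \<lfloor>w\<rfloor>" for w :: real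
      have bij: "bij_betw g Y X" unfolding Y_def g_def
        by (rule bij_betw_byWitness[of _ real]) auto
      have gY: "g w \<in> X" if "w \<in> Y" for w using that bij by (auto simp: bij_betw_def)
      have Y: "finite Y" "Y \<noteq> {}" using fin False by (auto simp: Y_def)
      define M where "M = uniform_count_measure Y"
      have sp: "space M = Y" and st: "sets M = Pow Y"
        by (auto simp: M_def space_uniform_count_measure sets_uniform_count_measure)
      \<comment> \<open>The measurable sets of \<open>F n\<close> are the unions of cells of level
        \<open>n\<close>; \<open>FI\<close> and \<open>FD\<close> below are the two directions of
        this.\<close>
      define F where "F n = vimage_algebra Y (\<lambda>w. c n (g w)) (count_space UNIV)" for n
      have Fsp: "space (F n) = Y" for n by (simp add: F_def)
      have Fst: "sets (F n) = {(\<lambda>w. c n (g w)) -` A \<inter> Y | A. True}" for n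
        unfolding F_def by (subst sets_vimage_algebra2) auto
      have FI: "A \<in> sets (F n)" if "A \<subseteq> Y" "\<And>w w'. w \<in> A \<Longrightarrow> w' \<in> Y \<Longrightarrow> c n (g w) = c n (g w') \<Longrightarrow> w' \<in> A" for A n
      proof -
        have "A = (\<lambda>w. c n (g w)) -` ((\<lambda>w. c n (g w)) ` A) \<inter> Y" using that by force
        then show ?thesis unfolding Fst by blast
      qed
      have FD: "w' \<in> A" if "A \<in> sets (F n)" "w \<in> A" "w' \<in> Y" "c n (g w) = c n (g w')" for A n w w'
        using that unfolding Fst by auto
      have Fsub: "A \<subseteq> Y" if "A \<in> sets (F n)" for A n using that unfolding Fst by auto
      \<comment> \<open>The differences are indexed from 1 in the definition of UMD and from 0 in
        the finite version.\<close>
      define e where "e n w = d (n - 1) (g w)" for n w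
      have "martingale_differences p M F N e"
        unfolding martingale_differences_def
      proof (intro conjI allI impI ballI)
        fix n show "subalgebra M (F n)"
          unfolding subalgebra_def sp st Fsp using Fsub by auto
      next
        fix n assume n: "n < N"
        show "subalgebra (F (Suc n)) (F n)"
          unfolding subalgebra_def Fsp
        proof (intro conjI subsetI)
          fix A assume A: "A \<in> sets (F n)"
          show "A \<in> sets (F (Suc n))"
          proof (rule FI)
            fix w w' assume w: "w \<in> A" "w' \<in> Y" "c (Suc n) (g w) = c (Suc n) (g w')"
            then have "c n (g w) = c n (g w')"
              using fin_mdsD(1)[OF mds n] gY Fsub[OF A] by blast
            then show "w' \<in> A" using FD[OF A w(1,2)] by simp
          qed (use Fsub[OF A] in simp)
        qed simp
      next
        fix n assume n: "n \<in> {1..N}"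
        have "simple_function M (e n)" using Y by (auto simp: simple_function_def sp st)
        then show "e n \<in> fst (Lp p M)"
          unfolding Lp_def M_def uniform_count_measure_def using Y(1)
          by (simp add: simple_function_strongly_measurable integrable_point_measure_finite)
        have "simple_function (F n) (e n)"
          unfolding simple_function_def Fsp
        proof (intro conjI ballI)
          fix x
          show "e n -` {x} \<inter> Y \<in> sets (F n)"
          proof (rule FI)
            fix w w' assume w: "w \<in> e n -` {x} \<inter> Y" "w' \<in> Y" "c n (g w) = c n (g w')"
            have n': "n - 1 < N" "Suc (n - 1) = n" using n by auto
            have "d (n - 1) (g w) = d (n - 1) (g w')"
              using fin_mdsD(2)[OF mds n'(1), of "g w" "g w'"] w gY n'(2) by simp
            then show "w' \<in> e n -` {x} \<inter> Y" using w by (auto simp: e_def)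
          qed auto
        qed (use Y in simp)
        then show "strongly_measurable (F n) (e n)" by (rule simple_function_strongly_measurable)
        fix A assume A: "A \<in> sets (F (n - 1))"
        have "(\<Sum>w\<in>Y. indicator A w *\<^sub>R e n w) = (\<Sum>w\<in>A. e n w)"
          using Y Fsub[OF A] by (intro sum.mono_neutral_cong_right) auto
        also have "\<dots> = (\<Sum>b\<in>(\<lambda>w. c (n - 1) (g w)) ` A. \<Sum>w\<in>{w \<in> A. c (n - 1) (g w) = b}. e n w)"
          using Fsub[OF A] Y(1) finite_subset by (intro sum.image_gen) blast
        also have "\<dots> = 0"
        proof (rule sum.neutral, rule ballI)
          fix b assume "b \<in> (\<lambda>w. c (n - 1) (g w)) ` A"
          then obtain w0 where w0: "w0 \<in> A" "b = c (n - 1) (g w0)" by auto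
          let ?C = "{w \<in> Y. c (n - 1) (g w) = c (n - 1) (g w0)}"
          have "w \<in> A" if "w \<in> ?C" for w using FD[OF A w0(1), of w] that by simp
          then have C: "{w \<in> A. c (n - 1) (g w) = b} = ?C"
            using w0(2) Fsub[OF A] by blast
          have "inj_on g Y" "g ` Y = X" using bij by (auto simp: bij_betw_def)
          then have "g ` ?C = {w \<in> X. c (n - 1) w = c (n - 1) (g w0)}" "inj_on g ?C"
            by (blast, blast intro: inj_on_subset)
          then have "(\<Sum>w\<in>?C. d (n - 1) (g w)) = (\<Sum>w\<in>{w \<in> X. c (n - 1) w = c (n - 1) (g w0)}. d (n - 1) w)"
            by (metis (no_types, lifting) sum.reindex_cong)
          also have "\<dots> = 0"
            using n w0 gY Fsub[OF A] by (intro fin_mdsD(3)[OF mds]) auto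
          finally show "(\<Sum>w\<in>{w \<in> A. c (n - 1) (g w) = b}. e n w) = 0"
            unfolding C e_def .
        qed
        finally show "strong_integral M (\<lambda>w. indicator A w *\<^sub>R e n w) = 0"
          unfolding M_def strong_integral_uniform_count_measure[OF Y(1)] by simp
      qed
      moreover have "prob_space M" unfolding M_def by (rule prob_space_uniform_count_measure[OF Y])
      ultimately have "Lp_norm p M (\<lambda>w. \<Sum>n=1..N. \<sigma> (n - 1) *\<^sub>R e n w) \<le> B * Lp_norm p M (\<lambda>w. \<Sum>n=1..N. e n w)"
        using B \<sigma> by (elim allE[of _ M] allE[of _ F] allE[of _ N] allE[of _ e] allE[of _ "\<lambda>n. \<sigma> (n - 1)"]) simp
      also have "\<dots> \<le> \<bar>B\<bar> * Lp_norm p M (\<lambda>w. \<Sum>n=1..N. e n w)"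
        by (intro mult_right_mono) (auto simp: Lp_norm_def)
      finally have "Lp_norm p (uniform_count_measure Y) (\<lambda>w. \<Sum>n=1..N. \<sigma> (n - 1) *\<^sub>R e n w)
          \<le> \<bar>B\<bar> * Lp_norm p (uniform_count_measure Y) (\<lambda>w. \<Sum>n=1..N. e n w)"
        by (simp only: M_def)
      moreover have "(\<Sum>n=1..N. \<sigma> (n - 1) *\<^sub>R e n w) = (\<Sum>n<N. \<sigma> n *\<^sub>R d n (g w))"
        "(\<Sum>n=1..N. e n w) = (\<Sum>n<N. d n (g w))" for w
        by (simp_all add: e_def sum.atLeast1_atMost_eq)
      ultimately have "((\<Sum>w\<in>Y. norm (\<Sum>n<N. \<sigma> n *\<^sub>R d n (g w)) powr p) / card Y) powr (1 / p)
          \<le> \<bar>B\<bar> * ((\<Sum>w\<in>Y. norm (\<Sum>n<N. d n (g w)) powr p) / card Y) powr (1 / p)"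
        by (simp add: Lp_norm_uniform_count_measure[OF Y(1)])
      then have "(((\<Sum>w\<in>Y. norm (\<Sum>n<N. \<sigma> n *\<^sub>R d n (g w)) powr p) / card Y) powr (1 / p)) powr p
          \<le> (\<bar>B\<bar> * ((\<Sum>w\<in>Y. norm (\<Sum>n<N. d n (g w)) powr p) / card Y) powr (1 / p)) powr p"
        using p by (intro powr_mono2) auto
      then have "(\<Sum>w\<in>Y. norm (\<Sum>n<N. \<sigma> n *\<^sub>R d n (g w)) powr p) / card Y
          \<le> \<bar>B\<bar> powr p * ((\<Sum>w\<in>Y. norm (\<Sum>n<N. d n (g w)) powr p) / card Y)"
        using p by (simp add: powr_mult powr_powr sum_nonneg)
      moreover have "real (card Y) > 0" using Y by (simp add: card_gt_0_iff)
      ultimately have "(\<Sum>w\<in>Y. norm (\<Sum>n<N. \<sigma> n *\<^sub>R d n (g w)) powr p)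
          \<le> \<bar>B\<bar> powr p * (\<Sum>w\<in>Y. norm (\<Sum>n<N. d n (g w)) powr p)"
        by (simp add: divide_le_cancel)
      then show ?thesis
        using sum.reindex_bij_betw[OF bij, of "\<lambda>w. norm (\<Sum>n<N. \<sigma> n *\<^sub>R d n w) powr p"]
          sum.reindex_bij_betw[OF bij, of "\<lambda>w. norm (\<Sum>n<N. d n w) powr p"] by simp
    qed simp
  qed auto
  then show ?thesis ..
qed

section \<open>Conditional averages and duality\<close>

text \<open>The conditional expectation given the label \<open>c\<close>, for the uniform measure on
  \<open>X\<close>.\<close>

definition cavg :: "'w set \<Rightarrow> ('w \<Rightarrow> 'b) \<Rightarrow> ('w \<Rightarrow> 'x::real_vector) \<Rightarrow> 'w \<Rightarrow> 'x" where
  "cavg X c f w = (1 / card {w'\<in>X. c w' = c w}) *\<^sub>R (\<Sum>w'\<in>{w'\<in>X. c w' = c w}. f w')"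

lemma cavg_cong: "c w = c w' \<Longrightarrow> cavg X c f w = cavg X c f w'"
  by (simp add: cavg_def)

lemma sum_cells:
  fixes f :: "'w \<Rightarrow> 'x::comm_monoid_add"
  assumes "finite S"
  shows "(\<Sum>w\<in>S. f w) = (\<Sum>b\<in>c ` S. \<Sum>w\<in>{w\<in>S. c w = b}. f w)"
  by (rule sum.image_gen[OF assms])

text \<open>On each cell the average is constant and has the same total as the function, and a
  saturated set is a union of cells.\<close>

lemma sum_cavg_saturated:
  assumes X: "finite X" and S: "S \<subseteq> X" "\<And>w w'. w \<in> S \<Longrightarrow> w' \<in> X \<Longrightarrow> c w = c w' \<Longrightarrow> w' \<in> S"
  shows "(\<Sum>w\<in>S. cavg X c f w) = (\<Sum>w\<in>S. f w)"
proof -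
  have fS: "finite S" using X S finite_subset by blast
  show ?thesis
    unfolding sum_cells[OF fS, of "cavg X c f" c] sum_cells[OF fS, of f c]
  proof (rule sum.cong[OF refl])
    fix b assume "b \<in> c ` S"
    then obtain w0 where w0: "w0 \<in> S" "b = c w0" by auto
    have eq: "{w\<in>S. c w = b} = {w'\<in>X. c w' = c w0}" using w0 S by auto
    have "(\<Sum>w\<in>{w\<in>S. c w = b}. cavg X c f w) = (\<Sum>w\<in>{w'\<in>X. c w' = c w0}. cavg X c f w0)"
      unfolding eq by (intro sum.cong refl cavg_cong) auto
    also have "\<dots> = (\<Sum>w\<in>{w'\<in>X. c w' = c w0}. f w)"
      using w0 S X by (simp add: sum_constant_scaleR cavg_def) (auto simp: card_eq_0_iff)
    finally show "(\<Sum>w\<in>{w\<in>S. c w = b}. cavg X c f w) = (\<Sum>w\<in>{w\<in>S. c w = b}. f w)" by (simp only: eq)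
  qed
qed

lemma sum_cavg_coarser:
  assumes X: "finite X" and r: "\<And>w w'. w \<in> X \<Longrightarrow> w' \<in> X \<Longrightarrow> c w = c w' \<Longrightarrow> c' w = c' w'"
  shows "(\<Sum>w\<in>{w'\<in>X. c' w' = b}. cavg X c f w) = (\<Sum>w\<in>{w'\<in>X. c' w' = b}. f w)"
proof (rule sum_cavg_saturated[OF X])
  fix w w' assume "w \<in> {w' \<in> X. c' w' = b}" "w' \<in> X" "c w = c w'"
  then show "w' \<in> {w' \<in> X. c' w' = b}" using r[of w w'] by simp
qed simp

lemma cavg_scaleR: "cavg X c (\<lambda>w. r *\<^sub>R f w) w = r *\<^sub>R cavg X c f w"
  by (simp add: cavg_def scaleR_sum_right[symmetric] mult.commute)

lemma cavg_sum: "cavg X c (\<lambda>w. \<Sum>i\<in>I. f i w) w = (\<Sum>i\<in>I. cavg X c (f i) w)"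
  unfolding cavg_def by (subst sum.swap) (simp add: scaleR_sum_right)

text \<open>Orthogonality of a function that is constant on cells and one with mean zero on cells.
  The pairing is left abstract in order to cover scalar multiplication and the evaluation of
  functionals, with either factor in the role of the constant one.\<close>

lemma sum_cells_zero:
  fixes b :: "'w \<Rightarrow> 'x::real_vector"
  assumes X: "finite X" and lin: "\<And>x. linear (prd x)"
    and a: "\<And>w w'. w \<in> X \<Longrightarrow> w' \<in> X \<Longrightarrow> c w = c w' \<Longrightarrow> a w = a w'"
    and b: "\<And>w. w \<in> X \<Longrightarrow> (\<Sum>w'\<in>{w'\<in>X. c w' = c w}. b w') = 0"
  shows "(\<Sum>w\<in>X. prd (a w) (b w)) = 0"
  unfolding sum_cells[OF X, of _ c]
proof (rule sum.neutral, rule ballI)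
  fix v assume "v \<in> c ` X"
  then obtain w0 where w0: "w0 \<in> X" "v = c w0" by auto
  have "(\<Sum>w\<in>{w\<in>X. c w = v}. prd (a w) (b w)) = (\<Sum>w\<in>{w\<in>X. c w = c w0}. prd (a w0) (b w))"
  proof (rule sum.cong)
    fix w assume "w \<in> {w\<in>X. c w = c w0}"
    then have "a w = a w0" using a[of w w0] w0(1) by simp
    then show "prd (a w) (b w) = prd (a w0) (b w)" by simp
  qed (simp add: w0)
  also have "\<dots> = prd (a w0) (\<Sum>w\<in>{w\<in>X. c w = c w0}. b w)"
    by (rule linear_sum[OF lin, symmetric])
  also have "\<dots> = 0" unfolding b[OF w0(1)] by (rule linear_0[OF lin])
  finally show "(\<Sum>w\<in>{w\<in>X. c w = v}. prd (a w) (b w)) = 0" .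
qed

text \<open>Jensen's inequality in each cell; the averages of the powers then have the same total as
  the powers.\<close>

lemma cavg_power_le:
  fixes f :: "'w \<Rightarrow> 'x::real_normed_vector"
  assumes X: "finite X" and p: "1 < p"
  shows "(\<Sum>w\<in>X. norm (cavg X c f w) powr p) \<le> (\<Sum>w\<in>X. norm (f w) powr p)"
proof -
  have "(\<Sum>w\<in>X. norm (cavg X c f w) powr p) \<le> (\<Sum>w\<in>X. cavg X c (\<lambda>w. norm (f w) powr p) w)"
  proof (rule sum_mono)
    fix w assume "w \<in> X"
    let ?S = "{w'\<in>X. c w' = c w}"
    have "norm (cavg X c f w) \<le> (\<Sum>w'\<in>?S. norm (f w')) / card ?S"
      unfolding cavg_def by (simp add: divide_right_mono norm_sum)
    then have "norm (cavg X c f w) powr p \<le> ((\<Sum>w'\<in>?S. norm (f w')) / card ?S) powr p"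
      using p by (intro powr_mono2) auto
    also have "\<dots> \<le> (\<Sum>w'\<in>?S. norm (f w') powr p) / card ?S"
      using X p by (intro power_sum_le) auto
    finally show "norm (cavg X c f w) powr p \<le> cavg X c (\<lambda>w. norm (f w) powr p) w"
      by (simp add: cavg_def)
  qed
  also have "\<dots> = (\<Sum>w\<in>X. norm (f w) powr p)"
    by (rule sum_cavg_saturated[OF X]) auto
  finally show ?thesis .
qed

lemma Hoelder2:
  fixes a b :: "'a \<Rightarrow> real"
  assumes fin: "finite S" and p: "1 < p" "1 < q" "1/p + 1/q = 1"
    and nn: "\<And>s. s \<in> S \<Longrightarrow> 0 \<le> a s" "\<And>s. s \<in> S \<Longrightarrow> 0 \<le> b s"
  shows "(\<Sum>s\<in>S. a s * b s) \<le> lpsum p S a * lpsum q S b"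
proof (cases "lpsum p S a = 0 \<or> lpsum q S b = 0")
  case True
  then have "\<forall>s\<in>S. a s * b s = 0"
    using lpsum_eq_0[OF fin, of p a] lpsum_eq_0[OF fin, of q b] p nn by auto
  then have "(\<Sum>s\<in>S. a s * b s) = 0" by (intro sum.neutral)
  then show ?thesis by simp
next
  case False
  define A where "A = lpsum p S a"
  define B where "B = lpsum q S b"
  have pos: "A > 0" "B > 0" using False by (auto simp: A_def B_def less_le)
  have "(\<Sum>s\<in>S. (a s / A) * (b s / B)) \<le> (\<Sum>s\<in>S. (a s / A) powr p / p + (b s / B) powr q / q)"
    using p pos nn by (intro sum_mono Youngs_inequality) auto
  also have "\<dots> = (\<Sum>s\<in>S. a s powr p) / A powr p / p + (\<Sum>s\<in>S. b s powr q) / B powr q / q"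
    using pos nn by (simp add: sum.distrib sum_divide_distrib powr_divide)
  also have "\<dots> = 1"
  proof -
    have "(\<Sum>s\<in>S. a s powr p) = A powr p" "(\<Sum>s\<in>S. b s powr q) = B powr q"
      using p by (simp_all add: A_def B_def lpsum_powr)
    then show ?thesis using p pos by simp
  qed
  finally have "(\<Sum>s\<in>S. a s * b s) / (A * B) \<le> 1" by (simp add: sum_divide_distrib)
  then show ?thesis using pos by (simp add: A_def B_def)
qed

lemma lpsum_cavg_le:
  fixes f :: "'w \<Rightarrow> 'x::real_normed_vector"
  assumes "finite X" "1 < p"
  shows "lpsum p X (\<lambda>w. norm (cavg X c f w)) \<le> lpsum p X (\<lambda>w. norm (f w))"
  unfolding lpsum_def using assms by (intro powr_mono2 cavg_power_le sum_nonneg) auto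

text \<open>The norm of a functional need not be attained on the unit ball, but half of it is
  reached: otherwise half the norm would already be a bound. Length and sign of the vector are
  adjusted afterwards.\<close>

lemma dual_norming_vector:
  fixes G :: "'y::real_normed_vector \<Rightarrow>\<^sub>L real"
  shows "\<exists>y. norm y \<le> 1 \<and> norm G / 2 \<le> G y"
proof (cases "norm G = 0")
  case False
  have "\<exists>y. norm G / 2 * norm y < \<bar>G y\<bar>"
  proof (rule ccontr)
    assume "\<not> ?thesis"
    then have "norm G \<le> norm G / 2" by (intro norm_blinfun_bound) (auto simp: not_less)
    then show False using False norm_ge_zero[of G] by linarith
  qed
  then obtain y where y: "norm G / 2 * norm y < \<bar>G y\<bar>" by blast
  have y0: "norm y > 0"
  proof (rule ccontr)
    assume "\<not> 0 < norm y"
    then have "y = 0" by simp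
    then show False using y by (simp add: blinfun.zero_right)
  qed
  define z where "z = (sgn (G y) / norm y) *\<^sub>R y"
  have "norm z \<le> 1" using y0 by (simp add: z_def abs_sgn_eq)
  moreover have "G z = \<bar>G y\<bar> / norm y" by (simp add: z_def blinfun.scaleR_right abs_sgn mult.commute)
  moreover have "norm G / 2 \<le> \<bar>G y\<bar> / norm y" using y y0 by (simp add: field_simps)
  ultimately show ?thesis by (intro exI[of _ z]) simp
qed (intro exI[of _ 0], simp)

text \<open>The converse of Hoelder's inequality for functionals. The test function is
  \<open>norm (G s) powr (p - 1)\<close> times a nearly norming vector, the extremal choice in
  Hoelder; the factor 2 comes from norming only up to one half.\<close>

lemma dual_norming:
  fixes G :: "'s \<Rightarrow> 'y::real_normed_vector \<Rightarrow>\<^sub>L real"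
  assumes fin: "finite S" and p: "1 < p" "1 < q" "1/p + 1/q = 1" and C: "0 \<le> C"
    and bd: "\<And>h. (\<Sum>s\<in>S. G s (h s)) \<le> C * lpsum q S (\<lambda>s. norm (h s))"
  shows "lpsum p S (\<lambda>s. norm (G s)) \<le> 2 * C"
proof -
  have "\<forall>s. \<exists>y. norm y \<le> 1 \<and> norm (G s) / 2 \<le> G s y" using dual_norming_vector by blast
  then obtain y where y: "\<And>s. norm (y s) \<le> 1" "\<And>s. norm (G s) / 2 \<le> G s (y s)" by metis
  define h where "h s = (norm (G s) powr (p - 1)) *\<^sub>R y s" for s
  define A where "A = (\<Sum>s\<in>S. norm (G s) powr p)"
  have A: "0 \<le> A" by (simp add: A_def sum_nonneg)
  have "norm (G s) powr p \<le> 2 * G s (h s)" for s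
  proof -
    have "norm (G s) powr p = norm (G s) powr (p - 1) * norm (G s)"
      using p by (cases "norm (G s) = 0") (auto simp: powr_mult_base mult.commute)
    also have "\<dots> \<le> norm (G s) powr (p - 1) * (2 * G s (y s))"
      using y(2)[of s] by (intro mult_left_mono) auto
    finally show ?thesis by (simp add: h_def blinfun.scaleR_right)
  qed
  then have "A \<le> 2 * (\<Sum>s\<in>S. G s (h s))" unfolding A_def sum_distrib_left by (rule sum_mono)
  also have "\<dots> \<le> 2 * (C * lpsum q S (\<lambda>s. norm (h s)))" using bd by (intro mult_left_mono) auto
  also have "lpsum q S (\<lambda>s. norm (h s)) \<le> A powr (1/q)"
  proof -
    have "norm (h s) powr q \<le> norm (G s) powr p" for s
    proof -
      have "norm (h s) \<le> norm (G s) powr (p - 1)"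
        using mult_left_mono[OF y(1)[of s], of "norm (G s) powr (p - 1)"] by (simp add: h_def)
      then have "norm (h s) powr q \<le> (norm (G s) powr (p - 1)) powr q" using p by (intro powr_mono2) auto
      moreover have "(p - 1) * q = p"
      proof -
        have "1 / q = (p - 1) / p" using p by (simp add: field_simps)
        then show ?thesis using p by (simp add: field_simps)
      qed
      ultimately show ?thesis by (simp add: powr_powr)
    qed
    then show ?thesis unfolding lpsum_def A_def using p by (intro powr_mono2 sum_mono) (auto intro: sum_nonneg)
  qed
  \<comment> \<open>Division by \<open>A powr (1/q)\<close> will leave \<open>A powr (1/p)\<close>,
    which is the norm to be bounded.\<close>
  finally have le: "A \<le> 2 * C * A powr (1/q)" using C by (simp add: mult_left_mono mult.assoc)
  show ?thesis
  proof (cases "A = 0")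
    case False
    then have Ap: "A > 0" using A by simp
    have e: "1/p = 1 - 1/q" using p by simp
    have "A powr (1/p) = A / A powr (1/q)" unfolding e using Ap by (subst powr_diff) auto
    also have "\<dots> \<le> 2 * C" using le Ap by (simp add: field_simps)
    finally show ?thesis by (simp add: lpsum_def A_def)
  qed (use C in \<open>simp add: lpsum_def A_def\<close>)
qed

lemma fin_mds_refine:
  assumes mds: "fin_mds X N c d" and "m \<le> n" "n \<le> N" "w \<in> X" "w' \<in> X" "c n w = c n w'"
  shows "c m w = c m w'"
  using assms(2,3,6)
proof (induction n rule: dec_induct)
  case (step n)
  then show ?case using fin_mdsD(1)[OF mds, of n w w'] assms(4,5) by simp
qed

lemma fin_mds_cavg:
  assumes X: "finite X"
    and c: "\<And>n w w'. n < N \<Longrightarrow> w \<in> X \<Longrightarrow> w' \<in> X \<Longrightarrow> c (Suc n) w = c (Suc n) w' \<Longrightarrow> c n w = c n w'"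
  shows "fin_mds X N c (\<lambda>n w. cavg X (c (Suc n)) h w - cavg X (c n) h w)"
  unfolding fin_mds_def
proof (intro conjI allI impI ballI X)
  fix n w w' assume *: "n < N" "w \<in> X" "w' \<in> X" "c (Suc n) w = c (Suc n) w'"
  show "c n w = c n w'" by (rule c[OF *])
  from cavg_cong[where c = "c n", OF this, of X h] cavg_cong[where c = "c (Suc n)", OF *(4), of X h]
  show "cavg X (c (Suc n)) h w - cavg X (c n) h w = cavg X (c (Suc n)) h w' - cavg X (c n) h w'" by simp
next
  fix n w assume n: "n < N"
  have "(\<Sum>w'\<in>{w'\<in>X. c n w' = c n w}. cavg X (c (Suc n)) h w') = (\<Sum>w'\<in>{w'\<in>X. c n w' = c n w}. h w')"
    by (intro sum_cavg_coarser[OF X] c[OF n])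
  moreover have "(\<Sum>w'\<in>{w'\<in>X. c n w' = c n w}. cavg X (c n) h w') = (\<Sum>w'\<in>{w'\<in>X. c n w' = c n w}. h w')"
    by (intro sum_cavg_coarser[OF X])
  ultimately show "(\<Sum>w'\<in>{w'\<in>X. c n w' = c n w}. cavg X (c (Suc n)) h w' - cavg X (c n) h w') = 0"
    by (simp add: sum_subtractf)
qed

text \<open>The differences of \<open>h\<close> telescope to the last average minus the first, and
  averages are contractions; this accounts for the factor \<open>2 powr p\<close>.\<close>

lemma umd_fin_cavg:
  fixes h :: "'w \<Rightarrow> 'x::real_normed_vector"
  assumes umd: "umd_fin TYPE('x) p \<beta>" and p: "1 < p" and X: "finite X"
    and c: "\<And>n w w'. n < N \<Longrightarrow> w \<in> X \<Longrightarrow> w' \<in> X \<Longrightarrow> c (Suc n) w = c (Suc n) w' \<Longrightarrow> c n w = c n w'"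
    and \<sigma>: "\<And>n. \<sigma> n \<in> {-1, 1}"
  shows "(\<Sum>w\<in>X. norm (\<Sum>n<N. \<sigma> n *\<^sub>R (cavg X (c (Suc n)) h w - cavg X (c n) h w)) powr p)
    \<le> \<beta> * 2 powr p * (\<Sum>w\<in>X. norm (h w) powr p)"
proof -
  have \<beta>: "0 \<le> \<beta>" using umd by (simp add: umd_fin_def)
  have "lpsum p X (\<lambda>w. norm (cavg X (c N) h w - cavg X (c 0) h w))
      \<le> lpsum p X (\<lambda>w. norm (cavg X (c N) h w) + norm (cavg X (c 0) h w))"
    using p by (intro lpsum_mono norm_triangle_ineq4) auto
  also have "\<dots> \<le> lpsum p X (\<lambda>w. norm (cavg X (c N) h w)) + lpsum p X (\<lambda>w. norm (cavg X (c 0) h w))"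
    using p X by (intro Minkowski) auto
  also have "\<dots> \<le> lpsum p X (\<lambda>w. norm (h w)) + lpsum p X (\<lambda>w. norm (h w))"
    using X p by (intro add_mono lpsum_cavg_le) auto
  finally have "lpsum p X (\<lambda>w. norm (cavg X (c N) h w - cavg X (c 0) h w)) powr p
      \<le> (2 * lpsum p X (\<lambda>w. norm (h w))) powr p"
    using p by (intro powr_mono2) auto
  then have "(\<Sum>w\<in>X. norm (cavg X (c N) h w - cavg X (c 0) h w) powr p) \<le> 2 powr p * (\<Sum>w\<in>X. norm (h w) powr p)"
    using p by (simp add: powr_mult lpsum_powr)
  then have "\<beta> * (\<Sum>w\<in>X. norm (cavg X (c N) h w - cavg X (c 0) h w) powr p) \<le> \<beta> * (2 powr p * (\<Sum>w\<in>X. norm (h w) powr p))"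
    using \<beta> by (rule mult_left_mono)
  moreover have tel: "(\<Sum>n<N. cavg X (c (Suc n)) h w - cavg X (c n) h w) = cavg X (c N) h w - cavg X (c 0) h w" for w
    by (rule sum_lessThan_telescope[of "\<lambda>n. cavg X (c n) h w"])
  moreover have "fin_mds X N c (\<lambda>n w. cavg X (c (Suc n)) h w - cavg X (c n) h w)"
    by (rule fin_mds_cavg[OF X c])
  from umd_finD[OF umd this \<sigma>]
  have "(\<Sum>w\<in>X. norm (\<Sum>n<N. \<sigma> n *\<^sub>R (cavg X (c (Suc n)) h w - cavg X (c n) h w)) powr p)
    \<le> \<beta> * (\<Sum>w\<in>X. norm (cavg X (c N) h w - cavg X (c 0) h w) powr p)" unfolding tel .
  ultimately show ?thesis unfolding mult.assoc by linarith
qed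

lemma linear_blinfun_apply: "linear (blinfun_apply f)"
  by (rule bounded_linear.linear[OF blinfun.bounded_linear_right])

lemma linear_blinfun_eval: "linear (\<lambda>f. blinfun_apply f y)"
  by (rule bounded_linear.linear[OF blinfun.bounded_linear_left])

text \<open>A martingale transform is its own adjoint: paired with \<open>h\<close>, the signs move
  from the functionals \<open>d n\<close> to the martingale differences of \<open>h\<close>, where
  UMD of the predual applies. In the constant one factor 2 comes from norming and one from the two
  averages left by telescoping.\<close>

lemma umd_fin_dual:
  assumes p: "1 < p" "1 < q" "1/p + 1/q = 1" and umd: "umd_fin TYPE('y::real_normed_vector) q \<beta>"
  shows "\<exists>\<beta>'. umd_fin TYPE('y \<Rightarrow>\<^sub>L real) p \<beta>'"
proof -
  define B where "B = 4 * \<beta> powr (1/q)"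
  have \<beta>: "0 \<le> \<beta>" using umd by (simp add: umd_fin_def)
  have "umd_fin TYPE('y \<Rightarrow>\<^sub>L real) p (B powr p)"
    unfolding umd_fin_def
  proof (intro conjI allI impI)
    fix X :: "nat set" and N and c :: "nat \<Rightarrow> nat \<Rightarrow> nat set" and d :: "nat \<Rightarrow> nat \<Rightarrow> 'y \<Rightarrow>\<^sub>L real" and \<sigma> :: "nat \<Rightarrow> real"
    assume "fin_mds X N c d \<and> (\<forall>n. \<sigma> n \<in> {-1, 1})"
    then have mds: "fin_mds X N c d" and \<sigma>: "\<And>n. \<sigma> n \<in> {-1, 1}" by auto
    have X: "finite X" using mds by (simp add: fin_mds_def)
    define G where "G w = (\<Sum>n<N. \<sigma> n *\<^sub>R d n w)" for w
    define F where "F w = (\<Sum>n<N. d n w)" for w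
    define A where "A = lpsum p X (\<lambda>w. norm (F w))"
    have A0: "0 \<le> A" by (simp add: A_def)
    have bd: "(\<Sum>w\<in>X. G w (h w)) \<le> (2 * \<beta> powr (1/q) * A) * lpsum q X (\<lambda>w. norm (h w))" for h :: "nat \<Rightarrow> 'y"
    proof -
      define D where "D n w = cavg X (c (Suc n)) h w - cavg X (c n) h w" for n w
      have Dm: "fin_mds X N c D"
        unfolding D_def by (rule fin_mds_cavg[OF X fin_mdsD(1)[OF mds]])
      note Dz = fin_mdsD(3)[OF Dm] and Dc = fin_mdsD(2)[OF Dm]
      \<comment> \<open>Differences of distinct levels are orthogonal: the earlier one is constant
        on the cells over which the later one has mean zero.\<close>
      have off: "(\<Sum>w\<in>X. d j w (D n w)) = 0" if jn: "j < N" "n < N" "j \<noteq> n" for j n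
      proof (cases "j < n")
        case True
        show ?thesis
        proof (rule sum_cells_zero[OF X, where c = "c n" and prd = blinfun_apply])
          fix w w' assume w: "w \<in> X" "w' \<in> X" "c n w = c n w'"
          then have "c (Suc j) w = c (Suc j) w'" using fin_mds_refine[OF mds, of "Suc j" n w w'] True jn by simp
          then show "d j w = d j w'" using fin_mdsD(2)[OF mds jn(1) w(1,2)] by simp
        qed (rule linear_blinfun_apply, rule Dz[OF jn(2)])
      next
        case False
        then have nj: "n < j" using jn by simp
        show ?thesis
        proof (rule sum_cells_zero[OF X, where c = "c j" and prd = "\<lambda>y f. blinfun_apply f y"])
          fix w w' assume w: "w \<in> X" "w' \<in> X" "c j w = c j w'"
          then have "c (Suc n) w = c (Suc n) w'" using fin_mds_refine[OF mds, of "Suc n" j w w'] nj jn by simp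
          then show "D n w = D n w'" by (rule Dc[OF jn(2) w(1,2)])
        qed (rule linear_blinfun_eval, rule fin_mdsD(3)[OF mds jn(1)])
      qed
      \<comment> \<open>The part of \<open>h\<close> beyond level \<open>n + 1\<close> and its
        average of level \<open>n\<close> are both orthogonal to \<open>d n\<close>, so only the
        \<open>n\<close>-th difference of \<open>h\<close> is seen.\<close>
      have diag: "(\<Sum>w\<in>X. d n w (h w)) = (\<Sum>w\<in>X. d n w (D n w))" if n: "n < N" for n
      proof -
        have "(\<Sum>w\<in>X. d n w (h w - cavg X (c (Suc n)) h w)) = 0"
        proof (rule sum_cells_zero[OF X, where c = "c (Suc n)" and prd = blinfun_apply])
          fix w
          have "(\<Sum>w'\<in>{w'\<in>X. c (Suc n) w' = c (Suc n) w}. cavg X (c (Suc n)) h w')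
              = (\<Sum>w'\<in>{w'\<in>X. c (Suc n) w' = c (Suc n) w}. h w')"
            by (intro sum_cavg_coarser[OF X])
          then show "(\<Sum>w'\<in>{w'\<in>X. c (Suc n) w' = c (Suc n) w}. h w' - cavg X (c (Suc n)) h w') = 0"
            by (simp add: sum_subtractf)
        qed (rule linear_blinfun_apply, rule fin_mdsD(2)[OF mds n])
        moreover have "(\<Sum>w\<in>X. d n w (cavg X (c n) h w)) = 0"
        proof (rule sum_cells_zero[OF X, where c = "c n" and prd = "\<lambda>y f. blinfun_apply f y"])
          fix w w' assume "c n w = c n w'"
          then show "cavg X (c n) h w = cavg X (c n) h w'" by (rule cavg_cong)
        qed (rule linear_blinfun_eval, rule fin_mdsD(3)[OF mds n])
        ultimately show ?thesis by (simp add: D_def blinfun.diff_right sum_subtractf)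
      qed
      have "(\<Sum>w\<in>X. G w (h w)) = (\<Sum>n<N. \<sigma> n * (\<Sum>w\<in>X. d n w (h w)))"
        unfolding G_def blinfun.sum_left blinfun.scaleR_left
        by (subst sum.swap) (simp add: sum_distrib_left)
      also have "\<dots> = (\<Sum>n<N. \<sigma> n * (\<Sum>j<N. \<Sum>w\<in>X. d j w (D n w)))"
      proof (rule sum.cong[OF refl])
        fix n assume "n \<in> {..<N}"
        then have n: "n < N" by simp
        have "(\<Sum>j<N. \<Sum>w\<in>X. d j w (D n w)) = (\<Sum>j\<in>{n}. \<Sum>w\<in>X. d j w (D n w))"
          using n off by (intro sum.mono_neutral_right) auto
        then show "\<sigma> n * (\<Sum>w\<in>X. d n w (h w)) = \<sigma> n * (\<Sum>j<N. \<Sum>w\<in>X. d j w (D n w))"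
          using diag[OF n] by simp
      qed
      also have "\<dots> = (\<Sum>n<N. \<Sum>w\<in>X. F w (\<sigma> n *\<^sub>R D n w))"
      proof (rule sum.cong[OF refl])
        fix n
        show "\<sigma> n * (\<Sum>j<N. \<Sum>w\<in>X. d j w (D n w)) = (\<Sum>w\<in>X. F w (\<sigma> n *\<^sub>R D n w))"
          unfolding F_def blinfun.sum_left by (subst sum.swap) (simp add: sum_distrib_left blinfun.scaleR_right)
      qed
      also have "\<dots> = (\<Sum>w\<in>X. F w (\<Sum>n<N. \<sigma> n *\<^sub>R D n w))"
        by (subst sum.swap) (simp add: blinfun.sum_right)
      also have "\<dots> \<le> (\<Sum>w\<in>X. norm (F w) * norm (\<Sum>n<N. \<sigma> n *\<^sub>R D n w))"
        by (intro sum_mono order_trans[OF _ norm_blinfun]) simp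
      also have "\<dots> \<le> A * lpsum q X (\<lambda>w. norm (\<Sum>n<N. \<sigma> n *\<^sub>R D n w))"
        unfolding A_def using X p by (intro Hoelder2) auto
      finally have 1: "(\<Sum>w\<in>X. G w (h w)) \<le> A * lpsum q X (\<lambda>w. norm (\<Sum>n<N. \<sigma> n *\<^sub>R D n w))" .
      have "lpsum q X (\<lambda>w. norm (\<Sum>n<N. \<sigma> n *\<^sub>R D n w)) \<le> (\<beta> * 2 powr q * (\<Sum>w\<in>X. norm (h w) powr q)) powr (1/q)"
        unfolding lpsum_def D_def
        by (rule powr_mono2[OF _ _ umd_fin_cavg[OF umd p(2) X fin_mdsD(1)[OF mds] \<sigma>]]) (use p in \<open>auto intro: sum_nonneg\<close>)
      also have "\<dots> = \<beta> powr (1/q) * (2 * lpsum q X (\<lambda>w. norm (h w)))"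
        using \<beta> p by (simp add: powr_mult powr_powr sum_nonneg lpsum_def)
      finally have 2: "lpsum q X (\<lambda>w. norm (\<Sum>n<N. \<sigma> n *\<^sub>R D n w)) \<le> \<beta> powr (1/q) * (2 * lpsum q X (\<lambda>w. norm (h w)))" .
      from mult_left_mono[OF 2 A0] 1
      have "(\<Sum>w\<in>X. G w (h w)) \<le> A * (\<beta> powr (1/q) * (2 * lpsum q X (\<lambda>w. norm (h w))))" by linarith
      then show ?thesis by (simp add: mult_ac)
    qed
    have "lpsum p X (\<lambda>w. norm (G w)) \<le> 2 * (2 * \<beta> powr (1/q) * A)"
      using dual_norming[OF X p _ bd] A0 by simp
    then have "lpsum p X (\<lambda>w. norm (G w)) \<le> B * A" by (simp add: B_def)
    then have "lpsum p X (\<lambda>w. norm (G w)) powr p \<le> (B * A) powr p"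
      using p by (intro powr_mono2) auto
    also have "\<dots> = B powr p * A powr p" by (simp add: powr_mult B_def A_def)
    finally show "(\<Sum>w\<in>X. norm (\<Sum>n<N. \<sigma> n *\<^sub>R d n w) powr p) \<le> B powr p * (\<Sum>w\<in>X. norm (\<Sum>n<N. d n w) powr p)"
      using p by (simp add: lpsum_powr A_def G_def F_def)
  qed auto
  then show ?thesis ..
qed

section \<open>Decoupling and K-convexity\<close>

text \<open>A selection picks a point in every cell of every level \<open>m < M\<close>; under the uniform measure these points are
  independent and uniformly distributed in their cells.\<close>

definition selections :: "'a set \<Rightarrow> nat \<Rightarrow> (nat \<Rightarrow> 'a \<Rightarrow> 'b) \<Rightarrow> (nat \<times> 'b \<Rightarrow> 'a) set" where
  "selections \<Omega> M C = PiE ((\<lambda>(m, x). (m, C m x)) ` ({..<M} \<times> \<Omega>)) (\<lambda>(m, b). {x\<in>\<Omega>. C m x = b})"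

lemma finite_selections: "finite \<Omega> \<Longrightarrow> finite (selections \<Omega> M C)"
  unfolding selections_def by (intro finite_PiE) auto

lemma selections_nonempty: "selections \<Omega> M C \<noteq> {}"
  unfolding selections_def by (auto simp: PiE_eq_empty_iff)

lemma selectionsD:
  assumes "y \<in> selections \<Omega> M C" "m < M" "x \<in> \<Omega>"
  shows "y (m, C m x) \<in> \<Omega>" "C m (y (m, C m x)) = C m x"
proof -
  have "(m, C m x) \<in> (\<lambda>(m, x). (m, C m x)) ` ({..<M} \<times> \<Omega>)" using assms(2,3) by force
  from PiE_mem[OF assms(1)[unfolded selections_def] this]
  show "y (m, C m x) \<in> \<Omega>" "C m (y (m, C m x)) = C m x" by auto
qed

lemma selections_upd:
  assumes "y \<in> selections \<Omega> M C" "m < M" "x \<in> \<Omega>" "z \<in> \<Omega>" "C m z = C m x"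
  shows "y((m, C m x) := z) \<in> selections \<Omega> M C"
proof -
  have "(m, C m x) \<in> (\<lambda>(m, x). (m, C m x)) ` ({..<M} \<times> \<Omega>)" using assms(2,3) by force
  then have ins: "insert (m, C m x) ((\<lambda>(m, x). (m, C m x)) ` ({..<M} \<times> \<Omega>)) = (\<lambda>(m, x). (m, C m x)) ` ({..<M} \<times> \<Omega>)"
    by (rule insert_absorb)
  have "y((m, C m x) := z) \<in> PiE (insert (m, C m x) ((\<lambda>(m, x). (m, C m x)) ` ({..<M} \<times> \<Omega>))) (\<lambda>(m, b). {x\<in>\<Omega>. C m x = b})"
    by (rule PiE_fun_upd) (use assms in \<open>auto simp: selections_def\<close>)
  then show ?thesis unfolding ins selections_def .
qed

lemma sum_swap_antisymmetric:
  fixes V :: "'s \<Rightarrow> 'x::real_vector"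
  assumes "\<And>w. w \<in> S \<Longrightarrow> s w \<in> S" "\<And>w. w \<in> S \<Longrightarrow> s (s w) = w" "\<And>w. w \<in> S \<Longrightarrow> V (s w) = - V w"
  shows "(\<Sum>w\<in>S. V w) = 0"
proof -
  have "(\<Sum>w\<in>S. V w) = (\<Sum>w\<in>S. - V w)"
    by (rule sum.reindex_bij_witness[of S s s]) (use assms in auto)
  then have "(\<Sum>w\<in>S. V w) = - (\<Sum>w\<in>S. V w)" by (simp add: sum_negf)
  then have "2 *\<^sub>R (\<Sum>w\<in>S. V w) = 0" unfolding scaleR_2 eq_neg_iff_add_eq_0 .
  then show ?thesis by simp
qed

text \<open>The differences at \<open>x\<close> and at an independently selected point \<open>y\<close> of the same cell are \<open>U + V\<close>
  and \<open>U - V\<close> with \<open>U\<close>, \<open>V\<close> half their sum and half their difference. Exchanging \<open>x\<close> and \<open>y\<close> fixes the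
  past and \<open>U\<close> and negates \<open>V\<close>, so that \<open>U\<close>, \<open>V\<close> interlaced are again martingale differences, and passing
  from \<open>x\<close> to \<open>y\<close> is a change of signs.\<close>

lemma decoupling:
  fixes d :: "nat \<Rightarrow> 'a \<Rightarrow> 'x::real_normed_vector" and C :: "nat \<Rightarrow> 'a \<Rightarrow> 'b"
  assumes umd: "umd_fin TYPE('x) p \<beta>" and mds: "fin_mds \<Omega> M C d" and \<sigma>: "\<And>m. \<sigma> m \<in> {-1, 1}"
  defines "Y \<equiv> selections \<Omega> M C"
  shows "(\<Sum>x\<in>\<Omega>. \<Sum>y\<in>Y. norm (\<Sum>m<M. \<sigma> m *\<^sub>R d m (y (m, C m x))) powr p)
    \<le> \<beta> * (card Y * (\<Sum>x\<in>\<Omega>. norm (\<Sum>m<M. d m x) powr p))"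
proof -
  have fin: "finite \<Omega>" using mds by (simp add: fin_mds_def)
  have fY: "finite Y" unfolding Y_def by (rule finite_selections[OF fin])
  define P where "P m w = snd w (m, C m (fst w))" for m and w :: "'a \<times> (nat \<times> 'b \<Rightarrow> 'a)"
  define U where "U m w = (1/2) *\<^sub>R (d m (fst w) + d m (P m w))" for m w
  define V where "V m w = (1/2) *\<^sub>R (d m (fst w) - d m (P m w))" for m w
  \<comment> \<open>For every earlier level the history keeps the finer cell of the selected point,
    which determines the earlier differences at the selected points.\<close>
  define hist where "hist m w = (\<lambda>j. if j < m then Some (C (Suc j) (P j w)) else None)" for m w
  \<comment> \<open>An even index carries the past of level \<open>m\<close>, the following odd
    index in addition the value of \<open>U m\<close>. Both are preserved by the exchange that
    negates \<open>V m\<close>.\<close>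
  define c where "c n w = (C (n div 2) (fst w), hist (n div 2) w, if odd n then Some (U (n div 2) w) else None)" for n w
  define e where "e n = (if even n then U (n div 2) else V (n div 2))" for n
  \<comment> \<open>The exchange of \<open>x\<close> with the point selected in its cell of level
    \<open>m\<close>; the cells of level at most \<open>m\<close> stay the same.\<close>
  define s where "s m w = (P m w, (snd w)((m, C m (fst w)) := fst w))" for m and w :: "'a \<times> (nat \<times> 'b \<Rightarrow> 'a)"
  let ?X = "\<Omega> \<times> Y"
  have P: "P m w \<in> \<Omega>" "C m (P m w) = C m (fst w)" if "w \<in> ?X" "m < M" for m w
    using selectionsD[of "snd w" \<Omega> M C m "fst w"] that by (auto simp: P_def Y_def)
  have sX: "s m w \<in> ?X" if "w \<in> ?X" "m < M" for m w
    using P[OF that] selections_upd[of "snd w" \<Omega> M C m "fst w" "fst w"] that by (auto simp: s_def Y_def)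
  have ss: "s m (s m w) = w" if "w \<in> ?X" "m < M" for m w
    using P[OF that] by (simp add: s_def P_def prod_eq_iff)
  have Cs: "C j (fst (s m w)) = C j (fst w)" if "w \<in> ?X" "m < M" "j \<le> m" for j m w
    using fin_mds_refine[OF mds that(3) _ P(1)[OF that(1,2)], of "fst w"] P(2)[OF that(1,2)] that
    by (auto simp: s_def)
  have Pm: "P m (s m w) = fst w" if "w \<in> ?X" "m < M" for m w
    using P(2)[OF that] by (simp add: s_def P_def)
  have Ps: "P j (s m w) = P j w" if "w \<in> ?X" "m < M" "j < m" for j m w
    using Cs[OF that(1,2), of j] that(3) by (simp add: P_def s_def)
  have hs: "hist m (s m w) = hist m w" if "w \<in> ?X" "m < M" for m w
    using Ps[OF that] by (auto simp: hist_def fun_eq_iff)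
  have Us: "U m (s m w) = U m w" if "w \<in> ?X" "m < M" for m w
    using Pm[OF that] by (simp add: U_def add.commute) (simp add: s_def)
  have Vs: "V m (s m w) = - V m w" if "w \<in> ?X" "m < M" for m w
    using Pm[OF that] by (simp add: V_def scaleR_minus_right[symmetric] del: scaleR_minus_right) (simp add: s_def)
  have cs: "c n (s (n div 2) w) = c n w" if "w \<in> ?X" "n div 2 < M" for n w
    unfolding c_def using Cs[OF that] hs[OF that] Us[OF that] by simp
  have "fin_mds ?X (2 * M) c e"
    unfolding fin_mds_def
  proof (intro conjI allI impI ballI)
    show "finite ?X" using fin fY by simp
  next
    fix n w w' assume n: "n < 2 * M" and w: "w \<in> ?X" "w' \<in> ?X" and eq: "c (Suc n) w = c (Suc n) w'"
    define m where "m = n div 2"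
    have m: "m < M" using n by (auto simp: m_def)
    have fw: "fst w \<in> \<Omega>" "fst w' \<in> \<Omega>" using w by auto
    have "c n w = c n w' \<and> e n w = e n w'"
    proof (cases "even n")
      case True
      then have "Suc n div 2 = m" by (simp add: m_def)
      then show ?thesis using eq True unfolding c_def e_def m_def[symmetric] by simp
    next
      case False
      then have S: "Suc n div 2 = Suc m" by (simp add: m_def)
      have 1: "C (Suc m) (fst w) = C (Suc m) (fst w')" and 2: "hist (Suc m) w = hist (Suc m) w'"
        using eq unfolding c_def S by auto
      have h: "C (Suc j) (P j w) = C (Suc j) (P j w')" if "j < Suc m" for j
        using fun_cong[OF 2, of j] that by (simp add: hist_def)
      have "d m (fst w) = d m (fst w')" by (rule fin_mdsD(2)[OF mds m fw 1])
      moreover have "d m (P m w) = d m (P m w')"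
        by (rule fin_mdsD(2)[OF mds m P(1)[OF w(1) m] P(1)[OF w(2) m] h]) simp
      moreover have "C m (fst w) = C m (fst w')" by (rule fin_mdsD(1)[OF mds m fw 1])
      moreover have "hist m w = hist m w'" using h by (auto simp: hist_def fun_eq_iff)
      ultimately show ?thesis unfolding c_def e_def m_def[symmetric] U_def V_def by simp
    qed
    then show "c n w = c n w'" "e n w = e n w'" by auto
  next
    fix n w0 assume n: "n < 2 * M" and w0: "w0 \<in> ?X"
    define m where "m = n div 2"
    have m: "m < M" using n by (auto simp: m_def)
    define S where "S = {w \<in> ?X. c n w = c n w0}"
    have SX: "w \<in> ?X" if "w \<in> S" for w using that by (simp add: S_def)
    have sS: "s m w \<in> S" "s m (s m w) = w" if "w \<in> S" for w
      using that sX[OF SX[OF that] m] cs[OF SX[OF that], of n] m ss[OF SX[OF that] m]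
      by (auto simp: S_def m_def)
    show "(\<Sum>w\<in>{w \<in> ?X. c n w = c n w0}. e n w) = 0"
      unfolding S_def[symmetric]
    proof (cases "even n")
      case False
      then have e: "e n = V m" by (simp add: e_def m_def)
      show "(\<Sum>w\<in>S. e n w) = 0"
        unfolding e using sS Vs[OF SX m] by (rule sum_swap_antisymmetric)
    next
      case True
      then have e: "e n = U m" by (simp add: e_def m_def)
      have mem: "w \<in> S \<longleftrightarrow> w \<in> ?X \<and> C m (fst w) = C m (fst w0) \<and> hist m w = hist m w0" for w
        using True by (auto simp: S_def c_def m_def)
      have fS: "finite S" unfolding S_def using fin fY by simp
      \<comment> \<open>The exchange makes the sums at \<open>x\<close> and at the selected point
        equal, so that it suffices to treat the first.\<close>
      have "(\<Sum>w\<in>S. d m (fst w) - d m (P m w)) = 0"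
      proof (rule sum_swap_antisymmetric[where s = "s m"])
        fix w assume w: "w \<in> S"
        show "s m w \<in> S" "s m (s m w) = w" using sS[OF w] by auto
        show "d m (fst (s m w)) - d m (P m (s m w)) = - (d m (fst w) - d m (P m w))"
          unfolding Pm[OF SX[OF w] m] by (simp add: s_def)
      qed
      then have eqd: "(\<Sum>w\<in>S. d m (P m w)) = (\<Sum>w\<in>S. d m (fst w))" by (simp add: sum_subtractf)
      have "(\<Sum>w\<in>S. d m (fst w)) = (\<Sum>y\<in>snd ` S. \<Sum>w\<in>{w \<in> S. snd w = y}. d m (fst w))"
        by (rule sum.image_gen[OF fS])
      also have "\<dots> = 0"
      proof (rule sum.neutral, rule ballI)
        fix y assume "y \<in> snd ` S"
        then obtain x1 where x1: "(x1, y) \<in> S" by auto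
        then have x1': "x1 \<in> \<Omega>" "y \<in> Y" using SX by auto
        have C1: "C m x1 = C m (fst w0)" using x1 mem by simp
        \<comment> \<open>For a fixed selection \<open>y\<close>, the points of one cell of level
          \<open>m\<close> share all earlier selected points and hence the history. The fibre is
          thus a whole cell, over which \<open>d m\<close> has mean zero.\<close>
        have "(x, y) \<in> S" if x: "x \<in> \<Omega>" "C m x = C m x1" for x
        proof -
          have "C j x = C j x1" if "j < m" for j
            using fin_mds_refine[OF mds, of j m x x1] that x m x1'(1) by simp
          then have "hist m (x, y) = hist m (x1, y)" by (auto simp: hist_def P_def fun_eq_iff)
          then show ?thesis using x x1 x1' C1 mem by simp
        qed
        moreover have "fst w \<in> \<Omega> \<and> C m (fst w) = C m x1" if "w \<in> S" for w
          using that mem[of w] C1 by auto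
        ultimately have eqS: "{w \<in> S. snd w = y} = (\<lambda>x. (x, y)) ` {x \<in> \<Omega>. C m x = C m x1}"
          by force
        have "(\<Sum>w\<in>{w \<in> S. snd w = y}. d m (fst w)) = (\<Sum>x\<in>{x \<in> \<Omega>. C m x = C m x1}. d m x)"
          unfolding eqS by (subst sum.reindex) (auto simp: inj_on_def)
        then show "(\<Sum>w\<in>{w \<in> S. snd w = y}. d m (fst w)) = 0"
          using fin_mdsD(3)[OF mds m x1'(1)] by simp
      qed
      finally show "(\<Sum>w\<in>S. e n w) = 0"
        unfolding e U_def scaleR_sum_right[symmetric] sum.distrib eqd by simp
    qed
  qed
  \<comment> \<open>Signs \<open>\<sigma>\<close> on \<open>U\<close> and the opposite ones on
    \<open>V\<close> turn U + V, the difference at \<open>x\<close>, into \<open>\<sigma>\<close>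
    times U - V, the signed difference at \<open>y\<close>.\<close>
  from umd_finD[OF umd this, of "\<lambda>n. if even n then \<sigma> (n div 2) else - \<sigma> (n div 2)"] \<sigma>
  have le: "(\<Sum>w\<in>?X. norm (\<Sum>n<2*M. (if even n then \<sigma> (n div 2) else - \<sigma> (n div 2)) *\<^sub>R e n w) powr p)
      \<le> \<beta> * (\<Sum>w\<in>?X. norm (\<Sum>n<2*M. e n w) powr p)" by fastforce
  have dbl: "(\<Sum>n<2*M. f n) = (\<Sum>m<M. f (2 * m) + f (2 * m + 1))" for f :: "nat \<Rightarrow> 'x"
    by (induction M) (simp_all add: add.assoc)
  have "(\<Sum>n<2*M. (if even n then \<sigma> (n div 2) else - \<sigma> (n div 2)) *\<^sub>R e n w) = (\<Sum>m<M. \<sigma> m *\<^sub>R d m (P m w))" for w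
    unfolding dbl by (intro sum.cong refl) (simp add: e_def U_def V_def algebra_simps flip: scaleR_2)
  moreover have "(\<Sum>n<2*M. e n w) = (\<Sum>m<M. d m (fst w))" for w
    unfolding dbl by (intro sum.cong refl) (simp add: e_def U_def V_def algebra_simps flip: scaleR_2)
  ultimately have "(\<Sum>w\<in>?X. norm (\<Sum>m<M. \<sigma> m *\<^sub>R d m (P m w)) powr p) \<le> \<beta> * (\<Sum>w\<in>?X. norm (\<Sum>m<M. d m (fst w)) powr p)"
    using le by simp
  then show ?thesis
    by (simp add: P_def sum.cartesian_product[symmetric] sum_distrib_left mult_ac)
      (simp add: sum.cartesian_product' P_def sum_distrib_left mult_ac)
qed

lemma norm_powr2: "norm x powr 2 = (norm x)\<^sup>2"
  by simp

text \<open>Only the martingale difference of \<open>h\<close> at the coordinate \<open>a\<close> contributes to \<open>H a\<close>; Jensen's inequality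
  reduces the claim to these differences, whose signs are then removed by UMD.\<close>

lemma K_convexity:
  fixes h :: "('i \<Rightarrow> real) \<Rightarrow> 'x::real_normed_vector"
  assumes umd: "umd_fin TYPE('x) 2 \<beta>" and A: "finite A"
  defines "H \<equiv> \<lambda>a. (1 / 2 ^ card A) *\<^sub>R (\<Sum>\<epsilon>\<in>signs A. \<epsilon> a *\<^sub>R h \<epsilon>)"
  shows "rad A (\<lambda>\<epsilon>. (norm (\<Sum>a\<in>A. \<epsilon> a *\<^sub>R H a))\<^sup>2) \<le> 4 * \<beta> * rad A (\<lambda>\<epsilon>. (norm (h \<epsilon>))\<^sup>2)"
proof -
  define S where "S = signs A"
  have S: "finite S" "S \<noteq> {}" "card S = 2 ^ card A"
    using A by (auto simp: S_def card_signs signs_nonempty)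
  define M where "M = card A"
  obtain g where g: "bij_betw g {..<M} A"
    using ex_bij_betw_nat_finite[OF A] by (auto simp: M_def atLeast0LessThan)
  have gA: "g m \<in> A" if "m < M" for m using g that by (auto simp: bij_betw_def)
  have ginj: "g i = g j \<longleftrightarrow> i = j" if "i < M" "j < M" for i j
    using g that by (auto simp: bij_betw_def inj_on_def)
  \<comment> \<open>The filtration that reveals the signs one after another; unrevealed coordinates
    are set to 1.\<close>
  define C where "C m \<epsilon> = (\<lambda>j. if j < m then \<epsilon> (g j) else 1)" for m and \<epsilon> :: "'i \<Rightarrow> real"
  define D where "D m \<epsilon> = cavg S (C (Suc m)) h \<epsilon> - cavg S (C m) h \<epsilon>" for m \<epsilon>
  have Cj: "\<epsilon> (g j) = \<epsilon>' (g j)" if "C m \<epsilon> = C m \<epsilon>'" "j < m" for \<epsilon> \<epsilon>' m j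
    using fun_cong[OF that(1), of j] that(2) by (simp add: C_def)
  have refine: "C n \<epsilon> = C n \<epsilon>'" if "C (Suc n) \<epsilon> = C (Suc n) \<epsilon>'" for n \<epsilon> \<epsilon>'
    using Cj[OF that] by (auto simp: C_def fun_eq_iff)
  \<comment> \<open>The sign at \<open>g m\<close> is known at level \<open>m + 1\<close> and has
    mean zero given level \<open>m\<close>, so in its pairing with \<open>h\<close> only the
    difference \<open>D m\<close> counts.\<close>
  have corr: "(\<Sum>\<epsilon>\<in>S. \<epsilon> (g m) *\<^sub>R D m \<epsilon>) = (\<Sum>\<epsilon>\<in>S. \<epsilon> (g m) *\<^sub>R h \<epsilon>)" if m: "m < M" for m
  proof -
    have "(\<Sum>\<epsilon>\<in>S. \<epsilon> (g m) *\<^sub>R (h \<epsilon> - cavg S (C (Suc m)) h \<epsilon>)) = 0"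
    proof (rule sum_cells_zero[OF S(1), where c = "C (Suc m)" and prd = scaleR and a = "\<lambda>\<epsilon>. \<epsilon> (g m)"
          and b = "\<lambda>\<epsilon>. h \<epsilon> - cavg S (C (Suc m)) h \<epsilon>"])
      show "linear (scaleR x :: 'x \<Rightarrow> 'x)" for x by (rule linear_scaleR)
      show "\<epsilon> (g m) = \<epsilon>' (g m)" if "C (Suc m) \<epsilon> = C (Suc m) \<epsilon>'" for \<epsilon> \<epsilon>' by (rule Cj[OF that]) simp
      show "(\<Sum>w'\<in>{w' \<in> S. C (Suc m) w' = C (Suc m) w}. h w' - cavg S (C (Suc m)) h w') = 0" for w
        using sum_cavg_coarser[OF S(1), where c = "C (Suc m)" and c' = "C (Suc m)" and f = h] by (simp add: sum_subtractf)
    qed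
    moreover have "(\<Sum>\<epsilon>\<in>S. \<epsilon> (g m) *\<^sub>R cavg S (C m) h \<epsilon>) = 0"
    proof (rule sum_cells_zero[OF S(1), where c = "C m" and prd = "\<lambda>x r. r *\<^sub>R x"])
      show "linear (\<lambda>r. r *\<^sub>R x)" for x :: 'x by (rule linear_scaleR_left)
      show "cavg S (C m) h \<epsilon> = cavg S (C m) h \<epsilon>'" if "C m \<epsilon> = C m \<epsilon>'" for \<epsilon> \<epsilon>' by (rule cavg_cong[where c = "C m", OF that])
      show "(\<Sum>w'\<in>{w' \<in> S. C m w' = C m w}. w' (g m)) = 0" for w
      proof (rule sum_swap_antisymmetric[where s = "\<lambda>\<epsilon>. \<epsilon>(g m := - \<epsilon> (g m))"])
        fix \<epsilon> assume e: "\<epsilon> \<in> {w' \<in> S. C m w' = C m w}"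
        have "\<epsilon>(g m := - \<epsilon> (g m)) \<in> S"
          using e gA[OF m] signsD[of \<epsilon> A "g m"] by (auto simp: S_def signs_def PiE_dflt_def)
        moreover have "C m (\<epsilon>(g m := - \<epsilon> (g m))) = C m \<epsilon>"
          using ginj m by (auto simp: C_def fun_eq_iff)
        ultimately show "\<epsilon>(g m := - \<epsilon> (g m)) \<in> {w' \<in> S. C m w' = C m w}" using e by simp
      qed auto
    qed
    ultimately show ?thesis by (simp add: D_def scaleR_diff_right sum_subtractf)
  qed
  have HD: "H (g m) = (1 / card S) *\<^sub>R (\<Sum>\<epsilon>\<in>S. \<epsilon> (g m) *\<^sub>R D m \<epsilon>)" if "m < M" for m
    unfolding H_def corr[OF that] S_def[symmetric] S(3) by simp
  have jens: "(norm (\<Sum>a\<in>A. \<sigma> a *\<^sub>R H a))\<^sup>2 \<le> (\<Sum>\<epsilon>\<in>S. (norm (\<Sum>a\<in>A. (\<sigma> a * \<epsilon> a) *\<^sub>R D (the_inv_into {..<M} g a) \<epsilon>))\<^sup>2) / card S" for \<sigma>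
  proof -
    have "(\<Sum>a\<in>A. \<sigma> a *\<^sub>R H a) = (\<Sum>m<M. \<sigma> (g m) *\<^sub>R H (g m))"
      by (rule sum.reindex_bij_betw[OF g, symmetric])
    also have "\<dots> = (1 / card S) *\<^sub>R (\<Sum>\<epsilon>\<in>S. \<Sum>m<M. (\<sigma> (g m) * \<epsilon> (g m)) *\<^sub>R D m \<epsilon>)"
      by (subst sum.swap) (simp add: HD scaleR_sum_right mult.commute)
    also have "(\<Sum>\<epsilon>\<in>S. \<Sum>m<M. (\<sigma> (g m) * \<epsilon> (g m)) *\<^sub>R D m \<epsilon>)
        = (\<Sum>\<epsilon>\<in>S. \<Sum>a\<in>A. (\<sigma> a * \<epsilon> a) *\<^sub>R D (the_inv_into {..<M} g a) \<epsilon>)"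
      using g by (intro sum.cong refl, subst sum.reindex_bij_betw[OF g, symmetric])
        (auto simp: the_inv_into_f_f bij_betw_def)
    finally have "norm (\<Sum>a\<in>A. \<sigma> a *\<^sub>R H a)
        \<le> (\<Sum>\<epsilon>\<in>S. norm (\<Sum>a\<in>A. (\<sigma> a * \<epsilon> a) *\<^sub>R D (the_inv_into {..<M} g a) \<epsilon>)) / card S"
      by (simp add: divide_right_mono norm_sum)
    then have "norm (\<Sum>a\<in>A. \<sigma> a *\<^sub>R H a) powr 2
        \<le> ((\<Sum>\<epsilon>\<in>S. norm (\<Sum>a\<in>A. (\<sigma> a * \<epsilon> a) *\<^sub>R D (the_inv_into {..<M} g a) \<epsilon>)) / card S) powr 2"
      by (intro powr_mono2) auto
    also have "\<dots> \<le> (\<Sum>\<epsilon>\<in>S. norm (\<Sum>a\<in>A. (\<sigma> a * \<epsilon> a) *\<^sub>R D (the_inv_into {..<M} g a) \<epsilon>) powr 2) / card S"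
      using S by (intro power_sum_le) auto
    finally show ?thesis by (simp only: norm_powr2)
  qed
  have "rad A (\<lambda>\<sigma>. (norm (\<Sum>a\<in>A. \<sigma> a *\<^sub>R H a))\<^sup>2)
      \<le> rad A (\<lambda>\<sigma>. (\<Sum>\<epsilon>\<in>S. (norm (\<Sum>a\<in>A. (\<sigma> a * \<epsilon> a) *\<^sub>R D (the_inv_into {..<M} g a) \<epsilon>))\<^sup>2) / card S)"
    by (intro rad_mono jens)
  also have "\<dots> = (\<Sum>\<epsilon>\<in>S. rad A (\<lambda>\<sigma>. (norm (\<Sum>a\<in>A. (\<sigma> a * \<epsilon> a) *\<^sub>R D (the_inv_into {..<M} g a) \<epsilon>))\<^sup>2)) / card S"
    by (simp only: rad_cdiv rad_sum)
  \<comment> \<open>For fixed \<open>\<epsilon>\<close> the products of \<open>\<sigma>\<close> with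
    \<open>\<epsilon>\<close> are distributed like \<open>\<sigma>\<close>. Once
    \<open>\<epsilon>\<close> has left the coefficients, what remains for fixed
    \<open>\<sigma>\<close> is a martingale transform in the variable
    \<open>\<epsilon>\<close>.\<close>
  also have "\<dots> = (\<Sum>\<epsilon>\<in>S. rad A (\<lambda>\<sigma>. (norm (\<Sum>a\<in>A. \<sigma> a *\<^sub>R D (the_inv_into {..<M} g a) \<epsilon>))\<^sup>2)) / card S"
  proof -
    have "rad A (\<lambda>\<sigma>. (norm (\<Sum>a\<in>A. (\<sigma> a * \<epsilon> a) *\<^sub>R D (the_inv_into {..<M} g a) \<epsilon>))\<^sup>2)
        = rad A (\<lambda>\<sigma>. (norm (\<Sum>a\<in>A. \<sigma> a *\<^sub>R D (the_inv_into {..<M} g a) \<epsilon>))\<^sup>2)" if "\<epsilon> \<in> S" for \<epsilon>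
      by (rule rad_flip[OF A, where G = "\<lambda>v. (norm v)\<^sup>2"]) (rule signsD, use that S_def in simp)
    then show ?thesis by simp
  qed
  also have "\<dots> = rad A (\<lambda>\<sigma>. (\<Sum>\<epsilon>\<in>S. (norm (\<Sum>a\<in>A. \<sigma> a *\<^sub>R D (the_inv_into {..<M} g a) \<epsilon>))\<^sup>2) / card S)"
    by (simp only: rad_cdiv rad_sum)
  also have "\<dots> \<le> rad A (\<lambda>\<sigma>. 4 * \<beta> * rad A (\<lambda>\<epsilon>. (norm (h \<epsilon>))\<^sup>2))"
  proof (rule rad_mono)
    fix \<sigma> assume \<sigma>: "\<sigma> \<in> signs A"
    have "(\<Sum>\<epsilon>\<in>S. norm (\<Sum>m<M. \<sigma> (g m) *\<^sub>R D m \<epsilon>) powr 2) \<le> \<beta> * 2 powr 2 * (\<Sum>\<epsilon>\<in>S. norm (h \<epsilon>) powr 2)"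
      unfolding D_def by (rule umd_fin_cavg[OF umd _ S(1) refine signsD[OF \<sigma>]]) auto
    moreover have "(\<Sum>a\<in>A. \<sigma> a *\<^sub>R D (the_inv_into {..<M} g a) \<epsilon>) = (\<Sum>m<M. \<sigma> (g m) *\<^sub>R D m \<epsilon>)" for \<epsilon>
      using g by (subst sum.reindex_bij_betw[OF g, symmetric]) (auto simp: the_inv_into_f_f bij_betw_def)
    ultimately have "(\<Sum>\<epsilon>\<in>S. (norm (\<Sum>a\<in>A. \<sigma> a *\<^sub>R D (the_inv_into {..<M} g a) \<epsilon>))\<^sup>2) \<le> 4 * \<beta> * (\<Sum>\<epsilon>\<in>S. (norm (h \<epsilon>))\<^sup>2)"
      by simp
    then have "(\<Sum>\<epsilon>\<in>S. (norm (\<Sum>a\<in>A. \<sigma> a *\<^sub>R D (the_inv_into {..<M} g a) \<epsilon>))\<^sup>2) / card S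
        \<le> (4 * \<beta> * (\<Sum>\<epsilon>\<in>S. (norm (h \<epsilon>))\<^sup>2)) / card S"
      by (rule divide_right_mono) simp
    then show "(\<Sum>\<epsilon>\<in>S. (norm (\<Sum>a\<in>A. \<sigma> a *\<^sub>R D (the_inv_into {..<M} g a) \<epsilon>))\<^sup>2) / card S
        \<le> 4 * \<beta> * rad A (\<lambda>\<epsilon>. (norm (h \<epsilon>))\<^sup>2)"
      by (simp add: rad_def S_def card_signs[OF A])
  qed
  also have "\<dots> = 4 * \<beta> * rad A (\<lambda>\<epsilon>. (norm (h \<epsilon>))\<^sup>2)" by (rule rad_const[OF A])
  finally show ?thesis .
qed

section \<open>Property alpha and duality\<close>

text \<open>Property alpha leads to the equivalence of two second moments: with products of signs
  here, with doubly indexed signs in \<open>rad_full\<close>.\<close>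

definition rad_prod :: "nat \<Rightarrow> (nat \<Rightarrow> nat \<Rightarrow> 'x::real_normed_vector) \<Rightarrow> real" where
  "rad_prod N e = rad {1..N} (\<lambda>\<epsilon>. rad {1..N} (\<lambda>\<delta>. (norm (\<Sum>i=1..N. \<Sum>j=1..N. (\<epsilon> i * \<delta> j) *\<^sub>R e i j))\<^sup>2))"

definition rad_full :: "nat \<Rightarrow> (nat \<Rightarrow> nat \<Rightarrow> 'x::real_normed_vector) \<Rightarrow> real" where
  "rad_full N e = rad ({1..N} \<times> {1..N}) (\<lambda>\<epsilon>. (norm (\<Sum>i=1..N. \<Sum>j=1..N. \<epsilon> (i, j) *\<^sub>R e i j))\<^sup>2)"

text \<open>The two directions of the equivalence are kept apart because duality exchanges them:
  this one for the dual of \<open>Y3\<close> is derived from the opposite one for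
  \<open>Y3\<close>.\<close>

definition alpha_full_le :: "'x::real_normed_vector itself \<Rightarrow> real \<Rightarrow> bool" where
  "alpha_full_le _ K \<longleftrightarrow> 0 \<le> K \<and> (\<forall>N (e :: nat \<Rightarrow> nat \<Rightarrow> 'x). rad_full N e \<le> K * rad_prod N e)"

definition alpha_prod_le :: "'x::real_normed_vector itself \<Rightarrow> real \<Rightarrow> bool" where
  "alpha_prod_le _ K \<longleftrightarrow> 0 \<le> K \<and> (\<forall>N (e :: nat \<Rightarrow> nat \<Rightarrow> 'x). rad_prod N e \<le> K * rad_full N e)"

lemma property_alpha_signs:
  assumes "property_alpha TYPE('x::banach)"
  shows "\<exists>K\<ge>0. \<forall>N (a :: nat \<Rightarrow> nat \<Rightarrow> real) (e :: nat \<Rightarrow> nat \<Rightarrow> 'x).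
    (\<forall>i j. a i j \<in> {-1, 1}) \<longrightarrow> rad_prod N (\<lambda>i j. a i j *\<^sub>R e i j) \<le> K * rad_prod N e"
proof -
  obtain C :: real where C: "\<forall>(N::nat) (a :: nat \<Rightarrow> nat \<Rightarrow> real) (e :: nat \<Rightarrow> nat \<Rightarrow> 'x).
      sqrt (rad_prod N (\<lambda>i j. a i j *\<^sub>R e i j))
        \<le> C * (MAX (i, j)\<in>{1..N} \<times> {1..N}. \<bar>a i j\<bar>) * sqrt (rad_prod N e)"
    using assms unfolding property_alpha_def rad_prod_def
    by (simp add: expectation_random_signs) blast
  have nn: "0 \<le> rad_prod N e" for N and e :: "nat \<Rightarrow> nat \<Rightarrow> 'x"
    unfolding rad_prod_def by (intro rad_nonneg) auto
  show ?thesis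
  proof (intro exI[of _ "C\<^sup>2"] conjI allI impI)
    fix N and a :: "nat \<Rightarrow> nat \<Rightarrow> real" and e :: "nat \<Rightarrow> nat \<Rightarrow> 'x"
    assume a: "\<forall>i j. a i j \<in> {-1, 1}"
    show "rad_prod N (\<lambda>i j. a i j *\<^sub>R e i j) \<le> C\<^sup>2 * rad_prod N e"
    \<comment> \<open>For \<open>N = 0\<close> the maximum ranges over the empty set, so this case
      is treated separately.\<close>
    proof (cases "N = 0")
      case True
      then show ?thesis using nn[of N e] by (simp add: rad_prod_def rad_empty)
    next
      case False
      have "\<bar>a i j\<bar> = 1" for i j using a[rule_format, of i j] by auto
      moreover have "(1, 1) \<in> {1..N} \<times> {1..N}" using False by auto
      ultimately have "(\<lambda>(i, j). \<bar>a i j\<bar>) ` ({1..N} \<times> {1..N}) = {1}"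
        by (force simp: image_iff)
      then have M: "(MAX (i, j)\<in>{1..N} \<times> {1..N}. \<bar>a i j\<bar>) = 1" by simp
      have "sqrt (rad_prod N (\<lambda>i j. a i j *\<^sub>R e i j)) \<le> C * sqrt (rad_prod N e)"
        using C[rule_format, of N a e] unfolding M by simp
      also have "\<dots> \<le> \<bar>C\<bar> * sqrt (rad_prod N e)" by (intro mult_right_mono) (auto simp: nn)
      finally have "(sqrt (rad_prod N (\<lambda>i j. a i j *\<^sub>R e i j)))\<^sup>2 \<le> (\<bar>C\<bar> * sqrt (rad_prod N e))\<^sup>2"
        by (intro power_mono) (auto simp: nn)
      then show ?thesis by (simp add: power_mult_distrib nn)
    qed
  qed simp
qed

text \<open>For fixed \<open>\<epsilon>\<close> and \<open>\<delta>\<close>, multiplying random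
  coefficients by the products of signs leaves their distribution unchanged. Averaged over the
  coefficients, the expression thus no longer depends on \<open>\<epsilon>\<close> and
  \<open>\<delta>\<close>.\<close>

lemma rad_full_average:
  fixes e :: "nat \<Rightarrow> nat \<Rightarrow> 'x::real_normed_vector"
  shows "rad ({1..N} \<times> {1..N}) (\<lambda>a. rad_prod N (\<lambda>i j. a (i, j) *\<^sub>R e i j)) = rad_full N e"
proof -
  let ?I = "{1..N}"
  have "rad (?I \<times> ?I) (\<lambda>a. (norm (\<Sum>i=1..N. \<Sum>j=1..N. (\<epsilon> i * \<delta> j) *\<^sub>R a (i, j) *\<^sub>R e i j))\<^sup>2) = rad_full N e"
    if "\<epsilon> \<in> signs ?I" "\<delta> \<in> signs ?I" for \<epsilon> \<delta>
  proof -
    have "\<epsilon> i * \<delta> j \<in> {-1, 1}" for i j using signsD[OF that(1), of i] signsD[OF that(2), of j] by auto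
    then have "rad (?I \<times> ?I) (\<lambda>a. (norm (\<Sum>z\<in>?I \<times> ?I. (a z * (\<epsilon> (fst z) * \<delta> (snd z))) *\<^sub>R e (fst z) (snd z)))\<^sup>2)
        = rad (?I \<times> ?I) (\<lambda>a. (norm (\<Sum>z\<in>?I \<times> ?I. a z *\<^sub>R e (fst z) (snd z)))\<^sup>2)"
      by (intro rad_flip[where G = "\<lambda>v. (norm v)\<^sup>2"]) auto
    then show ?thesis
      by (simp add: rad_full_def sum.cartesian_product case_prod_beta mult_ac)
  qed
  then have "rad ?I (\<lambda>\<epsilon>. rad ?I (\<lambda>\<delta>. rad (?I \<times> ?I) (\<lambda>a. (norm (\<Sum>i=1..N. \<Sum>j=1..N. (\<epsilon> i * \<delta> j) *\<^sub>R a (i, j) *\<^sub>R e i j))\<^sup>2)))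
      = rad ?I (\<lambda>\<epsilon>. rad ?I (\<lambda>\<delta>. rad_full N e))"
    by (intro rad_cong) auto
  then have "rad ?I (\<lambda>\<epsilon>. rad (?I \<times> ?I) (\<lambda>a. rad ?I (\<lambda>\<delta>. (norm (\<Sum>i=1..N. \<Sum>j=1..N. (\<epsilon> i * \<delta> j) *\<^sub>R a (i, j) *\<^sub>R e i j))\<^sup>2)))
      = rad_full N e"
    by (subst (2) rad_swap) (simp add: rad_const)
  then show ?thesis
    unfolding rad_prod_def by (subst rad_swap)
qed

text \<open>The inequality for fixed coefficients of modulus 1 is averaged over random ones. For the
  reverse direction the same coefficients are applied twice, since their squares are 1.\<close>

lemma property_alpha_imp:
  assumes "property_alpha TYPE('x::banach)"
  shows "\<exists>K. alpha_full_le TYPE('x) K" "\<exists>K. alpha_prod_le TYPE('x) K"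
proof -
  obtain K where K: "K \<ge> 0" and le: "\<And>N (a :: nat \<Rightarrow> nat \<Rightarrow> real) (e :: nat \<Rightarrow> nat \<Rightarrow> 'x).
      (\<And>i j. a i j \<in> {-1, 1}) \<Longrightarrow> rad_prod N (\<lambda>i j. a i j *\<^sub>R e i j) \<le> K * rad_prod N e"
    using property_alpha_signs[OF assms] by auto
  have "rad_full N e \<le> K * rad_prod N e" for N and e :: "nat \<Rightarrow> nat \<Rightarrow> 'x"
  proof -
    have "rad_full N e = rad ({1..N} \<times> {1..N}) (\<lambda>a. rad_prod N (\<lambda>i j. a (i, j) *\<^sub>R e i j))"
      by (rule rad_full_average[symmetric])
    also have "\<dots> \<le> rad ({1..N} \<times> {1..N}) (\<lambda>a. K * rad_prod N e)"
      by (intro rad_mono le signsD)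
    finally show ?thesis by (simp add: rad_const)
  qed
  then show "\<exists>K. alpha_full_le TYPE('x) K" using K unfolding alpha_full_le_def by blast
  have "rad_prod N e \<le> K * rad_full N e" for N and e :: "nat \<Rightarrow> nat \<Rightarrow> 'x"
  proof -
    have "rad_prod N e = rad ({1..N} \<times> {1..N}) (\<lambda>a. rad_prod N e)" by (simp add: rad_const)
    also have "\<dots> \<le> rad ({1..N} \<times> {1..N}) (\<lambda>a. K * rad_prod N (\<lambda>i j. a (i, j) *\<^sub>R e i j))"
    proof (rule rad_mono)
      fix a assume a: "a \<in> signs ({1..N} \<times> {1..N})"
      have sq: "a z * a z = 1" for z using signsD[OF a, of z] by auto
      show "rad_prod N e \<le> K * rad_prod N (\<lambda>i j. a (i, j) *\<^sub>R e i j)"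
        using le[of "\<lambda>i j. a (i, j)" N "\<lambda>i j. a (i, j) *\<^sub>R e i j", OF signsD[OF a]] by (simp add: sq)
    qed
    also have "\<dots> = K * rad_full N e" unfolding rad_cmult rad_full_average ..
    finally show ?thesis .
  qed
  then show "\<exists>K. alpha_prod_le TYPE('x) K" using K unfolding alpha_prod_le_def by blast
qed

text \<open>Tested on functions \<open>h\<close> of the signs, the full sum sees only the Rademacher
  coefficients \<open>H\<close> of \<open>h\<close>. Their pairing with \<open>e\<close> equals a
  pairing of two product sums, so Cauchy-Schwarz leaves the product sum of \<open>H\<close>, which
  is bounded by its full sum and then by K-convexity. Of the constant 16, one factor 4 comes from
  K-convexity and one from the squared norming factor.\<close>

lemma alpha_full_le_dual:
  assumes umd: "umd_fin TYPE('y::real_normed_vector) 2 \<beta>" and al: "alpha_prod_le TYPE('y) K"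
  shows "alpha_full_le TYPE('y \<Rightarrow>\<^sub>L real) (16 * K * \<beta>)"
  unfolding alpha_full_le_def
proof (intro conjI allI)
  have \<beta>: "0 \<le> \<beta>" using umd by (simp add: umd_fin_def)
  have K: "0 \<le> K" using al by (simp add: alpha_prod_le_def)
  show "0 \<le> 16 * K * \<beta>" using \<beta> K by simp
  fix N :: nat and e :: "nat \<Rightarrow> nat \<Rightarrow> 'y \<Rightarrow>\<^sub>L real"
  let ?I = "{1..N}"
  define A where "A = ?I \<times> ?I"
  have A: "finite A" by (simp add: A_def)
  define R where "R = rad_prod N e"
  have R: "0 \<le> R" unfolding R_def rad_prod_def by (intro rad_nonneg) auto
  define T :: real where "T = 2 ^ card A"
  have T: "T > 0" by (simp add: T_def)
  define G where "G \<epsilon> = (\<Sum>i=1..N. \<Sum>j=1..N. \<epsilon> (i, j) *\<^sub>R e i j)" for \<epsilon>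
  have bd: "(\<Sum>\<epsilon>\<in>signs A. G \<epsilon> (h \<epsilon>)) \<le> sqrt (T * R * K * (4 * \<beta>)) * lpsum 2 (signs A) (\<lambda>\<epsilon>. norm (h \<epsilon>))" for h
  proof -
    define H where "H z = (1 / 2 ^ card A) *\<^sub>R (\<Sum>\<epsilon>\<in>signs A. \<epsilon> z *\<^sub>R h \<epsilon>)" for z
    define E2 where "E2 \<epsilon> \<delta> = (\<Sum>i=1..N. \<Sum>j=1..N. (\<epsilon> i * \<delta> j) *\<^sub>R e i j)" for \<epsilon> \<delta> :: "nat \<Rightarrow> real"
    define H2 where "H2 \<epsilon> \<delta> = (\<Sum>i=1..N. \<Sum>j=1..N. (\<epsilon> i * \<delta> j) *\<^sub>R H (i, j))" for \<epsilon> \<delta> :: "nat \<Rightarrow> real"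
    have "(\<Sum>\<epsilon>\<in>signs A. G \<epsilon> (h \<epsilon>)) = (\<Sum>\<epsilon>\<in>signs A. \<Sum>i=1..N. \<Sum>j=1..N. e i j (\<epsilon> (i, j) *\<^sub>R h \<epsilon>))"
      by (simp add: G_def blinfun.sum_left blinfun.scaleR_left blinfun.scaleR_right)
    also have "\<dots> = (\<Sum>i=1..N. \<Sum>\<epsilon>\<in>signs A. \<Sum>j=1..N. e i j (\<epsilon> (i, j) *\<^sub>R h \<epsilon>))" by (rule sum.swap)
    also have "\<dots> = (\<Sum>i=1..N. \<Sum>j=1..N. \<Sum>\<epsilon>\<in>signs A. e i j (\<epsilon> (i, j) *\<^sub>R h \<epsilon>))"
      by (intro sum.cong refl sum.swap)
    also have "\<dots> = T * (\<Sum>i=1..N. \<Sum>j=1..N. e i j (H (i, j)))"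
      using T by (simp add: H_def T_def[symmetric] blinfun.sum_right blinfun.scaleR_right sum_distrib_left)
    \<comment> \<open>Orthonormality of the products
      \<open>\<epsilon> i * \<delta> j\<close>.\<close>
    also have "(\<Sum>i=1..N. \<Sum>j=1..N. e i j (H (i, j))) = rad ?I (\<lambda>\<epsilon>. rad ?I (\<lambda>\<delta>. E2 \<epsilon> \<delta> (H2 \<epsilon> \<delta>)))"
    proof -
      have "rad ?I (\<lambda>\<epsilon>. rad ?I (\<lambda>\<delta>. E2 \<epsilon> \<delta> (H2 \<epsilon> \<delta>)))
        = rad ?I (\<lambda>\<epsilon>. rad ?I (\<lambda>\<delta>. \<Sum>i=1..N. \<Sum>j=1..N. \<Sum>i'=1..N. \<Sum>j'=1..N. e i j (H (i', j')) * (\<epsilon> i * \<epsilon> i') * (\<delta> j * \<delta> j')))"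
        unfolding E2_def H2_def blinfun.sum_left blinfun.scaleR_left
        by (simp add: blinfun.sum_right blinfun.scaleR_right sum_distrib_left mult_ac)
      also have "\<dots> = (\<Sum>i=1..N. \<Sum>j=1..N. \<Sum>i'=1..N. \<Sum>j'=1..N. e i j (H (i', j')) * (if i = i' then 1 else 0) * (if j = j' then 1 else 0))"
        unfolding rad_sum rad_cmult
      proof (intro sum.cong refl)
        fix i j i' j' assume ij: "i \<in> ?I" "j \<in> ?I" "i' \<in> ?I" "j' \<in> ?I"
        have "rad ?I (\<lambda>\<epsilon>. e i j (H (i', j')) * (\<epsilon> i * \<epsilon> i') * rad ?I (\<lambda>\<delta>. \<delta> j * \<delta> j'))
          = rad ?I (\<lambda>\<epsilon>. (e i j (H (i', j')) * rad ?I (\<lambda>\<delta>. \<delta> j * \<delta> j')) * (\<epsilon> i * \<epsilon> i'))"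
          by (simp only: mult_ac)
        also have "\<dots> = e i j (H (i', j')) * (if i = i' then 1 else 0) * (if j = j' then 1 else 0)"
          unfolding rad_cmult using rad_prod2[OF _ ij(2,4)] rad_prod2[OF _ ij(1,3)] by simp
        finally show "rad ?I (\<lambda>\<epsilon>. e i j (H (i', j')) * (\<epsilon> i * \<epsilon> i') * rad ?I (\<lambda>\<delta>. \<delta> j * \<delta> j'))
            = e i j (H (i', j')) * (if i = i' then 1 else 0) * (if j = j' then 1 else 0)" .
      qed
      also have "\<dots> = (\<Sum>i=1..N. \<Sum>j=1..N. e i j (H (i, j)))"
      proof (intro sum.cong refl)
        fix i j assume ij: "i \<in> ?I" "j \<in> ?I"
        have "(\<Sum>j'=1..N. e i j (H (i', j')) * (if i = i' then 1 else 0) * (if j = j' then 1 else 0))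
            = (if i = i' then e i j (H (i', j)) else 0)" for i'
          using ij by (simp add: if_distrib cong: if_cong)
        then show "(\<Sum>i'=1..N. \<Sum>j'=1..N. e i j (H (i', j')) * (if i = i' then 1 else 0) * (if j = j' then 1 else 0)) = e i j (H (i, j))"
          using ij by simp
      qed
      finally show ?thesis ..
    qed
    also have "rad ?I (\<lambda>\<epsilon>. rad ?I (\<lambda>\<delta>. E2 \<epsilon> \<delta> (H2 \<epsilon> \<delta>))) \<le> sqrt R * sqrt (rad_prod N (\<lambda>i j. H (i, j)))"
    proof -
      let ?S = "signs ?I \<times> signs ?I"
      let ?n = "(2 ^ card ?I * 2 ^ card ?I) :: real"
      have rr: "rad ?I (\<lambda>\<epsilon>. rad ?I (\<lambda>\<delta>. F \<epsilon> \<delta>)) = (\<Sum>z\<in>?S. F (fst z) (snd z)) / ?n" for F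
        by (simp add: rad_def sum_divide_distrib[symmetric] sum.cartesian_product case_prod_beta)
      have "rad ?I (\<lambda>\<epsilon>. rad ?I (\<lambda>\<delta>. E2 \<epsilon> \<delta> (H2 \<epsilon> \<delta>)))
          \<le> rad ?I (\<lambda>\<epsilon>. rad ?I (\<lambda>\<delta>. norm (E2 \<epsilon> \<delta>) * norm (H2 \<epsilon> \<delta>)))"
        by (intro rad_mono order_trans[OF _ norm_blinfun]) simp
      also have "\<dots> \<le> lpsum 2 ?S (\<lambda>z. norm (E2 (fst z) (snd z))) * lpsum 2 ?S (\<lambda>z. norm (H2 (fst z) (snd z))) / ?n"
        unfolding rr by (intro divide_right_mono Hoelder2) auto
      also have "\<dots> = sqrt R * sqrt (rad_prod N (\<lambda>i j. H (i, j)))"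
      proof -
        have n: "?n = sqrt ?n * sqrt ?n" by simp
        show ?thesis
          unfolding R_def rad_prod_def E2_def[symmetric] H2_def[symmetric] rr real_sqrt_divide
          by (subst n) (simp add: lpsum2 del: real_sqrt_mult_self)
      qed
      finally show ?thesis .
    qed
    finally have 1: "(\<Sum>\<epsilon>\<in>signs A. G \<epsilon> (h \<epsilon>)) \<le> T * (sqrt R * sqrt (rad_prod N (\<lambda>i j. H (i, j))))"
      using T by simp
    have "rad_prod N (\<lambda>i j. H (i, j)) \<le> K * rad_full N (\<lambda>i j. H (i, j))"
      using al by (simp add: alpha_prod_le_def)
    also have "rad_full N (\<lambda>i j. H (i, j)) = rad A (\<lambda>\<epsilon>. (norm (\<Sum>a\<in>A. \<epsilon> a *\<^sub>R H a))\<^sup>2)"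
      by (simp add: rad_full_def A_def sum.cartesian_product case_prod_beta)
    also have "K * \<dots> \<le> K * (4 * \<beta> * rad A (\<lambda>\<epsilon>. (norm (h \<epsilon>))\<^sup>2))"
      unfolding H_def by (intro mult_left_mono K_convexity[OF umd A] K)
    also have "rad A (\<lambda>\<epsilon>. (norm (h \<epsilon>))\<^sup>2) = (lpsum 2 (signs A) (\<lambda>\<epsilon>. norm (h \<epsilon>)))\<^sup>2 / T"
      by (simp add: rad_def T_def lpsum2 sum_nonneg)
    finally have "sqrt (rad_prod N (\<lambda>i j. H (i, j))) \<le> sqrt (K * (4 * \<beta> * ((lpsum 2 (signs A) (\<lambda>\<epsilon>. norm (h \<epsilon>)))\<^sup>2 / T)))"
      by simp
    then have "T * (sqrt R * sqrt (rad_prod N (\<lambda>i j. H (i, j))))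
        \<le> T * (sqrt R * sqrt (K * (4 * \<beta> * ((lpsum 2 (signs A) (\<lambda>\<epsilon>. norm (h \<epsilon>)))\<^sup>2 / T))))"
      using T R by (intro mult_left_mono) auto
    also have "\<dots> = sqrt (T * R * K * (4 * \<beta>)) * lpsum 2 (signs A) (\<lambda>\<epsilon>. norm (h \<epsilon>))"
    proof -
      have "T = sqrt T * sqrt T" using T by simp
      then show ?thesis using T by (simp add: real_sqrt_mult real_sqrt_divide field_simps)
    qed
    finally show ?thesis using 1 by linarith
  qed
  have "lpsum 2 (signs A) (\<lambda>\<epsilon>. norm (G \<epsilon>)) \<le> 2 * sqrt (T * R * K * (4 * \<beta>))"
    by (rule dual_norming[OF _ _ _ _ _ bd]) (use A T R K \<beta> in auto)
  then have "(lpsum 2 (signs A) (\<lambda>\<epsilon>. norm (G \<epsilon>)))\<^sup>2 \<le> (2 * sqrt (T * R * K * (4 * \<beta>)))\<^sup>2"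
    by (intro power_mono) auto
  also have "\<dots> = T * (16 * K * \<beta> * R)" using T R K \<beta> by (simp add: power_mult_distrib)
  also have "(lpsum 2 (signs A) (\<lambda>\<epsilon>. norm (G \<epsilon>)))\<^sup>2 = T * rad_full N e"
    using T by (simp add: lpsum2 sum_nonneg rad_full_def rad_def A_def G_def T_def)
  finally show "rad_full N e \<le> 16 * K * \<beta> * rad_prod N e" using T by (simp add: R_def)
qed

section \<open>Property alpha over arbitrary finite index sets\<close>

lemma ex_inj_interval:
  assumes "finite I" "card I \<le> N"
  shows "\<exists>f. inj_on f I \<and> f ` I \<subseteq> {1..N::nat}"
proof -
  have "card I \<le> card {1..N}" using assms by simp
  then show ?thesis using card_le_inj[OF assms(1), of "{1..N}"] by auto
qed

lemma alpha_full_leD: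
  fixes e :: "'i \<Rightarrow> 'j \<Rightarrow> 'x::real_normed_vector"
  assumes al: "alpha_full_le TYPE('x) K" and I: "finite I" and J: "finite J"
  shows "rad (I \<times> J) (\<lambda>\<epsilon>. (norm (\<Sum>z\<in>I \<times> J. \<epsilon> z *\<^sub>R e (fst z) (snd z)))\<^sup>2)
    \<le> K * rad I (\<lambda>\<epsilon>. rad J (\<lambda>\<delta>. (norm (\<Sum>i\<in>I. \<Sum>j\<in>J. (\<epsilon> i * \<delta> j) *\<^sub>R e i j))\<^sup>2))"
proof -
  define N where "N = max (card I) (card J)"
  obtain f where f: "inj_on f I" "f ` I \<subseteq> {1..N}" using ex_inj_interval[OF I, of N] by (auto simp: N_def)
  obtain g where g: "inj_on g J" "g ` J \<subseteq> {1..N}" using ex_inj_interval[OF J, of N] by (auto simp: N_def)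
  \<comment> \<open>Outside the images of the two injections the array is padded with zeros.\<close>
  define e' where "e' i' j' = (if i' \<in> f ` I \<and> j' \<in> g ` J then e (the_inv_into I f i') (the_inv_into J g j') else 0)" for i' j'
  have e': "e' (f i) (g j) = e i j" if "i \<in> I" "j \<in> J" for i j
    using that f g by (simp add: e'_def the_inv_into_f_f)
  have sums: "(\<Sum>i'=1..N. \<Sum>j'=1..N. c i' j' *\<^sub>R e' i' j') = (\<Sum>i\<in>I. \<Sum>j\<in>J. c (f i) (g j) *\<^sub>R e i j)" for c
  proof -
    have "(\<Sum>j'=1..N. c i' j' *\<^sub>R e' i' j') = (\<Sum>j\<in>J. c i' (g j) *\<^sub>R e' i' (g j))" for i'
    proof -
      have "(\<Sum>j'=1..N. c i' j' *\<^sub>R e' i' j') = (\<Sum>j'\<in>g ` J. c i' j' *\<^sub>R e' i' j')"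
        using g(2) by (intro sum.mono_neutral_right) (auto simp: e'_def)
      then show ?thesis by (simp add: sum.reindex[OF g(1)])
    qed
    then have "(\<Sum>i'=1..N. \<Sum>j'=1..N. c i' j' *\<^sub>R e' i' j') = (\<Sum>i'=1..N. \<Sum>j\<in>J. c i' (g j) *\<^sub>R e' i' (g j))" by simp
    also have "\<dots> = (\<Sum>i'\<in>f ` I. \<Sum>j\<in>J. c i' (g j) *\<^sub>R e' i' (g j))"
      using f(2) by (intro sum.mono_neutral_right) (auto simp: e'_def)
    also have "\<dots> = (\<Sum>i\<in>I. \<Sum>j\<in>J. c (f i) (g j) *\<^sub>R e i j)"
      by (simp add: sum.reindex[OF f(1)] e')
    finally show ?thesis .
  qed
  have "rad_full N e' = rad ({1..N} \<times> {1..N}) (\<lambda>\<epsilon>. (norm (\<Sum>z\<in>I \<times> J. \<epsilon> (map_prod f g z) *\<^sub>R e (fst z) (snd z)))\<^sup>2)"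
    unfolding rad_full_def sums by (simp add: sum.cartesian_product case_prod_beta map_prod_def)
  also have "\<dots> = rad (I \<times> J) (\<lambda>\<epsilon>. (norm (\<Sum>z\<in>I \<times> J. \<epsilon> z *\<^sub>R e (fst z) (snd z)))\<^sup>2)"
    by (rule rad_reindex[where G = "\<lambda>v. (norm v)\<^sup>2"]) (use f g in \<open>auto simp: map_prod_inj_on\<close>)
  finally have 1: "rad_full N e' = rad (I \<times> J) (\<lambda>\<epsilon>. (norm (\<Sum>z\<in>I \<times> J. \<epsilon> z *\<^sub>R e (fst z) (snd z)))\<^sup>2)" .
  have "rad_prod N e' = rad {1..N} (\<lambda>\<epsilon>. rad {1..N} (\<lambda>\<delta>. (norm (\<Sum>i\<in>I. \<Sum>j\<in>J. (\<epsilon> (f i) * \<delta> (g j)) *\<^sub>R e i j))\<^sup>2))"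
    unfolding rad_prod_def sums ..
  also have "\<dots> = rad {1..N} (\<lambda>\<epsilon>. rad J (\<lambda>\<delta>. (norm (\<Sum>i\<in>I. \<Sum>j\<in>J. (\<epsilon> (f i) * \<delta> j) *\<^sub>R e i j))\<^sup>2))"
    by (intro rad_cong rad_reindex_fun[where h = g, OF _ g(1) g(2), where F = "\<lambda>\<delta>. (norm (\<Sum>i\<in>I. \<Sum>j\<in>J. (_ i * \<delta> j) *\<^sub>R e i j))\<^sup>2"])
      (auto intro!: arg_cong[of _ _ "\<lambda>v. (norm v)\<^sup>2"] sum.cong)
  also have "\<dots> = rad I (\<lambda>\<epsilon>. rad J (\<lambda>\<delta>. (norm (\<Sum>i\<in>I. \<Sum>j\<in>J. (\<epsilon> i * \<delta> j) *\<^sub>R e i j))\<^sup>2))"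
    by (rule rad_reindex_fun[where h = f, OF _ f(1) f(2), where F = "\<lambda>\<epsilon>. rad J (\<lambda>\<delta>. (norm (\<Sum>i\<in>I. \<Sum>j\<in>J. (\<epsilon> i * \<delta> j) *\<^sub>R e i j))\<^sup>2)"])
      (auto intro!: rad_cong arg_cong[of _ _ "\<lambda>v. (norm v)\<^sup>2"] sum.cong)
  finally show ?thesis
    using al unfolding alpha_full_le_def 1[symmetric] by metis
qed

section \<open>Trilinear forms\<close>

definition rad_norm :: "'i set \<Rightarrow> ('i \<Rightarrow> 'x::real_normed_vector) \<Rightarrow> real" where
  "rad_norm I e = sqrt (rad I (\<lambda>\<epsilon>. (norm (\<Sum>z\<in>I. \<epsilon> z *\<^sub>R e z))\<^sup>2))"

lemma rad_norm_nonneg [simp]: "0 \<le> rad_norm I e"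
  by (simp add: rad_norm_def rad_nonneg)

lemma rad_norm_inj:
  fixes e :: "'i \<Rightarrow> 'x::real_normed_vector"
  assumes "finite A" "inj_on h I" "h ` I \<subseteq> A" "\<And>i. i \<in> I \<Longrightarrow> e' (h i) = e i" "\<And>a. a \<in> A \<Longrightarrow> a \<notin> h ` I \<Longrightarrow> e' a = 0"
  shows "rad_norm A e' = rad_norm I e"
proof -
  have "(\<Sum>z\<in>A. \<epsilon> z *\<^sub>R e' z) = (\<Sum>i\<in>I. \<epsilon> (h i) *\<^sub>R e i)" for \<epsilon>
  proof -
    have "(\<Sum>z\<in>A. \<epsilon> z *\<^sub>R e' z) = (\<Sum>z\<in>h ` I. \<epsilon> z *\<^sub>R e' z)"
      using assms by (intro sum.mono_neutral_right) auto
    then show ?thesis using assms(4) by (simp add: sum.reindex[OF assms(2)])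
  qed
  then show ?thesis
    using rad_reindex[OF assms(1-3), of "\<lambda>v. (norm v)\<^sup>2" e] by (simp add: rad_norm_def)
qed

text \<open>An R-hat-bound for trilinear forms on three normed spaces. The pairing with the third
  vector is part of the form, so that the three slots can be permuted.\<close>

definition rhat_bd :: "real \<Rightarrow> ('x::real_normed_vector \<Rightarrow> 'y::real_normed_vector \<Rightarrow> 'z::real_normed_vector \<Rightarrow> real) set \<Rightarrow> bool" where
  "rhat_bd R \<T> \<longleftrightarrow> 0 \<le> R \<and> (\<forall>(N::nat) T e1 e2 e3.
     (\<forall>t\<in>{1..N}. \<forall>u\<in>{1..N}. \<forall>v\<in>{1..N}. T t u v \<in> \<T>) \<longrightarrow>
     (\<Sum>t=1..N. \<Sum>u=1..N. \<Sum>v=1..N. \<bar>T t u v (e1 (t, u)) (e2 (u, v)) (e3 (t, v))\<bar>)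
       \<le> R * (rad_norm ({1..N} \<times> {1..N}) e1 * rad_norm ({1..N} \<times> {1..N}) e2 * rad_norm ({1..N} \<times> {1..N}) e3))"

lemma rad_norm_transpose:
  assumes "finite A" "finite B"
  shows "rad_norm (B \<times> A) (\<lambda>z. e (prod.swap z)) = rad_norm (A \<times> B) e"
  by (rule rad_norm_inj[where h = prod.swap]) (use assms in \<open>auto simp: image_iff\<close>)

text \<open>The pairs (t, u), (u, v), (t, v) are the edges of a triangle. Exchanging the first and
  third slot amounts to exchanging \<open>u\<close> and \<open>v\<close>, which transposes the array
  of the second slot; Rademacher norms do not change under transposition.\<close>

lemma rhat_bd_perm1:
  fixes \<T> :: "('a::real_normed_vector \<Rightarrow> 'b::real_normed_vector \<Rightarrow> 'c::real_normed_vector \<Rightarrow> real) set"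
  assumes "rhat_bd R \<T>"
  shows "rhat_bd R ((\<lambda>\<phi> z y x. \<phi> x y z) ` \<T>)"
  unfolding rhat_bd_def
proof (intro conjI allI impI)
  show "0 \<le> R" using assms by (simp add: rhat_bd_def)
  fix N :: nat and T :: "nat \<Rightarrow> nat \<Rightarrow> nat \<Rightarrow> 'c \<Rightarrow> 'b \<Rightarrow> 'a \<Rightarrow> real" and e1 e2 e3
  assume T: "\<forall>t\<in>{1..N}. \<forall>u\<in>{1..N}. \<forall>v\<in>{1..N}. T t u v \<in> (\<lambda>\<phi> z y x. \<phi> x y z) ` \<T>"
  let ?T = "\<lambda>t u v x y z. T t v u z y x"
  have "\<forall>t\<in>{1..N}. \<forall>u\<in>{1..N}. \<forall>v\<in>{1..N}. ?T t u v \<in> \<T>" using T by fastforce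
  then have "(\<Sum>t=1..N. \<Sum>u=1..N. \<Sum>v=1..N. \<bar>?T t u v (e3 (t, u)) (e2 (prod.swap (u, v))) (e1 (t, v))\<bar>)
      \<le> R * (rad_norm ({1..N} \<times> {1..N}) e3 * rad_norm ({1..N} \<times> {1..N}) (\<lambda>z. e2 (prod.swap z)) * rad_norm ({1..N} \<times> {1..N}) e1)"
    using assms[unfolded rhat_bd_def, THEN conjunct2, rule_format, of N ?T e3 "\<lambda>z. e2 (prod.swap z)" e1] by simp
  also have "(\<Sum>t=1..N. \<Sum>u=1..N. \<Sum>v=1..N. \<bar>?T t u v (e3 (t, u)) (e2 (prod.swap (u, v))) (e1 (t, v))\<bar>)
      = (\<Sum>t=1..N. \<Sum>v=1..N. \<Sum>u=1..N. \<bar>T t v u (e1 (t, v)) (e2 (v, u)) (e3 (t, u))\<bar>)"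
    unfolding prod.swap_def by (rule sum.cong[OF refl], subst sum.swap) simp
  finally show "(\<Sum>t=1..N. \<Sum>u=1..N. \<Sum>v=1..N. \<bar>T t u v (e1 (t, u)) (e2 (u, v)) (e3 (t, v))\<bar>)
       \<le> R * (rad_norm ({1..N} \<times> {1..N}) e1 * rad_norm ({1..N} \<times> {1..N}) e2 * rad_norm ({1..N} \<times> {1..N}) e3)"
    by (simp add: rad_norm_transpose mult_ac)
qed

text \<open>The same relabelling with \<open>t\<close> and \<open>u\<close> exchanged and the first
  array transposed.\<close>

lemma rhat_bd_perm2:
  fixes \<T> :: "('a::real_normed_vector \<Rightarrow> 'b::real_normed_vector \<Rightarrow> 'c::real_normed_vector \<Rightarrow> real) set"
  assumes "rhat_bd R \<T>"
  shows "rhat_bd R ((\<lambda>\<phi> x z y. \<phi> x y z) ` \<T>)"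
  unfolding rhat_bd_def
proof (intro conjI allI impI)
  show "0 \<le> R" using assms by (simp add: rhat_bd_def)
  fix N :: nat and T :: "nat \<Rightarrow> nat \<Rightarrow> nat \<Rightarrow> 'a \<Rightarrow> 'c \<Rightarrow> 'b \<Rightarrow> real" and e1 e2 e3
  assume T: "\<forall>t\<in>{1..N}. \<forall>u\<in>{1..N}. \<forall>v\<in>{1..N}. T t u v \<in> (\<lambda>\<phi> x z y. \<phi> x y z) ` \<T>"
  let ?T = "\<lambda>t u v x y z. T u t v x z y"
  have "\<forall>t\<in>{1..N}. \<forall>u\<in>{1..N}. \<forall>v\<in>{1..N}. ?T t u v \<in> \<T>" using T by fastforce
  then have "(\<Sum>t=1..N. \<Sum>u=1..N. \<Sum>v=1..N. \<bar>?T t u v (e1 (prod.swap (t, u))) (e3 (u, v)) (e2 (t, v))\<bar>)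
      \<le> R * (rad_norm ({1..N} \<times> {1..N}) (\<lambda>z. e1 (prod.swap z)) * rad_norm ({1..N} \<times> {1..N}) e3 * rad_norm ({1..N} \<times> {1..N}) e2)"
    using assms[unfolded rhat_bd_def, THEN conjunct2, rule_format, of N ?T "\<lambda>z. e1 (prod.swap z)" e3 e2] by simp
  also have "(\<Sum>t=1..N. \<Sum>u=1..N. \<Sum>v=1..N. \<bar>?T t u v (e1 (prod.swap (t, u))) (e3 (u, v)) (e2 (t, v))\<bar>)
      = (\<Sum>u=1..N. \<Sum>t=1..N. \<Sum>v=1..N. \<bar>T u t v (e1 (u, t)) (e2 (t, v)) (e3 (u, v))\<bar>)"
    unfolding prod.swap_def by (subst sum.swap) simp
  finally show "(\<Sum>t=1..N. \<Sum>u=1..N. \<Sum>v=1..N. \<bar>T t u v (e1 (t, u)) (e2 (u, v)) (e3 (t, v))\<bar>)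
       \<le> R * (rad_norm ({1..N} \<times> {1..N}) e1 * rad_norm ({1..N} \<times> {1..N}) e2 * rad_norm ({1..N} \<times> {1..N}) e3)"
    by (simp add: rad_norm_transpose mult_ac)
qed

text \<open>Index sets of different sizes are embedded into one interval. Missing entries become
  zero vectors, and missing forms are filled by an arbitrary member of the nonempty family.\<close>

lemma rhat_bd_index_sets:
  assumes R: "rhat_bd R \<T>" and ne: "\<T> \<noteq> {}" and fin: "finite T" "finite U" "finite V"
    and B: "\<And>t u v. t \<in> T \<Longrightarrow> u \<in> U \<Longrightarrow> v \<in> V \<Longrightarrow> B t u v \<in> \<T>"
  shows "(\<Sum>t\<in>T. \<Sum>u\<in>U. \<Sum>v\<in>V. \<bar>B t u v (e1 (t, u)) (e2 (u, v)) (e3 (t, v))\<bar>)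
    \<le> R * (rad_norm (T \<times> U) e1 * rad_norm (U \<times> V) e2 * rad_norm (T \<times> V) e3)"
proof -
  define N where "N = card T + card U + card V"
  obtain f where f: "inj_on f T" "f ` T \<subseteq> {1..N}" using ex_inj_interval[OF fin(1), of N] by (auto simp: N_def)
  obtain g where g: "inj_on g U" "g ` U \<subseteq> {1..N}" using ex_inj_interval[OF fin(2), of N] by (auto simp: N_def)
  obtain h where h: "inj_on h V" "h ` V \<subseteq> {1..N}" using ex_inj_interval[OF fin(3), of N] by (auto simp: N_def)
  obtain \<phi> where \<phi>: "\<phi> \<in> \<T>" using ne by blast
  let ?f = "the_inv_into T f" and ?g = "the_inv_into U g" and ?h = "the_inv_into V h"
  note inv = the_inv_into_f_f[OF f(1)] the_inv_into_f_f[OF g(1)] the_inv_into_f_f[OF h(1)]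
  define B' where "B' t u v = (if t \<in> f ` T \<and> u \<in> g ` U \<and> v \<in> h ` V then B (?f t) (?g u) (?h v) else \<phi>)" for t u v
  have B': "B' t u v \<in> \<T>" for t u v unfolding B'_def using B \<phi> inv by auto
  define e1' where "e1' z = (if z \<in> map_prod f g ` (T \<times> U) then e1 (map_prod ?f ?g z) else 0)" for z
  define e2' where "e2' z = (if z \<in> map_prod g h ` (U \<times> V) then e2 (map_prod ?g ?h z) else 0)" for z
  define e3' where "e3' z = (if z \<in> map_prod f h ` (T \<times> V) then e3 (map_prod ?f ?h z) else 0)" for z
  have v1: "e1' (f t, g u) = e1 (t, u)" if "t \<in> T" "u \<in> U" for t u
    using that inv by (auto simp: e1'_def image_iff)
  have v2: "e2' (g u, h v) = e2 (u, v)" if "u \<in> U" "v \<in> V" for u v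
    using that inv by (auto simp: e2'_def image_iff)
  have v3: "e3' (f t, h v) = e3 (t, v)" if "t \<in> T" "v \<in> V" for t v
    using that inv by (auto simp: e3'_def image_iff)
  have r1: "rad_norm ({1..N} \<times> {1..N}) e1' = rad_norm (T \<times> U) e1"
    by (rule rad_norm_inj[where h = "map_prod f g"]) (use f g v1 in \<open>auto simp: map_prod_inj_on e1'_def[of "(_, _)"]\<close>)
  have r2: "rad_norm ({1..N} \<times> {1..N}) e2' = rad_norm (U \<times> V) e2"
    by (rule rad_norm_inj[where h = "map_prod g h"]) (use g h v2 in \<open>auto simp: map_prod_inj_on e2'_def[of "(_, _)"]\<close>)
  have r3: "rad_norm ({1..N} \<times> {1..N}) e3' = rad_norm (T \<times> V) e3"
    by (rule rad_norm_inj[where h = "map_prod f h"]) (use f h v3 in \<open>auto simp: map_prod_inj_on e3'_def[of "(_, _)"]\<close>)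
  let ?F = "\<lambda>t u v. \<bar>B' t u v (e1' (t, u)) (e2' (u, v)) (e3' (t, v))\<bar>"
  have "(\<Sum>t\<in>T. \<Sum>u\<in>U. \<Sum>v\<in>V. \<bar>B t u v (e1 (t, u)) (e2 (u, v)) (e3 (t, v))\<bar>) = (\<Sum>t\<in>T. \<Sum>u\<in>U. \<Sum>v\<in>V. ?F (f t) (g u) (h v))"
    by (intro sum.cong refl) (simp add: v1 v2 v3 B'_def inv)
  also have "\<dots> = (\<Sum>t\<in>f ` T. \<Sum>u\<in>g ` U. \<Sum>v\<in>h ` V. ?F t u v)"
    by (simp add: sum.reindex[OF f(1)] sum.reindex[OF g(1)] sum.reindex[OF h(1)])
  also have "\<dots> \<le> (\<Sum>t\<in>f ` T. \<Sum>u\<in>g ` U. \<Sum>v=1..N. ?F t u v)"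
    using h by (intro sum_mono sum_mono2) auto
  also have "\<dots> \<le> (\<Sum>t\<in>f ` T. \<Sum>u=1..N. \<Sum>v=1..N. ?F t u v)"
    using g by (intro sum_mono sum_mono2) (auto intro: sum_nonneg)
  also have "\<dots> \<le> (\<Sum>t=1..N. \<Sum>u=1..N. \<Sum>v=1..N. ?F t u v)"
    using f by (intro sum_mono2) (auto intro!: sum_nonneg)
  also have "\<dots> \<le> R * (rad_norm ({1..N} \<times> {1..N}) e1' * rad_norm ({1..N} \<times> {1..N}) e2' * rad_norm ({1..N} \<times> {1..N}) e3')"
    using R B' unfolding rhat_bd_def by blast
  finally show ?thesis unfolding r1 r2 r3 .
qed

text \<open>The block diagonal matrix with blocks \<open>a m\<close>; both of its indices carry a
  level.\<close>

definition diagonal_lift :: "(nat \<Rightarrow> 'i \<times> 'i \<Rightarrow> 'v::zero) \<Rightarrow> (nat \<times> 'i) \<times> (nat \<times> 'i) \<Rightarrow> 'v" where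
  "diagonal_lift a z = (if fst (fst z) = fst (snd z) then a (fst (fst z)) (snd (fst z), snd (snd z)) else 0)"

lemma rad_norm_diagonal_lift:
  assumes "finite I"
  shows "rad_norm (({..<M} \<times> I) \<times> ({..<M} \<times> I)) (diagonal_lift a) = rad_norm ({..<M} \<times> (I \<times> I)) (\<lambda>z. a (fst z) (snd z))"
  by (rule rad_norm_inj[where h = "\<lambda>z. ((fst z, fst (snd z)), (fst z, snd (snd z)))"])
    (use assms in \<open>auto simp: diagonal_lift_def inj_on_def image_iff\<close>)

text \<open>Taking the level \<open>m\<close> into all three indices, with matrices that are diagonal in \<open>m\<close>, requires
  cancellation in all three slots; taking it into the middle index only leaves the third slot
  independent of \<open>m\<close>.\<close>

lemma rhat_bd_diagonal:
  assumes R: "rhat_bd R \<T>" and ne: "\<T> \<noteq> {}" and I: "finite I" and B: "\<And>m t u v. B m t u v \<in> \<T>"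
  shows "(\<Sum>m<M. \<Sum>t\<in>I. \<Sum>u\<in>I. \<Sum>v\<in>I. \<bar>B m t u v (a m (t, u)) (b m (u, v)) (d m (t, v))\<bar>)
    \<le> R * (rad_norm ({..<M::nat} \<times> (I \<times> I)) (\<lambda>z. a (fst z) (snd z)) *
        rad_norm ({..<M} \<times> (I \<times> I)) (\<lambda>z. b (fst z) (snd z)) * rad_norm ({..<M} \<times> (I \<times> I)) (\<lambda>z. d (fst z) (snd z)))"
proof -
  let ?T = "{..<M} \<times> I"
  note rl = rad_norm_diagonal_lift[OF I]
  let ?F = "\<lambda>t u v. \<bar>B (fst t) (snd t) (snd u) (snd v) (diagonal_lift a (t, u)) (diagonal_lift b (u, v)) (diagonal_lift d (t, v))\<bar>"
  have "(\<Sum>m<M. \<Sum>t\<in>I. \<Sum>u\<in>I. \<Sum>v\<in>I. \<bar>B m t u v (a m (t, u)) (b m (u, v)) (d m (t, v))\<bar>)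
    = (\<Sum>t\<in>?T. \<Sum>u\<in>{fst t} \<times> I. \<Sum>v\<in>{fst t} \<times> I. ?F t u v)"
    by (simp add: sum.cartesian_product' diagonal_lift_def)
  \<comment> \<open>Off-diagonal terms may be added, as all terms are nonnegative.\<close>
  also have "\<dots> \<le> (\<Sum>t\<in>?T. \<Sum>u\<in>{fst t} \<times> I. \<Sum>v\<in>?T. ?F t u v)"
    using I by (intro sum_mono sum_mono2) auto
  also have "\<dots> \<le> (\<Sum>t\<in>?T. \<Sum>u\<in>?T. \<Sum>v\<in>?T. ?F t u v)"
    using I by (intro sum_mono sum_mono2) (auto intro: sum_nonneg)
  also have "\<dots> \<le> R * (rad_norm (?T \<times> ?T) (diagonal_lift a) * rad_norm (?T \<times> ?T) (diagonal_lift b) * rad_norm (?T \<times> ?T) (diagonal_lift d))"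
    by (rule rhat_bd_index_sets[OF R ne]) (use I B in auto)
  finally show ?thesis unfolding rl .
qed

lemma rhat_bd_middle:
  assumes R: "rhat_bd R \<T>" and ne: "\<T> \<noteq> {}" and I: "finite I" and B: "\<And>m t u v. B m t u v \<in> \<T>"
  shows "(\<Sum>m<M. \<Sum>t\<in>I. \<Sum>u\<in>I. \<Sum>v\<in>I. \<bar>B m t u v (a m (t, u)) (b m (u, v)) (d (t, v))\<bar>)
    \<le> R * (rad_norm ({..<M::nat} \<times> (I \<times> I)) (\<lambda>z. a (fst z) (snd z)) *
        rad_norm ({..<M} \<times> (I \<times> I)) (\<lambda>z. b (fst z) (snd z)) * rad_norm (I \<times> I) d)"
proof -
  let ?U = "{..<M} \<times> I"
  \<comment> \<open>The level joins the index \<open>u\<close>, the one shared by the first two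
    slots and absent from the third.\<close>
  define a' where "a' z = a (fst (snd z)) (fst z, snd (snd z))" for z
  define b' where "b' z = b (fst (fst z)) (snd (fst z), snd z)" for z
  have ra: "rad_norm (I \<times> ?U) a' = rad_norm ({..<M} \<times> (I \<times> I)) (\<lambda>z. a (fst z) (snd z))"
    by (rule rad_norm_inj[where h = "\<lambda>z. (fst (snd z), (fst z, snd (snd z)))"])
      (use I in \<open>auto simp: a'_def inj_on_def image_iff\<close>)
  have rb: "rad_norm (?U \<times> I) b' = rad_norm ({..<M} \<times> (I \<times> I)) (\<lambda>z. b (fst z) (snd z))"
    by (rule rad_norm_inj[where h = "\<lambda>z. ((fst z, fst (snd z)), snd (snd z))"])
      (use I in \<open>auto simp: b'_def inj_on_def image_iff\<close>)
  have "(\<Sum>m<M. \<Sum>t\<in>I. \<Sum>u\<in>I. \<Sum>v\<in>I. \<bar>B m t u v (a m (t, u)) (b m (u, v)) (d (t, v))\<bar>)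
    = (\<Sum>t\<in>I. \<Sum>u\<in>?U. \<Sum>v\<in>I. \<bar>B (fst u) t (snd u) v (a' (t, u)) (b' (u, v)) (d (t, v))\<bar>)"
    by (subst sum.swap) (simp add: sum.cartesian_product' a'_def b'_def)
  also have "\<dots> \<le> R * (rad_norm (I \<times> ?U) a' * rad_norm (?U \<times> I) b' * rad_norm (I \<times> I) d)"
    by (rule rhat_bd_index_sets[OF R ne]) (use I B in auto)
  finally show ?thesis unfolding ra rb .
qed

text \<open>The lower Khinchine-Kahane inequality is applied twice: in \<open>\<delta>\<close> with
  the norm, then in \<open>\<epsilon>\<close> with the seminorm that assigns to a function of
  \<open>\<delta>\<close> its mean norm.\<close>

lemma double_Kahane:
  fixes e :: "'i \<Rightarrow> 'j \<Rightarrow> 'x::real_normed_vector"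
  assumes I: "finite I" and J: "finite J"
  shows "rad I (\<lambda>\<epsilon>. rad J (\<lambda>\<delta>. (norm (\<Sum>i\<in>I. \<Sum>j\<in>J. (\<epsilon> i * \<delta> j) *\<^sub>R e i j))\<^sup>2))
    \<le> 2048\<^sup>2 * (rad I (\<lambda>\<epsilon>. rad J (\<lambda>\<delta>. norm (\<Sum>i\<in>I. \<Sum>j\<in>J. (\<epsilon> i * \<delta> j) *\<^sub>R e i j))))\<^sup>2"
proof -
  define q where "q F = rad J (\<lambda>\<delta>. norm (F \<delta>))" for F :: "('j \<Rightarrow> real) \<Rightarrow> 'x"
  have q: "is_seminorm q"
    unfolding is_seminorm_def q_def
    by (auto simp: scaleR_fun_def plus_fun_def rad_cmult rad_add[symmetric] norm_triangle_ineq intro!: rad_mono)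
  define v where "v i = (\<lambda>\<delta>. \<Sum>j\<in>J. \<delta> j *\<^sub>R e i j)" for i
  have v: "(\<Sum>i\<in>I. \<epsilon> i *\<^sub>R v i) \<delta> = (\<Sum>i\<in>I. \<Sum>j\<in>J. (\<epsilon> i * \<delta> j) *\<^sub>R e i j)" for \<epsilon> \<delta>
    by (induction I rule: infinite_finite_induct) (auto simp: v_def scaleR_fun_def scaleR_sum_right)
  have "rad J (\<lambda>\<delta>. (norm (\<Sum>i\<in>I. \<Sum>j\<in>J. (\<epsilon> i * \<delta> j) *\<^sub>R e i j))\<^sup>2) \<le> 2048 * (q (\<Sum>i\<in>I. \<epsilon> i *\<^sub>R v i))\<^sup>2" for \<epsilon>
  proof -
    have eq: "(\<Sum>i\<in>I. \<Sum>j\<in>J. (\<epsilon> i * \<delta> j) *\<^sub>R e i j) = (\<Sum>j\<in>J. \<delta> j *\<^sub>R (\<Sum>i\<in>I. \<epsilon> i *\<^sub>R e i j))" for \<delta>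
      by (subst sum.swap) (simp add: scaleR_sum_right mult.commute)
    show ?thesis
      unfolding q_def v unfolding eq by (rule Khinchine_Kahane_lower[OF is_seminorm_norm J])
  qed
  then have "rad I (\<lambda>\<epsilon>. rad J (\<lambda>\<delta>. (norm (\<Sum>i\<in>I. \<Sum>j\<in>J. (\<epsilon> i * \<delta> j) *\<^sub>R e i j))\<^sup>2))
      \<le> rad I (\<lambda>\<epsilon>. 2048 * (q (\<Sum>i\<in>I. \<epsilon> i *\<^sub>R v i))\<^sup>2)" by (rule rad_mono)
  also have "\<dots> \<le> 2048 * (2048 * (rad I (\<lambda>\<epsilon>. q (\<Sum>i\<in>I. \<epsilon> i *\<^sub>R v i)))\<^sup>2)"
    unfolding rad_cmult by (intro mult_left_mono Khinchine_Kahane_lower[OF q I]) auto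
  finally show ?thesis unfolding q_def v by simp
qed

text \<open>Property alpha passes to product signs, Kahane goes down from second to first moments,
  and Jensen up to \<open>p\<close>-th moments, which are what is summed over points and selections
  afterwards.\<close>

lemma rad_norm_powr_le_rad_prod:
  fixes e :: "'i \<Rightarrow> 'j \<Rightarrow> 'x::real_normed_vector"
  assumes al: "alpha_full_le TYPE('x) K" and I: "finite I" and J: "finite J" and p: "1 < p"
  shows "rad_norm (I \<times> J) (\<lambda>z. e (fst z) (snd z)) powr p
    \<le> K powr (p / 2) * 2048 powr p * rad I (\<lambda>\<epsilon>. rad J (\<lambda>\<delta>. norm (\<Sum>i\<in>I. \<Sum>j\<in>J. (\<epsilon> i * \<delta> j) *\<^sub>R e i j) powr p))"
proof -
  define S where "S \<epsilon> \<delta> = norm (\<Sum>i\<in>I. \<Sum>j\<in>J. (\<epsilon> i * \<delta> j) *\<^sub>R e i j)" for \<epsilon> \<delta>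
  have K: "0 \<le> K" using al by (simp add: alpha_full_le_def)
  define W where "W = rad I (\<lambda>\<epsilon>. rad J (\<lambda>\<delta>. S \<epsilon> \<delta>))"
  have W: "0 \<le> W" unfolding W_def S_def by (intro rad_nonneg) auto
  have "(rad_norm (I \<times> J) (\<lambda>z. e (fst z) (snd z)))\<^sup>2 = rad (I \<times> J) (\<lambda>\<epsilon>. (norm (\<Sum>z\<in>I \<times> J. \<epsilon> z *\<^sub>R e (fst z) (snd z)))\<^sup>2)"
    by (simp add: rad_norm_def rad_nonneg)
  also have "\<dots> \<le> K * rad I (\<lambda>\<epsilon>. rad J (\<lambda>\<delta>. (S \<epsilon> \<delta>)\<^sup>2))"
    unfolding S_def by (rule alpha_full_leD[OF al I J])
  also have "\<dots> \<le> K * (2048\<^sup>2 * W\<^sup>2)"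
    unfolding S_def W_def by (intro mult_left_mono double_Kahane I J K)
  finally have "((rad_norm (I \<times> J) (\<lambda>z. e (fst z) (snd z)))\<^sup>2) powr (p / 2) \<le> (K * (2048\<^sup>2 * W\<^sup>2)) powr (p / 2)"
    using p by (intro powr_mono2) auto
  moreover have sq: "(x\<^sup>2) powr (p / 2) = x powr p" if "0 \<le> x" for x :: real
    using that powr_powr[of x 2 "p / 2"] by simp
  ultimately have "rad_norm (I \<times> J) (\<lambda>z. e (fst z) (snd z)) powr p \<le> K powr (p / 2) * (2048 powr p * W powr p)"
    using K W by (simp add: powr_mult sq)
  also have "W powr p \<le> rad I (\<lambda>\<epsilon>. rad J (\<lambda>\<delta>. S \<epsilon> \<delta> powr p))"
  proof -
    have "W powr p \<le> rad I (\<lambda>\<epsilon>. rad J (\<lambda>\<delta>. S \<epsilon> \<delta>) powr p)"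
      unfolding W_def S_def by (intro rad_powr_le I p rad_nonneg) auto
    also have "\<dots> \<le> rad I (\<lambda>\<epsilon>. rad J (\<lambda>\<delta>. S \<epsilon> \<delta> powr p))"
      unfolding S_def by (intro rad_mono rad_powr_le J p) auto
    finally show ?thesis .
  qed
  finally show ?thesis by (simp add: S_def mult.assoc mult_left_mono)
qed

lemma rad_norm_powr_le:
  fixes e :: "'i \<Rightarrow> 'x::real_normed_vector"
  assumes I: "finite I" and p: "1 < p"
  shows "rad_norm I e powr p \<le> 2048 powr (p / 2) * rad I (\<lambda>\<epsilon>. norm (\<Sum>i\<in>I. \<epsilon> i *\<^sub>R e i) powr p)"
proof -
  define W where "W = rad I (\<lambda>\<epsilon>. norm (\<Sum>i\<in>I. \<epsilon> i *\<^sub>R e i))"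
  have W: "0 \<le> W" unfolding W_def by (intro rad_nonneg) auto
  have sq: "(x\<^sup>2) powr (p / 2) = x powr p" if "0 \<le> x" for x :: real
    using that powr_powr[of x 2 "p / 2"] by simp
  have "(rad_norm I e)\<^sup>2 \<le> 2048 * W\<^sup>2"
    unfolding rad_norm_def W_def using Khinchine_Kahane_lower[OF is_seminorm_norm I, of e] by (simp add: rad_nonneg)
  then have "((rad_norm I e)\<^sup>2) powr (p / 2) \<le> (2048 * W\<^sup>2) powr (p / 2)"
    using p by (intro powr_mono2) auto
  then have "rad_norm I e powr p \<le> 2048 powr (p / 2) * W powr p"
    using W by (simp add: powr_mult sq)
  also have "W powr p \<le> rad I (\<lambda>\<epsilon>. norm (\<Sum>i\<in>I. \<epsilon> i *\<^sub>R e i) powr p)"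
    unfolding W_def by (intro rad_powr_le I p) auto
  finally show ?thesis by (simp add: mult_left_mono)
qed

section \<open>The trilinear estimate for a finite filtration\<close>

text \<open>Changing the point selected in one cell is a bijection between selections, so every
  point of the cell is selected equally often.\<close>

lemma sum_selections:
  fixes F :: "'a \<Rightarrow> real"
  assumes fin: "finite \<Omega>" and m: "m < M" and x: "x \<in> \<Omega>"
  shows "(\<Sum>y\<in>selections \<Omega> M C. F (y (m, C m x))) / card (selections \<Omega> M C)
    = (\<Sum>z\<in>{z\<in>\<Omega>. C m z = C m x}. F z) / card {z\<in>\<Omega>. C m z = C m x}"
proof -
  let ?Y = "selections \<Omega> M C" and ?S = "{z\<in>\<Omega>. C m z = C m x}" and ?k = "(m, C m x)"
  have fY: "finite ?Y" by (rule finite_selections[OF fin])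
  have fS: "finite ?S" using fin by simp
  have yS: "y ?k \<in> ?S" if "y \<in> ?Y" for y using selectionsD[OF that m x] by simp
  define w where "w = card {y\<in>?Y. y ?k = x}"
  have cw: "card {y\<in>?Y. y ?k = z} = w" if z: "z \<in> ?S" for z
    unfolding w_def
  proof (rule bij_betw_same_card[where f = "\<lambda>y. y(?k := x)"], rule bij_betw_byWitness[where f' = "\<lambda>y. y(?k := z)"])
    show "(\<lambda>y. y(?k := x)) ` {y\<in>?Y. y ?k = z} \<subseteq> {y\<in>?Y. y ?k = x}"
      using selections_upd[OF _ m x x] by auto
    show "(\<lambda>y. y(?k := z)) ` {y\<in>?Y. y ?k = x} \<subseteq> {y\<in>?Y. y ?k = z}"
      using selections_upd[OF _ m x, where z = z] z by auto
  qed auto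
  have grp: "(\<Sum>y\<in>?Y. F' (y ?k)) = w * (\<Sum>z\<in>?S. F' z)" for F' :: "'a \<Rightarrow> real"
  proof -
    have "(\<Sum>y\<in>?Y. F' (y ?k)) = (\<Sum>z\<in>?S. \<Sum>y\<in>{y\<in>?Y. y ?k = z}. F' (y ?k))"
      by (rule sum.group[OF fY fS, symmetric]) (use yS in auto)
    also have "\<dots> = (\<Sum>z\<in>?S. w * F' z)" by (intro sum.cong refl) (simp add: cw)
    finally show ?thesis by (simp add: sum_distrib_left)
  qed
  from grp[of "\<lambda>_. 1"] have cY: "real (card ?Y) = w * card ?S" by simp
  have "card ?Y \<noteq> 0" using fY selections_nonempty by auto
  then have "w \<noteq> 0" using cY by (intro notI) simp
  then show ?thesis unfolding grp cY by simp
qed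

text \<open>Each factor depends on its own selection only. In Hoelder's inequality over points and
  triples of selections the other two selections merely contribute the factor
  \<open>card Y ^ 2\<close>.\<close>

lemma Hoelder_selections:
  fixes a b d :: "'s \<Rightarrow> 'y \<Rightarrow> real" and A B D :: real
  assumes p: "1 < p" "1 < q" "1 < r" "1/p + 1/q + 1/r = 1" and Y: "finite Y" "Y \<noteq> {}"
    and nn: "\<And>x y. 0 \<le> a x y" "\<And>x y. 0 \<le> b x y" "\<And>x y. 0 \<le> d x y"
    and bd: "(\<Sum>x\<in>S. \<Sum>y\<in>Y. a x y powr p) \<le> card Y * A" "(\<Sum>x\<in>S. \<Sum>y\<in>Y. b x y powr q) \<le> card Y * B"
      "(\<Sum>x\<in>S. \<Sum>y\<in>Y. d x y powr r) \<le> card Y * D"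
  shows "(\<Sum>x\<in>S. \<Sum>y1\<in>Y. \<Sum>y2\<in>Y. \<Sum>y3\<in>Y. a x y1 * b x y2 * d x y3)
    \<le> card Y ^ 3 * (A powr (1/p) * B powr (1/q) * D powr (1/r))"
proof -
  let ?Z = "S \<times> (Y \<times> (Y \<times> Y))"
  define n where "n = real (card Y)"
  have n: "n > 0" using Y by (simp add: n_def card_gt_0_iff)
  have ABD: "0 \<le> A" "0 \<le> B" "0 \<le> D"
  proof -
    have pos: "0 \<le> X" if "0 \<le> T" "T \<le> n * X" for T X :: real
      using that n by (meson order_trans zero_le_mult_iff not_less less_le_not_le)
    show "0 \<le> A" by (rule pos[OF _ bd(1)[folded n_def]]) (auto intro!: sum_nonneg)
    show "0 \<le> B" by (rule pos[OF _ bd(2)[folded n_def]]) (auto intro!: sum_nonneg)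
    show "0 \<le> D" by (rule pos[OF _ bd(3)[folded n_def]]) (auto intro!: sum_nonneg)
  qed
  have s1: "(\<Sum>z\<in>?Z. a (fst z) (fst (snd z)) powr p) \<le> n ^ 3 * A"
  proof -
    have "(\<Sum>z\<in>?Z. a (fst z) (fst (snd z)) powr p) = n ^ 2 * (\<Sum>x\<in>S. \<Sum>y\<in>Y. a x y powr p)"
      by (simp add: sum.cartesian_product' n_def sum_distrib_left power2_eq_square card_cartesian_product mult.assoc)
    also have "\<dots> \<le> n ^ 2 * (n * A)" using bd(1) by (intro mult_left_mono) (auto simp: n_def)
    finally show ?thesis by (simp add: power2_eq_square power3_eq_cube mult_ac)
  qed
  have s2: "(\<Sum>z\<in>?Z. b (fst z) (fst (snd (snd z))) powr q) \<le> n ^ 3 * B"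
  proof -
    have "(\<Sum>z\<in>?Z. b (fst z) (fst (snd (snd z))) powr q) = n ^ 2 * (\<Sum>x\<in>S. \<Sum>y\<in>Y. b x y powr q)"
      by (simp add: sum.cartesian_product' n_def sum_distrib_left power2_eq_square card_cartesian_product mult.assoc)
    also have "\<dots> \<le> n ^ 2 * (n * B)" using bd(2) by (intro mult_left_mono) (auto simp: n_def)
    finally show ?thesis by (simp add: power2_eq_square power3_eq_cube mult_ac)
  qed
  have s3: "(\<Sum>z\<in>?Z. d (fst z) (snd (snd (snd z))) powr r) \<le> n ^ 3 * D"
  proof -
    have "(\<Sum>z\<in>?Z. d (fst z) (snd (snd (snd z))) powr r) = n ^ 2 * (\<Sum>x\<in>S. \<Sum>y\<in>Y. d x y powr r)"
      by (simp add: sum.cartesian_product' n_def sum_distrib_left power2_eq_square card_cartesian_product mult.assoc)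
    also have "\<dots> \<le> n ^ 2 * (n * D)" using bd(3) by (intro mult_left_mono) (auto simp: n_def)
    finally show ?thesis by (simp add: power2_eq_square power3_eq_cube mult_ac)
  qed
  have "(\<Sum>x\<in>S. \<Sum>y1\<in>Y. \<Sum>y2\<in>Y. \<Sum>y3\<in>Y. a x y1 * b x y2 * d x y3)
      = (\<Sum>z\<in>?Z. a (fst z) (fst (snd z)) * b (fst z) (fst (snd (snd z))) * d (fst z) (snd (snd (snd z))))"
    by (simp add: sum.cartesian_product')
  also have "\<dots> \<le> (\<Sum>z\<in>?Z. a (fst z) (fst (snd z)) powr p) powr (1/p) *
      (\<Sum>z\<in>?Z. b (fst z) (fst (snd (snd z))) powr q) powr (1/q) *
      (\<Sum>z\<in>?Z. d (fst z) (snd (snd (snd z))) powr r) powr (1/r)"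
    using nn by (intro Hoelder3 p) auto
  also have "\<dots> \<le> (n ^ 3 * A) powr (1/p) * (n ^ 3 * B) powr (1/q) * (n ^ 3 * D) powr (1/r)"
    using p s1 s2 s3 by (intro mult_mono powr_mono2) (auto intro!: sum_nonneg)
  also have "\<dots> = (n ^ 3) powr (1/p + 1/q + 1/r) * (A powr (1/p) * B powr (1/q) * D powr (1/r))"
    using n ABD by (simp add: powr_mult powr_add mult_ac)
  also have "(n ^ 3) powr (1/p + 1/q + 1/r) = n ^ 3" unfolding p(4) using n by simp
  finally show ?thesis by (simp add: n_def)
qed

section \<open>Blocks of martingale differences along a finite filtration\<close>

locale levels =
  fixes \<Omega> :: "'a set" and c :: "nat \<Rightarrow> 'a \<Rightarrow> 'b" and L :: nat
  assumes fin: "finite \<Omega>"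
    and refine: "n < L \<Longrightarrow> x \<in> \<Omega> \<Longrightarrow> x' \<in> \<Omega> \<Longrightarrow> c (Suc n) x = c (Suc n) x' \<Longrightarrow> c n x = c n x'"
begin

abbreviation E :: "nat \<Rightarrow> ('a \<Rightarrow> 'x::real_vector) \<Rightarrow> 'a \<Rightarrow> 'x" where
  "E n f \<equiv> cavg \<Omega> (c n) f"

abbreviation cell :: "nat \<Rightarrow> 'a \<Rightarrow> 'a set" where
  "cell n x \<equiv> {z\<in>\<Omega>. c n z = c n x}"

lemma refine_le:
  assumes "m \<le> n" "n \<le> L" "x \<in> \<Omega>" "x' \<in> \<Omega>" "c n x = c n x'"
  shows "c m x = c m x'"
  using assms(1,2,5)
proof (induction n rule: dec_induct)
  case (step n)
  then show ?case using refine[OF _ assms(3,4), of n] by simp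
qed

lemma E_telescope:
  fixes f :: "'a \<Rightarrow> 'x::real_vector"
  assumes "a \<le> b"
  shows "E b f x - E a f x = (\<Sum>n\<in>{a..<b}. E (Suc n) f x - E n f x)"
  using sum_Suc_diff'[OF assms, of "\<lambda>n. E n f x"] by simp

text \<open>The blocks are disjoint intervals of levels. With signs 1 inside their union and -1
  outside, half the plain sum of all differences plus half the signed sum is the sum over the
  blocks, and UMD applies to both halves.\<close>

lemma block_differences_bound:
  fixes f :: "'a \<Rightarrow> 'x::real_normed_vector"
  assumes umd: "umd_fin TYPE('x) p \<beta>" and p: "1 < p"
    and blk: "\<And>m. m < M \<Longrightarrow> G m \<le> a m \<and> a m \<le> b m \<and> b m \<le> G (Suc m) \<and> G (Suc m) \<le> L"
  shows "(\<Sum>x\<in>\<Omega>. norm (\<Sum>m<M. E (b m) f x - E (a m) f x) powr p) \<le> \<beta> * 2 powr p * (\<Sum>x\<in>\<Omega>. norm (f x) powr p)"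
proof -
  define W where "W = (\<Union>m<M. {a m..<b m})"
  define \<sigma> where "\<sigma> n = (if n \<in> W then 1 else -1 :: real)" for n
  define D where "D n x = E (Suc n) f x - E n f x" for n x
  have G: "G i \<le> G j" if "i \<le> j" "j \<le> M" for i j
    using that
  proof (induction j rule: dec_induct)
    case (step j)
    then show ?case using blk[of j] by simp
  qed simp
  have ba: "b i \<le> a j" if "i < j" "j < M" for i j
    using blk[of i] blk[of j] G[of "Suc i" j] that by linarith
  have disj: "{a i..<b i} \<inter> {a j..<b j} = {}" if "i < M" "j < M" "i \<noteq> j" for i j
    using ba[of i j] ba[of j i] that by (cases "i < j") (auto simp: disjoint_iff)
  have WL: "W \<subseteq> {..<L}" unfolding W_def using blk by fastforce
  have half: "(\<Sum>m<M. E (b m) f x - E (a m) f x)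
      = (1/2) *\<^sub>R (\<Sum>n<L. 1 *\<^sub>R D n x) + (1/2) *\<^sub>R (\<Sum>n<L. \<sigma> n *\<^sub>R D n x)" for x
  proof -
    have "(\<Sum>m<M. E (b m) f x - E (a m) f x) = (\<Sum>m<M. \<Sum>n\<in>{a m..<b m}. D n x)"
      unfolding D_def using blk by (intro sum.cong refl E_telescope) auto
    also have "\<dots> = (\<Sum>n\<in>W. D n x)"
      unfolding W_def using disj by (intro sum.UNION_disjoint[symmetric]) auto
    also have "\<dots> = (\<Sum>n<L. if n \<in> W then D n x else 0)"
      using WL by (simp add: sum.inter_restrict[symmetric] Int_absorb1)
    also have "\<dots> = (\<Sum>n<L. (1/2) *\<^sub>R (D n x + \<sigma> n *\<^sub>R D n x))"
      by (intro sum.cong refl) (simp add: \<sigma>_def flip: scaleR_2)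
    finally show ?thesis by (simp add: sum.distrib scaleR_sum_right scaleR_add_right)
  qed
  have tr: "(\<Sum>x\<in>\<Omega>. norm (\<Sum>n<L. \<tau> n *\<^sub>R D n x) powr p) \<le> \<beta> * 2 powr p * (\<Sum>x\<in>\<Omega>. norm (f x) powr p)"
    if "\<And>n. \<tau> n \<in> {-1, 1}" for \<tau>
    unfolding D_def by (rule umd_fin_cavg[OF umd p fin refine that])
  have "(\<Sum>x\<in>\<Omega>. norm (\<Sum>m<M. E (b m) f x - E (a m) f x) powr p)
      \<le> (\<Sum>x\<in>\<Omega>. 1/2 * norm (\<Sum>n<L. 1 *\<^sub>R D n x) powr p + 1/2 * norm (\<Sum>n<L. \<sigma> n *\<^sub>R D n x) powr p)"
  proof (rule sum_mono)
    fix x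
    let ?u = "\<Sum>n<L. 1 *\<^sub>R D n x" and ?v = "\<Sum>n<L. \<sigma> n *\<^sub>R D n x"
    have "norm (\<Sum>m<M. E (b m) f x - E (a m) f x) \<le> 1/2 * norm ?u + 1/2 * norm ?v"
      unfolding half by (rule order_trans[OF norm_triangle_ineq]) simp
    then have "norm (\<Sum>m<M. E (b m) f x - E (a m) f x) powr p \<le> (1/2 * norm ?u + 1/2 * norm ?v) powr p"
      using p by (intro powr_mono2) auto
    also have "\<dots> \<le> 1/2 * norm ?u powr p + 1/2 * norm ?v powr p"
      by (rule powr_convex2) (use p in auto)
    finally show "norm (\<Sum>m<M. E (b m) f x - E (a m) f x) powr p \<le> 1/2 * norm ?u powr p + 1/2 * norm ?v powr p" .
  qed
  also have "\<dots> = 1/2 * (\<Sum>x\<in>\<Omega>. norm (\<Sum>n<L. 1 *\<^sub>R D n x) powr p) + 1/2 * (\<Sum>x\<in>\<Omega>. norm (\<Sum>n<L. \<sigma> n *\<^sub>R D n x) powr p)"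
    by (simp only: sum.distrib sum_distrib_left)
  also have "\<dots> \<le> \<beta> * 2 powr p * (\<Sum>x\<in>\<Omega>. norm (f x) powr p)"
  proof -
    have "\<And>n. \<sigma> n \<in> {-1, 1}" by (simp add: \<sigma>_def)
    from tr[of \<sigma>, OF this] tr[of "\<lambda>_. 1"] show ?thesis by simp
  qed
  finally show ?thesis .
qed

text \<open>Property alpha separates the signs of the levels from those of the array. For fixed
  signs of the array the sum over it is one function, whose blocks are martingale differences with
  respect to the levels \<open>G m\<close>. Decoupling takes them back from the selected points and
  removes the level signs, and UMD sums the blocks; each of these two steps contributes a factor
  \<open>\<beta>\<close>.\<close>

lemma slot_estimate:
  fixes f :: "'j \<Rightarrow> 'a \<Rightarrow> 'x::real_normed_vector"
  assumes umd: "umd_fin TYPE('x) p \<beta>" and al: "alpha_full_le TYPE('x) K" and p: "1 < p" and J: "finite J"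
    and blk: "\<And>m. m < M \<Longrightarrow> G m \<le> a m \<and> a m \<le> b m \<and> b m \<le> G (Suc m) \<and> G (Suc m) \<le> L"
  defines "Y \<equiv> selections \<Omega> M (\<lambda>m. c (G m))"
  defines "D \<equiv> \<lambda>m f x. E (b m) f x - E (a m) f x"
  shows "(\<Sum>x\<in>\<Omega>. \<Sum>y\<in>Y. rad_norm ({..<M} \<times> J) (\<lambda>z. D (fst z) (f (snd z)) (y (fst z, c (G (fst z)) x))) powr p)
    \<le> card Y * ((K powr (p / 2) * 2048 powr p * \<beta>\<^sup>2 * 2 powr p) *
        (\<Sum>x\<in>\<Omega>. rad J (\<lambda>\<delta>. norm (\<Sum>j\<in>J. \<delta> j *\<^sub>R f j x) powr p)))"
proof -
  define \<kappa> where "\<kappa> = K powr (p / 2) * 2048 powr p"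
  have \<kappa>: "0 \<le> \<kappa>" by (simp add: \<kappa>_def)
  have \<beta>: "0 \<le> \<beta>" using umd by (simp add: umd_fin_def)
  have Dsum: "(\<Sum>j\<in>J. \<delta> j *\<^sub>R D m (f j) x) = D m (\<lambda>x. \<Sum>j\<in>J. \<delta> j *\<^sub>R f j x) x" for \<delta> m x
    unfolding D_def cavg_sum cavg_scaleR by (simp add: sum_subtractf scaleR_diff_right)
  have dec: "(\<Sum>x\<in>\<Omega>. \<Sum>y\<in>Y. norm (\<Sum>m<M. \<epsilon> m *\<^sub>R D m h (y (m, c (G m) x))) powr p)
      \<le> \<beta> * (card Y * (\<beta> * 2 powr p * (\<Sum>x\<in>\<Omega>. norm (h x) powr p)))"
    if \<epsilon>: "\<And>m. \<epsilon> m \<in> {-1, 1}" for \<epsilon> and h :: "'a \<Rightarrow> 'x"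
  proof -
    have "fin_mds \<Omega> M (\<lambda>m. c (G m)) (\<lambda>m. D m h)"
      unfolding fin_mds_def
    proof (intro conjI allI impI ballI fin)
      fix m x x' assume *: "m < M" "x \<in> \<Omega>" "x' \<in> \<Omega>" "c (G (Suc m)) x = c (G (Suc m)) x'"
      have le: "c n x = c n x'" if "n \<le> G (Suc m)" for n
        by (rule refine_le[OF that _ *(2,3,4)]) (use blk[OF *(1)] in simp)
      show "c (G m) x = c (G m) x'" by (rule le) (use blk[OF *(1)] in linarith)
      have "c (a m) x = c (a m) x'" "c (b m) x = c (b m) x'"
        by (rule le, use blk[OF *(1)] in linarith)+
      then show "D m h x = D m h x'"
        unfolding D_def using cavg_cong[where c = "c (a m)"] cavg_cong[where c = "c (b m)"] by metis
    next
      fix m x assume m: "m < M" and x: "x \<in> \<Omega>"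
      have s: "(\<Sum>z\<in>cell (G m) x. E n h z) = (\<Sum>z\<in>cell (G m) x. h z)" if "G m \<le> n" "n \<le> L" for n
      proof (rule sum_cavg_coarser[OF fin])
        fix w w' assume "w \<in> \<Omega>" "w' \<in> \<Omega>" "c n w = c n w'"
        then show "c (G m) w = c (G m) w'" by (rule refine_le[OF that])
      qed
      show "(\<Sum>z\<in>cell (G m) x. D m h z) = 0"
        unfolding D_def sum_subtractf using s[of "a m"] s[of "b m"] blk[OF m] by simp
    qed
    from decoupling[OF umd this \<epsilon>]
    have "(\<Sum>x\<in>\<Omega>. \<Sum>y\<in>Y. norm (\<Sum>m<M. \<epsilon> m *\<^sub>R D m h (y (m, c (G m) x))) powr p)
        \<le> \<beta> * (card Y * (\<Sum>x\<in>\<Omega>. norm (\<Sum>m<M. D m h x) powr p))" unfolding Y_def .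
    also have "\<dots> \<le> \<beta> * (card Y * (\<beta> * 2 powr p * (\<Sum>x\<in>\<Omega>. norm (h x) powr p)))"
      unfolding D_def
      by (intro mult_left_mono block_differences_bound[OF umd p, where G = G]) (use blk \<beta> in auto)
    finally show ?thesis .
  qed
  have "(\<Sum>x\<in>\<Omega>. \<Sum>y\<in>Y. rad_norm ({..<M} \<times> J) (\<lambda>z. D (fst z) (f (snd z)) (y (fst z, c (G (fst z)) x))) powr p)
    \<le> (\<Sum>x\<in>\<Omega>. \<Sum>y\<in>Y. \<kappa> * rad {..<M} (\<lambda>\<epsilon>. rad J (\<lambda>\<delta>.
        norm (\<Sum>m<M. \<Sum>j\<in>J. (\<epsilon> m * \<delta> j) *\<^sub>R D m (f j) (y (m, c (G m) x))) powr p)))"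
    unfolding \<kappa>_def
    by (intro sum_mono rad_norm_powr_le_rad_prod[OF al _ J p, where e = "\<lambda>m j. D m (f j) (_ (m, c (G m) _))"]) simp
  also have "\<dots> = \<kappa> * rad {..<M} (\<lambda>\<epsilon>. rad J (\<lambda>\<delta>. \<Sum>x\<in>\<Omega>. \<Sum>y\<in>Y.
        norm (\<Sum>m<M. \<epsilon> m *\<^sub>R D m (\<lambda>x. \<Sum>j\<in>J. \<delta> j *\<^sub>R f j x) (y (m, c (G m) x))) powr p))"
    unfolding Dsum[symmetric] by (simp add: rad_sum sum_distrib_left scaleR_sum_right)
  also have "\<dots> \<le> \<kappa> * rad {..<M} (\<lambda>\<epsilon>. rad J (\<lambda>\<delta>. \<beta> * (card Y * (\<beta> * 2 powr p * (\<Sum>x\<in>\<Omega>. norm (\<Sum>j\<in>J. \<delta> j *\<^sub>R f j x) powr p)))))"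
    by (intro mult_left_mono[OF _ \<kappa>] rad_mono dec signsD)
  also have "\<dots> = \<kappa> * (\<beta> * (card Y * (\<beta> * 2 powr p * (\<Sum>x\<in>\<Omega>. rad J (\<lambda>\<delta>. norm (\<Sum>j\<in>J. \<delta> j *\<^sub>R f j x) powr p)))))"
    by (simp add: rad_const rad_cmult rad_sum)
  finally show ?thesis by (simp add: \<kappa>_def power2_eq_square mult_ac)
qed

end

text \<open>The constant of \<open>slot_estimate\<close>: property alpha, Kahane, and UMD used
  twice.\<close>

definition slot_const :: "real \<Rightarrow> real \<Rightarrow> real \<Rightarrow> real" where
  "slot_const K \<beta> p = K powr (p / 2) * 2048 powr p * \<beta>\<^sup>2 * 2 powr p"

text \<open>The hypothesis \<open>g\<close> is the R-hat-bound for a fixed point and fixed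
  selections. Averaging it and applying Hoelder's inequality to the three Rademacher norms makes the
  number of selections disappear.\<close>

lemma average_selections:
  fixes A B D :: real
  assumes p: "1 < p" "1 < q" "1 < r" "1/p + 1/q + 1/r = 1" and Y: "finite Y" "Y \<noteq> {}" and R: "0 \<le> R"
    and nn: "\<And>x y. 0 \<le> a x y" "\<And>x y. 0 \<le> b x y" "\<And>x y. 0 \<le> d x y"
    and bd: "(\<Sum>x\<in>S. \<Sum>y\<in>Y. a x y powr p) \<le> card Y * A" "(\<Sum>x\<in>S. \<Sum>y\<in>Y. b x y powr q) \<le> card Y * B"
      "(\<Sum>x\<in>S. \<Sum>y\<in>Y. d x y powr r) \<le> card Y * D"
    and g: "\<And>x y1 y2 y3. x \<in> S \<Longrightarrow> y1 \<in> Y \<Longrightarrow> y2 \<in> Y \<Longrightarrow> y3 \<in> Y \<Longrightarrow>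
      (\<Sum>m<M. \<Sum>t\<in>I. \<Sum>u\<in>I. \<Sum>v\<in>I. g m t u v x y1 y2 y3) \<le> R * (a x y1 * b x y2 * d x y3)"
  shows "(\<Sum>m<M::nat. \<Sum>t\<in>I. \<Sum>u\<in>I. \<Sum>v\<in>I. \<Sum>x\<in>S. (\<Sum>y1\<in>Y. \<Sum>y2\<in>Y. \<Sum>y3\<in>Y. g m t u v x y1 y2 y3) / card Y ^ 3)
    \<le> R * (A powr (1/p) * B powr (1/q) * D powr (1/r))"
proof -
  have n: "real (card Y ^ 3) > 0" using Y by (simp add: card_gt_0_iff)
  have "(\<Sum>m<M. \<Sum>t\<in>I. \<Sum>u\<in>I. \<Sum>v\<in>I. \<Sum>x\<in>S. (\<Sum>y1\<in>Y. \<Sum>y2\<in>Y. \<Sum>y3\<in>Y. g m t u v x y1 y2 y3) / card Y ^ 3)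
      = (\<Sum>z\<in>{..<M} \<times> (I \<times> (I \<times> I)). \<Sum>w\<in>S \<times> (Y \<times> (Y \<times> Y)).
          g (fst z) (fst (snd z)) (fst (snd (snd z))) (snd (snd (snd z)))
            (fst w) (fst (snd w)) (fst (snd (snd w))) (snd (snd (snd w)))) / card Y ^ 3"
    by (simp add: sum.cartesian_product' sum_divide_distrib)
  also have "\<dots> = (\<Sum>w\<in>S \<times> (Y \<times> (Y \<times> Y)). \<Sum>z\<in>{..<M} \<times> (I \<times> (I \<times> I)).
          g (fst z) (fst (snd z)) (fst (snd (snd z))) (snd (snd (snd z)))
            (fst w) (fst (snd w)) (fst (snd (snd w))) (snd (snd (snd w)))) / card Y ^ 3"
    by (subst sum.swap) (rule refl)
  also have "\<dots> = (\<Sum>x\<in>S. \<Sum>y1\<in>Y. \<Sum>y2\<in>Y. \<Sum>y3\<in>Y. \<Sum>m<M. \<Sum>t\<in>I. \<Sum>u\<in>I. \<Sum>v\<in>I. g m t u v x y1 y2 y3) / card Y ^ 3"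
    by (simp add: sum.cartesian_product')
  also have "\<dots> \<le> (\<Sum>x\<in>S. \<Sum>y1\<in>Y. \<Sum>y2\<in>Y. \<Sum>y3\<in>Y. R * (a x y1 * b x y2 * d x y3)) / card Y ^ 3"
    by (intro divide_right_mono sum_mono g) auto
  also have "\<dots> = R * ((\<Sum>x\<in>S. \<Sum>y1\<in>Y. \<Sum>y2\<in>Y. \<Sum>y3\<in>Y. a x y1 * b x y2 * d x y3) / card Y ^ 3)"
    by (simp add: sum_distrib_left)
  also have "\<dots> \<le> R * ((card Y ^ 3 * (A powr (1/p) * B powr (1/q) * D powr (1/r))) / card Y ^ 3)"
    using Hoelder_selections[OF p Y nn bd] by (intro mult_left_mono divide_right_mono R) auto
  also have "\<dots> = R * (A powr (1/p) * B powr (1/q) * D powr (1/r))" using n by simp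
  finally show ?thesis .
qed

section \<open>Averages over triples of points of a cell\<close>

context levels
begin

definition kav :: "nat \<Rightarrow> 'a \<Rightarrow> ('a \<Rightarrow> 'a \<Rightarrow> 'a \<Rightarrow> real) \<Rightarrow> real" where
  "kav n x F = (\<Sum>y1\<in>cell n x. \<Sum>y2\<in>cell n x. \<Sum>y3\<in>cell n x. F y1 y2 y3) / card (cell n x) ^ 3"

lemma kav_mono:
  "(\<And>y1 y2 y3. y1 \<in> cell n x \<Longrightarrow> y2 \<in> cell n x \<Longrightarrow> y3 \<in> cell n x \<Longrightarrow> F y1 y2 y3 \<le> F' y1 y2 y3) \<Longrightarrow> kav n x F \<le> kav n x F'"
  unfolding kav_def by (intro divide_right_mono sum_mono) auto

lemma kav_add: "kav n x (\<lambda>y1 y2 y3. F y1 y2 y3 + F' y1 y2 y3) = kav n x F + kav n x F'"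
  by (simp add: kav_def sum.distrib add_divide_distrib)

lemma kav_cdiv: "kav n x (\<lambda>y1 y2 y3. F y1 y2 y3 / k) = kav n x F / k"
  by (simp add: kav_def sum_divide_distrib[symmetric])

lemma kav_sum: "kav n x (\<lambda>y1 y2 y3. \<Sum>s\<in>S. F s y1 y2 y3) = (\<Sum>s\<in>S. kav n x (F s))"
proof (induction S rule: infinite_finite_induct)
  case (insert s S)
  then show ?case using kav_add[of n x "F s" "\<lambda>y1 y2 y3. \<Sum>s\<in>S. F s y1 y2 y3"] by simp
qed (simp_all add: kav_def)

text \<open>Three independent selections give three independent uniform points of the cell; the
  averages are exchanged from the innermost variable outwards.\<close>

lemma kav_selections:
  fixes G :: "nat \<Rightarrow> nat"
  assumes m: "m < M" and x: "x \<in> \<Omega>"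
  defines "Y \<equiv> selections \<Omega> M (\<lambda>m. c (G m))"
  shows "kav (G m) x F = (\<Sum>y1\<in>Y. \<Sum>y2\<in>Y. \<Sum>y3\<in>Y. F (y1 (m, c (G m) x)) (y2 (m, c (G m) x)) (y3 (m, c (G m) x))) / card Y ^ 3"
proof -
  have s: "(\<Sum>y\<in>Y. f (y (m, c (G m) x))) / card Y = (\<Sum>z\<in>cell (G m) x. f z) / card (cell (G m) x)" for f :: "'a \<Rightarrow> real"
    unfolding Y_def by (rule sum_selections[OF fin m x])
  let ?S = "cell (G m) x" and ?k = "(m, c (G m) x)"
  define H3 where "H3 a b = (\<Sum>z\<in>?S. F a b z) / card ?S" for a b
  define H2 where "H2 a = (\<Sum>z\<in>?S. H3 a z) / card ?S" for a
  have s3: "(\<Sum>y\<in>Y. F a b (y ?k)) / card Y = H3 a b" for a b unfolding H3_def by (rule s)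
  have s2: "(\<Sum>y\<in>Y. H3 a (y ?k)) / card Y = H2 a" for a unfolding H2_def by (rule s)
  have "(\<Sum>y1\<in>Y. \<Sum>y2\<in>Y. \<Sum>y3\<in>Y. F (y1 ?k) (y2 ?k) (y3 ?k)) / card Y ^ 3
      = (\<Sum>y1\<in>Y. (\<Sum>y2\<in>Y. (\<Sum>y3\<in>Y. F (y1 ?k) (y2 ?k) (y3 ?k)) / card Y) / card Y) / card Y"
    by (simp add: power3_eq_cube sum_divide_distrib)
  also have "\<dots> = (\<Sum>z\<in>?S. H2 z) / card ?S" unfolding s3 s2 by (rule s)
  also have "\<dots> = kav (G m) x F"
    by (simp add: kav_def H2_def H3_def power3_eq_cube sum_divide_distrib)
  finally show ?thesis ..
qed

text \<open>A sum over \<open>x\<close> does not change when a function of \<open>x\<close> is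
  replaced by its cell averages. As \<open>H\<close> depends on the base point only through its
  cell, the additional point \<open>x'\<close> can take the place of \<open>x\<close>.\<close>

lemma sum_kav_const:
  fixes H :: "'b \<Rightarrow> 'a \<Rightarrow> 'a \<Rightarrow> 'a \<Rightarrow> 'a \<Rightarrow> real"
  shows "(\<Sum>x\<in>\<Omega>. kav n x (\<lambda>y1 y2 y3. (\<Sum>x'\<in>cell n x. H (c n x) x' y1 y2 y3) / card (cell n x)))
    = (\<Sum>x\<in>\<Omega>. kav n x (H (c n x) x))"
proof -
  define K where "K x' = kav n x' (H (c n x') x')" for x'
  have "kav n x (\<lambda>y1 y2 y3. (\<Sum>x'\<in>cell n x. H (c n x) x' y1 y2 y3) / card (cell n x)) = cavg \<Omega> (c n) K x" for x
  proof -
    have "K x' = kav n x (H (c n x) x')" if "x' \<in> cell n x" for x'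
      using that by (simp add: K_def kav_def)
    then show ?thesis
      by (simp add: kav_cdiv kav_sum cavg_def)
  qed
  then show ?thesis
    using sum_cavg_saturated[OF fin, of \<Omega> "c n" K] by (simp add: K_def)
qed

text \<open>In the third slot \<open>E (G m + k3)\<close> is a block of differences plus \<open>E (G m)\<close>, and the latter may be replaced by
  the function itself, averaged over the cell.\<close>

lemma sparse_estimate:
  fixes f1 :: "'i \<times> 'i \<Rightarrow> 'a \<Rightarrow> 'x::real_normed_vector"
    and f2 :: "'i \<times> 'i \<Rightarrow> 'a \<Rightarrow> 'y::real_normed_vector"
    and f3 :: "'i \<times> 'i \<Rightarrow> 'a \<Rightarrow> 'z::real_normed_vector"
  assumes p: "1 < p" "1 < q" "1 < r" "1/p + 1/q + 1/r = 1"
    and umd: "umd_fin TYPE('x) p \<beta>1" "umd_fin TYPE('y) q \<beta>2" "umd_fin TYPE('z) r \<beta>3"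
    and al: "alpha_full_le TYPE('x) K1" "alpha_full_le TYPE('y) K2" "alpha_full_le TYPE('z) K3"
    and rh: "rhat_bd R \<T>" and ne: "\<T> \<noteq> {}" and lin: "\<And>\<phi> x y. \<phi> \<in> \<T> \<Longrightarrow> linear (\<phi> x y)"
    and I: "finite I" and k: "k1 \<le> k" "k2 \<le> k" "k3 \<le> k"
    and G: "\<And>m. m < M \<Longrightarrow> G m + k + 1 = G (Suc m) \<and> G (Suc m) \<le> L"
    and \<Phi>: "\<And>n b t u v y1 y2 y3. \<Phi> n b t u v y1 y2 y3 \<in> \<T>"
  defines "F1 \<equiv> \<Sum>x\<in>\<Omega>. rad (I \<times> I) (\<lambda>\<delta>. norm (\<Sum>j\<in>I \<times> I. \<delta> j *\<^sub>R f1 j x) powr p)"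
    and "F2 \<equiv> \<Sum>x\<in>\<Omega>. rad (I \<times> I) (\<lambda>\<delta>. norm (\<Sum>j\<in>I \<times> I. \<delta> j *\<^sub>R f2 j x) powr q)"
    and "F3 \<equiv> \<Sum>x\<in>\<Omega>. rad (I \<times> I) (\<lambda>\<delta>. norm (\<Sum>j\<in>I \<times> I. \<delta> j *\<^sub>R f3 j x) powr r)"
  shows "(\<Sum>m<M. \<Sum>t\<in>I. \<Sum>u\<in>I. \<Sum>v\<in>I. \<Sum>x\<in>\<Omega>. kav (G m) x (\<lambda>y1 y2 y3.
      \<bar>\<Phi> (G m) (c (G m) x) t u v y1 y2 y3
        (E (G m + k1 + 1) (f1 (t, u)) y1 - E (G m + k1) (f1 (t, u)) y1)
        (E (G m + k2 + 1) (f2 (u, v)) y2 - E (G m + k2) (f2 (u, v)) y2)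
        (E (G m + k3) (f3 (t, v)) y3)\<bar>))
    \<le> R * (slot_const K1 \<beta>1 p powr (1/p) * slot_const K2 \<beta>2 q powr (1/q) *
         (slot_const K3 \<beta>3 r powr (1/r) + (2048 powr (r/2)) powr (1/r)) *
         (F1 powr (1/p) * F2 powr (1/q) * F3 powr (1/r)))"
proof -
  define Y where "Y = selections \<Omega> M (\<lambda>m. c (G m))"
  have Y: "finite Y" "Y \<noteq> {}" unfolding Y_def by (rule finite_selections[OF fin], rule selections_nonempty)
  have R: "0 \<le> R" using rh by (simp add: rhat_bd_def)
  have FF: "0 \<le> F1" "0 \<le> F2" "0 \<le> F3" unfolding F1_def F2_def F3_def by (auto intro!: sum_nonneg rad_nonneg)
  have sc: "0 \<le> slot_const K \<beta> s" for K \<beta> s by (simp add: slot_const_def)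
  define d1 where "d1 m f y = E (G m + k1 + 1) f y - E (G m + k1) f y" for m and f :: "'a \<Rightarrow> 'x" and y
  define d2 where "d2 m f y = E (G m + k2 + 1) f y - E (G m + k2) f y" for m and f :: "'a \<Rightarrow> 'y" and y
  define d3 where "d3 m f y = E (G m + k3) f y - E (G m) f y" for m and f :: "'a \<Rightarrow> 'z" and y
  define P where "P m x y = y (m, c (G m) x)" for m x and y :: "nat \<times> 'b \<Rightarrow> 'a"
  define \<rho>1 where "\<rho>1 x y = rad_norm ({..<M} \<times> (I \<times> I)) (\<lambda>z. d1 (fst z) (f1 (snd z)) (P (fst z) x y))" for x y
  define \<rho>2 where "\<rho>2 x y = rad_norm ({..<M} \<times> (I \<times> I)) (\<lambda>z. d2 (fst z) (f2 (snd z)) (P (fst z) x y))" for x y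
  define \<rho>3 where "\<rho>3 x y = rad_norm ({..<M} \<times> (I \<times> I)) (\<lambda>z. d3 (fst z) (f3 (snd z)) (P (fst z) x y))" for x y
  \<comment> \<open>The constant dependence on \<open>y\<close> gives this norm the shape expected
    by \<open>average_selections\<close>.\<close>
  define \<rho>0 where "\<rho>0 x y = rad_norm (I \<times> I) (\<lambda>j. f3 j x)" for x and y :: "nat \<times> 'b \<Rightarrow> 'a"
  have II: "finite (I \<times> I)" using I by simp
  \<comment> \<open>The block from \<open>G m + k1\<close> to \<open>G m + k1 + 1\<close> lies in
    the window from \<open>G m\<close> to \<open>G (Suc m)\<close>, since
    \<open>k1 \<le> k\<close>.\<close>
  have b1: "(\<Sum>x\<in>\<Omega>. \<Sum>y\<in>Y. \<rho>1 x y powr p) \<le> card Y * (slot_const K1 \<beta>1 p * F1)"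
    unfolding \<rho>1_def d1_def P_def Y_def F1_def slot_const_def
    by (rule slot_estimate[OF umd(1) al(1) p(1) II]) (use G k in fastforce)
  have b2: "(\<Sum>x\<in>\<Omega>. \<Sum>y\<in>Y. \<rho>2 x y powr q) \<le> card Y * (slot_const K2 \<beta>2 q * F2)"
    unfolding \<rho>2_def d2_def P_def Y_def F2_def slot_const_def
    by (rule slot_estimate[OF umd(2) al(2) p(2) II]) (use G k in fastforce)
  have b3: "(\<Sum>x\<in>\<Omega>. \<Sum>y\<in>Y. \<rho>3 x y powr r) \<le> card Y * (slot_const K3 \<beta>3 r * F3)"
    unfolding \<rho>3_def d3_def P_def Y_def F3_def slot_const_def
    by (rule slot_estimate[OF umd(3) al(3) p(3) II]) (use G k in fastforce)
  have b0: "(\<Sum>x\<in>\<Omega>. \<Sum>y\<in>Y. \<rho>0 x y powr r) \<le> card Y * (2048 powr (r/2) * F3)"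
    unfolding \<rho>0_def F3_def sum_constant sum_distrib_left
    by (intro sum_mono mult_left_mono rad_norm_powr_le II p) auto
  define h3 where "h3 m x a b y1 y2 y3 t u v z = \<bar>\<Phi> (G m) (c (G m) x) t u v y1 y2 y3 (d1 m (f1 (t, u)) a) (d2 m (f2 (u, v)) b) z\<bar>"
    for m x a b y1 y2 y3 t u v z
  let ?gA = "\<lambda>m t u v x y1 y2 y3. h3 m x (P m x y1) (P m x y2) (P m x y1) (P m x y2) (P m x y3) t u v (d3 m (f3 (t, v)) (P m x y3))"
  let ?gB = "\<lambda>m t u v x y1 y2 y3. h3 m x (P m x y1) (P m x y2) (P m x y1) (P m x y2) (P m x y3) t u v (f3 (t, v) x)"
  \<comment> \<open>Differences in all three slots: the pattern that is diagonal in the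
    level.\<close>
  have A: "(\<Sum>m<M. \<Sum>t\<in>I. \<Sum>u\<in>I. \<Sum>v\<in>I. \<Sum>x\<in>\<Omega>. (\<Sum>y1\<in>Y. \<Sum>y2\<in>Y. \<Sum>y3\<in>Y. ?gA m t u v x y1 y2 y3) / card Y ^ 3)
      \<le> R * ((slot_const K1 \<beta>1 p * F1) powr (1/p) * (slot_const K2 \<beta>2 q * F2) powr (1/q) * (slot_const K3 \<beta>3 r * F3) powr (1/r))"
  proof (rule average_selections[OF p Y R _ _ _ b1 b2 b3])
    fix x y1 y2 y3
    show "(\<Sum>m<M. \<Sum>t\<in>I. \<Sum>u\<in>I. \<Sum>v\<in>I. ?gA m t u v x y1 y2 y3) \<le> R * (\<rho>1 x y1 * \<rho>2 x y2 * \<rho>3 x y3)"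
      unfolding h3_def \<rho>1_def \<rho>2_def \<rho>3_def
      by (rule rhat_bd_diagonal[OF rh ne I, where a = "\<lambda>m j. d1 m (f1 j) (P m x y1)" and b = "\<lambda>m j. d2 m (f2 j) (P m x y2)"
          and d = "\<lambda>m j. d3 m (f3 j) (P m x y3)"]) (rule \<Phi>)
  qed (auto simp: \<rho>1_def \<rho>2_def \<rho>3_def)
  \<comment> \<open>The third slot holds \<open>f3\<close> at \<open>x\<close> itself, the same at
    every level, so the level is carried by the index common to the other two slots.\<close>
  have B: "(\<Sum>m<M. \<Sum>t\<in>I. \<Sum>u\<in>I. \<Sum>v\<in>I. \<Sum>x\<in>\<Omega>. (\<Sum>y1\<in>Y. \<Sum>y2\<in>Y. \<Sum>y3\<in>Y. ?gB m t u v x y1 y2 y3) / card Y ^ 3)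
      \<le> R * ((slot_const K1 \<beta>1 p * F1) powr (1/p) * (slot_const K2 \<beta>2 q * F2) powr (1/q) * (2048 powr (r/2) * F3) powr (1/r))"
  proof (rule average_selections[OF p Y R _ _ _ b1 b2 b0])
    fix x y1 y2 y3
    show "(\<Sum>m<M. \<Sum>t\<in>I. \<Sum>u\<in>I. \<Sum>v\<in>I. ?gB m t u v x y1 y2 y3) \<le> R * (\<rho>1 x y1 * \<rho>2 x y2 * \<rho>0 x y3)"
      unfolding h3_def \<rho>1_def \<rho>2_def \<rho>0_def
      by (rule rhat_bd_middle[OF rh ne I, where a = "\<lambda>m j. d1 m (f1 j) (P m x y1)" and b = "\<lambda>m j. d2 m (f2 j) (P m x y2)"
          and d = "\<lambda>j. f3 j x"]) (rule \<Phi>)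
  qed (auto simp: \<rho>1_def \<rho>2_def \<rho>0_def)
  have split: "(\<Sum>x\<in>\<Omega>. kav (G m) x (\<lambda>y1 y2 y3. h3 m x y1 y2 y1 y2 y3 t u v (E (G m + k3) (f3 (t, v)) y3)))
      \<le> (\<Sum>x\<in>\<Omega>. (\<Sum>y1\<in>Y. \<Sum>y2\<in>Y. \<Sum>y3\<in>Y. ?gA m t u v x y1 y2 y3) / card Y ^ 3)
      + (\<Sum>x\<in>\<Omega>. (\<Sum>y1\<in>Y. \<Sum>y2\<in>Y. \<Sum>y3\<in>Y. ?gB m t u v x y1 y2 y3) / card Y ^ 3)" if m: "m < M" for m t u v
  proof -
    define H where "H b x' y1 y2 y3 = \<bar>\<Phi> (G m) b t u v y1 y2 y3 (d1 m (f1 (t, u)) y1) (d2 m (f2 (u, v)) y2) (f3 (t, v) x')\<bar>"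
      for b x' y1 y2 y3
    have "(\<Sum>x\<in>\<Omega>. kav (G m) x (\<lambda>y1 y2 y3. h3 m x y1 y2 y1 y2 y3 t u v (E (G m + k3) (f3 (t, v)) y3)))
      \<le> (\<Sum>x\<in>\<Omega>. kav (G m) x (\<lambda>y1 y2 y3. h3 m x y1 y2 y1 y2 y3 t u v (d3 m (f3 (t, v)) y3)
          + (\<Sum>x'\<in>cell (G m) x. H (c (G m) x) x' y1 y2 y3) / card (cell (G m) x)))"
    proof (intro sum_mono kav_mono)
      fix x y1 y2 y3 assume y3: "y3 \<in> cell (G m) x"
      let ?\<phi> = "\<Phi> (G m) (c (G m) x) t u v y1 y2 y3 (d1 m (f1 (t, u)) y1) (d2 m (f2 (u, v)) y2)"
      have l: "linear ?\<phi>" by (rule lin[OF \<Phi>])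
      have "E (G m) (f3 (t, v)) y3 = (1 / card (cell (G m) x)) *\<^sub>R (\<Sum>x'\<in>cell (G m) x. f3 (t, v) x')"
        using y3 by (simp add: cavg_def)
      then have "?\<phi> (E (G m) (f3 (t, v)) y3) = (\<Sum>x'\<in>cell (G m) x. ?\<phi> (f3 (t, v) x')) / card (cell (G m) x)"
        by (simp add: linear_scale[OF l] linear_sum[OF l])
      then have "\<bar>?\<phi> (E (G m) (f3 (t, v)) y3)\<bar> \<le> (\<Sum>x'\<in>cell (G m) x. H (c (G m) x) x' y1 y2 y3) / card (cell (G m) x)"
        unfolding H_def by (simp add: divide_right_mono)
      moreover have "?\<phi> (E (G m + k3) (f3 (t, v)) y3) = ?\<phi> (d3 m (f3 (t, v)) y3) + ?\<phi> (E (G m) (f3 (t, v)) y3)"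
        by (simp add: d3_def linear_diff[OF l])
      ultimately show "h3 m x y1 y2 y1 y2 y3 t u v (E (G m + k3) (f3 (t, v)) y3)
          \<le> h3 m x y1 y2 y1 y2 y3 t u v (d3 m (f3 (t, v)) y3) + (\<Sum>x'\<in>cell (G m) x. H (c (G m) x) x' y1 y2 y3) / card (cell (G m) x)"
        unfolding h3_def by linarith
    qed
    also have "\<dots> = (\<Sum>x\<in>\<Omega>. kav (G m) x (\<lambda>y1 y2 y3. h3 m x y1 y2 y1 y2 y3 t u v (d3 m (f3 (t, v)) y3)))
        + (\<Sum>x\<in>\<Omega>. kav (G m) x (H (c (G m) x) x))"
      unfolding kav_add sum.distrib sum_kav_const ..
    also have "(\<Sum>x\<in>\<Omega>. kav (G m) x (\<lambda>y1 y2 y3. h3 m x y1 y2 y1 y2 y3 t u v (d3 m (f3 (t, v)) y3)))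
        = (\<Sum>x\<in>\<Omega>. (\<Sum>y1\<in>Y. \<Sum>y2\<in>Y. \<Sum>y3\<in>Y. ?gA m t u v x y1 y2 y3) / card Y ^ 3)"
      unfolding P_def Y_def by (intro sum.cong refl kav_selections[OF m])
    also have "(\<Sum>x\<in>\<Omega>. kav (G m) x (H (c (G m) x) x))
        = (\<Sum>x\<in>\<Omega>. (\<Sum>y1\<in>Y. \<Sum>y2\<in>Y. \<Sum>y3\<in>Y. ?gB m t u v x y1 y2 y3) / card Y ^ 3)"
      unfolding P_def Y_def h3_def H_def
      by (intro sum.cong refl kav_selections[OF m, where F = "\<lambda>y1 y2 y3. \<bar>\<Phi> (G m) (c (G m) _) t u v y1 y2 y3 (d1 m (f1 (t, u)) y1) (d2 m (f2 (u, v)) y2) (f3 (t, v) _)\<bar>"])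
    finally show ?thesis .
  qed
  have "(\<Sum>m<M. \<Sum>t\<in>I. \<Sum>u\<in>I. \<Sum>v\<in>I. \<Sum>x\<in>\<Omega>. kav (G m) x (\<lambda>y1 y2 y3. h3 m x y1 y2 y1 y2 y3 t u v (E (G m + k3) (f3 (t, v)) y3)))
    \<le> R * ((slot_const K1 \<beta>1 p * F1) powr (1/p) * (slot_const K2 \<beta>2 q * F2) powr (1/q) * (slot_const K3 \<beta>3 r * F3) powr (1/r))
      + R * ((slot_const K1 \<beta>1 p * F1) powr (1/p) * (slot_const K2 \<beta>2 q * F2) powr (1/q) * (2048 powr (r/2) * F3) powr (1/r))"
    by (rule order_trans[OF _ add_mono[OF A B]], unfold sum.distrib[symmetric],
        rule sum_mono, rule sum_mono, rule sum_mono, rule sum_mono, rule split[unfolded sum.distrib[symmetric]]) simp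
  also have "\<dots> = R * (slot_const K1 \<beta>1 p powr (1/p) * slot_const K2 \<beta>2 q powr (1/q) *
         (slot_const K3 \<beta>3 r powr (1/r) + (2048 powr (r/2)) powr (1/r)) *
         (F1 powr (1/p) * F2 powr (1/q) * F3 powr (1/r)))"
    using FF sc by (simp add: powr_mult algebra_simps)
  finally show ?thesis unfolding h3_def d1_def d2_def .
qed

end

text \<open>The class of \<open>r\<close> contains \<open>(N - r + k) div Suc k\<close> numbers
  below \<open>N\<close>, the quotient rounded up. For \<open>r \<ge> N\<close> truncated
  subtraction leaves \<open>k div Suc k = 0\<close>, as it should.\<close>

lemma sum_residue_classes:
  fixes f :: "nat \<Rightarrow> real"
  shows "(\<Sum>n<N. f n) = (\<Sum>r<Suc k. \<Sum>m<(N - r + k) div Suc k. f (r + m * Suc k))"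
proof -
  have img: "{n\<in>{..<N}. n mod Suc k = r} = (\<lambda>m. r + m * Suc k) ` {..<(N - r + k) div Suc k}" if r: "r < Suc k" for r
  proof (intro equalityI subsetI)
    fix n assume n: "n \<in> {n\<in>{..<N}. n mod Suc k = r}"
    define m where "m = n div Suc k"
    have nm: "n = r + m * Suc k" using n div_mult_mod_eq[of n "Suc k"] by (simp add: m_def)
    have "r + m * Suc k < N" using n nm by simp
    then have "Suc m * Suc k \<le> N - r + k" unfolding mult_Suc by linarith
    then have "Suc m \<le> (N - r + k) div Suc k" by (simp add: less_eq_div_iff_mult_less_eq)
    then show "n \<in> (\<lambda>m. r + m * Suc k) ` {..<(N - r + k) div Suc k}" using nm by auto
  next
    fix n assume "n \<in> (\<lambda>m. r + m * Suc k) ` {..<(N - r + k) div Suc k}"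
    then obtain m where m: "n = r + m * Suc k" "Suc m \<le> (N - r + k) div Suc k" by auto
    then have "Suc m * Suc k \<le> N - r + k" by (simp add: less_eq_div_iff_mult_less_eq del: mult_Suc)
    then have "n < N" using m(1) by simp
    moreover have "n mod Suc k = r" unfolding m(1) using r by (simp only: mod_mult_self1 mod_less)
    ultimately show "n \<in> {n\<in>{..<N}. n mod Suc k = r}" by simp
  qed
  have inj: "inj_on (\<lambda>m. r + m * Suc k) A" for r A by (auto simp: inj_on_def simp del: mult_Suc_right)
  have "(\<Sum>n<N. f n) = (\<Sum>r<Suc k. \<Sum>n\<in>{n\<in>{..<N}. n mod Suc k = r}. f n)"
    by (rule sum.group[symmetric]) auto
  also have "\<dots> = (\<Sum>r<Suc k. \<Sum>m<(N - r + k) div Suc k. f (r + m * Suc k))"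
  proof (rule sum.cong[OF refl])
    fix r assume "r \<in> {..<Suc k}"
    then show "(\<Sum>n\<in>{n\<in>{..<N}. n mod Suc k = r}. f n) = (\<Sum>m<(N - r + k) div Suc k. f (r + m * Suc k))"
      using img[of r] by (simp add: sum.reindex[OF inj] del: mult_Suc_right)
  qed
  finally show ?thesis .
qed

text \<open>Within a residue class modulo \<open>k + 1\<close> the levels are spaced so that
  \<open>sparse_estimate\<close> applies; the number of classes is the factor
  \<open>1 + k\<close>.\<close>

lemma (in levels) dyadic_estimate:
  fixes f1 :: "'i \<times> 'i \<Rightarrow> 'a \<Rightarrow> 'x::real_normed_vector"
    and f2 :: "'i \<times> 'i \<Rightarrow> 'a \<Rightarrow> 'y::real_normed_vector"
    and f3 :: "'i \<times> 'i \<Rightarrow> 'a \<Rightarrow> 'z::real_normed_vector"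
  assumes p: "1 < p" "1 < q" "1 < r" "1/p + 1/q + 1/r = 1"
    and umd: "umd_fin TYPE('x) p \<beta>1" "umd_fin TYPE('y) q \<beta>2" "umd_fin TYPE('z) r \<beta>3"
    and al: "alpha_full_le TYPE('x) K1" "alpha_full_le TYPE('y) K2" "alpha_full_le TYPE('z) K3"
    and rh: "rhat_bd R \<T>" and ne: "\<T> \<noteq> {}" and lin: "\<forall>\<phi>\<in>\<T>. \<forall>x y. linear (\<phi> x y)"
    and I: "finite I" and k: "k1 \<le> k" "k2 \<le> k" "k3 \<le> k" and N: "N + k \<le> L"
    and \<Phi>: "\<forall>n b t u v y1 y2 y3. \<Phi> n b t u v y1 y2 y3 \<in> \<T>"
  defines "F1 \<equiv> \<Sum>x\<in>\<Omega>. rad (I \<times> I) (\<lambda>\<delta>. norm (\<Sum>j\<in>I \<times> I. \<delta> j *\<^sub>R f1 j x) powr p)"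
    and "F2 \<equiv> \<Sum>x\<in>\<Omega>. rad (I \<times> I) (\<lambda>\<delta>. norm (\<Sum>j\<in>I \<times> I. \<delta> j *\<^sub>R f2 j x) powr q)"
    and "F3 \<equiv> \<Sum>x\<in>\<Omega>. rad (I \<times> I) (\<lambda>\<delta>. norm (\<Sum>j\<in>I \<times> I. \<delta> j *\<^sub>R f3 j x) powr r)"
  shows "(\<Sum>n<N. \<Sum>t\<in>I. \<Sum>u\<in>I. \<Sum>v\<in>I. \<Sum>x\<in>\<Omega>. kav n x (\<lambda>y1 y2 y3.
      \<bar>\<Phi> n (c n x) t u v y1 y2 y3
        (E (n + k1 + 1) (f1 (t, u)) y1 - E (n + k1) (f1 (t, u)) y1)
        (E (n + k2 + 1) (f2 (u, v)) y2 - E (n + k2) (f2 (u, v)) y2)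
        (E (n + k3) (f3 (t, v)) y3)\<bar>))
    \<le> (1 + real k) * (R * (slot_const K1 \<beta>1 p powr (1/p) * slot_const K2 \<beta>2 q powr (1/q) *
         (slot_const K3 \<beta>3 r powr (1/r) + (2048 powr (r/2)) powr (1/r)) *
         (F1 powr (1/p) * F2 powr (1/q) * F3 powr (1/r))))"
    (is "(\<Sum>n<N. ?T n) \<le> (1 + real k) * ?B")
proof -
  have "(\<Sum>n<N. ?T n) = (\<Sum>s<Suc k. \<Sum>m<(N - s + k) div Suc k. ?T (s + m * Suc k))"
    by (rule sum_residue_classes)
  also have "\<dots> \<le> (\<Sum>s<Suc k. ?B)"
  proof (rule sum_mono)
    fix s assume s: "s \<in> {..<Suc k}"
    show "(\<Sum>m<(N - s + k) div Suc k. ?T (s + m * Suc k)) \<le> ?B"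
      unfolding F1_def F2_def F3_def
    proof (rule sparse_estimate[where G = "\<lambda>m. s + m * Suc k" and \<Phi> = \<Phi> and \<T> = \<T> and k = k, OF p umd al rh ne])
      fix m assume "m < (N - s + k) div Suc k"
      then have "Suc m \<le> (N - s + k) div Suc k" by simp
      then have le: "Suc m * Suc k \<le> N - s + k" by (simp add: less_eq_div_iff_mult_less_eq del: mult_Suc)
      then have "s + m * Suc k < N" by simp
      \<comment> \<open>The last window may pass \<open>N\<close> by up to \<open>k\<close> levels,
        which explains \<open>N + k \<le> L\<close>.\<close>
      then show "s + m * Suc k + k + 1 = s + Suc m * Suc k \<and> s + Suc m * Suc k \<le> L"
        using N by simp
    qed (fact lin[rule_format] I k \<Phi>[rule_format])+
  qed
  also have "\<dots> = (1 + real k) * ?B" by simp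
  finally show ?thesis .
qed

section \<open>Dyadic grids\<close>

lemma powi2_neg: "(2::real) powi (- g) = 1 / 2 powi g"
  by (simp add: power_int_minus inverse_eq_divide)

lemma powi2_Suc: "(2::real) powi (g + 1) = 2 * 2 powi g"
  by (simp add: power_int_add)

lemma powi2_plus: "(2::real) powi (g + int k) = 2 powi g * 2 ^ k"
  by (simp add: power_int_add)

lemma powi2_less_iff: "(2::real) powi a < 2 powi b \<longleftrightarrow> a < b"
proof
  show "a < b" if "(2::real) powi a < 2 powi b"
  proof (rule ccontr)
    assume "\<not> a < b"
    then have "(2::real) powi b \<le> 2 powi a" by (intro power_int_increasing) auto
    with that show False by simp
  qed
  show "(2::real) powi a < 2 powi b" if "a < b" using that by (intro power_int_strict_increasing) auto
qed

lemma powi2_eq_iff: "(2::real) powi a = 2 powi b \<longleftrightarrow> a = b"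
  using powi2_less_iff[of a b] powi2_less_iff[of b a] by (cases a b rule: linorder_cases) auto

text \<open>The half-open box lies between the open and the closed one, which have the same
  measure.\<close>

lemma half_open_box:
  fixes a :: "real ^ 'n"
  assumes s: "0 < s"
  defines "B \<equiv> {x. \<forall>i. a $ i \<le> x $ i \<and> x $ i < a $ i + s}"
  shows "B \<in> sets lborel" and "emeasure lborel B = ennreal (s ^ CARD('n))"
proof -
  define b where "b = (\<chi> i. a $ i + s)"
  have "B = {x \<in> space borel. \<forall>i. a $ i \<le> x $ i \<and> x $ i < a $ i + s}" by (simp add: B_def)
  also have "\<dots> \<in> sets borel" by measurable
  finally show B: "B \<in> sets lborel" by simp
  have le: "a \<bullet> e \<le> b \<bullet> e" "(b - a) \<bullet> e = s" if "e \<in> Basis" for e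
    using that s by (auto simp: b_def Basis_vec_def inner_axis)
  have "(\<Prod>e\<in>(Basis :: (real ^ 'n) set). (b - a) \<bullet> e) = s ^ CARD('n)"
    using le(2) by simp
  then have eq: "emeasure lborel (box a b) = ennreal (s ^ CARD('n))" "emeasure lborel (cbox a b) = ennreal (s ^ CARD('n))"
    using le(1) by (simp_all add: emeasure_lborel_cbox_eq)
  have "box a b \<subseteq> B" "B \<subseteq> cbox a b"
    by (auto simp: B_def b_def mem_box_cart less_imp_le)
  then have "emeasure lborel (box a b) \<le> emeasure lborel B" "emeasure lborel B \<le> emeasure lborel (cbox a b)"
    using B by (auto intro!: emeasure_mono)
  then show "emeasure lborel B = ennreal (s ^ CARD('n))" unfolding eq by (rule antisym[rotated])
qed

locale dyadic_grid =
  fixes \<omega> :: "int \<Rightarrow> real ^ 'n::finite"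
  assumes \<omega>: "\<And>k i. \<omega> k $ i \<in> {0, 1}"
begin

definition shift_at :: "int \<Rightarrow> real ^ 'n" where
  "shift_at g = (\<Sum>\<^sub>\<infinity>k\<in>{g<..}. 2 powi (- k) *\<^sub>R \<omega> k)"

text \<open>The position, within generation \<open>g\<close>, of the cube that contains
  \<open>x\<close>. Describing cubes as fibres of this map makes those of one generation a partition
  of the space.\<close>

definition idx :: "int \<Rightarrow> real ^ 'n \<Rightarrow> int ^ 'n" where
  "idx g x = (\<chi> i. \<lfloor>2 powi g * (x $ i - shift_at g $ i)\<rfloor>)"

definition cube :: "int \<Rightarrow> int ^ 'n \<Rightarrow> (real ^ 'n) set" where
  "cube g m = {x. idx g x = m}"

text \<open>The lower corner, which also serves as the representative point of the cube.\<close>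

definition corner :: "int \<Rightarrow> int ^ 'n \<Rightarrow> real ^ 'n" where
  "corner g m = (\<chi> i. 2 powi (- g) * of_int (m $ i) + shift_at g $ i)"

text \<open>The parity of \<open>half g x i\<close> tells in which half of its cube of generation \<open>g\<close> the point \<open>x\<close> lies.\<close>

definition half :: "int \<Rightarrow> real ^ 'n \<Rightarrow> 'n \<Rightarrow> int" where
  "half g x i = \<lfloor>2 powi (g + 1) * (x $ i - shift_at g $ i)\<rfloor>"

text \<open>A geometric series dominates, as the vectors \<open>\<omega> k\<close> are
  bounded.\<close>

lemma shift_at_summable: "(\<lambda>k. 2 powi (- k) *\<^sub>R \<omega> k) summable_on {g<..}"
proof -
  let ?h = "\<lambda>j::nat. g + 1 + int j"
  have bij: "bij_betw ?h UNIV {g<..}"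
    by (rule bij_betw_byWitness[where f' = "\<lambda>k. nat (k - g - 1)"]) auto
  have "norm (\<omega> k) \<le> CARD('n)" for k
  proof -
    have "norm (\<omega> k) \<le> (\<Sum>i\<in>UNIV. \<bar>\<omega> k $ i\<bar>)" by (rule norm_le_l1_cart)
    also have "\<dots> \<le> (\<Sum>i\<in>(UNIV :: 'n set). 1)"
    proof (rule sum_mono)
      fix i show "\<bar>\<omega> k $ i\<bar> \<le> 1" using \<omega>[of k i] by auto
    qed
    finally show ?thesis by simp
  qed
  then have "2 powi (- ?h j) * norm (\<omega> (?h j)) \<le> (2 powi (- (g + 1)) * (1/2) ^ j) * CARD('n)" for j
    unfolding powi2_neg powi2_plus by (intro mult_mono) (simp_all add: power_divide)
  then have "norm (2 powi (- ?h j) *\<^sub>R \<omega> (?h j)) \<le> (2 powi (- (g + 1)) * CARD('n)) * (1/2) ^ j" for j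
    by (simp add: mult_ac)
  then have "\<exists>N. \<forall>j\<ge>N. norm (norm (2 powi (- ?h j) *\<^sub>R \<omega> (?h j))) \<le> (2 powi (- (g + 1)) * CARD('n)) * (1/2) ^ j"
    by simp
  then have "summable (\<lambda>j. norm (2 powi (- ?h j) *\<^sub>R \<omega> (?h j)))"
    by (rule summable_comparison_test) (simp add: summable_mult summable_geometric)
  then have "(\<lambda>j. 2 powi (- ?h j) *\<^sub>R \<omega> (?h j)) summable_on UNIV"
    by (rule norm_summable_imp_summable_on)
  then show ?thesis
    by (rule iffD1[OF summable_on_reindex_bij_betw[OF bij, of "\<lambda>k. 2 powi (- k) *\<^sub>R \<omega> k"]])
qed

lemma shift_at_rec: "shift_at g = 2 powi (- (g + 1)) *\<^sub>R \<omega> (g + 1) + shift_at (g + 1)"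
proof -
  have "{g<..} = insert (g + 1) {g + 1<..}" by auto
  then show ?thesis
    unfolding shift_at_def using infsum_insert[OF shift_at_summable, of "g + 1" "g + 1"] by simp
qed

text \<open>The translations of generations \<open>g\<close> and \<open>g + 1\<close> differ by
  \<open>2 powi (- (g + 1))\<close> times a vector of zeros and ones, which is a lattice vector of
  generation \<open>g + 1\<close>. Halves of cubes of generation \<open>g\<close> are thus aligned
  with cubes of generation \<open>g + 1\<close>, and the grid is nested despite the shifts.\<close>

lemma half_eq: "half g x i = idx (g + 1) x $ i - \<lfloor>\<omega> (g + 1) $ i\<rfloor>"
proof -
  have w: "\<omega> (g + 1) $ i = of_int \<lfloor>\<omega> (g + 1) $ i\<rfloor>" using \<omega>[of "g + 1" i] by auto
  have "2 powi (g + 1) * (x $ i - shift_at g $ i) = 2 powi (g + 1) * (x $ i - shift_at (g + 1) $ i) - \<omega> (g + 1) $ i"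
    unfolding shift_at_rec[of g] powi2_neg by (simp add: algebra_simps)
  also have "\<lfloor>\<dots>\<rfloor> = idx (g + 1) x $ i - \<lfloor>\<omega> (g + 1) $ i\<rfloor>"
    by (subst (1) w) (simp add: idx_def)
  finally show ?thesis by (simp add: half_def)
qed

lemma idx_half: "idx g x $ i = half g x i div 2"
proof -
  have "2 powi g * (x $ i - shift_at g $ i) = (2 powi (g + 1) * (x $ i - shift_at g $ i)) / real_of_int 2"
    unfolding powi2_Suc by simp
  then show ?thesis
    unfolding idx_def half_def by (simp only: vec_lambda_beta floor_divide_real_eq_div)
qed

lemma half_cong: "idx (g + 1) x = idx (g + 1) y \<Longrightarrow> half g x i = half g y i"
  by (simp add: half_eq)

lemma idx_parent: "idx (g + 1) x = idx (g + 1) y \<Longrightarrow> idx g x = idx g y"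
  unfolding vec_eq_iff[of "idx g x"] idx_half[of g] using half_cong[of g x y] by simp

lemma idx_coarser: "idx g x = idx g y \<Longrightarrow> g' \<le> g \<Longrightarrow> idx g' x = idx g' y"
proof (induction "nat (g - g')" arbitrary: g')
  case (Suc n)
  then have "idx (g' + 1) x = idx (g' + 1) y" using Suc(1)[of "g' + 1"] Suc(2-) by simp
  then show ?case by (rule idx_parent)
qed simp

lemma corner_idx: "idx g (corner g m) = m"
  unfolding idx_def corner_def vec_eq_iff powi2_neg by simp

lemma mem_cube: "x \<in> cube g m \<longleftrightarrow> (\<forall>i. corner g m $ i \<le> x $ i \<and> x $ i < corner g m $ i + 2 powi (- g))"
proof -
  have p: "(2::real) powi g > 0" by simp
  have "\<lfloor>2 powi g * t\<rfloor> = k \<longleftrightarrow> 2 powi (- g) * of_int k \<le> t \<and> t < 2 powi (- g) * of_int k + 2 powi (- g)" for t :: real and k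
    unfolding floor_eq_iff powi2_neg using p by (simp add: field_simps)
  from this[of "x $ _ - shift_at g $ _"] show ?thesis
    by (auto simp: cube_def idx_def corner_def vec_eq_iff algebra_simps)
qed

lemma cube_box: "cube g m = {x. \<forall>i. corner g m $ i \<le> x $ i \<and> x $ i < corner g m $ i + 2 powi (- g)}"
  using mem_cube by blast

definition vol :: "int \<Rightarrow> real" where
  "vol g = (2 powi (- g)) ^ CARD('n)"

lemma vol_pos: "0 < vol g"
  by (simp add: vol_def)

lemma sets_cube: "cube g m \<in> sets lborel"
  unfolding cube_box by (rule half_open_box(1)) simp

lemma emeasure_cube: "emeasure lborel (cube g m) = ennreal (vol g)"
  unfolding cube_box vol_def by (rule half_open_box(2)) simp

lemma measure_cube: "measure lborel (cube g m) = vol g"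
  unfolding measure_def emeasure_cube using vol_pos[of g] by simp

lemma side_cube: "side (cube g m) = 2 powi (- g)"
  unfolding side_def measure_cube vol_def by (rule real_root_power_cancel) simp_all

text \<open>The translation depends on a cube only through its side length, so it is
  \<open>shift_at g\<close> for the whole generation.\<close>

lemma translated_std_cube: "translated_cube \<omega> (std_cube g m) = cube g m"
proof -
  have std: "std_cube g m = {x. \<forall>i. (\<chi> i. 2 powi (- g) * of_int (m $ i)) $ i \<le> x $ i \<and> x $ i < (\<chi> i. 2 powi (- g) * of_int (m $ i)) $ i + 2 powi (- g)}"
    by (simp add: std_cube_def algebra_simps)
  have "measure lborel (std_cube g m) = vol g"
    unfolding std vol_def measure_def by (subst half_open_box(2)) simp_all
  then have "side (std_cube g m) = 2 powi (- g)"
    unfolding side_def vol_def by (simp add: real_root_power_cancel)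
  moreover have "(2::real) powi (- k) < 2 powi (- g) \<longleftrightarrow> g < k" for k
    using powi2_less_iff[of "- k" "- g"] by simp
  ultimately have "{k::int. 2 powi (- k) < side (std_cube g m)} = {g<..}" by auto
  then have "translated_cube \<omega> (std_cube g m) = (\<lambda>x. x + shift_at g) ` std_cube g m"
    by (simp add: translated_cube_def shift_at_def)
  also have "\<dots> = cube g m"
  proof (intro equalityI subsetI)
    fix x assume "x \<in> cube g m"
    then have "x - shift_at g \<in> std_cube g m"
      by (simp add: std_cube_def mem_cube corner_def algebra_simps)
    then show "x \<in> (\<lambda>x. x + shift_at g) ` std_cube g m" by (force intro: image_eqI[of _ _ "x - shift_at g"])
  qed (auto simp: std_cube_def mem_cube corner_def algebra_simps)
  finally show ?thesis .
qed

lemma cube_inj: "cube g m = cube g' m' \<longleftrightarrow> g = g' \<and> m = m'"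
proof
  assume eq: "cube g m = cube g' m'"
  then have "(2::real) powi (- g) = 2 powi (- g')" using side_cube by metis
  then have g: "g = g'" unfolding powi2_eq_iff by simp
  have "corner g m \<in> cube g' m'" using eq corner_idx by (auto simp: cube_def)
  then show "g = g' \<and> m = m'" using g corner_idx by (simp add: cube_def)
qed auto

text \<open>The side length determines the generation of the ancestor, and any point of the smaller
  cube its position.\<close>

lemma ancestor_cube:
  assumes "\<D> = {cube g m | g m. True}"
  shows "ancestor \<D> k (cube g m) = cube (g - int k) (idx (g - int k) (corner g m))"
  unfolding ancestor_def
proof (rule the_equality)
  have sub: "cube g m \<subseteq> cube (g - int k) (idx (g - int k) (corner g m))"
  proof
    fix x assume "x \<in> cube g m"
    then have "idx g x = idx g (corner g m)" by (simp add: cube_def corner_idx)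
    then have "idx (g - int k) x = idx (g - int k) (corner g m)" by (rule idx_coarser) simp
    then show "x \<in> cube (g - int k) (idx (g - int k) (corner g m))" by (simp add: cube_def)
  qed
  have sd: "(2::real) powi (- (g - int k)) = 2 ^ k * 2 powi (- g)"
    using powi2_plus[of "- g" k] by (simp add: mult.commute)
  show "cube (g - int k) (idx (g - int k) (corner g m)) \<in> \<D> \<and> cube g m \<subseteq> cube (g - int k) (idx (g - int k) (corner g m)) \<and>
      side (cube (g - int k) (idx (g - int k) (corner g m))) = 2 ^ k * side (cube g m)"
    unfolding side_cube sd using sub assms by auto
  fix R assume R: "R \<in> \<D> \<and> cube g m \<subseteq> R \<and> side R = 2 ^ k * side (cube g m)"
  then obtain g' m' where gm: "R = cube g' m'" using assms by auto
  then have "(2::real) powi (- g') = 2 powi (- (g - int k))" using R unfolding gm side_cube sd by simp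
  then have g': "g' = g - int k" unfolding powi2_eq_iff by simp
  have "corner g m \<in> R" using R corner_idx by (auto simp: cube_def)
  then show "R = cube (g - int k) (idx (g - int k) (corner g m))"
    unfolding gm g' by (simp add: cube_def)
qed

text \<open>The Haar function without its support and without the factor
  \<open>vol g powr (- 1/2)\<close>; an odd value of \<open>half\<close> marks the right
  half.\<close>

definition haar_sign :: "('n \<Rightarrow> bool) \<Rightarrow> int \<Rightarrow> real ^ 'n \<Rightarrow> real" where
  "haar_sign \<eta> g x = (\<Prod>i\<in>UNIV. if \<eta> i \<and> odd (half g x i) then -1 else 1)"

lemma haar_sign_abs: "\<bar>haar_sign \<eta> g x\<bar> = 1"
  unfolding haar_sign_def abs_prod by (rule prod.neutral) auto

lemma haar_sign_cong: "idx (g + 1) x = idx (g + 1) y \<Longrightarrow> haar_sign \<eta> g x = haar_sign \<eta> g y"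
  unfolding haar_sign_def using half_cong[of g x y] by simp

lemma haar_sign_noncancellative: "(\<And>j. \<not> \<eta> j) \<Longrightarrow> haar_sign \<eta> g x = 1"
  by (simp add: haar_sign_def)

lemma cube_projection: "(\<lambda>y. y $ i) ` cube g m = {corner g m $ i ..< corner g m $ i + 2 powi (- g)}"
proof (intro equalityI subsetI)
  fix t assume t: "t \<in> {corner g m $ i ..< corner g m $ i + 2 powi (- g)}"
  have "(\<chi> j. if j = i then t else corner g m $ j) \<in> cube g m" using t by (auto simp: mem_cube)
  then show "t \<in> (\<lambda>y. y $ i) ` cube g m" by (force intro: image_eqI[of _ _ "\<chi> j. if j = i then t else corner g m $ j"])
qed (auto simp: mem_cube)

lemma haar_cube:
  "haar \<eta> (cube g m) x = (if idx g x = m then vol g powr (- 1/2) * haar_sign \<eta> g x else 0)"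
proof -
  let ?s = "(2::real) powi (- g)"
  have s: "?s > 0" by simp
  have h1: "haar1 b {a..<a + ?s} t = ?s powr (- 1/2) * (if a \<le> t \<and> t < a + ?s then (if b \<and> a + ?s / 2 \<le> t then -1 else 1) else 0)"
    for a t b
  proof -
    have "Inf {a..<a + ?s} = a" "Sup {a..<a + ?s} = a + ?s" using s by (simp_all add: cInf_atLeastLessThan cSup_atLeastLessThan)
    moreover have "(a + (a + ?s)) / 2 = a + ?s / 2" by (simp add: field_simps)
    ultimately show ?thesis
      using s by (auto simp: haar1_def left_half_def right_half_def indicator_def)
  qed
  have odd: "corner g m $ i + ?s / 2 \<le> x $ i \<longleftrightarrow> odd (half g x i)" if "idx g x = m" for i
  proof -
    have m: "m $ i = half g x i div 2" using that idx_half by auto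
    have "corner g m $ i + ?s / 2 \<le> x $ i \<longleftrightarrow> of_int (2 * m $ i + 1) \<le> 2 powi (g + 1) * (x $ i - shift_at g $ i)"
      unfolding corner_def powi2_neg powi2_Suc by (simp add: field_simps)
    also have "\<dots> \<longleftrightarrow> 2 * m $ i + 1 \<le> half g x i" unfolding half_def by (rule le_floor_iff[symmetric])
    also have "\<dots> \<longleftrightarrow> odd (half g x i)" unfolding m by presburger
    finally show ?thesis .
  qed
  have "haar \<eta> (cube g m) x = (\<Prod>i\<in>UNIV. ?s powr (- 1/2) *
      (if corner g m $ i \<le> x $ i \<and> x $ i < corner g m $ i + ?s then (if \<eta> i \<and> corner g m $ i + ?s / 2 \<le> x $ i then -1 else 1) else 0))"
    unfolding haar_def cube_projection h1 ..
  also have "\<dots> = vol g powr (- 1/2) * (\<Prod>i\<in>UNIV.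
      (if corner g m $ i \<le> x $ i \<and> x $ i < corner g m $ i + ?s then (if \<eta> i \<and> corner g m $ i + ?s / 2 \<le> x $ i then -1 else 1) else 0))"
    unfolding prod.distrib vol_def using s by (simp add: powr_power powr_realpow[symmetric] powr_powr mult.commute)
  also have "(\<Prod>i\<in>UNIV. (if corner g m $ i \<le> x $ i \<and> x $ i < corner g m $ i + ?s then (if \<eta> i \<and> corner g m $ i + ?s / 2 \<le> x $ i then -1 else 1) else 0))
      = (if idx g x = m then haar_sign \<eta> g x else 0 :: real)"
  proof (cases "idx g x = m")
    case True
    then have "x \<in> cube g m" by (simp add: cube_def)
    then show ?thesis using True odd by (simp add: mem_cube haar_sign_def)
  next
    case False
    then have "x \<notin> cube g m" by (simp add: cube_def)
    then obtain i where "\<not> (corner g m $ i \<le> x $ i \<and> x $ i < corner g m $ i + ?s)" unfolding mem_cube by blast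
    then show ?thesis using False by (auto intro!: prod_zero)
  qed
  finally show ?thesis by simp
qed

text \<open>Moving by half a side length in a direction in which the Haar function is cancellative changes
  its sign; on the indices of cubes of generation \<open>h\<close> this is an involution.\<close>

lemma sum_haar_sign:
  assumes j: "\<eta> j" and gh: "g < h"
  shows "(\<Sum>a\<in>{a. idx g (corner h a) = m}. haar_sign \<eta> g (corner h a)) = 0"
proof -
  define k where "k = nat (h - g - 1)"
  have kh: "h = g + 1 + int k" using gh by (simp add: k_def)
  \<comment> \<open>Upwards from a left half, downwards from a right half, so that the cube of
    generation \<open>g\<close> is kept.\<close>
  define sg where "sg x = (if even (half g x j) then 1 else -1 :: int)" for x
  \<comment> \<open>Half a side of generation \<open>g\<close> is \<open>2 ^ k\<close> sides of
    generation \<open>h\<close>.\<close>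
  define mv where "mv a = (\<chi> i. a $ i + (if i = j then sg (corner h a) * 2 ^ k else 0))" for a
  have cm: "corner h (mv a) $ i = corner h a $ i + (if i = j then sg (corner h a) * 2 powi (- (g + 1)) else 0)" for a i
    unfolding kh corner_def mv_def powi2_neg powi2_plus by (simp add: field_simps)
  have hm: "half g (corner h (mv a)) i = half g (corner h a) i + (if i = j then sg (corner h a) else 0)" for a i
  proof -
    have "2 powi (g + 1) * (corner h (mv a) $ i - shift_at g $ i)
        = 2 powi (g + 1) * (corner h a $ i - shift_at g $ i) + of_int (if i = j then sg (corner h a) else 0)"
      unfolding cm powi2_neg by (simp add: field_simps)
    then show ?thesis unfolding half_def by simp
  qed
  have sgm: "sg (corner h (mv a)) = - sg (corner h a)" for a
    by (simp add: sg_def hm)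
  show ?thesis
  proof (rule sum_swap_antisymmetric[where s = mv])
    fix a assume "a \<in> {a. idx g (corner h a) = m}"
    moreover have "idx g (corner h (mv a)) = idx g (corner h a)"
    proof -
      have "(half g (corner h a) j + sg (corner h a)) div 2 = half g (corner h a) j div 2"
        unfolding sg_def by (cases "even (half g (corner h a) j)"; presburger)
      then show ?thesis by (simp add: vec_eq_iff idx_half hm)
    qed
    ultimately show "mv a \<in> {a. idx g (corner h a) = m}" by simp
    show "mv (mv a) = a" by (simp add: vec_eq_iff mv_def[of "mv a"] sgm) (simp add: mv_def)
    have "haar_sign \<eta> g (corner h b) = (if odd (half g (corner h b) j) then -1 else 1) *
        (\<Prod>i\<in>UNIV - {j}. if \<eta> i \<and> odd (half g (corner h b) i) then -1 else 1)" for b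
      unfolding haar_sign_def using j by (subst prod.remove[of UNIV j]) auto
    then show "haar_sign \<eta> g (corner h (mv a)) = - haar_sign \<eta> g (corner h a)"
      by (simp add: hm sg_def)
  qed
qed

text \<open>In the passage to the next generation an index is determined by that of its parent and
  one bit in each direction.\<close>

lemma finite_descendants:
  assumes "finite T"
  shows "finite {idx (g + int n) x | x. idx g x \<in> T}"
proof (induction n)
  case 0
  have "{idx (g + int 0) x | x. idx g x \<in> T} \<subseteq> T" by auto
  then show ?case using assms finite_subset by blast
next
  case (Suc n)
  let ?S = "{idx (g + int n) x | x. idx g x \<in> T}"
  let ?B = "vec_lambda ` (PiE UNIV (\<lambda>_::'n. {0, 1 :: int}))"
  have "{idx (g + int (Suc n)) x | x. idx g x \<in> T}
      \<subseteq> (\<lambda>(m, b). \<chi> i. 2 * m $ i + b $ i + \<lfloor>\<omega> (g + int n + 1) $ i\<rfloor>) ` (?S \<times> ?B)"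
  proof
    fix m assume "m \<in> {idx (g + int (Suc n)) x | x. idx g x \<in> T}"
    then obtain x where x: "m = idx (g + int n + 1) x" "idx g x \<in> T" by (auto simp: algebra_simps)
    define b where "b = (\<chi> i. half (g + int n) x i mod 2)"
    have "m $ i = 2 * idx (g + int n) x $ i + b $ i + \<lfloor>\<omega> (g + int n + 1) $ i\<rfloor>" for i
      using half_eq[of "g + int n" x i] idx_half[of "g + int n" x i] unfolding x(1) b_def by simp
    then have "m = (\<lambda>(m, b). \<chi> i. 2 * m $ i + b $ i + \<lfloor>\<omega> (g + int n + 1) $ i\<rfloor>) (idx (g + int n) x, b)"
      by (simp add: vec_eq_iff)
    moreover have "b \<in> ?B"
      unfolding b_def by (intro imageI) (auto simp: PiE_def extensional_def)
    ultimately show "m \<in> (\<lambda>(m, b). \<chi> i. 2 * m $ i + b $ i + \<lfloor>\<omega> (g + int n + 1) $ i\<rfloor>) ` (?S \<times> ?B)"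
      using x(2) by blast
  qed
  moreover have "finite (?S \<times> ?B)" using Suc by (intro finite_cartesian_product finite_imageI finite_PiE) auto
  ultimately show ?case by (meson finite_imageI finite_subset)
qed

end

section \<open>Discretization\<close>

lemma Lp_carrierD:
  assumes "F \<in> fst (Lp p M)"
  shows "strongly_measurable M F" "integrable M (\<lambda>w. norm (F w) powr p)"
  using assms by (auto simp: Lp_def)

lemma snd_Lp: "snd (Lp p M) = Lp_norm p M"
  by (simp add: Lp_def)

text \<open>The bound \<open>t \<le> 1 + t powr p\<close> reduces the claim to the integrability of
  the indicator and of the power.\<close>

lemma integrable_indicator_norm:
  fixes F :: "'w \<Rightarrow> 'x::banach"
  assumes F: "F \<in> fst (Lp p M)" and p: "1 < p" and A: "A \<in> sets M" "emeasure M A < \<infinity>"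
  shows "integrable M (\<lambda>w. indicator A w * norm (F w))"
proof (rule Bochner_Integration.integrable_bound)
  show "integrable M (\<lambda>w. indicator A w + norm (F w) powr p)"
    using A Lp_carrierD(2)[OF F] by (intro Bochner_Integration.integrable_add integrable_real_indicator) auto
  show "(\<lambda>w. indicator A w * norm (F w)) \<in> borel_measurable M"
    using strongly_measurable_norm[OF Lp_carrierD(1)[OF F]] A by measurable
  have "t \<le> 1 + t powr p" if "0 \<le> t" for t :: real
  proof (cases "t \<le> 1")
    case False
    then have "t powr 1 \<le> t powr p" using p by (intro powr_mono) auto
    then show ?thesis using False by simp
  qed (simp add: add_increasing2)
  then show "AE w in M. norm (indicator A w * norm (F w)) \<le> norm (indicator A w + norm (F w) powr p :: real)"
    by (intro AE_I2) (simp add: indicator_def)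
qed

lemma has_strong_integral_indicator:
  fixes F :: "'w \<Rightarrow> 'x::banach"
  assumes F: "F \<in> fst (Lp p M)" and p: "1 < p" and A: "A \<in> sets M" "emeasure M A < \<infinity>"
  shows "has_strong_integral M (\<lambda>w. indicator A w *\<^sub>R F w) (strong_integral M (\<lambda>w. indicator A w *\<^sub>R F w))"
proof -
  have "simple_function M (indicator A :: 'w \<Rightarrow> real)" using A(1) by (rule simple_function_indicator)
  then have "strongly_measurable M (\<lambda>w. (indicator A w :: real) *\<^sub>R F w)"
    by (rule strongly_measurable_compose2[OF simple_function_strongly_measurable Lp_carrierD(1)[OF F]]) (intro continuous_intros)
  moreover have "(\<integral>\<^sup>+w. ennreal (norm ((indicator A w :: real) *\<^sub>R F w)) \<partial>M) < \<infinity>"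
  proof -
    have "(\<integral>\<^sup>+w. ennreal (norm (indicator A w * norm (F w))) \<partial>M) < \<infinity>"
      using integrable_indicator_norm[OF assms] by (simp add: integrable_iff_bounded)
    then show ?thesis by (simp add: abs_mult)
  qed
  ultimately obtain v where "has_strong_integral M (\<lambda>w. indicator A w *\<^sub>R F w) v"
    using has_strong_integral_exists by blast
  then show ?thesis using strong_integral_eqI by metis
qed

text \<open>Jensen's inequality for a vector-valued mean: the tangent of the power at the norm
  \<open>l\<close> of the mean is integrated, and its linear term is nonnegative because the norm of
  an integral is at most the integral of the norm.\<close>

lemma average_powr_le:
  fixes F :: "'w \<Rightarrow> 'x::banach"
  assumes F: "F \<in> fst (Lp p M)" and p: "1 < p" and A: "A \<in> sets M" "emeasure M A = ennreal \<mu>" and \<mu>: "0 < \<mu>"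
  shows "\<mu> * norm ((1 / \<mu>) *\<^sub>R strong_integral M (\<lambda>w. indicator A w *\<^sub>R F w)) powr p \<le> (\<integral>w. indicator A w * norm (F w) powr p \<partial>M)"
proof -
  have Af: "emeasure M A < \<infinity>" using A by simp
  define l where "l = norm ((1 / \<mu>) *\<^sub>R strong_integral M (\<lambda>w. indicator A w *\<^sub>R F w))"
  have l0: "0 \<le> l" by (simp add: l_def)
  note int = integrable_indicator_norm[OF F p A(1) Af]
  have "ennreal (norm (strong_integral M (\<lambda>w. indicator A w *\<^sub>R F w))) \<le> (\<integral>\<^sup>+w. ennreal (norm ((indicator A w :: real) *\<^sub>R F w)) \<partial>M)"
    by (rule norm_has_strong_integral_le[OF has_strong_integral_indicator[OF F p A(1) Af]])
  also have "\<dots> = (\<integral>\<^sup>+w. ennreal (indicator A w * norm (F w)) \<partial>M)" by simp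
  also have "\<dots> = ennreal (\<integral>w. indicator A w * norm (F w) \<partial>M)"
    by (rule nn_integral_eq_integral[OF int]) simp
  finally have "norm (strong_integral M (\<lambda>w. indicator A w *\<^sub>R F w)) \<le> (\<integral>w. indicator A w * norm (F w) \<partial>M)"
    by (subst (asm) ennreal_le_iff) (auto intro: integral_nonneg_AE)
  then have le: "\<mu> * l \<le> (\<integral>w. indicator A w * norm (F w) \<partial>M)" using \<mu> by (simp add: l_def)
  have intA: "integrable M (indicator A :: 'w \<Rightarrow> real)" and mA: "(\<integral>w. indicator A w \<partial>M) = \<mu>"
    using A Af \<mu> by (auto simp: measure_def)
  have intp: "integrable M (\<lambda>w. indicator A w * norm (F w) powr p)"
    using integrable_mult_indicator[OF A(1) Lp_carrierD(2)[OF F]] by simp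
  have "(\<integral>w. l powr p * indicator A w + p * l powr (p - 1) * (indicator A w * norm (F w) - l * indicator A w) \<partial>M)
      \<le> (\<integral>w. indicator A w * norm (F w) powr p \<partial>M)"
  proof (rule integral_mono)
    fix w
    show "l powr p * indicator A w + p * l powr (p - 1) * (indicator A w * norm (F w) - l * indicator A w) \<le> indicator A w * norm (F w) powr p"
      using tangent_powr[OF p norm_ge_zero[of "F w"] l0] by (simp add: indicator_def)
  qed (use int intA intp in auto)
  also have "(\<integral>w. l powr p * indicator A w + p * l powr (p - 1) * (indicator A w * norm (F w) - l * indicator A w) \<partial>M)
      = l powr p * \<mu> + p * l powr (p - 1) * ((\<integral>w. indicator A w * norm (F w) \<partial>M) - l * \<mu>)"
    using int intA mA by simp
  finally have "l powr p * \<mu> + p * l powr (p - 1) * ((\<integral>w. indicator A w * norm (F w) \<partial>M) - l * \<mu>) \<le> (\<integral>w. indicator A w * norm (F w) powr p \<partial>M)" .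
  moreover have "0 \<le> p * l powr (p - 1) * ((\<integral>w. indicator A w * norm (F w) \<partial>M) - l * \<mu>)"
    using p le by (intro mult_nonneg_nonneg) (auto simp: mult.commute)
  ultimately show ?thesis by (simp add: l_def mult.commute)
qed

lemma Lp_norm_nonneg: "0 \<le> Lp_norm p M F"
  by (simp add: Lp_norm_def)

section \<open>Functionals on seminormed spaces\<close>

lemma dualD:
  assumes "\<phi> \<in> fst (dual E)"
  shows "e \<in> fst E \<Longrightarrow> f \<in> fst E \<Longrightarrow> \<phi> (e + f) = \<phi> e + \<phi> f" "e \<in> fst E \<Longrightarrow> \<phi> (c *\<^sub>R e) = c * \<phi> e"
    "\<exists>C. \<forall>e\<in>fst E. \<bar>\<phi> e\<bar> \<le> C * snd E e"
  using assms by (auto simp: dual_def)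

lemma dual_bdd_above:
  assumes \<phi>: "\<phi> \<in> fst (dual E)" and nn: "\<And>e. e \<in> fst E \<Longrightarrow> 0 \<le> snd E e"
  shows "bdd_above ((\<lambda>e. \<bar>\<phi> e\<bar>) ` {e \<in> fst E. snd E e \<le> 1})"
proof -
  obtain C where C: "\<And>e. e \<in> fst E \<Longrightarrow> \<bar>\<phi> e\<bar> \<le> C * snd E e" using dualD(3)[OF \<phi>] by blast
  have "\<bar>\<phi> e\<bar> \<le> \<bar>C\<bar>" if "e \<in> {e \<in> fst E. snd E e \<le> 1}" for e
  proof -
    have "\<bar>\<phi> e\<bar> \<le> \<bar>C\<bar> * snd E e"
      using C[of e] that mult_right_mono[OF abs_ge_self[of C] nn[of e]] by simp
    also have "\<dots> \<le> \<bar>C\<bar> * 1" using that by (intro mult_left_mono) auto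
    finally show ?thesis by simp
  qed
  then show ?thesis by (intro bdd_aboveI) auto
qed

text \<open>Elements of positive seminorm are scaled into the unit ball; on elements of seminorm 0 a
  bounded functional vanishes.\<close>

lemma dual_norm_le:
  assumes \<phi>: "\<phi> \<in> fst (dual (Lp p M))" and F: "F \<in> fst (Lp p M)" and c: "\<And>c. c *\<^sub>R F \<in> fst (Lp p M)"
    and h: "\<And>c. Lp_norm p M (c *\<^sub>R F) = \<bar>c\<bar> * Lp_norm p M F"
  shows "\<bar>\<phi> F\<bar> \<le> dual_norm (Lp p M) \<phi> * Lp_norm p M F"
proof -
  obtain C where C: "\<And>e. e \<in> fst (Lp p M) \<Longrightarrow> \<bar>\<phi> e\<bar> \<le> C * Lp_norm p M e"
    using dualD(3)[OF \<phi>] by (auto simp: snd_Lp)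
  let ?S = "{e \<in> fst (Lp p M). snd (Lp p M) e \<le> 1}"
  have bdd: "bdd_above ((\<lambda>e. \<bar>\<phi> e\<bar>) ` ?S)"
    by (rule dual_bdd_above[OF \<phi>]) (simp add: snd_Lp Lp_norm_nonneg)
  show ?thesis
  proof (cases "Lp_norm p M F = 0")
    case True
    then show ?thesis using C[OF F] by simp
  next
    case False
    then have pos: "Lp_norm p M F > 0" using Lp_norm_nonneg[of p M F] by simp
    let ?G = "(1 / Lp_norm p M F) *\<^sub>R F"
    have "?G \<in> ?S" using c h[of "1 / Lp_norm p M F"] pos by (simp add: snd_Lp)
    then have "\<bar>\<phi> ?G\<bar> \<le> dual_norm (Lp p M) \<phi>"
      unfolding dual_norm_def by (intro cSUP_upper bdd)
    moreover have "\<phi> ?G = \<phi> F / Lp_norm p M F" using dualD(2)[OF \<phi> F, of "1 / Lp_norm p M F"] by simp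
    ultimately show ?thesis using pos by (simp add: field_simps abs_mult)
  qed
qed

lemma dual_whole:
  fixes f :: "'y::real_normed_vector \<Rightarrow>\<^sub>L real"
  shows "blinfun_apply f \<in> fst (dual whole)" "snd (dual whole) (blinfun_apply f) \<le> norm f"
proof -
  have b: "\<bar>f e\<bar> \<le> norm f * norm e" for e using norm_blinfun[of f e] by simp
  then show "blinfun_apply f \<in> fst (dual whole)"
    by (auto simp: dual_def whole_def blinfun.add_right blinfun.scaleR_right)
  have "\<bar>f e\<bar> \<le> norm f" if "norm e \<le> 1" for e
    using b[of e] mult_left_mono[OF that norm_ge_zero[of f]] by simp
  then show "snd (dual whole) (blinfun_apply f) \<le> norm f"
    unfolding dual_def dual_norm_def whole_def snd_conv fst_conv
    by (intro cSUP_least) (auto intro!: exI[of _ 0])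
qed

text \<open>One constant for both roles of a slot; the second summand accounts for the averages that
  remain in the non-cancellative role.\<close>

definition slot_total :: "real \<Rightarrow> real \<Rightarrow> real \<Rightarrow> real" where
  "slot_total K \<beta> p = slot_const K \<beta> p powr (1/p) + (2048 powr (p/2)) powr (1/p)"

section \<open>The estimate with the non-cancellative slot in any position\<close>

context levels
begin

text \<open>What a Haar function of level \<open>n\<close> sees of \<open>f\<close>: a martingale
  difference in a cancellative slot, an average otherwise.\<close>

definition proj :: "bool \<Rightarrow> nat \<Rightarrow> ('a \<Rightarrow> 'x::real_vector) \<Rightarrow> 'a \<Rightarrow> 'x" where
  "proj b n f a = (if b then E (n + 1) f a - E n f a else E n f a)"

lemma kav_nonneg: "(\<And>y1 y2 y3. 0 \<le> F y1 y2 y3) \<Longrightarrow> 0 \<le> kav n x F"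
  unfolding kav_def by (intro divide_nonneg_nonneg sum_nonneg) auto

lemma kav_perm1: "kav n x (\<lambda>y1 y2 y3. F y3 y2 y1) = kav n x F"
proof -
  have "(\<Sum>y1\<in>A. \<Sum>y2\<in>A. \<Sum>y3\<in>A. F y3 y2 y1) = (\<Sum>y1\<in>A. \<Sum>y2\<in>A. \<Sum>y3\<in>A. F y1 y2 y3)" for A
  proof -
    have "(\<Sum>y1\<in>A. \<Sum>y2\<in>A. \<Sum>y3\<in>A. F y3 y2 y1) = (\<Sum>y1\<in>A. \<Sum>y3\<in>A. \<Sum>y2\<in>A. F y3 y2 y1)"
      by (rule sum.cong[OF refl]) (rule sum.swap)
    also have "\<dots> = (\<Sum>y3\<in>A. \<Sum>y1\<in>A. \<Sum>y2\<in>A. F y3 y2 y1)" by (rule sum.swap)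
    also have "\<dots> = (\<Sum>y3\<in>A. \<Sum>y2\<in>A. \<Sum>y1\<in>A. F y3 y2 y1)"
      by (rule sum.cong[OF refl]) (rule sum.swap)
    finally show ?thesis .
  qed
  then show ?thesis by (simp add: kav_def)
qed

lemma kav_perm2: "kav n x (\<lambda>y1 y2 y3. F y1 y3 y2) = kav n x F"
  unfolding kav_def by (rule arg_cong2[where f = "(/)", OF sum.cong[OF refl sum.swap] refl])

lemma sum_perm1: "(\<Sum>t\<in>I. \<Sum>u\<in>I. \<Sum>v\<in>I. G t v u) = (\<Sum>t\<in>I. \<Sum>u\<in>I. \<Sum>v\<in>I. G t u v)"
  by (rule sum.cong[OF refl sum.swap])

lemma rad_swap_index:
  fixes f :: "'i \<times> 'i \<Rightarrow> 'x::real_vector"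
  assumes "finite I"
  shows "rad (I \<times> I) (\<lambda>\<delta>. G (\<Sum>j\<in>I \<times> I. \<delta> j *\<^sub>R f (prod.swap j))) = rad (I \<times> I) (\<lambda>\<delta>. G (\<Sum>j\<in>I \<times> I. \<delta> j *\<^sub>R f j))"
proof -
  have "(\<Sum>j\<in>I \<times> I. \<delta> j *\<^sub>R f (prod.swap j)) = (\<Sum>j\<in>I \<times> I. \<delta> (prod.swap j) *\<^sub>R f j)" for \<delta> :: "'i \<times> 'i \<Rightarrow> real"
    by (rule sum.reindex_bij_witness[of _ prod.swap prod.swap]) auto
  then show ?thesis
    using rad_reindex[where A = "I \<times> I" and B = "I \<times> I" and h = prod.swap and e = f and G = G] assms by (simp add: product_swap)
qed

text \<open>In \<open>dyadic_estimate\<close> the third slot is the non-cancellative one; the other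
  positions follow by exchanging slots of the forms and transposing one array.\<close>

lemma dyadic_estimate_slots:
  fixes f1 :: "'i \<times> 'i \<Rightarrow> 'a \<Rightarrow> 'x::real_normed_vector"
    and f2 :: "'i \<times> 'i \<Rightarrow> 'a \<Rightarrow> 'y::real_normed_vector"
    and f3 :: "'i \<times> 'i \<Rightarrow> 'a \<Rightarrow> 'z::real_normed_vector"
  assumes p: "1 < p" "1 < q" "1 < r" "1/p + 1/q + 1/r = 1"
    and umd: "umd_fin TYPE('x) p \<beta>1" "umd_fin TYPE('y) q \<beta>2" "umd_fin TYPE('z) r \<beta>3"
    and al: "alpha_full_le TYPE('x) K1" "alpha_full_le TYPE('y) K2" "alpha_full_le TYPE('z) K3"
    and rh: "rhat_bd R \<T>" and ne: "\<T> \<noteq> {}"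
    and lin: "\<forall>\<phi>\<in>\<T>. \<forall>y z. linear (\<lambda>x. \<phi> x y z)" "\<forall>\<phi>\<in>\<T>. \<forall>x z. linear (\<lambda>y. \<phi> x y z)"
      "\<forall>\<phi>\<in>\<T>. \<forall>x y. linear (\<phi> x y)"
    and I: "finite I" and k: "k1 \<le> k" "k2 \<le> k" "k3 \<le> k" and N: "N + k \<le> L"
    and \<Phi>: "\<forall>n b t u v y1 y2 y3. \<Phi> n b t u v y1 y2 y3 \<in> \<T>"
    and i0: "i0 \<in> {1, 2, 3 :: nat}"
  defines "F1 \<equiv> \<Sum>x\<in>\<Omega>. rad (I \<times> I) (\<lambda>\<delta>. norm (\<Sum>j\<in>I \<times> I. \<delta> j *\<^sub>R f1 j x) powr p)"
    and "F2 \<equiv> \<Sum>x\<in>\<Omega>. rad (I \<times> I) (\<lambda>\<delta>. norm (\<Sum>j\<in>I \<times> I. \<delta> j *\<^sub>R f2 j x) powr q)"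
    and "F3 \<equiv> \<Sum>x\<in>\<Omega>. rad (I \<times> I) (\<lambda>\<delta>. norm (\<Sum>j\<in>I \<times> I. \<delta> j *\<^sub>R f3 j x) powr r)"
  shows "(\<Sum>n<N. \<Sum>t\<in>I. \<Sum>u\<in>I. \<Sum>v\<in>I. \<Sum>x\<in>\<Omega>. kav n x (\<lambda>y1 y2 y3.
      \<bar>\<Phi> n (c n x) t u v y1 y2 y3 (proj (i0 \<noteq> 1) (n + k1) (f1 (t, u)) y1)
        (proj (i0 \<noteq> 2) (n + k2) (f2 (u, v)) y2) (proj (i0 \<noteq> 3) (n + k3) (f3 (t, v)) y3)\<bar>))
    \<le> (1 + real k) * (R * (slot_total K1 \<beta>1 p * slot_total K2 \<beta>2 q * slot_total K3 \<beta>3 r *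
         (F1 powr (1/p) * F2 powr (1/q) * F3 powr (1/r))))"
proof -
  have R: "0 \<le> R" using rh by (simp add: rhat_bd_def)
  have sc: "slot_const K \<beta> p powr (1/p) \<le> slot_total K \<beta> p" "0 \<le> slot_total K \<beta> p" for K \<beta> p
    by (simp_all add: slot_total_def)
  \<comment> \<open>The constants of both kinds lie below \<open>slot_total\<close>, which makes the
    bound symmetric in the slots.\<close>
  have pad: "a \<le> (1 + real k) * (R * (slot_total K1 \<beta>1 p * slot_total K2 \<beta>2 q * slot_total K3 \<beta>3 r *
         (F1 powr (1/p) * F2 powr (1/q) * F3 powr (1/r))))"
    if "a \<le> (1 + real k) * (R * (s1 * s2 * s3 * (F1 powr (1/p) * F2 powr (1/q) * F3 powr (1/r))))"
      and "s1 \<le> slot_total K1 \<beta>1 p" "s2 \<le> slot_total K2 \<beta>2 q" "s3 \<le> slot_total K3 \<beta>3 r" "0 \<le> s1" "0 \<le> s2" "0 \<le> s3"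
    for a s1 s2 s3
  proof (rule order_trans[OF that(1)])
    show "(1 + real k) * (R * (s1 * s2 * s3 * (F1 powr (1/p) * F2 powr (1/q) * F3 powr (1/r))))
      \<le> (1 + real k) * (R * (slot_total K1 \<beta>1 p * slot_total K2 \<beta>2 q * slot_total K3 \<beta>3 r * (F1 powr (1/p) * F2 powr (1/q) * F3 powr (1/r))))"
      using that(2-) R by (intro mult_left_mono mult_right_mono mult_mono mult_nonneg_nonneg) auto
  qed
  consider "i0 = 1" | "i0 = 2" | "i0 = 3" using i0 by auto
  then show ?thesis
  proof cases
    case 3
    note est = dyadic_estimate[where \<T> = \<T> and \<Phi> = \<Phi> and ?f1.0 = f1 and ?f2.0 = f2 and ?f3.0 = f3, OF p umd al rh ne lin(3) I k N \<Phi>, folded F1_def F2_def F3_def slot_total_def]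
    show ?thesis
      by (rule pad[of _ "slot_const K1 \<beta>1 p powr (1/p)" "slot_const K2 \<beta>2 q powr (1/q)" "slot_total K3 \<beta>3 r"])
        (use est sc 3 in \<open>simp_all add: proj_def\<close>)
  next
    case 1
    have p': "1/r + 1/q + 1/p = 1" using p(4) by simp
    have lin': "\<forall>\<phi>\<in>(\<lambda>\<phi> z y x. \<phi> x y z) ` \<T>. \<forall>z y. linear (\<phi> z y)"
      using lin(1) by auto
    have ne': "(\<lambda>\<phi> z y x. \<phi> x y z) ` \<T> \<noteq> {}" using ne by simp
    let ?\<Phi> = "\<lambda>n b t v u y3 y2 y1 z y x. \<Phi> n b t u v y1 y2 y3 x y z"
    have \<Phi>': "\<forall>n b t v u y3 y2 y1. ?\<Phi> n b t v u y3 y2 y1 \<in> (\<lambda>\<phi> z y x. \<phi> x y z) ` \<T>"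
      using \<Phi> by blast
    note est = dyadic_estimate[where p = r and q = q and r = p and \<T> = "(\<lambda>\<phi> z y x. \<phi> x y z) ` \<T>" and I = I and N = N
      and \<Phi> = ?\<Phi> and ?f1.0 = f3 and ?f2.0 = "\<lambda>j. f2 (prod.swap j)" and ?f3.0 = f1,
      OF p(3,2,1) p' umd(3,2,1) al(3,2,1) rhat_bd_perm1[OF rh] ne' lin' I k(3,2,1) N \<Phi>']
    have F2': "(\<Sum>x\<in>\<Omega>. rad (I \<times> I) (\<lambda>\<delta>. norm (\<Sum>j\<in>I \<times> I. \<delta> j *\<^sub>R f2 (prod.swap j) x) powr q)) = F2"
      unfolding F2_def by (intro sum.cong refl rad_swap_index[OF I, where G = "\<lambda>v. norm v powr q"])
    have eq: "(\<Sum>t\<in>I. \<Sum>u\<in>I. \<Sum>v\<in>I. \<Sum>x\<in>\<Omega>. kav n x (\<lambda>y1 y2 y3. \<bar>\<Phi> n (c n x) t u v y1 y2 y3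
        (proj (i0 \<noteq> 1) (n + k1) (f1 (t, u)) y1) (proj (i0 \<noteq> 2) (n + k2) (f2 (u, v)) y2) (proj (i0 \<noteq> 3) (n + k3) (f3 (t, v)) y3)\<bar>))
      = (\<Sum>t\<in>I. \<Sum>v\<in>I. \<Sum>u\<in>I. \<Sum>x\<in>\<Omega>. kav n x (\<lambda>y3 y2 y1. \<bar>?\<Phi> n (c n x) t v u y3 y2 y1
        (E (n + k3 + 1) (f3 (t, v)) y3 - E (n + k3) (f3 (t, v)) y3) (E (n + k2 + 1) (f2 (prod.swap (v, u))) y2 - E (n + k2) (f2 (prod.swap (v, u))) y2)
        (E (n + k1) (f1 (t, u)) y1)\<bar>))" for n
      unfolding kav_perm1[symmetric, of n _ "\<lambda>y1 y2 y3. \<bar>\<Phi> n (c n _) _ _ _ y1 y2 y3 (_ y1) (_ y2) (_ y3)\<bar>"]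
      by (subst sum_perm1) (simp add: proj_def 1)
    show ?thesis
      unfolding eq
      by (rule pad[of _ "slot_total K1 \<beta>1 p" "slot_const K2 \<beta>2 q powr (1/q)" "slot_const K3 \<beta>3 r powr (1/r)"])
        (use est[unfolded F2', folded F1_def F3_def slot_total_def] sc in \<open>simp_all add: mult_ac\<close>)
  next
    case 2
    have p': "1/p + 1/r + 1/q = 1" using p(4) by simp
    have lin': "\<forall>\<phi>\<in>(\<lambda>\<phi> x z y. \<phi> x y z) ` \<T>. \<forall>x z. linear (\<phi> x z)"
      using lin(2) by auto
    have ne': "(\<lambda>\<phi> x z y. \<phi> x y z) ` \<T> \<noteq> {}" using ne by simp
    let ?\<Phi> = "\<lambda>n b u t v y1 y3 y2 x z y. \<Phi> n b t u v y1 y2 y3 x y z"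
    have \<Phi>': "\<forall>n b u t v y1 y3 y2. ?\<Phi> n b u t v y1 y3 y2 \<in> (\<lambda>\<phi> x z y. \<phi> x y z) ` \<T>"
      using \<Phi> by blast
    note est = dyadic_estimate[where p = p and q = r and r = q and \<T> = "(\<lambda>\<phi> x z y. \<phi> x y z) ` \<T>" and I = I and N = N
      and \<Phi> = ?\<Phi> and ?f1.0 = "\<lambda>j. f1 (prod.swap j)" and ?f2.0 = f3 and ?f3.0 = f2,
      OF p(1,3,2) p' umd(1,3,2) al(1,3,2) rhat_bd_perm2[OF rh] ne' lin' I k(1,3,2) N \<Phi>']
    have F1': "(\<Sum>x\<in>\<Omega>. rad (I \<times> I) (\<lambda>\<delta>. norm (\<Sum>j\<in>I \<times> I. \<delta> j *\<^sub>R f1 (prod.swap j) x) powr p)) = F1"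
      unfolding F1_def by (intro sum.cong refl rad_swap_index[OF I, where G = "\<lambda>v. norm v powr p"])
    have eq: "(\<Sum>t\<in>I. \<Sum>u\<in>I. \<Sum>v\<in>I. \<Sum>x\<in>\<Omega>. kav n x (\<lambda>y1 y2 y3. \<bar>\<Phi> n (c n x) t u v y1 y2 y3
        (proj (i0 \<noteq> 1) (n + k1) (f1 (t, u)) y1) (proj (i0 \<noteq> 2) (n + k2) (f2 (u, v)) y2) (proj (i0 \<noteq> 3) (n + k3) (f3 (t, v)) y3)\<bar>))
      = (\<Sum>u\<in>I. \<Sum>t\<in>I. \<Sum>v\<in>I. \<Sum>x\<in>\<Omega>. kav n x (\<lambda>y1 y3 y2. \<bar>?\<Phi> n (c n x) u t v y1 y3 y2
        (E (n + k1 + 1) (f1 (prod.swap (u, t))) y1 - E (n + k1) (f1 (prod.swap (u, t))) y1)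
        (E (n + k3 + 1) (f3 (t, v)) y3 - E (n + k3) (f3 (t, v)) y3) (E (n + k2) (f2 (u, v)) y2)\<bar>))" for n
      unfolding kav_perm2[symmetric, of n _ "\<lambda>y1 y2 y3. \<bar>\<Phi> n (c n _) _ _ _ y1 y2 y3 (_ y1) (_ y2) (_ y3)\<bar>"]
      by (subst sum.swap) (simp add: proj_def 2)
    show ?thesis
      unfolding eq
      by (rule pad[of _ "slot_const K1 \<beta>1 p powr (1/p)" "slot_total K2 \<beta>2 q" "slot_const K3 \<beta>3 r powr (1/r)"])
        (use est[unfolded F1', folded F2_def F3_def slot_total_def] sc in \<open>simp_all add: mult_ac\<close>)
  qed
qed

end

section \<open>A finite model: cubes of generation \<open>g0\<close> cut into atoms\<close>

locale dyadic_model = dyadic_grid \<omega> for \<omega> :: "int \<Rightarrow> real ^ 'n::finite" +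
  fixes g0 :: int and L :: nat and T :: "(int ^ 'n) set"
  assumes finite_T: "finite T"
begin

text \<open>Atoms are the cubes of generation \<open>h\<close>, identified by their indices. Those
  inside the cubes of \<open>T\<close> form \<open>\<Omega>\<close>, and level \<open>n\<close> of
  the filtration is generation \<open>g0 + n\<close>.\<close>

definition h :: int where "h = g0 + int L"
definition \<Omega> :: "(int ^ 'n) set" where "\<Omega> = {a. idx g0 (corner h a) \<in> T}"
definition c :: "nat \<Rightarrow> int ^ 'n \<Rightarrow> int ^ 'n" where "c n a = idx (g0 + int n) (corner h a)"
definition \<mu> :: real where "\<mu> = vol h"
definition atom :: "int ^ 'n \<Rightarrow> (real ^ 'n) set" where "atom a = cube h a"

lemma \<mu>_pos: "0 < \<mu>"
  by (simp add: \<mu>_def vol_pos)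

lemma finite_\<Omega>: "finite \<Omega>"
proof -
  have "\<Omega> \<subseteq> {idx (g0 + int L) x | x. idx g0 x \<in> T}"
  proof
    fix a assume "a \<in> \<Omega>"
    then have "a = idx (g0 + int L) (corner h a) \<and> idx g0 (corner h a) \<in> T"
      using corner_idx[of h a] by (simp add: \<Omega>_def h_def)
    then show "a \<in> {idx (g0 + int L) x | x. idx g0 x \<in> T}" by blast
  qed
  then show ?thesis using finite_descendants[OF finite_T] finite_subset by blast
qed

sublocale levels \<Omega> c L
proof
  fix n x x' assume "c (Suc n) x = c (Suc n) x'"
  then show "c n x = c n x'" unfolding c_def by (rule idx_coarser) simp
qed (rule finite_\<Omega>)

lemma idx_atom:
  assumes "idx h x = a" "n \<le> L"
  shows "idx (g0 + int n) x = c n a"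
proof -
  have "idx h x = idx h (corner h a)" by (simp add: corner_idx assms)
  then show ?thesis unfolding c_def by (rule idx_coarser) (use assms in \<open>simp add: h_def\<close>)
qed

lemma idx_mem_\<Omega>:
  assumes "n \<le> L" "a \<in> \<Omega>" "idx (g0 + int n) x = c n a"
  shows "idx h x \<in> \<Omega>"
proof -
  have "idx (g0 + int n) (corner h (idx h x)) = idx (g0 + int n) (corner h a)"
    using idx_atom[of x "idx h x" n] assms by (simp add: c_def)
  then have "idx g0 (corner h (idx h x)) = idx g0 (corner h a)" by (rule idx_coarser) simp
  then show ?thesis using assms(2) by (simp add: \<Omega>_def)
qed

lemma atom_measure: "atom a \<in> sets lborel" "emeasure lborel (atom a) = ennreal \<mu>" "emeasure lborel (atom a) < \<infinity>"
  unfolding atom_def \<mu>_def emeasure_cube by (rule sets_cube) simp_all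

lemma indicator_atom: "indicator (atom a) x = (if idx h x = a then 1 else 0)"
  by (simp add: atom_def cube_def indicator_def)

lemma sum_indicator_atoms:
  fixes v :: "int ^ 'n \<Rightarrow> 'x::real_vector"
  shows "(\<Sum>a\<in>\<Omega>. (indicator (atom a) x :: real) *\<^sub>R v a) = (if idx h x \<in> \<Omega> then v (idx h x) else 0)"
proof -
  have "(\<Sum>a\<in>\<Omega>. (indicator (atom a) x :: real) *\<^sub>R v a) = (\<Sum>a\<in>\<Omega>. if a = idx h x then v a else 0)"
    by (intro sum.cong refl) (simp add: indicator_atom)
  also have "\<dots> = (if idx h x \<in> \<Omega> then v (idx h x) else 0)" using finite_\<Omega> by simp
  finally show ?thesis .
qed

text \<open>The cube of generation \<open>g0 + n\<close> around \<open>a\<close> is the disjoint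
  union of the atoms in the cell of \<open>a\<close>.\<close>

lemma vol_cell:
  assumes n: "n \<le> L" and a: "a \<in> \<Omega>"
  shows "vol (g0 + int n) = card (cell n a) * \<mu>"
proof -
  have eq: "cube (g0 + int n) (c n a) = (\<Union>z\<in>cell n a. atom z)"
  proof (intro equalityI subsetI)
    fix x assume x: "x \<in> cube (g0 + int n) (c n a)"
    then have "idx (g0 + int n) x = c n a" by (simp add: cube_def)
    then have "idx h x \<in> cell n a" using idx_mem_\<Omega>[OF n a] idx_atom[of x "idx h x" n] n by simp
    then show "x \<in> (\<Union>z\<in>cell n a. atom z)" by (auto simp: atom_def cube_def)
  next
    fix x assume "x \<in> (\<Union>z\<in>cell n a. atom z)"
    then obtain z where "z \<in> cell n a" "idx h x = z" by (auto simp: atom_def cube_def)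
    then show "x \<in> cube (g0 + int n) (c n a)" using idx_atom[of x z n] n by (simp add: cube_def)
  qed
  have "vol (g0 + int n) = measure lborel (\<Union>z\<in>cell n a. atom z)"
    unfolding eq[symmetric] measure_cube ..
  also have "\<dots> = (\<Sum>z\<in>cell n a. measure lborel (atom z))"
  proof (rule measure_finite_Union)
    show "finite (cell n a)" using finite_\<Omega> by simp
    show "disjoint_family_on atom (cell n a)" by (auto simp: disjoint_family_on_def atom_def cube_def)
  qed (use atom_measure in auto)
  also have "\<dots> = card (cell n a) * \<mu>" by (simp add: atom_def measure_cube \<mu>_def)
  finally show ?thesis .
qed

text \<open>The value of a Haar function on the atom \<open>a\<close>, read off at its
  corner.\<close>

definition hv :: "('n \<Rightarrow> bool) \<Rightarrow> nat \<Rightarrow> int ^ 'n \<Rightarrow> int ^ 'n \<Rightarrow> real" where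
  "hv \<eta> n m a = haar \<eta> (cube (g0 + int n) m) (corner h a)"

lemma hv_eq: "hv \<eta> n m a = (if c n a = m then vol (g0 + int n) powr (- 1/2) * haar_sign \<eta> (g0 + int n) (corner h a) else 0)"
  by (simp add: hv_def haar_cube c_def)

lemma hv_cong:
  assumes "n < L" "c (Suc n) a = c (Suc n) a'"
  shows "hv \<eta> n m a = hv \<eta> n m a'"
proof -
  have 1: "idx (g0 + int n + 1) (corner h a) = idx (g0 + int n + 1) (corner h a')"
    using assms(2) by (simp add: c_def add.assoc add.commute[of 1])
  show ?thesis
    unfolding hv_eq c_def using idx_parent[OF 1] haar_sign_cong[OF 1] by simp
qed

text \<open>A Haar function is constant on the children of its cube, hence on atoms as long as
  \<open>n < L\<close>.\<close>

lemma haar_atoms: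
  assumes n: "n < L" and m: "m \<in> c n ` \<Omega>"
  shows "haar \<eta> (cube (g0 + int n) m) x = (\<Sum>a\<in>\<Omega>. (indicator (atom a) x :: real) *\<^sub>R hv \<eta> n m a)"
proof (cases "idx h x \<in> \<Omega>")
  case True
  have "g0 + int n + 1 = g0 + int (Suc n)" by simp
  then have "idx (g0 + int n + 1) x = idx (g0 + int n + 1) (corner h (idx h x))"
    using idx_atom[of x "idx h x" "Suc n"] n by (simp add: c_def add.assoc add.commute[of 1])
  from idx_parent[OF this] haar_sign_cong[OF this]
  have "haar \<eta> (cube (g0 + int n) m) x = hv \<eta> n m (idx h x)"
    unfolding haar_cube hv_def by simp
  then show ?thesis unfolding sum_indicator_atoms using True by simp
next
  case False
  then have "idx (g0 + int n) x \<noteq> m" using idx_mem_\<Omega>[of n _ x] n m by auto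
  then show ?thesis unfolding sum_indicator_atoms using False by (simp add: haar_cube)
qed

lemma sum_hv_cancellative:
  assumes n: "n < L" and j: "\<eta> j" and a: "a \<in> \<Omega>"
  shows "(\<Sum>z\<in>cell n a. hv \<eta> n m z) = 0"
proof (cases "m = c n a")
  case True
  have "cell n a = {z. idx (g0 + int n) (corner h z) = m}"
  proof (intro equalityI subsetI)
    fix z assume "z \<in> {z. idx (g0 + int n) (corner h z) = m}"
    then show "z \<in> cell n a"
      using idx_mem_\<Omega>[of n a "corner h z"] n a True by (simp add: c_def corner_idx)
  qed (auto simp: c_def True)
  then have "(\<Sum>z\<in>cell n a. hv \<eta> n m z) = (\<Sum>z\<in>{z. idx (g0 + int n) (corner h z) = m}. vol (g0 + int n) powr (- 1/2) * haar_sign \<eta> (g0 + int n) (corner h z))"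
    by (intro sum.cong) (auto simp: hv_eq c_def)
  also have "\<dots> = vol (g0 + int n) powr (- 1/2) * (\<Sum>z\<in>{z. idx (g0 + int n) (corner h z) = m}. haar_sign \<eta> (g0 + int n) (corner h z))"
    by (simp add: sum_distrib_left)
  also have "\<dots> = 0" by (subst sum_haar_sign[where \<eta> = \<eta> and j = j]) (use n j in \<open>simp_all add: h_def\<close>)
  finally show ?thesis .
qed (auto simp: hv_eq intro!: sum.neutral)

text \<open>A cancellative Haar function is constant on cells of level \<open>n + 1\<close> and has
  mean zero on cells of level \<open>n\<close>; a non-cancellative one is constant on cells of level
  \<open>n\<close>. In each case the rest of \<open>f\<close> is orthogonal to it.\<close>

lemma sum_hv_proj:
  fixes f :: "int ^ 'n \<Rightarrow> 'x::real_vector"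
  assumes n: "n < L" and \<eta>: "if b then \<exists>j. \<eta> j else \<forall>j. \<not> \<eta> j"
  shows "(\<Sum>a\<in>\<Omega>. hv \<eta> n m a *\<^sub>R f a) = (\<Sum>a\<in>\<Omega>. hv \<eta> n m a *\<^sub>R proj b n f a)"
proof -
  have rem: "(\<Sum>a\<in>\<Omega>. hv \<eta> n m a *\<^sub>R (f a - E l f a)) = 0"
    if "\<And>a a'. c l a = c l a' \<Longrightarrow> hv \<eta> n m a = hv \<eta> n m a'" for l
  proof (rule sum_cells_zero[OF finite_\<Omega>, where c = "c l" and prd = scaleR and a = "hv \<eta> n m" and b = "\<lambda>a. f a - E l f a"])
    show "linear (scaleR r :: 'x \<Rightarrow> 'x)" for r by (rule linear_scaleR)
    show "(\<Sum>z\<in>cell l w. f z - E l f z) = 0" for w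
      using sum_cavg_coarser[OF finite_\<Omega>, where c = "c l" and c' = "c l" and f = f] by (simp add: sum_subtractf)
  qed (rule that)
  show ?thesis
  proof (cases b)
    case True
    then obtain j where j: "\<eta> j" using \<eta> by auto
    have "(\<Sum>a\<in>\<Omega>. hv \<eta> n m a *\<^sub>R E n f a) = 0"
    proof (rule sum_cells_zero[OF finite_\<Omega>, where c = "c n" and prd = "\<lambda>x r. r *\<^sub>R x"])
      show "linear (\<lambda>r. r *\<^sub>R x)" for x :: 'x by (rule linear_scaleR_left)
      show "E n f w = E n f w'" if "c n w = c n w'" for w w' by (rule cavg_cong[where c = "c n", OF that])
    qed (rule sum_hv_cancellative[of n \<eta> j, OF n j])
    moreover have "(\<Sum>a\<in>\<Omega>. hv \<eta> n m a *\<^sub>R (f a - E (Suc n) f a)) = 0"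
      by (rule rem) (rule hv_cong[OF n])
    ultimately show ?thesis using True by (simp add: proj_def scaleR_diff_right sum_subtractf)
  next
    case False
    then have "hv \<eta> n m a = hv \<eta> n m a'" if "c n a = c n a'" for a a'
      using that \<eta> by (simp add: hv_eq haar_sign_noncancellative)
    from rem[OF this] False show ?thesis by (simp add: proj_def scaleR_diff_right sum_subtractf)
  qed
qed

definition avg :: "(real ^ 'n \<Rightarrow> 'x::banach) \<Rightarrow> int ^ 'n \<Rightarrow> 'x" where
  "avg F a = (1 / \<mu>) *\<^sub>R strong_integral lborel (\<lambda>x. indicator (atom a) x *\<^sub>R F x)"

lemma has_strong_integral_atom:
  fixes F :: "real ^ 'n \<Rightarrow> 'x::banach"
  assumes "F \<in> fst (Lp p lborel)" "1 < p"
  shows "has_strong_integral lborel (\<lambda>x. indicator (atom a) x *\<^sub>R F x) (\<mu> *\<^sub>R avg F a)"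
  using has_strong_integral_indicator[OF assms atom_measure(1,3)] \<mu>_pos by (simp add: avg_def)

lemma pairing_haar:
  fixes F :: "real ^ 'n \<Rightarrow> 'x::banach"
  assumes F: "F \<in> fst (Lp p lborel)" "1 < p" and n: "n < L" and m: "m \<in> c n ` \<Omega>"
  shows "pairing F (haar \<eta> (cube (g0 + int n) m)) = \<mu> *\<^sub>R (\<Sum>a\<in>\<Omega>. hv \<eta> n m a *\<^sub>R avg F a)"
proof -
  have "has_strong_integral lborel (\<lambda>x. \<Sum>a\<in>\<Omega>. hv \<eta> n m a *\<^sub>R (indicator (atom a) x *\<^sub>R F x)) (\<Sum>a\<in>\<Omega>. hv \<eta> n m a *\<^sub>R \<mu> *\<^sub>R avg F a)"
    by (intro has_strong_integral_sum has_strong_integral_scaleR has_strong_integral_atom[OF F])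
  moreover have "(\<Sum>a\<in>\<Omega>. hv \<eta> n m a *\<^sub>R (indicator (atom a) x *\<^sub>R F x)) = haar \<eta> (cube (g0 + int n) m) x *\<^sub>R F x" for x
    unfolding haar_atoms[OF n m] by (simp add: scaleR_sum_left mult.commute)
  ultimately show ?thesis
    unfolding pairing_def by (simp add: strong_integral_eqI scaleR_sum_right mult.commute)
qed

lemma avg_sum:
  fixes F :: "'i \<Rightarrow> real ^ 'n \<Rightarrow> 'x::banach"
  assumes "\<And>i. i \<in> I \<Longrightarrow> F i \<in> fst (Lp p lborel)" "1 < p"
  shows "avg (\<lambda>x. \<Sum>i\<in>I. r i *\<^sub>R F i x) a = (\<Sum>i\<in>I. r i *\<^sub>R avg (F i) a)"
proof -
  have "has_strong_integral lborel (\<lambda>x. \<Sum>i\<in>I. r i *\<^sub>R (indicator (atom a) x *\<^sub>R F i x)) (\<Sum>i\<in>I. r i *\<^sub>R \<mu> *\<^sub>R avg (F i) a)"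
    by (intro has_strong_integral_sum has_strong_integral_scaleR has_strong_integral_atom[OF assms])
  moreover have "(\<Sum>i\<in>I. r i *\<^sub>R (indicator (atom a) x *\<^sub>R F i x)) = indicator (atom a) x *\<^sub>R (\<Sum>i\<in>I. r i *\<^sub>R F i x)" for x
    by (simp add: scaleR_sum_right mult.commute)
  ultimately have "strong_integral lborel (\<lambda>x. indicator (atom a) x *\<^sub>R (\<Sum>i\<in>I. r i *\<^sub>R F i x)) = (\<Sum>i\<in>I. r i *\<^sub>R \<mu> *\<^sub>R avg (F i) a)"
    by (simp add: strong_integral_eqI)
  then show ?thesis
    unfolding avg_def[of "\<lambda>x. \<Sum>i\<in>I. r i *\<^sub>R F i x"] using \<mu>_pos by (simp add: scaleR_sum_right)
qed

text \<open>Jensen's inequality on each atom; the atoms are disjoint, so the integrals over them add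
  up to at most the whole. The factor \<open>\<mu> powr (1/p)\<close> turns the counting norm into
  that of a step function.\<close>

lemma avg_bound:
  fixes F :: "real ^ 'n \<Rightarrow> 'x::banach"
  assumes F: "F \<in> fst (Lp p lborel)" and p: "1 < p"
  shows "\<mu> powr (1/p) * lpsum p \<Omega> (\<lambda>a. norm (avg F a)) \<le> Lp_norm p lborel F"
proof -
  have int: "integrable lborel (\<lambda>x. indicator (atom a) x * norm (F x) powr p)" for a
    using integrable_mult_indicator[OF atom_measure(1) Lp_carrierD(2)[OF F]] by simp
  have "\<mu> * (\<Sum>a\<in>\<Omega>. norm (avg F a) powr p) \<le> (\<Sum>a\<in>\<Omega>. \<integral>x. indicator (atom a) x * norm (F x) powr p \<partial>lborel)"
    unfolding sum_distrib_left avg_def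
    by (intro sum_mono average_powr_le[OF F p atom_measure(1,2) \<mu>_pos])
  also have "\<dots> = (\<integral>x. (\<Sum>a\<in>\<Omega>. indicator (atom a) x * norm (F x) powr p) \<partial>lborel)"
    using int by simp
  also have "\<dots> \<le> (\<integral>x. norm (F x) powr p \<partial>lborel)"
  proof (rule integral_mono)
    show "integrable lborel (\<lambda>x. \<Sum>a\<in>\<Omega>. indicator (atom a) x * norm (F x) powr p)" using int by simp
    show "(\<Sum>a\<in>\<Omega>. indicator (atom a) x * norm (F x) powr p) \<le> norm (F x) powr p" for x
      using sum_indicator_atoms[of x "\<lambda>_. norm (F x) powr p"] by simp
  qed (rule Lp_carrierD(2)[OF F])
  finally have "(\<mu> * (\<Sum>a\<in>\<Omega>. norm (avg F a) powr p)) powr (1/p) \<le> (\<integral>x. norm (F x) powr p \<partial>lborel) powr (1/p)"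
    using p \<mu>_pos by (intro powr_mono2) (auto intro!: mult_nonneg_nonneg sum_nonneg)
  then show ?thesis using \<mu>_pos by (simp add: powr_mult sum_nonneg lpsum_def Lp_norm_def)
qed

section \<open>Step functions and densities of functionals\<close>

definition step :: "(int ^ 'n \<Rightarrow> 'x::real_vector) \<Rightarrow> real ^ 'n \<Rightarrow> 'x" where
  "step v x = (\<Sum>a\<in>\<Omega>. (indicator (atom a) x :: real) *\<^sub>R v a)"

lemma step_add: "step (\<lambda>a. v a + w a) = step v + step w"
  by (auto simp: step_def plus_fun_def scaleR_add_right sum.distrib)

lemma step_scaleR: "step (\<lambda>a. r *\<^sub>R v a) = r *\<^sub>R step v"
  by (auto simp: step_def scaleR_fun_def scaleR_sum_right mult.commute)

lemma step_Lp:
  fixes v :: "int ^ 'n \<Rightarrow> 'x::banach"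
  assumes p: "0 < p"
  shows "step v \<in> fst (Lp p lborel)" "Lp_norm p lborel (step v) = \<mu> powr (1/p) * lpsum p \<Omega> (\<lambda>a. norm (v a))"
proof -
  have pw: "norm (step v x) powr p = (\<Sum>a\<in>\<Omega>. indicator (atom a) x * norm (v a) powr p)" for x
    using sum_indicator_atoms[of x v] sum_indicator_atoms[of x "\<lambda>a. norm (v a) powr p"] p by (simp add: step_def)
  have ia: "has_bochner_integral lborel (indicator (atom a) :: _ \<Rightarrow> real) \<mu>" for a
    using has_bochner_integral_real_indicator[OF atom_measure(1,3), of a] by (simp add: atom_def measure_cube \<mu>_def)
  have hb: "has_bochner_integral lborel (\<lambda>x. norm (step v x) powr p) (\<Sum>a\<in>\<Omega>. \<mu> * norm (v a) powr p)"
    unfolding pw by (intro has_bochner_integral_sum has_bochner_integral_mult_left ia)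
  have "simple_function lborel (\<lambda>x. (indicator (atom a) x :: real) *\<^sub>R v a)" for a
    by (intro simple_function_compose1[OF simple_function_indicator[OF atom_measure(1)], where g = "\<lambda>r. r *\<^sub>R v a"])
  note sm = simple_function_strongly_measurable[OF this]
  have "strongly_measurable lborel (\<lambda>x. \<Sum>a\<in>A. (indicator (atom a) x :: real) *\<^sub>R v a)" if "finite A" for A
    using that
  proof (induction A)
    case empty
    show ?case using simple_function_strongly_measurable[of lborel "\<lambda>_. 0 :: 'x"] by simp
  next
    case (insert a A)
    show ?case unfolding sum.insert[OF insert.hyps] by (rule strongly_measurable_add[OF sm insert.IH])
  qed
  from this[OF finite_\<Omega>] have "strongly_measurable lborel (step v)" by (simp add: step_def[abs_def])
  then show "step v \<in> fst (Lp p lborel)" using hb by (simp add: Lp_def has_bochner_integral_iff)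
  show "Lp_norm p lborel (step v) = \<mu> powr (1/p) * lpsum p \<Omega> (\<lambda>a. norm (v a))"
    using hb \<mu>_pos unfolding Lp_norm_def lpsum_def
    by (simp add: has_bochner_integral_iff sum_distrib_left[symmetric] powr_mult sum_nonneg)
qed

lemma dual_step_bound:
  fixes \<phi> :: "(real ^ 'n \<Rightarrow> 'y::banach) \<Rightarrow> real"
  assumes \<phi>: "\<phi> \<in> fst (dual (Lp s lborel))" and s: "0 < s"
  shows "\<bar>\<phi> (step v)\<bar> \<le> dual_norm (Lp s lborel) \<phi> * (\<mu> powr (1/s) * lpsum s \<Omega> (\<lambda>a. norm (v a)))"
proof -
  have "\<bar>\<phi> (step v)\<bar> \<le> dual_norm (Lp s lborel) \<phi> * Lp_norm s lborel (step v)"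
  proof (rule dual_norm_le[OF \<phi> step_Lp(1)[OF s]])
    fix r
    show "r *\<^sub>R step v \<in> fst (Lp s lborel)" unfolding step_scaleR[symmetric] by (rule step_Lp(1)[OF s])
    show "Lp_norm s lborel (r *\<^sub>R step v) = \<bar>r\<bar> * Lp_norm s lborel (step v)"
      unfolding step_scaleR[symmetric] step_Lp(2)[OF s] by (simp add: lpsum_cmult[OF s])
  qed
  then show ?thesis unfolding step_Lp(2)[OF s] .
qed

text \<open>The density of a functional restricted to step functions: the functional is applied to
  \<open>v\<close> times the indicator of the atom and the result divided by the measure of the
  atom. It takes the place of a representation of the whole dual space.\<close>

definition dens :: "((real ^ 'n \<Rightarrow> 'y::banach) \<Rightarrow> real) \<Rightarrow> int ^ 'n \<Rightarrow> 'y \<Rightarrow>\<^sub>L real" where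
  "dens \<phi> a = Blinfun (\<lambda>v. \<phi> (step (\<lambda>b. if b = a then v else 0)) / \<mu>)"

lemma dens_apply:
  fixes \<phi> :: "(real ^ 'n \<Rightarrow> 'y::banach) \<Rightarrow> real"
  assumes \<phi>: "\<phi> \<in> fst (dual (Lp s lborel))" and s: "0 < s"
  shows "dens \<phi> a v = \<phi> (step (\<lambda>b. if b = a then v else 0)) / \<mu>"
proof -
  let ?e = "\<lambda>v b. if b = a then v else (0 :: 'y)"
  have "bounded_linear (\<lambda>v. \<phi> (step (?e v)) / \<mu>)"
  proof (rule bounded_linear_intro)
    fix v w :: 'y
    have "step (?e (v + w)) = step (?e v) + step (?e w)"
      unfolding step_add[symmetric] by (rule arg_cong[of _ _ step]) auto
    then show "\<phi> (step (?e (v + w))) / \<mu> = \<phi> (step (?e v)) / \<mu> + \<phi> (step (?e w)) / \<mu>"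
      by (simp add: dualD(1)[OF \<phi> step_Lp(1)[OF s] step_Lp(1)[OF s]] add_divide_distrib)
  next
    fix r and v :: 'y
    have "step (?e (r *\<^sub>R v)) = r *\<^sub>R step (?e v)"
      unfolding step_scaleR[symmetric] by (rule arg_cong[of _ _ step]) auto
    then show "\<phi> (step (?e (r *\<^sub>R v))) / \<mu> = r *\<^sub>R (\<phi> (step (?e v)) / \<mu>)"
      by (simp add: dualD(2)[OF \<phi> step_Lp(1)[OF s]])
  next
    fix v :: 'y
    have "lpsum s \<Omega> (\<lambda>b. norm (?e v b)) = lpsum s \<Omega> (\<lambda>b. norm v * (if b = a then 1 else 0))"
      unfolding lpsum_def by (intro arg_cong[of _ _ "\<lambda>t. t powr (1/s)"] sum.cong) auto
    also have "\<dots> = norm v * lpsum s \<Omega> (\<lambda>b. if b = a then 1 else 0)" by (rule lpsum_cmult[OF s]) auto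
    finally show "norm (\<phi> (step (?e v)) / \<mu>) \<le> norm v * (dual_norm (Lp s lborel) \<phi> * \<mu> powr (1/s) * lpsum s \<Omega> (\<lambda>b. if b = a then 1 else 0) / \<mu>)"
      using dual_step_bound[OF \<phi> s, of "?e v"] \<mu>_pos by (simp add: divide_right_mono mult_ac)
  qed
  then show ?thesis by (simp add: dens_def bounded_linear_Blinfun_apply)
qed

lemma dual_step:
  fixes \<phi> :: "(real ^ 'n \<Rightarrow> 'y::banach) \<Rightarrow> real"
  assumes \<phi>: "\<phi> \<in> fst (dual (Lp s lborel))" and s: "0 < s"
  shows "\<phi> (step v) = \<mu> * (\<Sum>a\<in>\<Omega>. dens \<phi> a (v a))"
proof -
  have z: "\<phi> (step (\<lambda>_. 0)) = 0" using dualD(2)[OF \<phi> step_Lp(1)[OF s, of "\<lambda>_. 0"], of 0] step_scaleR[of 0 "\<lambda>_. 0 :: 'y"] by simp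
  have "\<phi> (step (\<lambda>b. if b \<in> A then v b else 0)) = (\<Sum>a\<in>A. \<phi> (step (\<lambda>b. if b = a then v a else 0)))" if "finite A" for A
    using that
  proof (induction A)
    case empty
    then show ?case using z by simp
  next
    case (insert a A)
    have "step (\<lambda>b. if b \<in> insert a A then v b else 0) = step (\<lambda>b. if b = a then v a else 0) + step (\<lambda>b. if b \<in> A then v b else 0)"
      unfolding step_add[symmetric] by (rule arg_cong[of _ _ step]) (use insert.hyps in auto)
    then show ?case
      unfolding sum.insert[OF insert.hyps] insert.IH[symmetric] by (simp only: dualD(1)[OF \<phi> step_Lp(1)[OF s] step_Lp(1)[OF s]])
  qed
  from this[OF finite_\<Omega>] have "\<phi> (step (\<lambda>b. if b \<in> \<Omega> then v b else 0)) = \<mu> * (\<Sum>a\<in>\<Omega>. dens \<phi> a (v a))"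
    using \<mu>_pos by (simp add: dens_apply[OF \<phi> s] sum_distrib_left)
  moreover have "step (\<lambda>b. if b \<in> \<Omega> then v b else 0) = step v" by (auto simp: step_def)
  ultimately show ?thesis by simp
qed

text \<open>The density is tested against step functions through the converse of Hoelder's
  inequality, which costs the factor 2. The powers of \<open>\<mu>\<close> combine to
  \<open>\<mu>\<close>, the exponents being conjugate.\<close>

lemma dens_bound:
  fixes \<phi> :: "(real ^ 'n \<Rightarrow> 'y::banach) \<Rightarrow> real"
  assumes \<phi>: "\<phi> \<in> fst (dual (Lp s lborel))" and ps: "1 < p" "1 < s" "1/p + 1/s = 1" and nn: "0 \<le> dual_norm (Lp s lborel) \<phi>"
  shows "\<mu> powr (1/p) * lpsum p \<Omega> (\<lambda>a. norm (dens \<phi> a)) \<le> 2 * dual_norm (Lp s lborel) \<phi>"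
proof -
  have s: "0 < s" using ps by simp
  have "(\<Sum>a\<in>\<Omega>. dens \<phi> a (v a)) \<le> (dual_norm (Lp s lborel) \<phi> * \<mu> powr (1/s) / \<mu>) * lpsum s \<Omega> (\<lambda>a. norm (v a))" for v
  proof -
    have "\<mu> * (\<Sum>a\<in>\<Omega>. dens \<phi> a (v a)) \<le> dual_norm (Lp s lborel) \<phi> * (\<mu> powr (1/s) * lpsum s \<Omega> (\<lambda>a. norm (v a)))"
      using dual_step_bound[OF \<phi> s, of v] unfolding dual_step[OF \<phi> s] by linarith
    then show ?thesis using \<mu>_pos by (simp add: field_simps)
  qed
  from dual_norming[OF finite_\<Omega> ps _ this]
  have "lpsum p \<Omega> (\<lambda>a. norm (dens \<phi> a)) \<le> 2 * (dual_norm (Lp s lborel) \<phi> * \<mu> powr (1/s) / \<mu>)"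
    using nn \<mu>_pos by simp
  then have "\<mu> powr (1/p) * lpsum p \<Omega> (\<lambda>a. norm (dens \<phi> a)) \<le> \<mu> powr (1/p) * (2 * (dual_norm (Lp s lborel) \<phi> * \<mu> powr (1/s) / \<mu>))"
    by (rule mult_left_mono) simp
  also have "\<dots> = 2 * dual_norm (Lp s lborel) \<phi> * (\<mu> powr (1/p) * \<mu> powr (1/s)) / \<mu>" by (simp add: mult_ac)
  also have "\<mu> powr (1/p) * \<mu> powr (1/s) = \<mu>" using \<mu>_pos ps(3) by (simp flip: powr_add)
  finally show ?thesis using \<mu>_pos by simp
qed

end

text \<open>The non-cancellative slot may vary over the family, but the terms are nonnegative, so
  all three positions can be summed; this costs the factor 3.\<close>

lemma (in levels) dyadic_estimate_mixed:
  fixes f1 :: "'i \<times> 'i \<Rightarrow> 'a \<Rightarrow> 'x::real_normed_vector"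
    and f2 :: "'i \<times> 'i \<Rightarrow> 'a \<Rightarrow> 'y::real_normed_vector"
    and f3 :: "'i \<times> 'i \<Rightarrow> 'a \<Rightarrow> 'z::real_normed_vector"
  assumes p: "1 < p" "1 < q" "1 < r" "1/p + 1/q + 1/r = 1"
    and umd: "umd_fin TYPE('x) p \<beta>1" "umd_fin TYPE('y) q \<beta>2" "umd_fin TYPE('z) r \<beta>3"
    and al: "alpha_full_le TYPE('x) K1" "alpha_full_le TYPE('y) K2" "alpha_full_le TYPE('z) K3"
    and rh: "rhat_bd R \<T>" and ne: "\<T> \<noteq> {}"
    and lin: "\<forall>\<phi>\<in>\<T>. \<forall>y z. linear (\<lambda>x. \<phi> x y z)" "\<forall>\<phi>\<in>\<T>. \<forall>x z. linear (\<lambda>y. \<phi> x y z)"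
      "\<forall>\<phi>\<in>\<T>. \<forall>x y. linear (\<phi> x y)"
    and I: "finite I" and k: "k1 \<le> k" "k2 \<le> k" "k3 \<le> k" and N: "N + k \<le> L"
    and \<Phi>: "\<forall>n b t u v y1 y2 y3. \<Phi> n b t u v y1 y2 y3 \<in> \<T>"
    and i0: "\<And>t u v. t \<in> I \<Longrightarrow> u \<in> I \<Longrightarrow> v \<in> I \<Longrightarrow> i0 t u v \<in> {1, 2, 3 :: nat}"
  defines "F1 \<equiv> \<Sum>x\<in>\<Omega>. rad (I \<times> I) (\<lambda>\<delta>. norm (\<Sum>j\<in>I \<times> I. \<delta> j *\<^sub>R f1 j x) powr p)"
    and "F2 \<equiv> \<Sum>x\<in>\<Omega>. rad (I \<times> I) (\<lambda>\<delta>. norm (\<Sum>j\<in>I \<times> I. \<delta> j *\<^sub>R f2 j x) powr q)"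
    and "F3 \<equiv> \<Sum>x\<in>\<Omega>. rad (I \<times> I) (\<lambda>\<delta>. norm (\<Sum>j\<in>I \<times> I. \<delta> j *\<^sub>R f3 j x) powr r)"
  shows "(\<Sum>t\<in>I. \<Sum>u\<in>I. \<Sum>v\<in>I. \<Sum>n<N. \<Sum>x\<in>\<Omega>. kav n x (\<lambda>y1 y2 y3.
      \<bar>\<Phi> n (c n x) t u v y1 y2 y3 (proj (i0 t u v \<noteq> 1) (n + k1) (f1 (t, u)) y1)
        (proj (i0 t u v \<noteq> 2) (n + k2) (f2 (u, v)) y2) (proj (i0 t u v \<noteq> 3) (n + k3) (f3 (t, v)) y3)\<bar>))
    \<le> 3 * ((1 + real k) * (R * (slot_total K1 \<beta>1 p * slot_total K2 \<beta>2 q * slot_total K3 \<beta>3 r *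
         (F1 powr (1/p) * F2 powr (1/q) * F3 powr (1/r)))))"
    (is "_ \<le> 3 * ?B")
proof -
  define X where "X i n t u v = (\<Sum>x\<in>\<Omega>. kav n x (\<lambda>y1 y2 y3.
      \<bar>\<Phi> n (c n x) t u v y1 y2 y3 (proj (i \<noteq> 1) (n + k1) (f1 (t, u)) y1)
        (proj (i \<noteq> 2) (n + k2) (f2 (u, v)) y2) (proj (i \<noteq> 3) (n + k3) (f3 (t, v)) y3)\<bar>))" for i :: nat and n t u v
  have X: "0 \<le> X i n t u v" for i n t u v
    unfolding X_def by (intro sum_nonneg kav_nonneg) simp
  have "(\<Sum>t\<in>I. \<Sum>u\<in>I. \<Sum>v\<in>I. \<Sum>n<N. X (i0 t u v) n t u v) \<le> (\<Sum>t\<in>I. \<Sum>u\<in>I. \<Sum>v\<in>I. \<Sum>n<N. \<Sum>i\<in>{1, 2, 3}. X i n t u v)"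
  proof (intro sum_mono)
    fix t u v n assume "t \<in> I" "u \<in> I" "v \<in> I"
    then show "X (i0 t u v) n t u v \<le> (\<Sum>i\<in>{1, 2, 3}. X i n t u v)"
      by (intro member_le_sum i0 X) auto
  qed
  also have "\<dots> = (\<Sum>i\<in>{1, 2, 3}. \<Sum>n<N. \<Sum>t\<in>I. \<Sum>u\<in>I. \<Sum>v\<in>I. X i n t u v)"
  proof -
    have "(\<Sum>v\<in>I. \<Sum>n<N. \<Sum>i\<in>{1, 2, 3}. X i n t u v) = (\<Sum>i\<in>{1, 2, 3}. \<Sum>n<N. \<Sum>v\<in>I. X i n t u v)" for t u
      by (subst sum.swap, subst (2) sum.swap, subst sum.swap) (rule refl)
    then have "(\<Sum>u\<in>I. \<Sum>v\<in>I. \<Sum>n<N. \<Sum>i\<in>{1, 2, 3}. X i n t u v) = (\<Sum>i\<in>{1, 2, 3}. \<Sum>n<N. \<Sum>u\<in>I. \<Sum>v\<in>I. X i n t u v)" for t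
      by (simp only:) (subst sum.swap, subst (2) sum.swap, rule refl)
    then show ?thesis
      by (simp only:) (subst sum.swap, subst (2) sum.swap, rule refl)
  qed
  also have "\<dots> \<le> (\<Sum>i\<in>{1, 2, 3 :: nat}. ?B)"
  proof (rule sum_mono)
    fix i :: nat assume i: "i \<in> {1, 2, 3}"
    show "(\<Sum>n<N. \<Sum>t\<in>I. \<Sum>u\<in>I. \<Sum>v\<in>I. X i n t u v) \<le> ?B"
      unfolding X_def F1_def F2_def F3_def
      by (rule dyadic_estimate_slots[where \<T> = \<T> and \<Phi> = \<Phi>, OF p umd al rh ne lin I k N \<Phi> i])
  qed
  finally show ?thesis by (simp add: X_def)
qed

text \<open>The sum over \<open>x\<close> undoes the average over the first point, which thereby
  becomes the base point.\<close>

lemma (in levels) sum_kav_base: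
  "(\<Sum>x\<in>\<Omega>. kav n x (F (c n x))) = (\<Sum>y1\<in>\<Omega>. (\<Sum>y2\<in>cell n y1. \<Sum>y3\<in>cell n y1. F (c n y1) y1 y2 y3) / card (cell n y1) ^ 2)"
proof -
  define H where "H y1 = (\<Sum>y2\<in>cell n y1. \<Sum>y3\<in>cell n y1. F (c n y1) y1 y2 y3) / card (cell n y1) ^ 2" for y1
  have "kav n x (F (c n x)) = E n H x" for x
  proof -
    have "H y1 = (\<Sum>y2\<in>cell n x. \<Sum>y3\<in>cell n x. F (c n x) y1 y2 y3) / card (cell n x) ^ 2" if "y1 \<in> cell n x" for y1
      unfolding H_def using that by simp
    then have "(\<Sum>y1\<in>cell n x. H y1) = (\<Sum>y1\<in>cell n x. (\<Sum>y2\<in>cell n x. \<Sum>y3\<in>cell n x. F (c n x) y1 y2 y3) / card (cell n x) ^ 2)"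
      by (rule sum.cong[OF refl])
    then show ?thesis by (simp add: kav_def cavg_def sum_divide_distrib[symmetric] power3_eq_cube power2_eq_square)
  qed
  then have "(\<Sum>x\<in>\<Omega>. kav n x (F (c n x))) = (\<Sum>x\<in>\<Omega>. E n H x)" by simp
  also have "\<dots> = (\<Sum>x\<in>\<Omega>. H x)" using sum_cavg_saturated[OF fin, of \<Omega> "c n" H] by simp
  finally show ?thesis by (simp add: H_def)
qed

lemma is_seminorm_lpsum:
  assumes p: "1 < p" and S: "finite S"
  shows "is_seminorm (\<lambda>F :: 'a \<Rightarrow> 'x::real_normed_vector. lpsum p S (\<lambda>x. norm (F x)))"
  unfolding is_seminorm_def
proof (intro conjI allI)
  fix F G :: "'a \<Rightarrow> 'x"
  have "lpsum p S (\<lambda>x. norm ((F + G) x)) \<le> lpsum p S (\<lambda>x. norm (F x) + norm (G x))"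
    using p by (intro lpsum_mono) (auto simp: plus_fun_def norm_triangle_ineq)
  also have "\<dots> \<le> lpsum p S (\<lambda>x. norm (F x)) + lpsum p S (\<lambda>x. norm (G x))"
    by (rule Minkowski[OF p S]) auto
  finally show "lpsum p S (\<lambda>x. norm ((F + G) x)) \<le> lpsum p S (\<lambda>x. norm (F x)) + lpsum p S (\<lambda>x. norm (G x))" .
next
  fix r and F :: "'a \<Rightarrow> 'x"
  show "lpsum p S (\<lambda>x. norm ((r *\<^sub>R F) x)) = \<bar>r\<bar> * lpsum p S (\<lambda>x. norm (F x))"
    unfolding scaleR_fun_def norm_scaleR by (rule lpsum_cmult) (use p in auto)
qed

lemma sum_scaleR_fun_apply: "(\<Sum>j\<in>J. r j *\<^sub>R f j) x = (\<Sum>j\<in>J. r j *\<^sub>R f j x)"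
  by (induction J rule: infinite_finite_induct) (auto simp: scaleR_fun_def zero_fun_def plus_fun_def)

text \<open>Summed over the points, the \<open>p\<close>-th moments become the \<open>p\<close>-th
  moment of an l^p seminorm of functions, to which the upper Khinchine-Kahane inequality
  applies.\<close>

lemma Kahane_Lp:
  fixes f :: "'i \<Rightarrow> 'a \<Rightarrow> 'x::real_normed_vector"
  assumes p: "1 < p" and S: "finite S" and J: "finite J" and \<mu>: "0 < \<mu>"
    and B: "\<And>\<delta>. \<mu> powr (1/p) * lpsum p S (\<lambda>x. norm (\<Sum>j\<in>J. \<delta> j *\<^sub>R f j x)) \<le> B \<delta>"
  shows "(\<mu> * (\<Sum>x\<in>S. rad J (\<lambda>\<delta>. norm (\<Sum>j\<in>J. \<delta> j *\<^sub>R f j x) powr p))) powr (1/p)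
    \<le> (2 * real (nat \<lceil>p\<rceil>)) * sqrt (rad J (\<lambda>\<delta>. (B \<delta>)\<^sup>2))"
proof -
  let ?q = "\<lambda>F :: 'a \<Rightarrow> 'x. lpsum p S (\<lambda>x. norm (F x))"
  let ?Q = "\<lambda>\<delta>. ?q (\<Sum>j\<in>J. \<delta> j *\<^sub>R f j)"
  have Q: "?Q \<delta> = lpsum p S (\<lambda>x. norm (\<Sum>j\<in>J. \<delta> j *\<^sub>R f j x))" for \<delta>
    by (simp add: sum_scaleR_fun_apply)
  have r0: "0 \<le> rad J (\<lambda>\<delta>. (?Q \<delta>)\<^sup>2)" by (intro rad_nonneg) simp
  have "(\<Sum>x\<in>S. rad J (\<lambda>\<delta>. norm (\<Sum>j\<in>J. \<delta> j *\<^sub>R f j x) powr p)) = rad J (\<lambda>\<delta>. ?Q \<delta> powr p)"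
    unfolding Q using p by (simp add: lpsum_powr rad_sum)
  also have "\<dots> \<le> (2 * real (nat \<lceil>p\<rceil>)) powr p * rad J (\<lambda>\<delta>. (?Q \<delta>)\<^sup>2) powr (p / 2)"
    by (rule Khinchine_Kahane_upper[OF is_seminorm_lpsum[OF p S] p J])
  finally have "\<mu> * (\<Sum>x\<in>S. rad J (\<lambda>\<delta>. norm (\<Sum>j\<in>J. \<delta> j *\<^sub>R f j x) powr p))
      \<le> \<mu> * ((2 * real (nat \<lceil>p\<rceil>)) powr p * rad J (\<lambda>\<delta>. (?Q \<delta>)\<^sup>2) powr (p / 2))"
    using \<mu> by (intro mult_left_mono) auto
  then have "(\<mu> * (\<Sum>x\<in>S. rad J (\<lambda>\<delta>. norm (\<Sum>j\<in>J. \<delta> j *\<^sub>R f j x) powr p))) powr (1/p)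
      \<le> (\<mu> * ((2 * real (nat \<lceil>p\<rceil>)) powr p * rad J (\<lambda>\<delta>. (?Q \<delta>)\<^sup>2) powr (p / 2))) powr (1/p)"
    using \<mu> p by (intro powr_mono2 mult_nonneg_nonneg sum_nonneg rad_nonneg) auto
  also have "\<dots> = 2 * real (nat \<lceil>p\<rceil>) * (\<mu> powr (1/p) * sqrt (rad J (\<lambda>\<delta>. (?Q \<delta>)\<^sup>2)))"
    using \<mu> p r0 by (simp add: powr_mult powr_powr powr_half_sqrt)
  also have "\<mu> powr (1/p) * sqrt (rad J (\<lambda>\<delta>. (?Q \<delta>)\<^sup>2)) = sqrt (rad J (\<lambda>\<delta>. (\<mu> powr (1/p) * ?Q \<delta>)\<^sup>2))"
    by (simp add: power_mult_distrib rad_cmult real_sqrt_mult)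
  also have "2 * real (nat \<lceil>p\<rceil>) * \<dots> \<le> (2 * real (nat \<lceil>p\<rceil>)) * sqrt (rad J (\<lambda>\<delta>. (B \<delta>)\<^sup>2))"
    using B unfolding Q by (intro mult_left_mono real_sqrt_le_mono rad_mono power_mono mult_nonneg_nonneg) auto
  finally show ?thesis .
qed

section \<open>Shifts as trilinear forms\<close>

context dyadic_model
begin

lemma shift_index_cubes:
  assumes \<D>: "\<D> = {cube g m | g m. True}" and \<tau>: "(cube (g0 + int n) m, I1, I2, I3) \<in> shift_index \<D> k1 k2 k3"
  obtains m1 m2 m3 where
    "I1 = cube (g0 + int (n + k1)) m1" "idx (g0 + int n) (corner (g0 + int (n + k1)) m1) = m"
    "I2 = cube (g0 + int (n + k2)) m2" "idx (g0 + int n) (corner (g0 + int (n + k2)) m2) = m"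
    "I3 = cube (g0 + int (n + k3)) m3" "idx (g0 + int n) (corner (g0 + int (n + k3)) m3) = m"
proof -
  have *: "\<exists>m'. I = cube (g0 + int (n + k)) m' \<and> idx (g0 + int n) (corner (g0 + int (n + k)) m') = m"
    if mem: "I \<in> \<D>" and anc: "ancestor \<D> k I = cube (g0 + int n) m" for I k
  proof -
    obtain g m' where I: "I = cube g m'" using mem \<D> by auto
    have "cube (g - int k) (idx (g - int k) (corner g m')) = cube (g0 + int n) m"
      using anc unfolding I ancestor_cube[OF \<D>] .
    then have "g - int k = g0 + int n" "idx (g - int k) (corner g m') = m" by (auto simp: cube_inj)
    moreover from this have "g = g0 + int (n + k)" by simp
    ultimately show ?thesis using I by auto
  qed
  have "I1 \<in> \<D>" "I2 \<in> \<D>" "I3 \<in> \<D>" "ancestor \<D> k1 I1 = cube (g0 + int n) m"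
    "ancestor \<D> k2 I2 = cube (g0 + int n) m" "ancestor \<D> k3 I3 = cube (g0 + int n) m"
    using \<tau> by (auto simp: shift_index_def)
  then show ?thesis using *[of I1 k1] *[of I2 k2] *[of I3 k3] that by blast
qed

lemma descendant_mem:
  assumes n: "n + k \<le> L" and m: "m \<in> c n ` \<Omega>" and m': "idx (g0 + int n) (corner (g0 + int (n + k)) m') = m"
  shows "m' \<in> c (n + k) ` \<Omega>"
proof -
  let ?x = "corner (g0 + int (n + k)) m'"
  obtain a where a: "a \<in> \<Omega>" "m = c n a" using m by auto
  have "idx h ?x \<in> \<Omega>" by (rule idx_mem_\<Omega>[of n a]) (use n a m' in auto)
  moreover have "c (n + k) (idx h ?x) = m'"
    using idx_atom[of ?x "idx h ?x" "n + k"] n corner_idx[of "g0 + int (n + k)" m'] by simp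
  ultimately show ?thesis by (intro image_eqI[of _ _ "idx h ?x"]) simp_all
qed

lemma descendant_coarse:
  assumes m': "idx (g0 + int n) (corner (g0 + int (n + k)) m') = m" and y: "c (n + k) y = m'"
  shows "c n y = m"
proof -
  have "idx (g0 + int (n + k)) (corner h y) = idx (g0 + int (n + k)) (corner (g0 + int (n + k)) m')"
    using y by (simp only: corner_idx c_def)
  then have "idx (g0 + int n) (corner h y) = idx (g0 + int n) (corner (g0 + int (n + k)) m')"
    by (rule idx_coarser) simp
  then show ?thesis using m' by (simp add: c_def)
qed

lemma hv_abs: "\<bar>hv \<eta> n m a\<bar> = (if c n a = m then vol (g0 + int n) powr (- 1/2) else 0)"
  by (simp add: hv_eq abs_mult haar_sign_abs)

text \<open>Both pairings and the functional are expanded over atoms. Only the moduli of the Haar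
  values survive, and these are constant on the cubes; the factor \<open>\<mu>\<^sup>2\<close> stems
  from the two pairings.\<close>

lemma coefficient_bound:
  fixes A :: "'x1::banach \<Rightarrow> 'x2::banach \<Rightarrow> 'y3::banach" and g :: "int ^ 'n \<Rightarrow> 'y3 \<Rightarrow>\<^sub>L real"
    and F1 :: "real ^ 'n \<Rightarrow> 'x1" and F2 :: "real ^ 'n \<Rightarrow> 'x2"
  assumes A: "bounded_bilinear A" and F: "F1 \<in> fst (Lp p1 lborel)" "1 < p1" "F2 \<in> fst (Lp p2 lborel)" "1 < p2"
    and n: "n1 < L" "n2 < L" "n3 < L" and m: "m1 \<in> c n1 ` \<Omega>" "m2 \<in> c n2 ` \<Omega>"
    and \<eta>: "if b1 then \<exists>j. \<eta>1 j else \<forall>j. \<not> \<eta>1 j" "if b2 then \<exists>j. \<eta>2 j else \<forall>j. \<not> \<eta>2 j" "if b3 then \<exists>j. \<eta>3 j else \<forall>j. \<not> \<eta>3 j"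
  shows "\<bar>blinfun_apply (\<Sum>a\<in>\<Omega>. hv \<eta>3 n3 m3 a *\<^sub>R g a)
        (A (pairing F1 (haar \<eta>1 (cube (g0 + int n1) m1))) (pairing F2 (haar \<eta>2 (cube (g0 + int n2) m2))))\<bar>
    \<le> (\<Sum>y1\<in>\<Omega>. \<Sum>y2\<in>\<Omega>. \<Sum>y3\<in>\<Omega>. if c n1 y1 = m1 \<and> c n2 y2 = m2 \<and> c n3 y3 = m3 then
        \<mu>\<^sup>2 * (vol (g0 + int n1) powr (- 1/2) * vol (g0 + int n2) powr (- 1/2) * vol (g0 + int n3) powr (- 1/2)) *
        \<bar>proj b3 n3 g y3 (A (proj b1 n1 (avg F1) y1) (proj b2 n2 (avg F2) y2))\<bar> else 0)"
proof -
  interpret A: bounded_bilinear A by (rule A)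
  let ?P1 = "proj b1 n1 (avg F1)" and ?P2 = "proj b2 n2 (avg F2)" and ?P3 = "proj b3 n3 g"
  have e1: "blinfun_apply (\<Sum>a\<in>\<Omega>. hv \<eta>3 n3 m3 a *\<^sub>R g a)
        (A (pairing F1 (haar \<eta>1 (cube (g0 + int n1) m1))) (pairing F2 (haar \<eta>2 (cube (g0 + int n2) m2))))
      = blinfun_apply (\<Sum>y3\<in>\<Omega>. hv \<eta>3 n3 m3 y3 *\<^sub>R ?P3 y3)
        (A (\<mu> *\<^sub>R (\<Sum>y1\<in>\<Omega>. hv \<eta>1 n1 m1 y1 *\<^sub>R ?P1 y1)) (\<mu> *\<^sub>R (\<Sum>y2\<in>\<Omega>. hv \<eta>2 n2 m2 y2 *\<^sub>R ?P2 y2)))"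
    by (simp only: pairing_haar[OF F(1,2) n(1) m(1)] pairing_haar[OF F(3,4) n(2) m(2)]
      sum_hv_proj[OF n(1) \<eta>(1), of _ "avg F1"] sum_hv_proj[OF n(2) \<eta>(2), of _ "avg F2"] sum_hv_proj[OF n(3) \<eta>(3), of _ g])
  have e2: "blinfun_apply (\<Sum>y3\<in>\<Omega>. hv \<eta>3 n3 m3 y3 *\<^sub>R ?P3 y3)
        (A (\<mu> *\<^sub>R (\<Sum>y1\<in>\<Omega>. hv \<eta>1 n1 m1 y1 *\<^sub>R ?P1 y1)) (\<mu> *\<^sub>R (\<Sum>y2\<in>\<Omega>. hv \<eta>2 n2 m2 y2 *\<^sub>R ?P2 y2)))
      = (\<Sum>y1\<in>\<Omega>. \<Sum>y2\<in>\<Omega>. \<Sum>y3\<in>\<Omega>. \<mu>\<^sup>2 * (hv \<eta>1 n1 m1 y1 * hv \<eta>2 n2 m2 y2 * hv \<eta>3 n3 m3 y3) * ?P3 y3 (A (?P1 y1) (?P2 y2)))"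
  proof -
    have Aeq: "A (\<mu> *\<^sub>R (\<Sum>y1\<in>\<Omega>. hv \<eta>1 n1 m1 y1 *\<^sub>R ?P1 y1)) (\<mu> *\<^sub>R (\<Sum>y2\<in>\<Omega>. hv \<eta>2 n2 m2 y2 *\<^sub>R ?P2 y2))
        = (\<Sum>y1\<in>\<Omega>. \<Sum>y2\<in>\<Omega>. (\<mu>\<^sup>2 * hv \<eta>1 n1 m1 y1 * hv \<eta>2 n2 m2 y2) *\<^sub>R A (?P1 y1) (?P2 y2))"
      by (simp only: A.scaleR_left A.sum_left, simp only: A.scaleR_right A.sum_right scaleR_sum_right scaleR_scaleR)
        (intro sum.cong refl arg_cong2[where f = scaleR], simp add: power2_eq_square mult_ac)
    show ?thesis
      by (simp only: Aeq, simp only: blinfun.sum_right blinfun.scaleR_right, simp only: blinfun.sum_left blinfun.scaleR_left real_scaleR_def sum_distrib_left)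
        (intro sum.cong refl, simp add: mult_ac)
  qed
  have e3: "\<bar>\<Sum>y1\<in>\<Omega>. \<Sum>y2\<in>\<Omega>. \<Sum>y3\<in>\<Omega>. \<mu>\<^sup>2 * (hv \<eta>1 n1 m1 y1 * hv \<eta>2 n2 m2 y2 * hv \<eta>3 n3 m3 y3) * ?P3 y3 (A (?P1 y1) (?P2 y2))\<bar> \<le> (\<Sum>y1\<in>\<Omega>. \<Sum>y2\<in>\<Omega>. \<Sum>y3\<in>\<Omega>. \<bar>\<mu>\<^sup>2 * (hv \<eta>1 n1 m1 y1 * hv \<eta>2 n2 m2 y2 * hv \<eta>3 n3 m3 y3) * ?P3 y3 (A (?P1 y1) (?P2 y2))\<bar>)"
    by (rule order_trans[OF sum_abs], rule sum_mono, rule order_trans[OF sum_abs], rule sum_mono, rule sum_abs)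
  show ?thesis
    unfolding e1 e2
    by (rule order_trans[OF e3], rule eq_refl, intro sum.cong refl) (simp add: abs_mult hv_abs)
qed

text \<open>The quadruple of cubes determined by three points of one cube of level
  \<open>n\<close>.\<close>

definition tau :: "nat \<Rightarrow> nat \<Rightarrow> nat \<Rightarrow> nat \<Rightarrow> int ^ 'n \<Rightarrow> int ^ 'n \<Rightarrow> int ^ 'n \<Rightarrow>
    (real ^ 'n) set \<times> (real ^ 'n) set \<times> (real ^ 'n) set \<times> (real ^ 'n) set" where
  "tau k1 k2 k3 n y1 y2 y3 = (cube (g0 + int n) (c n y1), cube (g0 + int (n + k1)) (c (n + k1) y1),
     cube (g0 + int (n + k2)) (c (n + k2) y2), cube (g0 + int (n + k3)) (c (n + k3) y3))"

definition normal_coeff :: "('n, 'x1::banach, 'x2::banach, 'y3::banach) shift \<Rightarrow>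
    (real ^ 'n) set \<times> (real ^ 'n) set \<times> (real ^ 'n) set \<times> (real ^ 'n) set \<Rightarrow> 'x1 \<Rightarrow> 'x2 \<Rightarrow> 'y3" where
  "normal_coeff S = (\<lambda>(K, I1, I2, I3) x1 x2.
        ((measure lborel K)\<^sup>2 * measure lborel I1 powr (- 1 / 2) * measure lborel I2 powr (- 1 / 2) *
           measure lborel I3 powr (- 1 / 2)) *\<^sub>R snd S K I1 I2 I3 x1 x2)"

text \<open>The form \<open>\<psi>\<close> is a default that stays in the family where there is no coefficient.\<close>

definition form_at where
  "form_at \<D> k1 k2 k3 S \<psi> n y1 y2 y3 = (if tau k1 k2 k3 n y1 y2 y3 \<in> shift_index \<D> k1 k2 k3
     then (\<lambda>x1 x2 z. blinfun_apply z (normal_coeff S (tau k1 k2 k3 n y1 y2 y3) x1 x2)) else \<psi>)"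

text \<open>The output of the shift is a step function, so the functional acts through its density
  and every coefficient becomes a sum over triples of atoms. Conversely a triple of points in one
  cube determines the quadruple of cubes, which turns the sum over coefficients into averages over
  triples.\<close>

lemma shift_form_bound:
  fixes S :: "('n, 'x1::banach, 'x2::banach, 'y3::banach) shift" and F1 :: "real ^ 'n \<Rightarrow> 'x1" and F2 :: "real ^ 'n \<Rightarrow> 'x2"
  assumes \<D>: "\<D> = {cube g m | g m. True}" and fin: "finite (shift_support \<D> k1 k2 k3 S)"
    and bil: "\<forall>(K, I1, I2, I3)\<in>shift_index \<D> k1 k2 k3. bounded_bilinear (snd S K I1 I2 I3)"
    and i0: "i0 \<in> {1, 2, 3}" "\<forall>I\<in>\<D>. (\<forall>j. \<not> fst S i0 I j) \<and> (\<forall>i\<in>{1, 2, 3} - {i0}. \<exists>j. fst S i I j)"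
    and F: "F1 \<in> fst (Lp p1 lborel)" "1 < p1" "F2 \<in> fst (Lp p2 lborel)" "1 < p2"
    and \<phi>: "\<phi> \<in> fst (dual (Lp s lborel))" and s: "0 < s"
    and supp: "\<And>K I1 I2 I3. (K, I1, I2, I3) \<in> shift_support \<D> k1 k2 k3 S \<Longrightarrow> \<exists>n<N. \<exists>m\<in>c n ` \<Omega>. K = cube (g0 + int n) m"
    and N: "N + k1 \<le> L" "N + k2 \<le> L" "N + k3 \<le> L"
  shows "\<bar>\<phi> (shift_op \<D> k1 k2 k3 S F1 F2)\<bar> \<le> \<mu> * (\<Sum>n<N. \<Sum>x\<in>\<Omega>. kav n x (\<lambda>y1 y2 y3.
     \<bar>form_at \<D> k1 k2 k3 S \<psi> n y1 y2 y3 (proj (i0 \<noteq> 1) (n + k1) (avg F1) y1) (proj (i0 \<noteq> 2) (n + k2) (avg F2) y2)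
       (proj (i0 \<noteq> 3) (n + k3) (dens \<phi>) y3)\<bar>))"
proof -
  let ?U = "shift_support \<D> k1 k2 k3 S"
  define A where "A = (\<lambda>(K, I1, I2, I3). snd S K I1 I2 I3 (pairing F1 (haar (fst S 1 I1) I1)) (pairing F2 (haar (fst S 2 I2) I2)))"
  define H where "H = (\<lambda>(K :: (real ^ 'n) set, I1 :: (real ^ 'n) set, I2 :: (real ^ 'n) set, I3) x. haar (fst S 3 I3) I3 x)"
  define D where "D \<tau> = blinfun_apply (\<Sum>a\<in>\<Omega>. H \<tau> (corner h a) *\<^sub>R dens \<phi> a) (A \<tau>)" for \<tau>
  define P1 where "P1 n = proj (i0 \<noteq> 1) (n + k1) (avg F1)" for n
  define P2 where "P2 n = proj (i0 \<noteq> 2) (n + k2) (avg F2)" for n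
  define P3 where "P3 n = proj (i0 \<noteq> 3) (n + k3) (dens \<phi>)" for n
  define v where "v n = vol (g0 + int (n + k1)) powr (- 1/2) * vol (g0 + int (n + k2)) powr (- 1/2) * vol (g0 + int (n + k3)) powr (- 1/2)" for n
  define B where "B = (\<lambda>(K, I1, I2, I3). snd S K I1 I2 I3)"
  define X where "X n y1 y2 y3 \<tau> = \<mu>\<^sup>2 * v n * \<bar>blinfun_apply (P3 n y3) (B \<tau> (P1 n y1) (P2 n y2))\<bar>" for n y1 y2 y3 \<tau>
  define same where "same n y1 y2 y3 \<longleftrightarrow> c n y2 = c n y1 \<and> c n y3 = c n y1" for n y1 y2 y3
  have U: "?U \<subseteq> shift_index \<D> k1 k2 k3" by (auto simp: shift_support_def)
  have X0: "0 \<le> X n y1 y2 y3 \<tau>" for n y1 y2 y3 \<tau> by (simp add: X_def v_def)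
  have cubes: "\<exists>n m m1 m2 m3. n < N \<and> m \<in> c n ` \<Omega> \<and> m1 \<in> c (n + k1) ` \<Omega> \<and> m2 \<in> c (n + k2) ` \<Omega> \<and> m3 \<in> c (n + k3) ` \<Omega> \<and>
      \<tau> = (cube (g0 + int n) m, cube (g0 + int (n + k1)) m1, cube (g0 + int (n + k2)) m2, cube (g0 + int (n + k3)) m3) \<and>
      idx (g0 + int n) (corner (g0 + int (n + k1)) m1) = m \<and> idx (g0 + int n) (corner (g0 + int (n + k2)) m2) = m \<and>
      idx (g0 + int n) (corner (g0 + int (n + k3)) m3) = m" if \<tau>: "\<tau> \<in> ?U" for \<tau>
  proof -
    obtain K I1 I2 I3 where t: "\<tau> = (K, I1, I2, I3)" by (cases \<tau>)
    then obtain n m where nm: "n < N" "m \<in> c n ` \<Omega>" "K = cube (g0 + int n) m" using supp \<tau> by blast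
    then have "(cube (g0 + int n) m, I1, I2, I3) \<in> shift_index \<D> k1 k2 k3" using \<tau> t U by blast
    from shift_index_cubes[OF \<D> this] obtain m1 m2 m3 where
      "I1 = cube (g0 + int (n + k1)) m1" "idx (g0 + int n) (corner (g0 + int (n + k1)) m1) = m"
      "I2 = cube (g0 + int (n + k2)) m2" "idx (g0 + int n) (corner (g0 + int (n + k2)) m2) = m"
      "I3 = cube (g0 + int (n + k3)) m3" "idx (g0 + int n) (corner (g0 + int (n + k3)) m3) = m" .
    moreover from this have "m1 \<in> c (n + k1) ` \<Omega>" "m2 \<in> c (n + k2) ` \<Omega>" "m3 \<in> c (n + k3) ` \<Omega>"
      using descendant_mem[OF _ nm(2)] nm(1) N by auto
    ultimately show ?thesis using nm t by blast
  qed
  have H: "H \<tau> x = (\<Sum>a\<in>\<Omega>. (indicator (atom a) x :: real) *\<^sub>R H \<tau> (corner h a))" if \<tau>: "\<tau> \<in> ?U" for \<tau> x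
  proof -
    from cubes[OF \<tau>] obtain n m3 I1 I2 K where n: "n < N" "m3 \<in> c (n + k3) ` \<Omega>" and t: "\<tau> = (K, I1, I2, cube (g0 + int (n + k3)) m3)"
      by blast
    have "n + k3 < L" using n N by simp
    from haar_atoms[OF this n(2)] show ?thesis unfolding t H_def prod.case hv_def[symmetric] .
  qed
  have "shift_op \<D> k1 k2 k3 S F1 F2 = step (\<lambda>a. \<Sum>\<tau>\<in>?U. H \<tau> (corner h a) *\<^sub>R A \<tau>)"
  proof
    fix x
    have "shift_op \<D> k1 k2 k3 S F1 F2 x = (\<Sum>\<tau>\<in>?U. H \<tau> x *\<^sub>R A \<tau>)"
      unfolding shift_op_def H_def A_def by (intro sum.cong refl) auto
    also have "\<dots> = (\<Sum>\<tau>\<in>?U. (\<Sum>a\<in>\<Omega>. (indicator (atom a) x :: real) *\<^sub>R H \<tau> (corner h a)) *\<^sub>R A \<tau>)"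
      using H by (intro sum.cong refl arg_cong2[where f = scaleR]) auto
    also have "\<dots> = (\<Sum>a\<in>\<Omega>. \<Sum>\<tau>\<in>?U. ((indicator (atom a) x :: real) * H \<tau> (corner h a)) *\<^sub>R A \<tau>)"
      unfolding scaleR_sum_left real_scaleR_def by (rule sum.swap)
    also have "\<dots> = step (\<lambda>a. \<Sum>\<tau>\<in>?U. H \<tau> (corner h a) *\<^sub>R A \<tau>) x"
      by (simp only: step_def scaleR_sum_right scaleR_scaleR)
    finally show "shift_op \<D> k1 k2 k3 S F1 F2 x = step (\<lambda>a. \<Sum>\<tau>\<in>?U. H \<tau> (corner h a) *\<^sub>R A \<tau>) x" .
  qed
  then have "\<phi> (shift_op \<D> k1 k2 k3 S F1 F2) = \<mu> * (\<Sum>a\<in>\<Omega>. dens \<phi> a (\<Sum>\<tau>\<in>?U. H \<tau> (corner h a) *\<^sub>R A \<tau>))"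
    by (simp only: dual_step[OF \<phi> s])
  also have "(\<Sum>a\<in>\<Omega>. dens \<phi> a (\<Sum>\<tau>\<in>?U. H \<tau> (corner h a) *\<^sub>R A \<tau>)) = (\<Sum>\<tau>\<in>?U. D \<tau>)"
    unfolding D_def blinfun.sum_left blinfun.sum_right blinfun.scaleR_left blinfun.scaleR_right by (rule sum.swap)
  finally have eq: "\<phi> (shift_op \<D> k1 k2 k3 S F1 F2) = \<mu> * (\<Sum>\<tau>\<in>?U. D \<tau>)" .
  \<comment> \<open>A coefficient belongs to one level; the other levels may be added, as their
    terms are nonnegative, and give all coefficients a sum of the same shape.\<close>
  have D: "\<bar>D \<tau>\<bar> \<le> (\<Sum>n<N. \<Sum>y1\<in>\<Omega>. \<Sum>y2\<in>\<Omega>. \<Sum>y3\<in>\<Omega>. if same n y1 y2 y3 \<and> tau k1 k2 k3 n y1 y2 y3 = \<tau> then X n y1 y2 y3 \<tau> else 0)"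
    if \<tau>: "\<tau> \<in> ?U" for \<tau>
  proof -
    obtain n m m1 m2 m3 where n: "n < N" and m: "m \<in> c n ` \<Omega>" "m1 \<in> c (n + k1) ` \<Omega>" "m2 \<in> c (n + k2) ` \<Omega>" "m3 \<in> c (n + k3) ` \<Omega>"
      and t: "\<tau> = (cube (g0 + int n) m, cube (g0 + int (n + k1)) m1, cube (g0 + int (n + k2)) m2, cube (g0 + int (n + k3)) m3)"
      and par: "idx (g0 + int n) (corner (g0 + int (n + k1)) m1) = m" "idx (g0 + int n) (corner (g0 + int (n + k2)) m2) = m"
        "idx (g0 + int n) (corner (g0 + int (n + k3)) m3) = m"
      using cubes[OF \<tau>] by metis
    have W0: "0 \<le> (if b then X n y1 y2 y3 \<tau> else 0)" for b n y1 y2 y3 using X0 by simp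
    have nL: "n + k1 < L" "n + k2 < L" "n + k3 < L" using n N by auto
    have "bounded_bilinear (B \<tau>)" using bil \<tau> U t by (auto simp: B_def)
    note bb = this[unfolded t]
    have cD: "cube g m' \<in> \<D>" for g m' using \<D> by auto
    have \<eta>: "if i0 \<noteq> i then \<exists>j. fst S i (cube g m') j else \<forall>j. \<not> fst S i (cube g m') j" if "i \<in> {1, 2, 3}" for i g m'
      using i0(2)[rule_format, OF cD[of g m']] that by auto
    have "\<bar>D \<tau>\<bar> \<le> (\<Sum>y1\<in>\<Omega>. \<Sum>y2\<in>\<Omega>. \<Sum>y3\<in>\<Omega>. if c (n + k1) y1 = m1 \<and> c (n + k2) y2 = m2 \<and> c (n + k3) y3 = m3 then
        \<mu>\<^sup>2 * v n * \<bar>P3 n y3 (B \<tau> (P1 n y1) (P2 n y2))\<bar> else 0)"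
      unfolding D_def A_def H_def t prod.case v_def P1_def P2_def P3_def B_def
      by (rule coefficient_bound[unfolded hv_def, OF bb[unfolded B_def prod.case] F nL m(2,3)]; rule \<eta>; simp)
    also have "\<dots> \<le> (\<Sum>y1\<in>\<Omega>. \<Sum>y2\<in>\<Omega>. \<Sum>y3\<in>\<Omega>. if same n y1 y2 y3 \<and> tau k1 k2 k3 n y1 y2 y3 = \<tau> then X n y1 y2 y3 \<tau> else 0)"
    proof (intro sum_mono)
      fix y1 y2 y3
      show "(if c (n + k1) y1 = m1 \<and> c (n + k2) y2 = m2 \<and> c (n + k3) y3 = m3 then \<mu>\<^sup>2 * v n * \<bar>P3 n y3 (B \<tau> (P1 n y1) (P2 n y2))\<bar> else 0)
          \<le> (if same n y1 y2 y3 \<and> tau k1 k2 k3 n y1 y2 y3 = \<tau> then X n y1 y2 y3 \<tau> else 0)"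
      proof (cases "c (n + k1) y1 = m1 \<and> c (n + k2) y2 = m2 \<and> c (n + k3) y3 = m3")
        case True
        then have "c n y1 = m" "c n y2 = m" "c n y3 = m"
          using descendant_coarse[OF par(1), of y1] descendant_coarse[OF par(2), of y2] descendant_coarse[OF par(3), of y3] by auto
        then have "same n y1 y2 y3 \<and> tau k1 k2 k3 n y1 y2 y3 = \<tau>" using True by (simp add: same_def tau_def t)
        then show ?thesis using True by (simp add: X_def)
      next
        case False
        then show ?thesis using W0 by (simp only: if_False)
      qed
    qed
    also have "\<dots> \<le> (\<Sum>n<N. \<Sum>y1\<in>\<Omega>. \<Sum>y2\<in>\<Omega>. \<Sum>y3\<in>\<Omega>. if same n y1 y2 y3 \<and> tau k1 k2 k3 n y1 y2 y3 = \<tau> then X n y1 y2 y3 \<tau> else 0)"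
      by (rule member_le_sum[where f = "\<lambda>n. \<Sum>y1\<in>\<Omega>. \<Sum>y2\<in>\<Omega>. \<Sum>y3\<in>\<Omega>. if same n y1 y2 y3 \<and> tau k1 k2 k3 n y1 y2 y3 = \<tau> then X n y1 y2 y3 \<tau> else 0"])
        (use n in \<open>auto intro!: sum_nonneg W0\<close>)
    finally show ?thesis .
  qed
  define Z where "Z n y1 y2 y3 = \<bar>form_at \<D> k1 k2 k3 S \<psi> n y1 y2 y3 (P1 n y1) (P2 n y2) (P3 n y3)\<bar>" for n y1 y2 y3
  have XZ: "(\<Sum>\<tau>\<in>?U. if same n y1 y2 y3 \<and> tau k1 k2 k3 n y1 y2 y3 = \<tau> then X n y1 y2 y3 \<tau> else 0)
      \<le> (if same n y1 y2 y3 then Z n y1 y2 y3 / card (cell n y1) ^ 2 else 0)" if n: "n < N" and y: "y1 \<in> \<Omega>" for n y1 y2 y3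
  proof (cases "same n y1 y2 y3 \<and> tau k1 k2 k3 n y1 y2 y3 \<in> ?U")
    case True
    let ?t = "tau k1 k2 k3 n y1 y2 y3"
    have "(\<Sum>\<tau>\<in>?U. if same n y1 y2 y3 \<and> ?t = \<tau> then X n y1 y2 y3 \<tau> else 0) = X n y1 y2 y3 ?t"
      using True fin by (simp add: sum.delta)
    \<comment> \<open>The normalisation contains the squared volume of \<open>K\<close>, which is
      \<open>\<mu>\<^sup>2\<close> times the squared number of atoms. Expressing
      \<open>\<mu>\<^sup>2\<close> through it leaves exactly the weight of the averages over the
      cell.\<close>
    also have "X n y1 y2 y3 ?t = Z n y1 y2 y3 / card (cell n y1) ^ 2"
    proof -
      have "n \<le> L" using n N by simp
      note vc = vol_cell[OF this y]
      have cd: "0 < real (card (cell n y1))" using y finite_\<Omega> by (auto simp: card_gt_0_iff)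
      have "form_at \<D> k1 k2 k3 S \<psi> n y1 y2 y3 (P1 n y1) (P2 n y2) (P3 n y3) = P3 n y3 (normal_coeff S ?t (P1 n y1) (P2 n y2))"
        using True U by (auto simp: form_at_def)
      also have "normal_coeff S ?t (P1 n y1) (P2 n y2) = ((vol (g0 + int n))\<^sup>2 * v n) *\<^sub>R B ?t (P1 n y1) (P2 n y2)"
        unfolding normal_coeff_def tau_def prod.case measure_cube B_def v_def by (simp only: mult.assoc)
      finally have "Z n y1 y2 y3 = (vol (g0 + int n))\<^sup>2 * v n * \<bar>P3 n y3 (B ?t (P1 n y1) (P2 n y2))\<bar>"
        by (simp add: Z_def blinfun.scaleR_right abs_mult v_def)
      then show ?thesis unfolding vc X_def using cd by (simp add: field_simps power_mult_distrib)
    qed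
    finally show ?thesis using True by simp
  next
    case False
    have "(\<Sum>\<tau>\<in>?U. if same n y1 y2 y3 \<and> tau k1 k2 k3 n y1 y2 y3 = \<tau> then X n y1 y2 y3 \<tau> else 0) = 0"
      by (rule sum.neutral) (use False in auto)
    also have "\<dots> \<le> (if same n y1 y2 y3 then Z n y1 y2 y3 / card (cell n y1) ^ 2 else 0)" by (simp add: Z_def)
    finally show ?thesis .
  qed
  have "\<bar>\<Sum>\<tau>\<in>?U. D \<tau>\<bar> \<le> (\<Sum>\<tau>\<in>?U. \<Sum>n<N. \<Sum>y1\<in>\<Omega>. \<Sum>y2\<in>\<Omega>. \<Sum>y3\<in>\<Omega>.
      if same n y1 y2 y3 \<and> tau k1 k2 k3 n y1 y2 y3 = \<tau> then X n y1 y2 y3 \<tau> else 0)"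
    by (rule order_trans[OF sum_abs]) (rule sum_mono[OF D])
  also have "\<dots> = (\<Sum>n<N. \<Sum>y1\<in>\<Omega>. \<Sum>y2\<in>\<Omega>. \<Sum>y3\<in>\<Omega>. \<Sum>\<tau>\<in>?U.
      if same n y1 y2 y3 \<and> tau k1 k2 k3 n y1 y2 y3 = \<tau> then X n y1 y2 y3 \<tau> else 0)"
    unfolding sum.swap[of _ _ ?U] ..
  also have "\<dots> \<le> (\<Sum>n<N. \<Sum>y1\<in>\<Omega>. \<Sum>y2\<in>\<Omega>. \<Sum>y3\<in>\<Omega>. if same n y1 y2 y3 then Z n y1 y2 y3 / card (cell n y1) ^ 2 else 0)"
    by (intro sum_mono XZ) auto
  also have "\<dots> = (\<Sum>n<N. \<Sum>x\<in>\<Omega>. kav n x (Z n))"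
  proof (rule sum.cong[OF refl])
    fix n
    have "(\<Sum>y2\<in>\<Omega>. \<Sum>y3\<in>\<Omega>. if same n y1 y2 y3 then Z n y1 y2 y3 / card (cell n y1) ^ 2 else 0)
        = (\<Sum>y2\<in>cell n y1. \<Sum>y3\<in>cell n y1. Z n y1 y2 y3) / card (cell n y1) ^ 2" for y1
    proof -
      have "(\<Sum>y2\<in>\<Omega>. \<Sum>y3\<in>\<Omega>. if same n y1 y2 y3 then Z n y1 y2 y3 / card (cell n y1) ^ 2 else 0)
        = (\<Sum>y2\<in>\<Omega>. if c n y2 = c n y1 then (\<Sum>y3\<in>\<Omega>. if c n y3 = c n y1 then Z n y1 y2 y3 / card (cell n y1) ^ 2 else 0) else 0)"
        by (intro sum.cong refl) (auto simp: same_def)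
      also have "\<dots> = (\<Sum>y2\<in>cell n y1. \<Sum>y3\<in>cell n y1. Z n y1 y2 y3 / card (cell n y1) ^ 2)"
        by (simp only: sum.inter_filter[OF finite_\<Omega>])
      finally show ?thesis by (simp only: sum_divide_distrib)
    qed
    then show "(\<Sum>y1\<in>\<Omega>. \<Sum>y2\<in>\<Omega>. \<Sum>y3\<in>\<Omega>. if same n y1 y2 y3 then Z n y1 y2 y3 / card (cell n y1) ^ 2 else 0) = (\<Sum>x\<in>\<Omega>. kav n x (Z n))"
      using sum_kav_base[of n "\<lambda>_. Z n"] by simp
  qed
  finally have "\<bar>\<Sum>\<tau>\<in>?U. D \<tau>\<bar> \<le> (\<Sum>n<N. \<Sum>x\<in>\<Omega>. kav n x (Z n))" .
  then have "\<mu> * \<bar>\<Sum>\<tau>\<in>?U. D \<tau>\<bar> \<le> \<mu> * (\<Sum>n<N. \<Sum>x\<in>\<Omega>. kav n x (Z n))"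
    using \<mu>_pos by (intro mult_left_mono) auto
  then show ?thesis
    unfolding eq abs_mult using \<mu>_pos by (simp add: Z_def[abs_def] P1_def P2_def P3_def)
qed

end

section \<open>Admissible constants\<close>

text \<open>The constants over which \<open>Rhat\<close> takes the infimum.\<close>

definition admissible where
  "admissible E1 E2 F3 \<T> C \<longleftrightarrow> 0 \<le> C \<and>
       (\<forall>N T e1 e2 e3.
          (\<forall>t\<in>{1..N}. \<forall>u\<in>{1..N}. \<forall>v\<in>{1..N}. T t u v \<in> \<T>) \<and>
          (\<forall>t\<in>{1..N}. \<forall>u\<in>{1..N}. e1 t u \<in> fst E1) \<and>
          (\<forall>u\<in>{1..N}. \<forall>v\<in>{1..N}. e2 u v \<in> fst E2) \<and>
          (\<forall>t\<in>{1..N}. \<forall>v\<in>{1..N}. e3 t v \<in> fst (dual F3)) \<longrightarrow>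
          (\<Sum>t=1..N. \<Sum>u=1..N. \<Sum>v=1..N. \<bar>e3 t v (T t u v (e1 t u) (e2 u v))\<bar>)
            \<le> C * (Rad2 E1 N e1 * Rad2 E2 N e2 * Rad2 (dual F3) N e3))"

lemma Rhat_eq: "Rhat E1 E2 F3 \<T> = Inf (ennreal ` {C. admissible E1 E2 F3 \<T> C})"
  unfolding Rhat_def admissible_def ..

lemma Rad2_eq:
  "Rad2 E N e = sqrt (rad ({1..N} \<times> {1..N}) (\<lambda>\<epsilon>. (snd E (\<Sum>z\<in>{1..N} \<times> {1..N}. \<epsilon> z *\<^sub>R e (fst z) (snd z)))\<^sup>2))"
proof -
  have "(\<Sum>l=1..N. \<Sum>m=1..N. \<epsilon> (l, m) *\<^sub>R e l m) = (\<Sum>z\<in>{1..N} \<times> {1..N}. \<epsilon> z *\<^sub>R e (fst z) (snd z))" for \<epsilon>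
    unfolding sum.cartesian_product by (intro sum.cong refl) auto
  then show ?thesis unfolding Rad2_def by (simp add: expectation_random_signs)
qed

lemma Rad2_nonneg: "0 \<le> Rad2 E N e"
  unfolding Rad2_eq by (simp add: rad_nonneg)

lemma dual_norm_nonneg:
  assumes \<phi>: "\<phi> \<in> fst (dual E)" and E: "0 \<in> fst E" "snd E 0 = 0" "\<And>e. e \<in> fst E \<Longrightarrow> 0 \<le> snd E e"
  shows "0 \<le> dual_norm E \<phi>"
proof -
  have "\<bar>\<phi> 0\<bar> \<le> dual_norm E \<phi>" unfolding dual_norm_def by (rule cSUP_upper[OF _ dual_bdd_above[OF \<phi> E(3)]]) (use E in simp)
  then show ?thesis by linarith
qed

lemma fst_whole: "fst whole = UNIV"
  by (simp add: whole_def)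

lemma dual_norm_whole_nonneg: "0 \<le> dual_norm whole (blinfun_apply (f :: 'y::real_normed_vector \<Rightarrow>\<^sub>L real))"
  by (rule dual_norm_nonneg[OF dual_whole(1)]) (simp_all add: whole_def)

text \<open>With the functional as third argument, the dual of \<open>Y3\<close> enters as a normed
  space on an equal footing with the other two.\<close>

definition forms :: "('x1 \<Rightarrow> 'x2 \<Rightarrow> 'y3::real_normed_vector) set \<Rightarrow> ('x1 \<Rightarrow> 'x2 \<Rightarrow> ('y3 \<Rightarrow>\<^sub>L real) \<Rightarrow> real) set" where
  "forms \<C> = (\<lambda>A x y z. blinfun_apply z (A x y)) ` \<C>"

text \<open>Bounded functionals belong to the dual of the whole space, with dual norm at most the
  operator norm, so the Rademacher norm of the third array only grows.\<close>

lemma admissible_imp_rhat_bd: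
  fixes \<C> :: "('x1::real_normed_vector \<Rightarrow> 'x2::real_normed_vector \<Rightarrow> 'y3::real_normed_vector) set"
  assumes ad: "admissible whole whole whole \<C> R"
  shows "rhat_bd R (forms \<C>)"
  unfolding rhat_bd_def forms_def
proof (intro conjI allI impI)
  show R: "0 \<le> R" using ad by (simp add: admissible_def)
  fix N :: nat and T and e1 :: "nat \<times> nat \<Rightarrow> 'x1" and e2 :: "nat \<times> nat \<Rightarrow> 'x2" and e3 :: "nat \<times> nat \<Rightarrow> 'y3 \<Rightarrow>\<^sub>L real"
  let ?G = "\<lambda>(A :: 'x1 \<Rightarrow> 'x2 \<Rightarrow> 'y3) x y (z :: 'y3 \<Rightarrow>\<^sub>L real). blinfun_apply z (A x y)"
  let ?J = "{1..N} \<times> {1..N}"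
  assume T: "\<forall>t\<in>{1..N}. \<forall>u\<in>{1..N}. \<forall>v\<in>{1..N}. T t u v \<in> ?G ` \<C>"
  define T' where "T' t u v = inv_into \<C> ?G (T t u v)" for t u v
  have T': "T' t u v \<in> \<C>" "T t u v = ?G (T' t u v)" if "t \<in> {1..N}" "u \<in> {1..N}" "v \<in> {1..N}" for t u v
  proof -
    have m: "T t u v \<in> ?G ` \<C>" using T that by blast
    show "T' t u v \<in> \<C>" unfolding T'_def by (rule inv_into_into[OF m])
    show "T t u v = ?G (T' t u v)" unfolding T'_def by (rule f_inv_into_f[OF m, symmetric])
  qed
  have "(\<Sum>t=1..N. \<Sum>u=1..N. \<Sum>v=1..N. \<bar>T t u v (e1 (t, u)) (e2 (u, v)) (e3 (t, v))\<bar>)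
      = (\<Sum>t=1..N. \<Sum>u=1..N. \<Sum>v=1..N. \<bar>blinfun_apply (e3 (t, v)) (T' t u v (e1 (t, u)) (e2 (u, v)))\<bar>)"
    by (intro sum.cong refl) (simp only: T'(2))
  also have "\<dots> \<le> R * (Rad2 whole N (\<lambda>t u. e1 (t, u)) * Rad2 whole N (\<lambda>u v. e2 (u, v)) * Rad2 (dual whole) N (\<lambda>t v. blinfun_apply (e3 (t, v))))"
    using ad[unfolded admissible_def, THEN conjunct2, rule_format, of N T' "\<lambda>t u. e1 (t, u)" "\<lambda>u v. e2 (u, v)" "\<lambda>t v. blinfun_apply (e3 (t, v))"]
      T'(1) by (simp add: fst_whole dual_whole(1))
  also have "\<dots> \<le> R * (rad_norm ?J e1 * rad_norm ?J e2 * rad_norm ?J e3)"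
  proof -
    have w: "Rad2 whole N (\<lambda>t u. e (t, u)) = rad_norm ?J e" for e :: "nat \<times> nat \<Rightarrow> 'a::real_normed_vector"
      by (simp add: Rad2_eq rad_norm_def whole_def)
    have "Rad2 (dual whole) N (\<lambda>t v. blinfun_apply (e3 (t, v))) \<le> rad_norm ?J e3"
      unfolding Rad2_eq rad_norm_def
    proof (intro real_sqrt_le_mono rad_mono power_mono)
      fix \<epsilon> :: "nat \<times> nat \<Rightarrow> real"
      have eq: "(\<Sum>z\<in>?J. \<epsilon> z *\<^sub>R blinfun_apply (e3 (fst z, snd z))) = blinfun_apply (\<Sum>z\<in>?J. \<epsilon> z *\<^sub>R e3 z)"
        by (rule ext) (simp only: sum_scaleR_fun_apply blinfun.sum_left blinfun.scaleR_left prod.collapse)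
      show "snd (dual whole) (\<Sum>z\<in>?J. \<epsilon> z *\<^sub>R blinfun_apply (e3 (fst z, snd z))) \<le> norm (\<Sum>z\<in>?J. \<epsilon> z *\<^sub>R e3 z)"
        unfolding eq by (rule dual_whole(2))
      show "0 \<le> snd (dual whole) (\<Sum>z\<in>?J. \<epsilon> z *\<^sub>R blinfun_apply (e3 (fst z, snd z)))"
        unfolding eq using dual_norm_whole_nonneg by (simp add: dual_def)
    qed
    then show ?thesis unfolding w using R by (intro mult_left_mono mult_nonneg_nonneg) auto
  qed
  finally show "(\<Sum>t=1..N. \<Sum>u=1..N. \<Sum>v=1..N. \<bar>T t u v (e1 (t, u)) (e2 (u, v)) (e3 (t, v))\<bar>)
    \<le> R * (rad_norm ?J e1 * rad_norm ?J e2 * rad_norm ?J e3)" .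
qed

section \<open>Linear combinations of functions and of functionals\<close>

lemma Lp_zero: "0 \<in> fst (Lp p M)" "Lp_norm p M 0 = 0"
proof -
  show "0 \<in> fst (Lp p M)"
    using simple_function_strongly_measurable[of M "\<lambda>_. 0"] by (simp add: Lp_def zero_fun_def)
  show "Lp_norm p M 0 = 0" by (simp add: Lp_norm_def zero_fun_def)
qed

lemma Lp_scaleR:
  assumes "F \<in> fst (Lp p M)"
  shows "r *\<^sub>R F \<in> fst (Lp p M)"
  using Lp_carrierD[OF assms] strongly_measurable_scaleR[of M F r] by (simp add: Lp_def scaleR_fun_def powr_mult)

lemma Lp_add:
  fixes F G :: "'w \<Rightarrow> 'x::banach"
  assumes "F \<in> fst (Lp p M)" "G \<in> fst (Lp p M)" and p: "0 < p"
  shows "F + G \<in> fst (Lp p M)"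
proof -
  note F = Lp_carrierD[OF assms(1)] and G = Lp_carrierD[OF assms(2)]
  have sm: "strongly_measurable M (\<lambda>w. F w + G w)" by (rule strongly_measurable_add[OF F(1) G(1)])
  have "integrable M (\<lambda>w. norm (F w + G w) powr p)"
  proof (rule Bochner_Integration.integrable_bound)
    show "integrable M (\<lambda>w. 2 powr p * (norm (F w) powr p + norm (G w) powr p))" using F(2) G(2) by simp
    show "(\<lambda>w. norm (F w + G w) powr p) \<in> borel_measurable M" using strongly_measurable_norm[OF sm] by measurable
    have "norm (F w + G w) powr p \<le> 2 powr p * (norm (F w) powr p + norm (G w) powr p)" for w
    proof -
      have "norm (F w + G w) powr p \<le> (2 * max (norm (F w)) (norm (G w))) powr p"
        using norm_triangle_ineq[of "F w" "G w"] p by (intro powr_mono2) auto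
      also have "\<dots> = 2 powr p * max (norm (F w)) (norm (G w)) powr p" by (simp add: powr_mult)
      also have "\<dots> \<le> 2 powr p * (norm (F w) powr p + norm (G w) powr p)" by (intro mult_left_mono) (auto simp: max_def)
      finally show ?thesis .
    qed
    then show "AE w in M. norm (norm (F w + G w) powr p) \<le> norm (2 powr p * (norm (F w) powr p + norm (G w) powr p))"
      by (intro AE_I2) simp
  qed
  then show ?thesis using sm by (simp add: Lp_def plus_fun_def)
qed

lemma Lp_sum:
  assumes "0 < p" "\<And>j. j \<in> J \<Longrightarrow> F j \<in> fst (Lp p M)"
  shows "(\<Sum>j\<in>J. r j *\<^sub>R F j) \<in> fst (Lp p M)"
  using assms(2)
proof (induction J rule: infinite_finite_induct)
  case (insert j J)
  show ?case unfolding sum.insert[OF insert.hyps]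
    by (rule Lp_add[OF Lp_scaleR insert.IH assms(1)]) (use insert.prems in auto)
qed (simp_all add: Lp_zero)

lemma dual_sum:
  assumes "\<And>j. j \<in> J \<Longrightarrow> \<phi> j \<in> fst (dual E)"
  shows "(\<Sum>j\<in>J. r j *\<^sub>R \<phi> j) \<in> fst (dual E)"
proof -
  have "\<forall>j\<in>J. \<exists>C. \<forall>e\<in>fst E. \<bar>\<phi> j e\<bar> \<le> C * snd E e" using dualD(3)[OF assms] by blast
  then obtain C where C: "\<And>j e. j \<in> J \<Longrightarrow> e \<in> fst E \<Longrightarrow> \<bar>\<phi> j e\<bar> \<le> C j * snd E e" by metis
  have "\<bar>\<Sum>j\<in>J. r j * \<phi> j e\<bar> \<le> (\<Sum>j\<in>J. \<bar>r j\<bar> * C j) * snd E e" if "e \<in> fst E" for e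
    unfolding sum_distrib_right
    by (rule order_trans[OF sum_abs], rule sum_mono) (simp add: abs_mult mult.assoc mult_left_mono C that)
  then have "\<exists>C. \<forall>e\<in>fst E. \<bar>\<Sum>j\<in>J. r j * \<phi> j e\<bar> \<le> C * snd E e" by blast
  moreover have "(\<Sum>j\<in>J. r j * \<phi> j (e + f)) = (\<Sum>j\<in>J. r j * \<phi> j e) + (\<Sum>j\<in>J. r j * \<phi> j f)" if "e \<in> fst E" "f \<in> fst E" for e f
    unfolding sum.distrib[symmetric] by (rule sum.cong[OF refl]) (simp add: dualD(1)[OF assms] that distrib_left)
  moreover have "(\<Sum>j\<in>J. r j * \<phi> j (c *\<^sub>R e)) = c * (\<Sum>j\<in>J. r j * \<phi> j e)" if "e \<in> fst E" for e c
    unfolding sum_distrib_left by (rule sum.cong[OF refl]) (simp add: dualD(2)[OF assms] that)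
  ultimately show ?thesis unfolding dual_def by (simp add: sum_scaleR_fun_apply)
qed

lemma dual_norm_Lp_nonneg: "\<phi> \<in> fst (dual (Lp p M)) \<Longrightarrow> 0 \<le> dual_norm (Lp p M) \<phi>"
  by (rule dual_norm_nonneg) (simp_all add: Lp_zero snd_Lp Lp_norm_nonneg)

lemma (in dyadic_model) dens_sum:
  fixes \<phi> :: "'i \<Rightarrow> (real ^ 'n \<Rightarrow> 'y::banach) \<Rightarrow> real"
  assumes \<phi>: "\<And>j. j \<in> J \<Longrightarrow> \<phi> j \<in> fst (dual (Lp s lborel))" and s: "0 < s"
  shows "dens (\<Sum>j\<in>J. r j *\<^sub>R \<phi> j) a = (\<Sum>j\<in>J. r j *\<^sub>R dens (\<phi> j) a)"
proof (rule blinfun_eqI)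
  fix v
  have "blinfun_apply (\<Sum>j\<in>J. r j *\<^sub>R dens (\<phi> j) a) v = (\<Sum>j\<in>J. r j * (\<phi> j (step (\<lambda>b. if b = a then v else 0)) / \<mu>))"
    unfolding blinfun.sum_left blinfun.scaleR_left by (rule sum.cong[OF refl]) (simp add: dens_apply[OF \<phi> s])
  moreover have "blinfun_apply (dens (\<Sum>j\<in>J. r j *\<^sub>R \<phi> j) a) v = (\<Sum>j\<in>J. r j * \<phi> j (step (\<lambda>b. if b = a then v else 0))) / \<mu>"
    by (simp add: dens_apply[OF dual_sum[OF \<phi>] s] sum_scaleR_fun_apply)
  ultimately show "blinfun_apply (dens (\<Sum>j\<in>J. r j *\<^sub>R \<phi> j) a) v = blinfun_apply (\<Sum>j\<in>J. r j *\<^sub>R dens (\<phi> j) a) v"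
    by (simp add: sum_divide_distrib)
qed

definition Kahane_const :: "real \<Rightarrow> real" where
  "Kahane_const p = 2 * real (nat \<lceil>p\<rceil>)"

lemma form_at_mem_forms:
  fixes S :: "('n::finite, 'x1::banach, 'x2::banach, 'y3::banach) shift"
  assumes "dyadic_model \<omega> T" "normalized_coeffs \<D> k1 k2 k3 S \<subseteq> \<C>" "\<psi> \<in> forms \<C>"
  shows "dyadic_model.form_at \<omega> g0 L \<D> k1 k2 k3 S \<psi> n y1 y2 y3 \<in> forms \<C>"
proof -
  interpret dyadic_model \<omega> g0 L T by (rule assms)
  have nc: "normal_coeff S \<tau> \<in> normalized_coeffs \<D> k1 k2 k3 S" if "\<tau> \<in> shift_index \<D> k1 k2 k3" for \<tau>
    unfolding normalized_coeffs_def
    by (rule image_eqI[OF _ that]) (cases \<tau>, simp add: normal_coeff_def)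
  show ?thesis
  proof (cases "tau k1 k2 k3 n y1 y2 y3 \<in> shift_index \<D> k1 k2 k3")
    case True
    show ?thesis
      unfolding form_at_def if_P[OF True] forms_def by (rule image_eqI[OF refl subsetD[OF assms(2) nc[OF True]]])
  next
    case False
    then show ?thesis using assms(3) by (simp add: form_at_def)
  qed
qed

text \<open>All shifts of the array are estimated in one finite model. Kahane then returns from
  moments at the points to the Rademacher norms in the Lebesgue-Bochner spaces and in the
  dual.\<close>

lemma (in dyadic_model) family_estimate:
  fixes S :: "nat \<Rightarrow> nat \<Rightarrow> nat \<Rightarrow> ('n, 'x1::banach, 'x2::banach, 'y3::banach) shift"
    and e1 :: "nat \<Rightarrow> nat \<Rightarrow> real ^ 'n \<Rightarrow> 'x1" and e2 :: "nat \<Rightarrow> nat \<Rightarrow> real ^ 'n \<Rightarrow> 'x2"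
    and e3 :: "nat \<Rightarrow> nat \<Rightarrow> (real ^ 'n \<Rightarrow> 'y3) \<Rightarrow> real"
  assumes p: "1 < p1" "1 < p2" "1 < p3" "1/p1 + 1/p2 + 1/p3 = 1" and s: "1 < s" "1/p3 + 1/s = 1"
    and umd: "umd_fin TYPE('x1) p1 \<beta>1" "umd_fin TYPE('x2) p2 \<beta>2" "umd_fin TYPE('y3 \<Rightarrow>\<^sub>L real) p3 \<beta>3"
    and al: "alpha_full_le TYPE('x1) K1" "alpha_full_le TYPE('x2) K2" "alpha_full_le TYPE('y3 \<Rightarrow>\<^sub>L real) K3"
    and \<D>: "\<D> = {cube g m | g m. True}"
    and sh: "\<And>t u v. is_shift \<D> k1 k2 k3 (S t u v)"
    and rh: "rhat_bd R (forms \<C>)" and ne: "\<C> \<noteq> {}" and \<C>: "\<And>t u v. normalized_coeffs \<D> k1 k2 k3 (S t u v) \<subseteq> \<C>"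
    and bil: "\<And>A. A \<in> \<C> \<Longrightarrow> bounded_bilinear A"
    and e: "\<And>t u. t \<in> {1..M} \<Longrightarrow> u \<in> {1..M} \<Longrightarrow> e1 t u \<in> fst (Lp p1 lborel)"
      "\<And>u v. u \<in> {1..M} \<Longrightarrow> v \<in> {1..M} \<Longrightarrow> e2 u v \<in> fst (Lp p2 lborel)"
      "\<And>t v. t \<in> {1..M} \<Longrightarrow> v \<in> {1..M} \<Longrightarrow> e3 t v \<in> fst (dual (Lp s lborel))"
    and supp: "\<And>t u v K I1 I2 I3. t \<in> {1..M} \<Longrightarrow> u \<in> {1..M} \<Longrightarrow> v \<in> {1..M} \<Longrightarrow>
      (K, I1, I2, I3) \<in> shift_support \<D> k1 k2 k3 (S t u v) \<Longrightarrow> \<exists>n<N. \<exists>m\<in>c n ` \<Omega>. K = cube (g0 + int n) m"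
    and k: "k1 \<le> k" "k2 \<le> k" "k3 \<le> k" and N: "N + k \<le> L"
  shows "(\<Sum>t=1..M. \<Sum>u=1..M. \<Sum>v=1..M. \<bar>e3 t v (shift_op \<D> k1 k2 k3 (S t u v) (e1 t u) (e2 u v))\<bar>)
    \<le> 3 * (1 + real k) * R * (slot_total K1 \<beta>1 p1 * slot_total K2 \<beta>2 p2 * slot_total K3 \<beta>3 p3) *
      (Kahane_const p1 * Rad2 (Lp p1 lborel) M e1 * (Kahane_const p2 * Rad2 (Lp p2 lborel) M e2) *
       (Kahane_const p3 * (2 * Rad2 (dual (Lp s lborel)) M e3)))"
proof -
  let ?I = "{1..M}" and ?J = "{1..M} \<times> {1..M}"
  define f1 where "f1 j = avg (e1 (fst j) (snd j))" for j
  define f2 where "f2 j = avg (e2 (fst j) (snd j))" for j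
  define f3 where "f3 j = dens (e3 (fst j) (snd j))" for j
  obtain \<psi> where \<psi>: "\<psi> \<in> forms \<C>" using ne by (auto simp: forms_def)
  have nef: "forms \<C> \<noteq> {}" using \<psi> by auto
  have lin: "\<forall>\<phi>\<in>forms \<C>. \<forall>y z. linear (\<lambda>x. \<phi> x y z)" "\<forall>\<phi>\<in>forms \<C>. \<forall>x z. linear (\<lambda>y. \<phi> x y z)"
      "\<forall>\<phi>\<in>forms \<C>. \<forall>x y. linear (\<phi> x y)"
  proof -
    have A: "linear (\<lambda>x. A x y)" "linear (\<lambda>y. A x y)" if "A \<in> \<C>" for A x y
      using bounded_bilinear.bounded_linear_left[OF bil[OF that]] bounded_bilinear.bounded_linear_right[OF bil[OF that]]
      by (simp_all add: bounded_linear.linear)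
    have B: "linear (\<lambda>x. blinfun_apply z (A x y))" "linear (\<lambda>x. blinfun_apply z (A y' x))"
      if "A \<in> \<C>" for A y y' and z :: "'y3 \<Rightarrow>\<^sub>L real"
      using linear_compose[OF A(1)[OF that, of y] linear_blinfun_apply[of z]] linear_compose[OF A(2)[OF that, of y'] linear_blinfun_apply[of z]]
      by (simp_all only: o_def)
    show "\<forall>\<phi>\<in>forms \<C>. \<forall>y z. linear (\<lambda>x. \<phi> x y z)" "\<forall>\<phi>\<in>forms \<C>. \<forall>x z. linear (\<lambda>y. \<phi> x y z)"
      unfolding forms_def by (auto intro: B)
    show "\<forall>\<phi>\<in>forms \<C>. \<forall>x y. linear (\<phi> x y)"
      unfolding forms_def by (simp add: linear_blinfun_eval)
  qed
  \<comment> \<open>The non-cancellative slot depends on the shift and hence on (t, u, v).\<close>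
  have "\<forall>t u v. \<exists>i0\<in>{1, 2, 3}. \<forall>I\<in>\<D>. (\<forall>j. \<not> fst (S t u v) i0 I j) \<and> (\<forall>i\<in>{1, 2, 3} - {i0}. \<exists>j. fst (S t u v) i I j)"
    using sh unfolding is_shift_def by blast
  then obtain i0 where i0: "\<And>t u v. i0 t u v \<in> {1, 2, 3}"
    "\<And>t u v. \<forall>I\<in>\<D>. (\<forall>j. \<not> fst (S t u v) (i0 t u v) I j) \<and> (\<forall>i\<in>{1, 2, 3} - {i0 t u v}. \<exists>j. fst (S t u v) i I j)"
    by metis
  define \<Phi> where "\<Phi> n (b :: int ^ 'n) t u v y1 y2 y3 = form_at \<D> k1 k2 k3 (S t u v) \<psi> n y1 y2 y3" for n b t u v y1 y2 y3
  have \<Phi>: "\<forall>n b t u v y1 y2 y3. \<Phi> n b t u v y1 y2 y3 \<in> forms \<C>"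
    unfolding \<Phi>_def using form_at_mem_forms[OF dyadic_model_axioms \<C> \<psi>] by blast
  define F1 where "F1 = (\<Sum>x\<in>\<Omega>. rad ?J (\<lambda>\<delta>. norm (\<Sum>j\<in>?J. \<delta> j *\<^sub>R f1 j x) powr p1))"
  define F2 where "F2 = (\<Sum>x\<in>\<Omega>. rad ?J (\<lambda>\<delta>. norm (\<Sum>j\<in>?J. \<delta> j *\<^sub>R f2 j x) powr p2))"
  define F3 where "F3 = (\<Sum>x\<in>\<Omega>. rad ?J (\<lambda>\<delta>. norm (\<Sum>j\<in>?J. \<delta> j *\<^sub>R f3 j x) powr p3))"
  have Fnn: "0 \<le> F1" "0 \<le> F2" "0 \<le> F3" unfolding F1_def F2_def F3_def by (auto intro!: sum_nonneg rad_nonneg)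
  define A where "A = slot_total K1 \<beta>1 p1 * slot_total K2 \<beta>2 p2 * slot_total K3 \<beta>3 p3"
  have A0: "0 \<le> A" by (simp add: A_def slot_total_def)
  have R: "0 \<le> R" using rh by (simp add: rhat_bd_def)
  define X where "X t u v = (\<Sum>n<N. \<Sum>x\<in>\<Omega>. kav n x (\<lambda>y1 y2 y3.
      \<bar>\<Phi> n (c n x) t u v y1 y2 y3 (proj (i0 t u v \<noteq> 1) (n + k1) (f1 (t, u)) y1)
        (proj (i0 t u v \<noteq> 2) (n + k2) (f2 (u, v)) y2) (proj (i0 t u v \<noteq> 3) (n + k3) (f3 (t, v)) y3)\<bar>))" for t u v
  have "(\<Sum>t\<in>?I. \<Sum>u\<in>?I. \<Sum>v\<in>?I. \<bar>e3 t v (shift_op \<D> k1 k2 k3 (S t u v) (e1 t u) (e2 u v))\<bar>)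
      \<le> (\<Sum>t\<in>?I. \<Sum>u\<in>?I. \<Sum>v\<in>?I. \<mu> * X t u v)"
  proof (intro sum_mono)
    fix t u v assume t: "t \<in> ?I" and u: "u \<in> ?I" and v: "v \<in> ?I"
    have fb: "finite (shift_support \<D> k1 k2 k3 (S t u v))"
      "\<forall>(K, I1, I2, I3)\<in>shift_index \<D> k1 k2 k3. bounded_bilinear (snd (S t u v) K I1 I2 I3)"
      using sh[of t u v] by (auto simp: is_shift_def)
    have NL: "N + k1 \<le> L" "N + k2 \<le> L" "N + k3 \<le> L" and s0: "0 < s" using N k s by auto
    show "\<bar>e3 t v (shift_op \<D> k1 k2 k3 (S t u v) (e1 t u) (e2 u v))\<bar> \<le> \<mu> * X t u v"
      using shift_form_bound[where \<psi> = \<psi>, OF \<D> fb i0(1,2) e(1)[OF t u] p(1) e(2)[OF u v] p(2) e(3)[OF t v] s0 supp[OF t u v] NL]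
      unfolding X_def \<Phi>_def f1_def f2_def f3_def by simp
  qed
  also have "\<dots> = \<mu> * (\<Sum>t\<in>?I. \<Sum>u\<in>?I. \<Sum>v\<in>?I. X t u v)" by (simp only: sum_distrib_left)
  also have "\<dots> \<le> \<mu> * (3 * ((1 + real k) * (R * (A * (F1 powr (1/p1) * F2 powr (1/p2) * F3 powr (1/p3))))))"
  proof (rule mult_left_mono)
    show "(\<Sum>t\<in>?I. \<Sum>u\<in>?I. \<Sum>v\<in>?I. X t u v) \<le> 3 * ((1 + real k) * (R * (A * (F1 powr (1/p1) * F2 powr (1/p2) * F3 powr (1/p3)))))"
      unfolding X_def F1_def F2_def F3_def A_def
      by (rule dyadic_estimate_mixed[where \<T> = "forms \<C>" and \<Phi> = \<Phi>, OF p umd al rh nef lin _ k N \<Phi> i0(1)]) simp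
  qed (use \<mu>_pos in simp)
  \<comment> \<open>The measure of an atom is distributed over the slots according to the exponents,
    whose reciprocals add up to 1.\<close>
  also have "\<dots> = 3 * (1 + real k) * R * A * ((\<mu> * F1) powr (1/p1) * (\<mu> * F2) powr (1/p2) * (\<mu> * F3) powr (1/p3))"
  proof -
    have "\<mu> powr (1/p1 + 1/p2 + 1/p3) = \<mu>" using \<mu>_pos p(4) by simp
    then have m: "\<mu> powr (1/p1) * \<mu> powr (1/p2) * \<mu> powr (1/p3) = \<mu>" by (simp only: powr_add)
    have "3 * (1 + real k) * R * A * ((\<mu> * F1) powr (1/p1) * (\<mu> * F2) powr (1/p2) * (\<mu> * F3) powr (1/p3))
        = (\<mu> powr (1/p1) * \<mu> powr (1/p2) * \<mu> powr (1/p3)) * (3 * ((1 + real k) * (R * (A * (F1 powr (1/p1) * F2 powr (1/p2) * F3 powr (1/p3))))))"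
      using \<mu>_pos Fnn by (simp only: powr_mult mult_ac)
    then show ?thesis unfolding m by (rule sym)
  qed
  also have "\<dots> \<le> 3 * (1 + real k) * R * A * (Kahane_const p1 * Rad2 (Lp p1 lborel) M e1 * (Kahane_const p2 * Rad2 (Lp p2 lborel) M e2) *
       (Kahane_const p3 * (2 * Rad2 (dual (Lp s lborel)) M e3)))"
  proof -
    have J: "finite ?J" by simp
    have eJ: "e1 (fst j) (snd j) \<in> fst (Lp p1 lborel)" "e2 (fst j) (snd j) \<in> fst (Lp p2 lborel)"
      "e3 (fst j) (snd j) \<in> fst (dual (Lp s lborel))" if "j \<in> ?J" for j
      using that e(1)[of "fst j" "snd j"] e(2)[of "fst j" "snd j"] e(3)[of "fst j" "snd j"] by (auto simp: mem_Times_iff)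
    have avgs: "avg (\<Sum>j\<in>?J. \<delta> j *\<^sub>R F j) x = (\<Sum>j\<in>?J. \<delta> j *\<^sub>R avg (F j) x)"
      if "\<And>j. j \<in> ?J \<Longrightarrow> F j \<in> fst (Lp q lborel)" "1 < q" for F :: "nat \<times> nat \<Rightarrow> real ^ 'n \<Rightarrow> 'x::banach" and q \<delta> x
    proof -
      have "(\<Sum>j\<in>?J. \<delta> j *\<^sub>R F j) = (\<lambda>y. \<Sum>j\<in>?J. \<delta> j *\<^sub>R F j y)" by (rule ext) (rule sum_scaleR_fun_apply)
      then show ?thesis using avg_sum[of ?J F q \<delta> x, OF that] by simp
    qed
    have Kp: "(\<mu> * (\<Sum>x\<in>\<Omega>. rad ?J (\<lambda>\<delta>. norm (\<Sum>j\<in>?J. \<delta> j *\<^sub>R avg (F (fst j) (snd j)) x) powr q))) powr (1/q)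
        \<le> Kahane_const q * Rad2 (Lp q lborel) M F"
      if F: "\<And>j. j \<in> ?J \<Longrightarrow> F (fst j) (snd j) \<in> fst (Lp q lborel)" and q: "1 < q" for F :: "nat \<Rightarrow> nat \<Rightarrow> real ^ 'n \<Rightarrow> 'x::banach" and q
      unfolding Rad2_eq Kahane_const_def snd_Lp
    proof (rule Kahane_Lp[OF q finite_\<Omega> J \<mu>_pos])
      fix \<delta> :: "nat \<times> nat \<Rightarrow> real"
      have "(\<Sum>j\<in>?J. \<delta> j *\<^sub>R F (fst j) (snd j)) \<in> fst (Lp q lborel)" by (rule Lp_sum[OF _ F]) (use q in simp_all)
      from avg_bound[OF this q]
      show "\<mu> powr (1/q) * lpsum q \<Omega> (\<lambda>x. norm (\<Sum>j\<in>?J. \<delta> j *\<^sub>R avg (F (fst j) (snd j)) x))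
          \<le> Lp_norm q lborel (\<Sum>j\<in>?J. \<delta> j *\<^sub>R F (fst j) (snd j))"
        by (simp only: avgs[of "\<lambda>j. F (fst j) (snd j)" q, OF F q])
    qed
    have K1: "(\<mu> * F1) powr (1/p1) \<le> Kahane_const p1 * Rad2 (Lp p1 lborel) M e1"
      unfolding F1_def f1_def by (rule Kp[of e1 p1, OF eJ(1) p(1)])
    have K2: "(\<mu> * F2) powr (1/p2) \<le> Kahane_const p2 * Rad2 (Lp p2 lborel) M e2"
      unfolding F2_def f2_def by (rule Kp[of e2 p2, OF eJ(2) p(2)])
    have "(\<mu> * F3) powr (1/p3) \<le> (2 * real (nat \<lceil>p3\<rceil>)) *
        sqrt (rad ?J (\<lambda>\<delta>. (2 * dual_norm (Lp s lborel) (\<Sum>j\<in>?J. \<delta> j *\<^sub>R e3 (fst j) (snd j)))\<^sup>2))"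
      unfolding F3_def f3_def
    proof (rule Kahane_Lp[OF p(3) finite_\<Omega> J \<mu>_pos])
      fix \<delta> :: "nat \<times> nat \<Rightarrow> real"
      have s0: "0 < s" using s by simp
      have d: "(\<Sum>j\<in>?J. \<delta> j *\<^sub>R e3 (fst j) (snd j)) \<in> fst (dual (Lp s lborel))" by (rule dual_sum[OF eJ(3)])
      have "(\<Sum>j\<in>?J. \<delta> j *\<^sub>R dens (e3 (fst j) (snd j)) x) = dens (\<Sum>j\<in>?J. \<delta> j *\<^sub>R e3 (fst j) (snd j)) x" for x
        by (rule dens_sum[OF eJ(3) s0, symmetric])
      then show "\<mu> powr (1/p3) * lpsum p3 \<Omega> (\<lambda>x. norm (\<Sum>j\<in>?J. \<delta> j *\<^sub>R dens (e3 (fst j) (snd j)) x))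
          \<le> 2 * dual_norm (Lp s lborel) (\<Sum>j\<in>?J. \<delta> j *\<^sub>R e3 (fst j) (snd j))"
        using dens_bound[OF d p(3) s dual_norm_Lp_nonneg[OF d]] by (simp only:)
    qed
    also have "sqrt (rad ?J (\<lambda>\<delta>. (2 * dual_norm (Lp s lborel) (\<Sum>j\<in>?J. \<delta> j *\<^sub>R e3 (fst j) (snd j)))\<^sup>2))
        = 2 * Rad2 (dual (Lp s lborel)) M e3"
      unfolding Rad2_eq power_mult_distrib rad_cmult real_sqrt_mult by (simp add: dual_def)
    finally have K3: "(\<mu> * F3) powr (1/p3) \<le> Kahane_const p3 * (2 * Rad2 (dual (Lp s lborel)) M e3)"
      by (simp only: Kahane_const_def)
    show ?thesis
      using K1 K2 K3 A0 R by (intro mult_left_mono mult_mono mult_nonneg_nonneg) (auto simp: Kahane_const_def Rad2_nonneg)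
  qed
  finally show ?thesis unfolding A_def .
qed

section \<open>Reduction to finitely many cubes\<close>

lemma bounded_bilinear_scaleR_left:
  assumes "bounded_bilinear B"
  shows "bounded_bilinear (\<lambda>x y. r *\<^sub>R B x y)"
proof -
  interpret B: bounded_bilinear B by (rule assms)
  obtain K where K: "\<And>a b. norm (B a b) \<le> norm a * norm b * K" using B.bounded by blast
  have "norm (r *\<^sub>R B a b) \<le> norm a * norm b * (\<bar>r\<bar> * K)" for a b
    using mult_left_mono[OF K[of a b] abs_ge_zero[of r]] by (simp add: mult_ac)
  then show ?thesis
    by unfold_locales (auto simp: B.add_left B.add_right B.scaleR_left B.scaleR_right scaleR_add_right mult.commute)
qed

lemma bounded_bilinear_normalized_coeffs:
  assumes S: "is_shift \<D> k1 k2 k3 S" and A: "A \<in> normalized_coeffs \<D> k1 k2 k3 S"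
  shows "bounded_bilinear A"
proof -
  obtain K I1 I2 I3 where i: "(K, I1, I2, I3) \<in> shift_index \<D> k1 k2 k3"
    and A: "A = (\<lambda>x1 x2. ((measure lborel K)\<^sup>2 * measure lborel I1 powr (- 1 / 2) * measure lborel I2 powr (- 1 / 2) *
           measure lborel I3 powr (- 1 / 2)) *\<^sub>R snd S K I1 I2 I3 x1 x2)"
    using A unfolding normalized_coeffs_def by auto
  have "bounded_bilinear (snd S K I1 I2 I3)" using S i by (auto simp: is_shift_def)
  then show ?thesis unfolding A by (rule bounded_bilinear_scaleR_left)
qed

text \<open>The factor 6 is 3 for the possible positions of the non-cancellative slot times 2 for
  the norming of functionals.\<close>

definition shift_const where
  "shift_const p1 p2 p3 a1 a2 a3 = 6 * (a1 * a2 * a3) * (Kahane_const p1 * Kahane_const p2 * Kahane_const p3)"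

context dyadic_grid
begin

text \<open>The cubes that contain the origin give an index. The family of coefficients is then
  nonempty and supplies the default form.\<close>

lemma shift_index_nonempty:
  assumes \<D>: "\<D> = {cube g m | g m. True}"
  shows "shift_index \<D> k1 k2 k3 \<noteq> {}"
proof -
  have "ancestor \<D> k (cube (int k) (idx (int k) 0)) = cube 0 (idx 0 0)" for k
  proof -
    have "idx (int k) (corner (int k) (idx (int k) 0)) = idx (int k) 0" by (rule corner_idx)
    then have "idx 0 (corner (int k) (idx (int k) 0)) = idx 0 0" by (rule idx_coarser) simp
    then show ?thesis unfolding ancestor_cube[OF \<D>] by simp
  qed
  moreover have "cube g m \<in> \<D>" for g m using \<D> by auto
  ultimately have "(cube 0 (idx 0 0), cube (int k1) (idx (int k1) 0), cube (int k2) (idx (int k2) 0), cube (int k3) (idx (int k3) 0))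
      \<in> shift_index \<D> k1 k2 k3"
    by (simp add: shift_index_def)
  then show ?thesis by blast
qed

text \<open>Finitely many cubes lie in a bounded range of generations: \<open>g0\<close> is below
  all of them, \<open>N\<close> counts the generations, and \<open>T\<close> collects the ancestors
  of generation \<open>g0\<close>. The depth \<open>L\<close> stays free, since the complexity needs
  room below the finest of the cubes.\<close>

lemma covering_model:
  assumes U: "finite U" and \<D>: "\<D> = {cube g m | g m. True}" "U \<subseteq> \<D>"
  obtains g0 N T where "\<And>L. dyadic_model \<omega> T"
    "\<And>L K. N \<le> L \<Longrightarrow> K \<in> U \<Longrightarrow> \<exists>n<N. \<exists>m\<in>dyadic_model.c \<omega> g0 L n ` dyadic_model.\<Omega> \<omega> g0 L T. K = cube (g0 + int n) m"
proof -
  have "\<forall>K\<in>U. \<exists>g m. K = cube g m" using \<D> by auto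
  then obtain gen pos where gp: "\<And>K. K \<in> U \<Longrightarrow> K = cube (gen K) (pos K)" by metis
  \<comment> \<open>Inserting 0 keeps the minimum meaningful for empty \<open>U\<close>.\<close>
  define g0 where "g0 = Min (insert 0 (gen ` U))"
  define g1 where "g1 = Max (insert 0 (gen ` U))"
  define N where "N = nat (g1 - g0 + 1)"
  define T where "T = (\<lambda>K. idx g0 (corner (gen K) (pos K))) ` U"
  have gr: "g0 \<le> gen K" "gen K \<le> g1" if "K \<in> U" for K
    unfolding g0_def g1_def using U that by (auto intro: Min_le Max_ge)
  have dm: "dyadic_model \<omega> T" by unfold_locales (use U in \<open>simp add: T_def\<close>)
  have "\<exists>n<N. \<exists>m\<in>dyadic_model.c \<omega> g0 L n ` dyadic_model.\<Omega> \<omega> g0 L T. K = cube (g0 + int n) m"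
    if NL: "N \<le> L" and K: "K \<in> U" for L K
  proof -
    interpret M: dyadic_model \<omega> g0 L T by (rule dm)
    define n where "n = nat (gen K - g0)"
    have n: "n < N" "g0 + int n = gen K" using gr[OF K] by (auto simp: n_def N_def)
    let ?x = "corner (gen K) (pos K)"
    define a where "a = idx M.h ?x"
    have "idx (g0 + int 0) ?x = M.c 0 a" using M.idx_atom[of ?x a 0] by (simp add: a_def)
    then have "idx g0 (corner M.h a) = idx g0 ?x" by (simp add: M.c_def)
    then have "idx g0 (corner M.h a) \<in> T" using K by (simp add: T_def)
    then have a: "a \<in> M.\<Omega>" by (simp add: M.\<Omega>_def)
    have "M.c n a = pos K"
      using M.idx_atom[of ?x a n] n NL corner_idx[of "gen K" "pos K"] by (simp add: a_def)
    then have "pos K \<in> M.c n ` M.\<Omega>" using a by (intro image_eqI[of _ _ a]) simp_all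
    moreover have "K = cube (g0 + int n) (pos K)" using gp[OF K] n(2) by simp
    ultimately show ?thesis using n(1) by blast
  qed
  with dm show ?thesis by (rule that)
qed

text \<open>A finite array of shifts involves only finitely many cubes, so one finite model serves
  all of them, and its size does not enter the constant.\<close>

lemma shifts_admissible:
  fixes \<S> :: "('n, 'x1::banach, 'x2::banach, 'y3::banach) shift set"
  assumes p: "1 < p1" "1 < p2" "1 < p3" "1/p1 + 1/p2 + 1/p3 = 1" and s: "1 < s" "1/p3 + 1/s = 1"
    and umd: "umd_fin TYPE('x1) p1 \<beta>1" "umd_fin TYPE('x2) p2 \<beta>2" "umd_fin TYPE('y3 \<Rightarrow>\<^sub>L real) p3 \<beta>3"
    and al: "alpha_full_le TYPE('x1) K1" "alpha_full_le TYPE('x2) K2" "alpha_full_le TYPE('y3 \<Rightarrow>\<^sub>L real) K3"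
    and \<D>: "\<D> = {cube g m | g m. True}" and sh: "\<forall>S\<in>\<S>. is_shift \<D> k1 k2 k3 S"
    and ad: "admissible whole whole whole (\<Union>S\<in>\<S>. normalized_coeffs \<D> k1 k2 k3 S) R"
  defines "C \<equiv> shift_const p1 p2 p3 (slot_total K1 \<beta>1 p1) (slot_total K2 \<beta>2 p2) (slot_total K3 \<beta>3 p3)"
  shows "admissible (Lp p1 lborel) (Lp p2 lborel) (Lp s lborel) (shift_op \<D> k1 k2 k3 ` \<S>) (C * (1 + real (Max {k1, k2, k3})) * R)"
  unfolding admissible_def
proof (intro conjI allI impI)
  have R: "0 \<le> R" using ad by (simp add: admissible_def)
  have C: "0 \<le> C" by (simp add: C_def shift_const_def slot_total_def Kahane_const_def)
  show R': "0 \<le> C * (1 + real (Max {k1, k2, k3})) * R" using R C by simp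
  fix M :: nat and T and e1 :: "nat \<Rightarrow> nat \<Rightarrow> real ^ 'n \<Rightarrow> 'x1" and e2 :: "nat \<Rightarrow> nat \<Rightarrow> real ^ 'n \<Rightarrow> 'x2"
    and e3 :: "nat \<Rightarrow> nat \<Rightarrow> (real ^ 'n \<Rightarrow> 'y3) \<Rightarrow> real"
  assume hyp: "(\<forall>t\<in>{1..M}. \<forall>u\<in>{1..M}. \<forall>v\<in>{1..M}. T t u v \<in> shift_op \<D> k1 k2 k3 ` \<S>) \<and>
     (\<forall>t\<in>{1..M}. \<forall>u\<in>{1..M}. e1 t u \<in> fst (Lp p1 lborel)) \<and>
     (\<forall>u\<in>{1..M}. \<forall>v\<in>{1..M}. e2 u v \<in> fst (Lp p2 lborel)) \<and>
     (\<forall>t\<in>{1..M}. \<forall>v\<in>{1..M}. e3 t v \<in> fst (dual (Lp s lborel)))"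
  show "(\<Sum>t=1..M. \<Sum>u=1..M. \<Sum>v=1..M. \<bar>e3 t v (T t u v (e1 t u) (e2 u v))\<bar>)
      \<le> C * (1 + real (Max {k1, k2, k3})) * R * (Rad2 (Lp p1 lborel) M e1 * Rad2 (Lp p2 lborel) M e2 * Rad2 (dual (Lp s lborel)) M e3)"
  proof (cases "M = 0")
    case True
    then show ?thesis using R' by (simp add: Rad2_nonneg)
  next
    case False
    then have "T 1 1 1 \<in> shift_op \<D> k1 k2 k3 ` \<S>" using hyp by auto
    then obtain S0 where S0: "S0 \<in> \<S>" by blast
    \<comment> \<open>The operators of the array are traced back to shifts; \<open>S0\<close> fills
      the remaining indices.\<close>
    define S where "S t u v = (if t \<in> {1..M} \<and> u \<in> {1..M} \<and> v \<in> {1..M} then inv_into \<S> (shift_op \<D> k1 k2 k3) (T t u v) else S0)" for t u v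
    have S: "S t u v \<in> \<S>" for t u v
      unfolding S_def using S0 hyp by (auto intro: inv_into_into)
    have TS: "T t u v = shift_op \<D> k1 k2 k3 (S t u v)" if "t \<in> {1..M}" "u \<in> {1..M}" "v \<in> {1..M}" for t u v
    proof -
      have "T t u v \<in> shift_op \<D> k1 k2 k3 ` \<S>" using hyp that by blast
      then show ?thesis using that by (simp only: S_def if_True simp_thms f_inv_into_f)
    qed
    define k where "k = Max {k1, k2, k3}"
    have k: "k1 \<le> k" "k2 \<le> k" "k3 \<le> k" by (simp_all add: k_def)
    let ?\<C> = "\<Union>S\<in>\<S>. normalized_coeffs \<D> k1 k2 k3 S"
    have ne: "?\<C> \<noteq> {}"
      using S0 shift_index_nonempty[OF \<D>, of k1 k2 k3] unfolding normalized_coeffs_def by blast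
    have bil: "bounded_bilinear A" if "A \<in> ?\<C>" for A
      using that sh bounded_bilinear_normalized_coeffs by blast
    define U where "U = fst ` (\<Union>t\<in>{1..M}. \<Union>u\<in>{1..M}. \<Union>v\<in>{1..M}. shift_support \<D> k1 k2 k3 (S t u v))"
    have "finite (shift_support \<D> k1 k2 k3 (S t u v))" for t u v using sh S by (auto simp: is_shift_def)
    then have "finite U" unfolding U_def by blast
    moreover have "U \<subseteq> \<D>" by (auto simp: U_def shift_support_def shift_index_def)
    ultimately obtain g0 N T0 where dm: "dyadic_model \<omega> T0"
      and cov: "\<And>L K. N \<le> L \<Longrightarrow> K \<in> U \<Longrightarrow> \<exists>n<N. \<exists>m\<in>dyadic_model.c \<omega> g0 L n ` dyadic_model.\<Omega> \<omega> g0 L T0. K = cube (g0 + int n) m"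
      using covering_model[OF _ \<D>] by metis
    \<comment> \<open>Below the \<open>N\<close> generations of the cubes \<open>K\<close> a slot
      reaches up to \<open>k + 1\<close> levels deeper, so the finest level that occurs is
      \<open>N + k\<close>.\<close>
    define L where "L = N + k"
    interpret M: dyadic_model \<omega> g0 L T0 by (rule dm)
    have "(\<Sum>t=1..M. \<Sum>u=1..M. \<Sum>v=1..M. \<bar>e3 t v (T t u v (e1 t u) (e2 u v))\<bar>)
        = (\<Sum>t=1..M. \<Sum>u=1..M. \<Sum>v=1..M. \<bar>e3 t v (shift_op \<D> k1 k2 k3 (S t u v) (e1 t u) (e2 u v))\<bar>)"
      by (intro sum.cong refl) (simp only: TS)
    also have "\<dots> \<le> 3 * (1 + real k) * R * (slot_total K1 \<beta>1 p1 * slot_total K2 \<beta>2 p2 * slot_total K3 \<beta>3 p3) *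
      (Kahane_const p1 * Rad2 (Lp p1 lborel) M e1 * (Kahane_const p2 * Rad2 (Lp p2 lborel) M e2) *
       (Kahane_const p3 * (2 * Rad2 (dual (Lp s lborel)) M e3)))"
    proof (rule M.family_estimate[OF p s umd al \<D> _ admissible_imp_rhat_bd[OF ad] ne _ bil _ _ _ _ k])
      show "is_shift \<D> k1 k2 k3 (S t u v)" for t u v using sh S by blast
      show "normalized_coeffs \<D> k1 k2 k3 (S t u v) \<subseteq> ?\<C>" for t u v using S by blast
      show "N + k \<le> L" by (simp add: L_def)
      fix t u v K I1 I2 I3 assume "t \<in> {1..M}" "u \<in> {1..M}" "v \<in> {1..M}" "(K, I1, I2, I3) \<in> shift_support \<D> k1 k2 k3 (S t u v)"
      then have "K \<in> U" unfolding U_def by force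
      then show "\<exists>n<N. \<exists>m\<in>M.c n ` M.\<Omega>. K = cube (g0 + int n) m" by (intro cov) (simp_all add: L_def)
    qed (use hyp in auto)
    also have "\<dots> = C * (1 + real (Max {k1, k2, k3})) * R * (Rad2 (Lp p1 lborel) M e1 * Rad2 (Lp p2 lborel) M e2 * Rad2 (dual (Lp s lborel)) M e3)"
      unfolding C_def shift_const_def k_def[symmetric] by simp
    finally show ?thesis .
  qed
qed

end

theorem theorem7p2:
  fixes p1 p2 p3 :: real
  assumes "UMD TYPE('x1::banach)" and "UMD TYPE('x2::banach)" and "UMD TYPE('y3::banach)"
    and "property_alpha TYPE('x1)" and "property_alpha TYPE('x2)" and "property_alpha TYPE('y3)"
    and "1 < p1" and "1 < p2" and "1 < p3"
    and "1 / p1 + 1 / p2 + 1 / p3 = 1"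
  shows "\<exists>C>0. \<forall>(\<D> :: (real ^ 'n::finite) set set) (k1::nat) (k2::nat) (k3::nat)
      (\<S> :: ('n, 'x1, 'x2, 'y3) shift set).
    dyadic_lattice \<D> \<and> (\<forall>S\<in>\<S>. is_shift \<D> k1 k2 k3 S) \<longrightarrow>
    Rhat (Lp p1 lborel) (Lp p2 lborel) (Lp (p3 / (p3 - 1)) lborel) (shift_op \<D> k1 k2 k3 ` \<S>)
      \<le> ennreal (C * (1 + real (Max {k1, k2, k3}))) *
         Rhat whole whole whole (\<Union>S\<in>\<S>. normalized_coeffs \<D> k1 k2 k3 S)"
proof -
  \<comment> \<open>The exponent conjugate to \<open>p3\<close>: functionals on the space with
    exponent \<open>s\<close> have densities with exponent \<open>p3\<close>.\<close>
  define s where "s = p3 / (p3 - 1)"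
  have s: "1 < s" "1/p3 + 1/s = 1" using \<open>1 < p3\<close> by (simp_all add: s_def field_simps)
  \<comment> \<open>The dual of \<open>Y3\<close> inherits UMD at \<open>p3\<close> from
    \<open>Y3\<close> at \<open>s\<close>; the exponent 2 serves the K-convexity behind property
    alpha of the dual.\<close>
  obtain \<beta>1 \<beta>2 \<beta>y \<beta>2y where u: "umd_fin TYPE('x1) p1 \<beta>1" "umd_fin TYPE('x2) p2 \<beta>2" "umd_fin TYPE('y3) s \<beta>y" "umd_fin TYPE('y3) 2 \<beta>2y"
    using UMD_imp_umd_fin[OF assms(1,7)] UMD_imp_umd_fin[OF assms(2,8)] UMD_imp_umd_fin[OF assms(3) s(1)] UMD_imp_umd_fin[OF assms(3), of 2] by auto
  obtain \<beta>3 where u3: "umd_fin TYPE('y3 \<Rightarrow>\<^sub>L real) p3 \<beta>3" using umd_fin_dual[OF assms(9) s u(3)] by blast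
  obtain K1 K2 Ky where a: "alpha_full_le TYPE('x1) K1" "alpha_full_le TYPE('x2) K2" "alpha_prod_le TYPE('y3) Ky"
    using property_alpha_imp(1)[OF assms(4)] property_alpha_imp(1)[OF assms(5)] property_alpha_imp(2)[OF assms(6)] by auto
  note a3 = alpha_full_le_dual[OF u(4) a(3)]
  define C0 where "C0 = shift_const p1 p2 p3 (slot_total K1 \<beta>1 p1) (slot_total K2 \<beta>2 p2) (slot_total (16 * Ky * \<beta>2y) \<beta>3 p3)"
  have C0: "0 \<le> C0" by (simp add: C0_def shift_const_def slot_total_def Kahane_const_def)
  show ?thesis
  \<comment> \<open>The summand 1 makes the constant positive.\<close>
  proof (intro exI[of _ "C0 + 1"] conjI allI impI)
    show "0 < C0 + 1" using C0 by simp
    fix \<D> :: "(real ^ 'n) set set" and k1 k2 k3 :: nat and \<S> :: "('n, 'x1, 'x2, 'y3) shift set"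
    assume h: "dyadic_lattice \<D> \<and> (\<forall>S\<in>\<S>. is_shift \<D> k1 k2 k3 S)"
    then obtain \<omega> where w: "\<And>k i. \<omega> k $ i \<in> {0, 1}" "\<D> = {translated_cube \<omega> (std_cube k m) | k m. True}"
      by (auto simp: dyadic_lattice_def)
    interpret dyadic_grid \<omega> by unfold_locales (rule w(1))
    have \<D>: "\<D> = {cube g m | g m. True}" unfolding w(2) translated_std_cube ..
    let ?k = "1 + real (Max {k1, k2, k3})"
    let ?c = "ennreal ((C0 + 1) * ?k)"
    let ?X = "Rhat (Lp p1 lborel) (Lp p2 lborel) (Lp (p3 / (p3 - 1)) lborel) (shift_op \<D> k1 k2 k3 ` \<S>)"
    have le: "?X \<le> ?c * ennreal R" if ad: "admissible whole whole whole (\<Union>S\<in>\<S>. normalized_coeffs \<D> k1 k2 k3 S) R" for R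
    proof -
      have R: "0 \<le> R" using ad by (simp add: admissible_def)
      have "admissible (Lp p1 lborel) (Lp p2 lborel) (Lp s lborel) (shift_op \<D> k1 k2 k3 ` \<S>) (C0 * ?k * R)"
        unfolding C0_def by (rule shifts_admissible[OF assms(7-10) s u(1,2) u3 a(1,2) a3 \<D> conjunct2[OF h] ad])
      then have "?X \<le> ennreal (C0 * ?k * R)"
        unfolding Rhat_eq s_def[symmetric] by (intro Inf_lower imageI) simp
      also have "\<dots> \<le> ennreal ((C0 + 1) * ?k * R)"
        using C0 R by (intro ennreal_leI mult_right_mono) auto
      also have "\<dots> = ?c * ennreal R" using C0 R by (intro ennreal_mult) auto
      finally show ?thesis .
    qed
    \<comment> \<open>Division by a finite nonzero constant moves the inequality under the infimum
      over admissible bounds; with no such bound the infimum is infinite.\<close>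
    have c: "?c \<noteq> 0" "?c \<noteq> \<top>" using C0 by (auto simp: ennreal_eq_0_iff add_nonneg_pos mult_le_0_iff not_le)
    have "?X / ?c \<le> Rhat whole whole whole (\<Union>S\<in>\<S>. normalized_coeffs \<D> k1 k2 k3 S)"
      unfolding Rhat_eq[of whole]
    proof (rule Inf_greatest)
      fix r assume "r \<in> ennreal ` {C. admissible whole whole whole (\<Union>S\<in>\<S>. normalized_coeffs \<D> k1 k2 k3 S) C}"
      then have "?X \<le> ?c * r" using le by auto
      then show "?X / ?c \<le> r" using c by (simp add: divide_le_posI_ennreal mult.commute zero_less_iff_neq_zero)
    qed
    then have "?c * (?X / ?c) \<le> ?c * Rhat whole whole whole (\<Union>S\<in>\<S>. normalized_coeffs \<D> k1 k2 k3 S)"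
      by (rule mult_left_mono) simp
    moreover have "?c * (?X / ?c) = ?X" 
      unfolding ennreal_times_divide mult.commute[of ?c ?X] by (rule ennreal_mult_divide_eq[OF c])
    ultimately show "?X \<le> ?c * Rhat whole whole whole (\<Union>S\<in>\<S>. normalized_coeffs \<D> k1 k2 k3 S)" by simp
  qed
qed

end
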